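(* Let $G$ be a complex Lie group with Lie algebra $\mathfrak{g}$, equipped with a left-invariant Hermitian metric $g$. Let $\mathfrak{n}$ be the nilradical of $\mathfrak{g}$ and $\mathfrak{r}$ its $g$-orthogonal complement, so that $\mathfrak{g}=\mathfrak{r}\oplus\mathfrak{n}$. Denote by $g_\mathfrak{n}$ the pull-back of $g$ to the (simply connected) Lie group $N$ with Lie algebra $\mathfrak{n}$. Then $g$ is an expanding semi-algebraic soliton to the Hermitian curvature flow (HCF) if and only if all of the following hold: (1) $g_\mathfrak{n}$ is an expanding algebraic soliton to HCF on $N$; (2) $\mathfrak{r}$ is a reductive Lie subalgebra of $\mathfrak{g}$; (3) $\sum_i[\operatorname{ad}_{r_i}|_\mathfrak{n},\operatorname{ad}_{\bar r_i}^t|_\mathfrak{n}]=0$ for any unitary basis $\{r_i\}$ of $\mathfrak{r}$; (4) for all $X,Y\in\mathfrak{r}$, $$K(g_\mathfrak{r})(X,\bar Y)=c\, g_\mathfrak{r}(X,\bar Y)+\tfrac12\operatorname{tr}(\operatorname{ad}_X|_\mathfrak{n}\operatorname{ad}_{\bar Y}^t|_\mathfrak{n})-\tfrac12\operatorname{tr}\operatorname{ad}_X\cdot\operatorname{tr}\operatorname{ad}_{\bar Y},$$ where $c<0$ is the soliton constant of $g$ and $g_\mathfrak{r}$ is the pull-back of $g$ to the Lie group with Lie algebra $\mathfrak{r}$.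
   Context: A complex Lie group is a Lie group with a bi-invariant complex structure (multiplication holomorphic). Left-invariant Hermitian metrics correspond to Hermitian inner products on $\mathfrak{g}$ (identified with the left-invariant $(1,0)$-vector fields); we write $g(X,\bar Y)$. For $X\in\mathfrak{g}$, $\operatorname{ad}_{\bar X}^t|_\mathfrak{n}$ denotes the adjoint of $\operatorname{ad}_X|_\mathfrak{n}$ with respect to $g$ (the conjugate transpose in a unitary basis), and $\operatorname{tr}\operatorname{ad}_{\bar Y}=\overline{\operatorname{tr}\operatorname{ad}_Y}$. The HCF tensor $K(g)$ is the Streets–Tian tensor $S-Q$ (a Ricci-type contraction of the Chern curvature minus a quadratic torsion term); for a left-invariant Hermitian metric on a complex Lie group it equals $K(g)(Z,\bar W)=\mathrm{Ric}^{1,1}(Z,\bar W)+\tfrac12\operatorname{tr}\operatorname{ad}_Z\cdot\operatorname{tr}\operatorname{ad}_{\bar W}$, where $\mathrm{Ric}^{1,1}$ is the $(1,1)$-part of the Ricci tensor of the underlying Riemannian metric. Let $K_g$ be the endomorphism with $g(K_g X,\bar Y)=K(g)(X,\bar Y)$. The metric $g$ is a semi-algebraic soliton to HCF if $K_g=c\,I+\tfrac12(D+D^t)$ for some $c\in\mathbb{R}$ and some derivation $D$ of $\mathfrak{g}$ ($D^t$ the $g$-adjoint); it is algebraic if moreover $D^t$ is a derivation; it is expanding if $c<0$. *)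

theory Defs
  imports "HOL-Analysis.Analysis"
begin

text \<open>A finite-dimensional complex Lie algebra is modelled on the ambient space
  complex^'n (complex scalar multiplication is *s, the real structure is scaleR).
  Sub-Lie algebras (nilradical, its orthogonal complement) are complex subspaces V,
  carrying the restricted bracket and the restricted (pulled-back) Hermitian metric.\<close>

type_synonym 'n cvec = "complex ^ ('n::finite)"

definition complex_lie_algebra :: "(('n::finite) cvec \<Rightarrow> 'n cvec \<Rightarrow> 'n cvec) \<Rightarrow> bool" where
  "complex_lie_algebra br \<longleftrightarrow>
     (\<forall>x y z. br (x + y) z = br x z + br y z) \<and>
     (\<forall>(a::complex) x y. br (a *s x) y = a *s br x y) \<and>
     (\<forall>x y. br x y = - br y x) \<and>
     (\<forall>x y z. br x (br y z) + br y (br z x) + br z (br x y) = 0)"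

text \<open>Hermitian inner product: complex linear in the first slot, conjugate symmetric,
  positive definite.  We write gh X Y for g(X, conj Y).\<close>
definition hermitian_ip :: "(('n::finite) cvec \<Rightarrow> 'n cvec \<Rightarrow> complex) \<Rightarrow> bool" where
  "hermitian_ip gh \<longleftrightarrow>
     (\<forall>x y z. gh (x + y) z = gh x z + gh y z) \<and>
     (\<forall>(a::complex) x y. gh (a *s x) y = a * gh x y) \<and>
     (\<forall>x y. gh y x = cnj (gh x y)) \<and>
     (\<forall>x. x \<noteq> 0 \<longrightarrow> Re (gh x x) > 0)"

definition lie_subalgebra :: "(('n::finite) cvec \<Rightarrow> 'n cvec \<Rightarrow> 'n cvec) \<Rightarrow> 'n cvec set \<Rightarrow> bool" where
  "lie_subalgebra br V \<longleftrightarrow> vec.subspace V \<and> (\<forall>x\<in>V. \<forall>y\<in>V. br x y \<in> V)"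

definition lie_ideal :: "(('n::finite) cvec \<Rightarrow> 'n cvec \<Rightarrow> 'n cvec) \<Rightarrow> 'n cvec set \<Rightarrow> 'n cvec set \<Rightarrow> bool" where
  "lie_ideal br V I \<longleftrightarrow> vec.subspace I \<and> I \<subseteq> V \<and> (\<forall>x\<in>V. \<forall>y\<in>I. br x y \<in> I)"

fun lower_central :: "(('n::finite) cvec \<Rightarrow> 'n cvec \<Rightarrow> 'n cvec) \<Rightarrow> 'n cvec set \<Rightarrow> nat \<Rightarrow> 'n cvec set" where
  "lower_central br I 0 = I"
| "lower_central br I (Suc k) = vec.span {br x y | x y. x \<in> I \<and> y \<in> lower_central br I k}"

definition nilpotent_lie :: "(('n::finite) cvec \<Rightarrow> 'n cvec \<Rightarrow> 'n cvec) \<Rightarrow> 'n cvec set \<Rightarrow> bool" where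
  "nilpotent_lie br I \<longleftrightarrow> (\<exists>k. lower_central br I k = {0})"

definition is_nilradical :: "(('n::finite) cvec \<Rightarrow> 'n cvec \<Rightarrow> 'n cvec) \<Rightarrow> 'n cvec set \<Rightarrow> bool" where
  "is_nilradical br N \<longleftrightarrow> lie_ideal br UNIV N \<and> nilpotent_lie br N \<and>
     (\<forall>I. lie_ideal br UNIV I \<and> nilpotent_lie br I \<longrightarrow> I \<subseteq> N)"

text \<open>Reductive Lie subalgebra: a subalgebra whose adjoint representation is completely
  reducible, i.e. every ideal has a complementary ideal.\<close>
definition reductive_subalgebra :: "(('n::finite) cvec \<Rightarrow> 'n cvec \<Rightarrow> 'n cvec) \<Rightarrow> 'n cvec set \<Rightarrow> bool" where
  "reductive_subalgebra br V \<longleftrightarrow> lie_subalgebra br V \<and>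
     (\<forall>I. lie_ideal br V I \<longrightarrow>
        (\<exists>I'. lie_ideal br V I' \<and> I \<inter> I' = {0} \<and> {x + y | x y. x \<in> I \<and> y \<in> I'} = V))"

definition unitary_basis :: "(('n::finite) cvec \<Rightarrow> 'n cvec \<Rightarrow> complex) \<Rightarrow> 'n cvec set \<Rightarrow> 'n cvec list \<Rightarrow> bool" where
  "unitary_basis gh V es \<longleftrightarrow> set es \<subseteq> V \<and> vec.span (set es) = V \<and>
     (\<forall>i<length es. \<forall>j<length es. gh (es ! i) (es ! j) = (if i = j then 1 else 0))"

definition some_ub :: "(('n::finite) cvec \<Rightarrow> 'n cvec \<Rightarrow> complex) \<Rightarrow> 'n cvec set \<Rightarrow> 'n cvec list" where
  "some_ub gh V = (SOME es. unitary_basis gh V es)"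

definition ctr :: "(('n::finite) cvec \<Rightarrow> 'n cvec \<Rightarrow> complex) \<Rightarrow> 'n cvec set \<Rightarrow> ('n cvec \<Rightarrow> 'n cvec) \<Rightarrow> complex" where
  "ctr gh V f = (\<Sum>e\<leftarrow>some_ub gh V. gh (f e) e)"

definition hadj :: "(('n::finite) cvec \<Rightarrow> 'n cvec \<Rightarrow> complex) \<Rightarrow> 'n cvec set \<Rightarrow> ('n cvec \<Rightarrow> 'n cvec) \<Rightarrow> 'n cvec \<Rightarrow> 'n cvec" where
  "hadj gh V f x = (\<Sum>e\<leftarrow>some_ub gh V. gh x (f e) *s e)"

definition is_derivation :: "(('n::finite) cvec \<Rightarrow> 'n cvec \<Rightarrow> 'n cvec) \<Rightarrow> 'n cvec set \<Rightarrow> ('n cvec \<Rightarrow> 'n cvec) \<Rightarrow> bool" where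
  "is_derivation br V D \<longleftrightarrow>
     (\<forall>x\<in>V. D x \<in> V) \<and>
     (\<forall>x\<in>V. \<forall>y\<in>V. D (x + y) = D x + D y) \<and>
     (\<forall>(a::complex). \<forall>x\<in>V. D (a *s x) = a *s D x) \<and>
     (\<forall>x\<in>V. \<forall>y\<in>V. D (br x y) = br (D x) y + br x (D y))"

text \<open>Underlying Riemannian metric: Re gh (a constant multiple of the Riemannian metric
  whose complex bilinear extension gives gh on (1,0)-vectors; Levi-Civita connection
  and Ricci tensor are invariant under constant rescaling).\<close>

definition real_onb :: "(('n::finite) cvec \<Rightarrow> 'n cvec \<Rightarrow> complex) \<Rightarrow> 'n cvec set \<Rightarrow> 'n cvec list \<Rightarrow> bool" where
  "real_onb gh V fs \<longleftrightarrow> set fs \<subseteq> V \<and> span (set fs) = V \<and>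
     (\<forall>i<length fs. \<forall>j<length fs. Re (gh (fs ! i) (fs ! j)) = (if i = j then 1 else 0))"

definition some_ronb :: "(('n::finite) cvec \<Rightarrow> 'n cvec \<Rightarrow> complex) \<Rightarrow> 'n cvec set \<Rightarrow> 'n cvec list" where
  "some_ronb gh V = (SOME fs. real_onb gh V fs)"

text \<open>Levi-Civita connection on left-invariant fields (Koszul formula):
  2<nabla_X Y, Z> = <[X,Y],Z> - <[Y,Z],X> + <[Z,X],Y>.\<close>
definition lc_conn :: "(('n::finite) cvec \<Rightarrow> 'n cvec \<Rightarrow> complex) \<Rightarrow> ('n cvec \<Rightarrow> 'n cvec \<Rightarrow> 'n cvec) \<Rightarrow> 'n cvec set
    \<Rightarrow> 'n cvec \<Rightarrow> 'n cvec \<Rightarrow> 'n cvec" where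
  "lc_conn gh br V X Y = (\<Sum>f\<leftarrow>some_ronb gh V.
      ((Re (gh (br X Y) f) - Re (gh (br Y f) X) + Re (gh (br f X) Y)) / 2) *\<^sub>R f)"

definition riem_curv :: "(('n::finite) cvec \<Rightarrow> 'n cvec \<Rightarrow> complex) \<Rightarrow> ('n cvec \<Rightarrow> 'n cvec \<Rightarrow> 'n cvec) \<Rightarrow> 'n cvec set
    \<Rightarrow> 'n cvec \<Rightarrow> 'n cvec \<Rightarrow> 'n cvec \<Rightarrow> 'n cvec" where
  "riem_curv gh br V X Y Z =
     lc_conn gh br V X (lc_conn gh br V Y Z) - lc_conn gh br V Y (lc_conn gh br V X Z)
     - lc_conn gh br V (br X Y) Z"

definition ricci :: "(('n::finite) cvec \<Rightarrow> 'n cvec \<Rightarrow> complex) \<Rightarrow> ('n cvec \<Rightarrow> 'n cvec \<Rightarrow> 'n cvec) \<Rightarrow> 'n cvec set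
    \<Rightarrow> 'n cvec \<Rightarrow> 'n cvec \<Rightarrow> real" where
  "ricci gh br V Y Z = (\<Sum>f\<leftarrow>some_ronb gh V. Re (gh (riem_curv gh br V f Y Z) f))"

text \<open>Ric^{1,1}(Z, conj W) where Z = (X - iJX)/2, W = (Y - iJY)/2 are the (1,0)-vectors
  corresponding to X, Y (J = multiplication by i):
  (1/4)(Ric(X,Y) + Ric(JX,JY) + i (Ric(X,JY) - Ric(JX,Y))).\<close>
definition ric11 :: "(('n::finite) cvec \<Rightarrow> 'n cvec \<Rightarrow> complex) \<Rightarrow> ('n cvec \<Rightarrow> 'n cvec \<Rightarrow> 'n cvec) \<Rightarrow> 'n cvec set
    \<Rightarrow> 'n cvec \<Rightarrow> 'n cvec \<Rightarrow> complex" where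
  "ric11 gh br V X Y =
     Complex ((ricci gh br V X Y + ricci gh br V (\<i> *s X) (\<i> *s Y)) / 4)
             ((ricci gh br V X (\<i> *s Y) - ricci gh br V (\<i> *s X) Y) / 4)"

definition hcf_K :: "(('n::finite) cvec \<Rightarrow> 'n cvec \<Rightarrow> complex) \<Rightarrow> ('n cvec \<Rightarrow> 'n cvec \<Rightarrow> 'n cvec) \<Rightarrow> 'n cvec set
    \<Rightarrow> 'n cvec \<Rightarrow> 'n cvec \<Rightarrow> complex" where
  "hcf_K gh br V X Y = ric11 gh br V X Y + ctr gh V (br X) * cnj (ctr gh V (br Y)) / 2"

text \<open>Semi-algebraic soliton with constant c: K_g = c I + (D + D^t)/2, written via
  g(K_g X, conj Y) = K(g)(X, conj Y).\<close>
definition semi_alg_soliton :: "(('n::finite) cvec \<Rightarrow> 'n cvec \<Rightarrow> complex) \<Rightarrow> ('n cvec \<Rightarrow> 'n cvec \<Rightarrow> 'n cvec) \<Rightarrow> 'n cvec set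
    \<Rightarrow> real \<Rightarrow> bool" where
  "semi_alg_soliton gh br V c \<longleftrightarrow> (\<exists>D. is_derivation br V D \<and>
     (\<forall>X\<in>V. \<forall>Y\<in>V. hcf_K gh br V X Y =
        of_real c * gh X Y + (gh (D X) Y + gh (hadj gh V D X) Y) / 2))"

definition alg_soliton :: "(('n::finite) cvec \<Rightarrow> 'n cvec \<Rightarrow> complex) \<Rightarrow> ('n cvec \<Rightarrow> 'n cvec \<Rightarrow> 'n cvec) \<Rightarrow> 'n cvec set
    \<Rightarrow> real \<Rightarrow> bool" where
  "alg_soliton gh br V c \<longleftrightarrow> (\<exists>D. is_derivation br V D \<and> is_derivation br V (hadj gh V D) \<and>
     (\<forall>X\<in>V. \<forall>Y\<in>V. hcf_K gh br V X Y =
        of_real c * gh X Y + (gh (D X) Y + gh (hadj gh V D X) Y) / 2))"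

end

theory Submission
  imports Defs "HOL-Computational_Algebra.Fundamental_Theorem_Algebra"
begin

text \<open>Up to the symmetric part of an inner derivation, which a soliton can absorb into \<open>D\<close>, the tensor \<open>K\<close>
  of the ambient algebra equals \<open>mom br + \<onehalf> th \<otimes> cnj th\<close>, where \<open>mom\<close> is the moment map of
  \<open>GL\<close> acting on brackets and \<open>th x = tr (ad x)\<close>. Its basic property is
  \<open>tr (mom br [A, A\<^sup>*]) = \<onefourth> \<parallel>A\<^sup>* \<cdot> br\<parallel>\<^sup>2\<close> for a derivation \<open>A\<close>.

  Given a soliton, minimise the distance to the constant weight \<open>-c\<close> among all multiplicative
  weighted filtrations of the Lie algebra. The minimiser is unique, hence invariant under derivations. Pairing the soliton
  equation with the minimising weights and with \<open>D\<close> gives a sum of nonnegative terms equal to zero, so the symmetric part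
  \<open>b\<close> of \<open>D\<close> is a derivation whose eigenvalues are the weights. The sum \<open>V\<close> of the positive weight spaces is a
  nilpotent ideal and its orthogonal complement, the zero weight space, is a subalgebra. Evaluating the soliton
  equation on \<open>\<Sum> [A\<^sub>i, A\<^sub>i\<^sup>*]\<close>, with \<open>A\<^sub>i\<close> the restrictions to \<open>V\<close> of \<open>ad\<close> of a unitary basis of the complement, yields
  condition (3). If the nilradical were larger than \<open>V\<close>, then (3) would produce an abelian ideal of weight zero, on which the
  moment map has nonnegative trace, against \<open>c < 0\<close>. Finally the dual \<open>H\<close> of \<open>th\<close> commutes with the complement, because the
  adjoint of \<open>ad H\<close> maps into the radical of the Killing form; so the adjoints of \<open>ad X\<close>, for \<open>X\<close> in the complement, are
  derivations, and this makes the complement reductive.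

  Conversely, (3) and the trace identity show that the adjoints of \<open>ad X\<close> on the nilradical are derivations and that
  \<open>ad X\<close> commutes with the symmetric part of the soliton derivation of the nilradical. Extended by zero the latter is a
  derivation of the whole algebra, and the mixed terms of the moment map vanish, being traces of nilpotent maps.\<close>

section \<open>Hermitian linear algebra\<close>

text \<open>The obstacle is that the soliton derivation \<open>D\<close> need not be normal, so its
  symmetric part \<open>S\<close> is not visibly a derivation. The equation reaches \<open>D\<close>
  only through traces: a derivation pairs to zero with \<open>mom\<close>, and pairing with
  \<open>D\<close> gives \<open>c tr S + |S|^2 = 0\<close>. Weights \<open>w\<close> meant to become
  the eigenvalues of \<open>S\<close> must thus have sum of squares equal to \<open>-c\<close> times
  their sum. This is the scaling condition at a minimum of the sum of \<open>(w + c)^2\<close>,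
  whence the target \<open>-c\<close>. Filtrations replace gradings because two of them always share
  an adapted basis, in which weights can be averaged, and because pairing \<open>mom\<close> with
  weights only needs the inequality \<open>w x + w y \<le> w z\<close>. As the optimal filtration is
  invariant under \<open>D\<close>, one unitary basis is adapted to it and makes \<open>D\<close>
  triangular; shifting the weights by the real parts of the eigenvalues of \<open>D\<close> gives
  the second trace relation. One pattern recurs afterwards: the equation is tested against a
  commutator \<open>[A, C]\<close> of a derivation \<open>A\<close>, with \<open>C\<close> chosen so
  that a squared norm comes out.\<close>

definition lin_on :: "('n::finite) cvec set \<Rightarrow> ('n cvec \<Rightarrow> 'n cvec) \<Rightarrow> bool" where
  "lin_on V f \<longleftrightarrow> (\<forall>x\<in>V. \<forall>y\<in>V. f (x + y) = f x + f y) \<and> (\<forall>a. \<forall>x\<in>V. f (a *s x) = a *s f x)"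

abbreviation clin :: "(('n::finite) cvec \<Rightarrow> 'n cvec) \<Rightarrow> bool" where
  "clin \<equiv> lin_on UNIV"

lemma clinI: "(\<And>x y. f (x + y) = f x + f y) \<Longrightarrow> (\<And>a x. f (a *s x) = a *s f x) \<Longrightarrow> clin f"
  by (simp add: lin_on_def)

lemma clin_add: "clin f \<Longrightarrow> f (x + y) = f x + f y"
  and clin_scale: "clin f \<Longrightarrow> f (a *s x) = a *s f x"
  by (simp_all add: lin_on_def)

lemma clin_linear: "clin f \<longleftrightarrow> Vector_Spaces.linear (*s) (*s) f"
proof
  assume "clin f" then show "Vector_Spaces.linear (*s) (*s) f"
    by (simp add: Vector_Spaces.linear_iff lin_on_def vec.vector_space_axioms)
next
  assume "Vector_Spaces.linear (*s) (*s) f"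
  then show "clin f" by (simp add: Vector_Spaces.linear_iff lin_on_def)
qed

lemma lin_on_sum:
  assumes "lin_on V f" "vec.subspace V" "\<And>i. i \<in> I \<Longrightarrow> g i \<in> V"
  shows "f (\<Sum>i\<in>I. g i) = (\<Sum>i\<in>I. f (g i))"
proof -
  have f0: "f 0 = 0"
    using assms(1) vec.subspace_0[OF assms(2)]
    by (metis lin_on_def vector_smult_lzero)
  show ?thesis using assms(3)
  proof (induction I rule: infinite_finite_induct)
    case (insert i I)
    then have "(\<Sum>i\<in>I. g i) \<in> V" using assms(2) by (intro vec.subspace_sum) auto
    with insert assms(1) show ?case by (simp add: lin_on_def)
  qed (use f0 in auto)
qed

lemma clin_zero: "clin f \<Longrightarrow> f 0 = 0"
  by (metis clin_scale vector_smult_lzero)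

lemma clin_minus: "clin f \<Longrightarrow> f (- x) = - f x"
  using clin_scale[of f "-1" x] by (simp add: vec.scale_minus_left)
lemma clin_diff: "clin f \<Longrightarrow> f (x - y) = f x - f y"
  by (metis ab_group_add_class.ab_diff_conv_add_uminus clin_add clin_minus)
lemma clin_sum: "clin f \<Longrightarrow> f (\<Sum>i\<in>I. g i) = (\<Sum>i\<in>I. f (g i))"
  by (rule lin_on_sum) auto

lemma clin_ident [simp, intro]: "clin (\<lambda>x. x)"
  and clin_const0 [simp, intro]: "clin (\<lambda>x. 0)"
  by (simp_all add: lin_on_def)
lemma clin_compose: "clin f \<Longrightarrow> clin g \<Longrightarrow> clin (\<lambda>x. f (g x))"
  by (simp add: lin_on_def)
lemma clin_plus: "clin f \<Longrightarrow> clin g \<Longrightarrow> clin (\<lambda>x. f x + g x)"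
  by (simp add: lin_on_def vec.scale_right_distrib algebra_simps)
lemma clin_sub: "clin f \<Longrightarrow> clin g \<Longrightarrow> clin (\<lambda>x. f x - g x)"
  by (simp add: lin_on_def vec.scale_right_diff_distrib algebra_simps)
lemma clin_smult: "clin f \<Longrightarrow> clin (\<lambda>x. a *s f x)"
  by (simp add: lin_on_def vec.scale_right_distrib vec.scale_left_commute del: vec.scale_scale)
lemma clin_uminus: "clin f \<Longrightarrow> clin (\<lambda>x. - f x)"
  by (simp add: lin_on_def)
lemma clin_setsum: "(\<And>i. i \<in> I \<Longrightarrow> clin (f i)) \<Longrightarrow> clin (\<lambda>x. \<Sum>i\<in>I. f i x)"
  by (simp add: lin_on_def sum.distrib vec.scale_sum_right)

definition bilin :: "(('n::finite) cvec \<Rightarrow> 'n cvec \<Rightarrow> 'n cvec) \<Rightarrow> bool" where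
  "bilin om \<longleftrightarrow> (\<forall>x. clin (om x)) \<and> (\<forall>y. clin (\<lambda>x. om x y))"

lemma bilin_add_left: "bilin om \<Longrightarrow> om (x + y) z = om x z + om y z"
  and bilin_add_right: "bilin om \<Longrightarrow> om z (x + y) = om z x + om z y"
  and bilin_scale_left: "bilin om \<Longrightarrow> om (a *s x) z = a *s om x z"
  and bilin_scale_right: "bilin om \<Longrightarrow> om z (a *s x) = a *s om z x"
  unfolding bilin_def using clin_add[of "\<lambda>x. om x z"] clin_add[of "om z"]
    clin_scale[of "\<lambda>x. om x z"] clin_scale[of "om z"] by blast+

lemma bilin_zero_left: "bilin om \<Longrightarrow> om 0 z = 0"
  and bilin_zero_right: "bilin om \<Longrightarrow> om z 0 = 0"
  and bilin_minus_left: "bilin om \<Longrightarrow> om (- x) z = - om x z"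
  and bilin_minus_right: "bilin om \<Longrightarrow> om z (- x) = - om z x"
  and bilin_diff_left: "bilin om \<Longrightarrow> om (x - y) z = om x z - om y z"
  and bilin_diff_right: "bilin om \<Longrightarrow> om z (x - y) = om z x - om z y"
  and bilin_sum_left: "bilin om \<Longrightarrow> om (\<Sum>i\<in>I. g i) z = (\<Sum>i\<in>I. om (g i) z)"
  and bilin_sum_right: "bilin om \<Longrightarrow> om z (\<Sum>i\<in>I. g i) = (\<Sum>i\<in>I. om z (g i))"
  using clin_zero[of "\<lambda>x. om x z"] clin_zero[of "om z"] clin_minus[of "\<lambda>x. om x z"]
    clin_minus[of "om z"] clin_diff[of "\<lambda>x. om x z"] clin_diff[of "om z"]
    clin_sum[of "\<lambda>x. om x z"] clin_sum[of "om z"]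
  unfolding bilin_def by blast+

lemmas bilin_simps = bilin_add_left bilin_add_right bilin_scale_left bilin_scale_right
  bilin_zero_left bilin_zero_right bilin_minus_left bilin_minus_right bilin_diff_left bilin_diff_right
  bilin_sum_left bilin_sum_right

locale hermitian =
  fixes gh :: "('n::finite) cvec \<Rightarrow> 'n cvec \<Rightarrow> complex"
  assumes ip: "hermitian_ip gh"
begin

lemma gh_add_left: "gh (x + y) z = gh x z + gh y z"
  and gh_scale_left [simp]: "gh (a *s x) y = a * gh x y"
  and gh_cnj: "gh y x = cnj (gh x y)"
  and gh_pos: "x \<noteq> 0 \<Longrightarrow> Re (gh x x) > 0"
  using ip unfolding hermitian_ip_def by blast+

lemma gh_add_right: "gh z (x + y) = gh z x + gh z y"
  by (metis complex_cnj_add gh_add_left gh_cnj)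
lemma gh_scale_right [simp]: "gh x (a *s y) = cnj a * gh x y"
  by (metis complex_cnj_mult gh_scale_left gh_cnj)
lemma gh_zero_left [simp]: "gh 0 y = 0"
  using gh_scale_left[of 0 0 y] by simp
lemma gh_zero_right [simp]: "gh y 0 = 0"
  using gh_scale_right[of y 0 0] by simp
lemma gh_minus_left [simp]: "gh (- x) y = - gh x y"
  using gh_scale_left[of "-1" x y] by (simp add: vec.scale_minus_left)
lemma gh_minus_right [simp]: "gh x (- y) = - gh x y"
  using gh_scale_right[of x "-1" y] by (simp add: vec.scale_minus_left)
lemma gh_diff_left: "gh (x - y) z = gh x z - gh y z"
  using gh_add_left[of x "-y" z] by simp
lemma gh_diff_right: "gh z (x - y) = gh z x - gh z y"
  using gh_add_right[of z x "-y"] by simp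
lemma gh_sum_left: "gh (\<Sum>i\<in>I. f i) y = (\<Sum>i\<in>I. gh (f i) y)"
  by (induction I rule: infinite_finite_induct) (auto simp: gh_add_left)
lemma gh_sum_right: "gh y (\<Sum>i\<in>I. f i) = (\<Sum>i\<in>I. gh y (f i))"
  by (induction I rule: infinite_finite_induct) (auto simp: gh_add_right)
lemmas gh_simps = gh_add_left gh_add_right gh_diff_left gh_diff_right gh_sum_left gh_sum_right

lemma gh_nonneg: "Re (gh x x) \<ge> 0"
  by (cases "x = 0") (auto dest: gh_pos)
lemma gh_eq0 [simp]: "gh x x = 0 \<longleftrightarrow> x = 0"
  using gh_pos[of x] by (cases "x = 0") auto
lemma gh_Re_eq0 [simp]: "Re (gh x x) = 0 \<longleftrightarrow> x = 0"
  using gh_pos[of x] by (cases "x = 0") auto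
lemma gh_self_real: "gh x x = of_real (Re (gh x x))"
proof -
  have "Im (gh x x) = Im (cnj (gh x x))" by (rule arg_cong[OF gh_cnj])
  then show ?thesis by (simp add: complex_eq_iff)
qed
lemma gh_mult_cnj: "gh x y * gh y x = of_real ((cmod (gh x y))\<^sup>2)"
  unfolding gh_cnj[of y x] by (simp only: complex_norm_square)

text \<open>Sets in place of the lists of \<open>unitary_basis\<close>, since bases are extended,
  split and united throughout; \<open>onb_unitary_basis\<close> and \<open>unitary_basis_onb\<close>
  translate.\<close>

definition ons :: "'n cvec set \<Rightarrow> bool" where
  "ons S \<longleftrightarrow> (\<forall>x\<in>S. \<forall>y\<in>S. gh x y = (if x = y then 1 else 0))"

definition onb :: "'n cvec set \<Rightarrow> 'n cvec set \<Rightarrow> bool" where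
  "onb V S \<longleftrightarrow> ons S \<and> vec.span S = V"

lemma ons_gh_sum:
  assumes "ons S" "finite T" "T \<subseteq> S" "y \<in> S"
  shows "gh (\<Sum>e\<in>T. c e *s e) y = (if y \<in> T then c y else 0)"
proof -
  have "gh (\<Sum>e\<in>T. c e *s e) y = (\<Sum>e\<in>T. c e * (if e = y then 1 else 0))"
    unfolding gh_sum_left using assms by (intro sum.cong) (auto simp: ons_def)
  also have "\<dots> = (if y \<in> T then c y else 0)" using assms(2) by (simp add: if_distrib cong: if_cong)
  finally show ?thesis .
qed

lemma ons_independent: assumes "ons S" shows "vec.independent S"
  unfolding vec.independent_explicit_module
proof safe
  fix T u v assume T: "finite T" "T \<subseteq> S" "(\<Sum>v\<in>T. u v *s v) = 0" "v \<in> T"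
  then show "u v = 0" using ons_gh_sum[OF assms T(1,2), of v u] by auto
qed

lemma ons_finite: "ons S \<Longrightarrow> finite S"
  using ons_independent vec.finiteI_independent by blast

lemma onb_finite: "onb V S \<Longrightarrow> finite S"
  and onb_subset: "onb V S \<Longrightarrow> S \<subseteq> V"
  and onb_subspace: "onb V S \<Longrightarrow> vec.subspace V"
  and onb_in: "onb V S \<Longrightarrow> e \<in> S \<Longrightarrow> e \<in> V"
  using ons_finite vec.span_superset by (auto simp: onb_def)

lemma onb_gh: "onb V S \<Longrightarrow> x \<in> S \<Longrightarrow> y \<in> S \<Longrightarrow> gh x y = (if x = y then 1 else 0)"
  by (auto simp: onb_def ons_def)

lemma onb_expand: assumes "onb V S" "x \<in> V" shows "x = (\<Sum>e\<in>S. gh x e *s e)"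
proof -
  have f: "finite S" and o: "ons S" using assms onb_finite by (auto simp: onb_def)
  obtain c where c: "x = (\<Sum>e\<in>S. c e *s e)"
    using assms vec.span_finite[OF f] by (auto simp: onb_def)
  have "c e = gh x e" if "e \<in> S" for e
    using ons_gh_sum[OF o f _ that, of c] c that by auto
  then show ?thesis using c by (metis (no_types, lifting) sum.cong)
qed

text \<open>One Gram-Schmidt step. The last two conclusions serve the Schur basis below: the new
  vector stays in every subspace that contains the data, and modulo \<open>vec.span S\<close> it is
  a multiple of \<open>x\<close>, so that eigenvectors modulo an invariant span stay
  eigenvectors.\<close>

lemma ons_insert:
  assumes "ons S" "x \<notin> vec.span S"
  obtains y where "ons (insert y S)" "y \<notin> S" "vec.span (insert y S) = vec.span (insert x S)"
    "\<And>W. vec.subspace W \<Longrightarrow> S \<subseteq> W \<Longrightarrow> x \<in> W \<Longrightarrow> y \<in> W"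
    "\<exists>a. a \<noteq> 0 \<and> y - a *s x \<in> vec.span S"
proof -
  have f: "finite S" using assms ons_finite by auto
  define z where "z = x - (\<Sum>e\<in>S. gh x e *s e)"
  have zS: "(\<Sum>e\<in>S. gh x e *s e) \<in> vec.span S"
    by (intro vec.span_sum vec.span_scale vec.span_base)
  have z0: "z \<noteq> 0" using assms(2) zS by (auto simp: z_def)
  have zo: "gh z e = 0" if "e \<in> S" for e
    using ons_gh_sum[OF assms(1) f _ that, of "gh x"] that by (simp add: z_def gh_diff_left)
  define r where "r = 1 / sqrt (Re (gh z z))"
  define a where "a = complex_of_real r"
  have a0: "a \<noteq> 0" using z0 by (simp add: a_def r_def)
  have r1: "Re (gh z z) * r\<^sup>2 = 1" using gh_pos[OF z0] z0 by (simp add: r_def power_divide)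
  define y where "y = a *s z"
  have ye: "gh y e = 0" if "e \<in> S" for e using zo[OF that] by (simp add: y_def)
  have ey: "gh e y = 0" if "e \<in> S" for e using ye[OF that] gh_cnj[of e y] by simp
  have "gh y y = a * (a * gh z z)" by (simp add: y_def a_def)
  also have "\<dots> = a * (a * of_real (Re (gh z z)))" by (subst gh_self_real) simp
  also have "\<dots> = of_real (Re (gh z z) * r\<^sup>2)" by (simp add: a_def power2_eq_square)
  also have "\<dots> = 1" unfolding r1 by simp
  finally have yy: "gh y y = 1" .
  have yS: "y \<notin> S"
  proof
    assume "y \<in> S" then show False using ye[of y] yy by simp
  qed
  have "ons (insert y S)" using assms(1) ye ey yy by (auto simp: ons_def)
  moreover have yd: "y = a *s x - a *s (\<Sum>e\<in>S. gh x e *s e)" by (simp add: y_def z_def vec.scale_right_diff_distrib)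
  have sp: "vec.span (insert y S) = vec.span (insert x S)"
  proof -
  have "vec.span (insert x S) = vec.span (insert ((1/a) *s y) S)"
    by (rule vec.eq_span_insert_eq) (use zS a0 in \<open>simp add: y_def z_def\<close>)
  also have "\<dots> = vec.span (insert y S)"
  proof -
    have "y \<in> vec.span (insert ((1/a) *s y) S)"
      using vec.span_scale[OF vec.span_base[of "(1/a) *s y" "insert ((1/a) *s y) S"], of a] a0 by simp
    moreover have "(1/a) *s y \<in> vec.span (insert y S)"
      by (intro vec.span_scale vec.span_base) simp
    ultimately show ?thesis unfolding vec.span_eq
      by (auto intro: vec.span_base)
  qed
  finally show ?thesis by simp
  qed
  moreover have "y \<in> W" if "vec.subspace W" "S \<subseteq> W" "x \<in> W" for W
    unfolding yd using that by (intro vec.subspace_diff vec.subspace_scale vec.subspace_sum) auto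
  moreover have "y - a *s x \<in> vec.span S" unfolding yd
    using zS by (simp add: vec.span_neg vec.span_scale)
  ultimately show ?thesis using that[of y] a0 yS sp by blast
qed

lemma ons_extend:
  assumes "ons S" "S \<subseteq> V" "vec.subspace V"
  obtains T where "S \<subseteq> T" "onb V T"
proof -
  have "\<exists>T. S \<subseteq> T \<and> onb V T" using assms(1,2)
  proof (induction "vec.dim V - card S" arbitrary: S rule: less_induct)
    case less
    show ?case
    proof (cases "vec.span S = V")
      case True then show ?thesis using less by (auto simp: onb_def)
    next
      case False
      then obtain x where x: "x \<in> V" "x \<notin> vec.span S"
        using vec.span_minimal[OF less.prems(2) assms(3)] by auto
      obtain y where y: "ons (insert y S)" "y \<notin> S" "y \<in> V"
        using ons_insert[OF less.prems(1) x(2)] less.prems(2) x(1) assms(3) by metis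
      have "card (insert y S) = Suc (card S)"
        using y ons_finite[OF less.prems(1)] by simp
      moreover have "card (insert y S) \<le> vec.dim V"
        using ons_independent[OF y(1)] y(3) less.prems(2)
        by (intro vec.independent_card_le_dim) auto
      ultimately have "\<exists>T. insert y S \<subseteq> T \<and> onb V T"
        using less.hyps[of "insert y S"] y less.prems by auto
      then show ?thesis by blast
    qed
  qed
  then show ?thesis using that by blast
qed

lemma onb_exists: assumes "vec.subspace V" obtains T where "onb V T"
  using ons_extend[of "{}" V] assms by (auto simp: ons_def)

lemma onb_extend: assumes "onb W S" "W \<subseteq> V" "vec.subspace V" obtains T where "S \<subseteq> T" "onb V T"
  using ons_extend[of S V] assms onb_subset[of W S] by (auto simp: onb_def)

lemma onb_unitary_basis: "onb V S \<Longrightarrow> \<exists>es. unitary_basis gh V es \<and> set es = S \<and> distinct es"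
proof -
  assume S: "onb V S"
  obtain es where es: "set es = S" "distinct es" using finite_distinct_list onb_finite[OF S] by blast
  have "unitary_basis gh V es"
    unfolding unitary_basis_def using S es onb_subset[OF S]
    by (auto simp: onb_def ons_def nth_eq_iff_index_eq)
  then show ?thesis using es by blast
qed

lemma unitary_basis_onb: assumes "unitary_basis gh V es" shows "onb V (set es)" "distinct es"
proof -
  show d: "distinct es" unfolding distinct_conv_nth
  proof (intro allI impI notI)
    fix i j assume "i < length es" "j < length es" "i \<noteq> j" "es ! i = es ! j"
    then show False using assms unfolding unitary_basis_def by (metis zero_neq_one)
  qed
  show "onb V (set es)" using assms d
    by (auto simp: unitary_basis_def onb_def ons_def in_set_conv_nth nth_eq_iff_index_eq)
qed

lemma some_ub: assumes "vec.subspace V"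
  shows "onb V (set (some_ub gh V))" "distinct (some_ub gh V)"
proof -
  obtain T where "onb V T" using onb_exists assms by blast
  then have "unitary_basis gh V (some_ub gh V)"
    unfolding some_ub_def by (metis onb_unitary_basis someI_ex)
  then show "onb V (set (some_ub gh V))" "distinct (some_ub gh V)" using unitary_basis_onb by auto
qed

section \<open>Diagonal sums of sesquilinear forms, traces and adjoints\<close>

definition sesq :: "('n cvec \<Rightarrow> 'n cvec \<Rightarrow> complex) \<Rightarrow> bool" where
  "sesq b \<longleftrightarrow> (\<forall>x y z. b (x + y) z = b x z + b y z) \<and> (\<forall>x y z. b z (x + y) = b z x + b z y) \<and>
     (\<forall>a x y. b (a *s x) y = a * b x y) \<and> (\<forall>a x y. b x (a *s y) = cnj a * b x y)"

lemma sesq_sum_left: assumes "sesq b" shows "b (\<Sum>i\<in>I. f i) y = (\<Sum>i\<in>I. b (f i) y)"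
proof -
  have "b 0 y = 0" using assms unfolding sesq_def by (metis mult_zero_left vector_smult_lzero)
  then show ?thesis using assms
    by (induction I rule: infinite_finite_induct) (auto simp: sesq_def)
qed
lemma sesq_sum_right: assumes "sesq b" shows "b y (\<Sum>i\<in>I. f i) = (\<Sum>i\<in>I. b y (f i))"
proof -
  have "b y 0 = 0" using assms unfolding sesq_def by (metis mult_zero_left vector_smult_lzero complex_cnj_zero)
  then show ?thesis using assms
    by (induction I rule: infinite_finite_induct) (auto simp: sesq_def)
qed

lemma sesq_expand_left: assumes "sesq b" "onb V S" "x \<in> V" shows "b x y = (\<Sum>e\<in>S. gh x e * b e y)"
proof -
  have "b x y = b (\<Sum>e\<in>S. gh x e *s e) y" using onb_expand[OF assms(2,3)] by simp
  then show ?thesis using assms(1) by (simp add: sesq_sum_left) (simp add: sesq_def)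
qed
lemma sesq_expand_right: assumes "sesq b" "onb V S" "x \<in> V" shows "b y x = (\<Sum>e\<in>S. gh e x * b y e)"
proof -
  have "b y x = b y (\<Sum>e\<in>S. gh x e *s e)" using onb_expand[OF assms(2,3)] by simp
  also have "\<dots> = (\<Sum>e\<in>S. cnj (gh x e) * b y e)"
    unfolding sesq_sum_right[OF assms(1)] using assms(1) by (simp add: sesq_def)
  finally show ?thesis by (simp only: gh_cnj[symmetric])
qed

text \<open>Expanding one slot in the other basis turns both sides into the same double sum. Traces,
  moment maps and norms of brackets are all such diagonal sums, so the bases picked by
  \<open>SOME\<close> in the definitions may be exchanged for adapted ones.\<close>

lemma sesq_indep: assumes "sesq b" "onb V S" "onb V T" shows "(\<Sum>e\<in>S. b e e) = (\<Sum>e\<in>T. b e e)"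
proof -
  have "(\<Sum>e\<in>S. b e e) = (\<Sum>e\<in>S. \<Sum>t\<in>T. gh e t * b t e)"
    using sesq_expand_left[OF assms(1,3)] onb_in[OF assms(2)] by (intro sum.cong) auto
  also have "\<dots> = (\<Sum>t\<in>T. \<Sum>e\<in>S. gh e t * b t e)" by (rule sum.swap)
  also have "\<dots> = (\<Sum>t\<in>T. b t t)"
    using sesq_expand_right[OF assms(1,2)] onb_in[OF assms(3)] by (intro sum.cong) auto
  finally show ?thesis .
qed

lemma gh_expand_left: "onb V S \<Longrightarrow> x \<in> V \<Longrightarrow> gh x y = (\<Sum>e\<in>S. gh x e * gh e y)"
  by (rule sesq_expand_left) (auto simp: sesq_def gh_simps)
lemma gh_expand_right: "onb V S \<Longrightarrow> y \<in> V \<Longrightarrow> gh x y = (\<Sum>e\<in>S. gh x e * gh e y)"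
  using sesq_expand_right[of gh V S y x] by (auto simp: sesq_def gh_simps mult.commute)

lemma ctr_onb: assumes "onb V S" "clin f" shows "ctr gh V f = (\<Sum>e\<in>S. gh (f e) e)"
proof -
  note u = some_ub[OF onb_subspace[OF assms(1)]]
  have "sesq (\<lambda>x y. gh (f x) y)" using assms(2) by (auto simp: sesq_def gh_simps lin_on_def)
  then have "(\<Sum>e\<in>set (some_ub gh V). gh (f e) e) = (\<Sum>e\<in>S. gh (f e) e)"
    using sesq_indep[OF _ u(1) assms(1)] by blast
  then show ?thesis using u by (simp add: ctr_def sum_list_distinct_conv_sum_set)
qed

lemma hadj_some: assumes "vec.subspace V"
  shows "hadj gh V f x = (\<Sum>e\<in>set (some_ub gh V). gh x (f e) *s e)"
  using some_ub[OF assms] by (simp add: hadj_def sum_list_distinct_conv_sum_set)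

lemma hadj_in: assumes "vec.subspace V" shows "hadj gh V f x \<in> V"
  unfolding hadj_some[OF assms] using some_ub[OF assms] onb_in assms
  by (intro vec.subspace_sum vec.subspace_scale) auto

lemma clin_hadj: "vec.subspace V \<Longrightarrow> clin (hadj gh V f)"
  by (rule clinI) (simp_all add: hadj_some gh_simps vec.scale_left_distrib sum.distrib vec.scale_sum_right)

text \<open>\<open>hadj gh V f\<close> is the adjoint of the restriction of \<open>f\<close> to
  \<open>V\<close>, as a map from the whole space to \<open>V\<close>. Linearity is asked on
  \<open>V\<close> alone because soliton derivations of an ideal are arbitrary outside it.\<close>

lemma gh_hadj: assumes "vec.subspace V" "lin_on V f" "y \<in> V" shows "gh (hadj gh V f x) y = gh x (f y)"
proof -
  note u = some_ub(1)[OF assms(1)]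
  have "f y = f (\<Sum>e\<in>set (some_ub gh V). gh y e *s e)" using onb_expand[OF u assms(3)] by simp
  also have "\<dots> = (\<Sum>e\<in>set (some_ub gh V). gh y e *s f e)"
    using lin_on_sum[OF assms(2,1), of "set (some_ub gh V)" "\<lambda>e. gh y e *s e"] assms(1,2) onb_in[OF u]
    by (simp add: vec.subspace_scale) (simp add: lin_on_def)
  finally have "gh x (f y) = (\<Sum>e\<in>set (some_ub gh V). cnj (gh y e) * gh x (f e))"
    by (simp add: gh_sum_right)
  then have "gh x (f y) = (\<Sum>e\<in>set (some_ub gh V). gh e y * gh x (f e))"
    by (simp only: gh_cnj[symmetric])
  then show ?thesis by (simp add: hadj_some[OF assms(1)] gh_sum_left mult.commute)
qed

lemma gh_eqI: assumes "vec.subspace V" "x \<in> V" "y \<in> V" "\<And>z. z \<in> V \<Longrightarrow> gh x z = gh y z" shows "x = y"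
  using assms(4)[of "x - y"] assms vec.subspace_diff[OF assms(1-3)]
  by (metis eq_iff_diff_eq_0 gh_diff_left gh_eq0)

abbreviation adj :: "('n cvec \<Rightarrow> 'n cvec) \<Rightarrow> 'n cvec \<Rightarrow> 'n cvec" where "adj f \<equiv> hadj gh UNIV f"

lemma clin_adj [intro]: "clin (adj f)" by (simp add: clin_hadj)
lemma gh_adj: "clin f \<Longrightarrow> gh (adj f x) y = gh x (f y)" by (simp add: gh_hadj)
lemma gh_adj': "clin f \<Longrightarrow> gh x (adj f y) = gh (f x) y" by (metis gh_adj gh_cnj)
lemma eq_by_gh: "(\<And>z. gh x z = gh y z) \<Longrightarrow> x = y" by (rule gh_eqI[of UNIV]) auto
lemma adjI: "clin f \<Longrightarrow> (\<And>z. gh y z = gh x (f z)) \<Longrightarrow> adj f x = y"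
  by (rule eq_by_gh) (simp add: gh_adj)

text \<open>Cyclicity of the trace in sesquilinear form: both sides equal the double sum of
  \<open>gh (A e) t * b t e\<close>.\<close>

lemma sesq_adj: assumes "sesq b" "onb UNIV S" "clin A"
  shows "(\<Sum>e\<in>S. b (A e) e) = (\<Sum>e\<in>S. b e (adj A e))"
proof -
  have "(\<Sum>e\<in>S. b (A e) e) = (\<Sum>e\<in>S. \<Sum>t\<in>S. gh (A e) t * b t e)"
    by (intro sum.cong refl sesq_expand_left[OF assms(1,2)]) simp
  also have "\<dots> = (\<Sum>t\<in>S. \<Sum>e\<in>S. gh (A e) t * b t e)" by (rule sum.swap)
  also have "\<dots> = (\<Sum>t\<in>S. b t (adj A t))"
    by (intro sum.cong refl) (simp add: sesq_expand_right[OF assms(1,2), of "adj A _"] gh_adj'[OF assms(3)])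
  finally show ?thesis .
qed

text \<open>The adjoint of the inclusion of \<open>V\<close> is the orthogonal projection onto
  \<open>V\<close>.\<close>

definition prj :: "'n cvec set \<Rightarrow> 'n cvec \<Rightarrow> 'n cvec" where
  "prj V = hadj gh V (\<lambda>x. x)"

lemma prj_in: "vec.subspace V \<Longrightarrow> prj V x \<in> V" and clin_prj: "vec.subspace V \<Longrightarrow> clin (prj V)"
  by (simp_all add: prj_def hadj_in clin_hadj)
lemma gh_prj: "vec.subspace V \<Longrightarrow> y \<in> V \<Longrightarrow> gh (prj V x) y = gh x y"
  by (simp add: prj_def gh_hadj lin_on_def)
lemma prj_id: "vec.subspace V \<Longrightarrow> x \<in> V \<Longrightarrow> prj V x = x"
  by (rule gh_eqI[of V]) (auto simp: prj_in gh_prj)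
lemma gh_prj_self: "vec.subspace V \<Longrightarrow> gh (prj V x) y = gh x (prj V y)"
  by (metis gh_cnj gh_prj prj_in)
lemma prj_zero: "vec.subspace V \<Longrightarrow> (\<And>y. y \<in> V \<Longrightarrow> gh x y = 0) \<Longrightarrow> prj V x = 0"
  by (rule gh_eqI[of V]) (auto simp: prj_in gh_prj vec.subspace_0)
lemma cmod_zero_of_sum: assumes "finite S" "(\<Sum>x\<in>S. gh (f x) (f x)) = 0" "x \<in> S" shows "f x = 0"
proof -
  have "(\<Sum>x\<in>S. Re (gh (f x) (f x))) = 0" using assms(2) by (metis Re_sum zero_complex.sel(1))
  then have "Re (gh (f x) (f x)) = 0" using assms(1,3) sum_nonneg_eq_0_iff[of S "\<lambda>x. Re (gh (f x) (f x))"] gh_nonneg by auto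
  then show ?thesis by simp
qed

lemma norm_expand: assumes "onb V S" "x \<in> V" shows "gh x x = (\<Sum>e\<in>S. of_real ((cmod (gh x e))\<^sup>2))"
  by (subst gh_expand_left[OF assms]) (simp add: gh_mult_cnj)

end

section \<open>Adapted bases and triangular form\<close>

text \<open>The vectors of \<open>K\<close> outside \<open>B\<close> are added one at a time. If one
  of them depended on the earlier ones, its part in \<open>vec.span B\<close> would also lie in
  \<open>vec.span K\<close>, hence be a combination of common vectors, and \<open>K\<close> would be
  dependent.\<close>

lemma independent_Un_of_Int:
  assumes "vec.independent B" "vec.independent K" "vec.span B \<inter> vec.span K \<subseteq> vec.span (B \<inter> K)"
  shows "vec.independent (B \<union> K :: ('a::field^'n) set)"
proof -
  have fin: "finite (K - B)" using vec.finiteI_independent[OF assms(2)] by simp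
  have "vec.independent (B \<union> F)" if "finite F" "F \<subseteq> K - B" for F
    using that
  proof (induction F)
    case empty then show ?case using assms by simp
  next
    case (insert x F)
    have "x \<notin> vec.span (B \<union> F)"
    proof
      assume "x \<in> vec.span (B \<union> F)"
      then obtain b f where bf: "x = b + f" "b \<in> vec.span B" "f \<in> vec.span F"
        unfolding vec.span_Un by auto
      have xK: "x \<in> vec.span K" using insert by (auto intro: vec.span_base)
      have fK: "f \<in> vec.span K" using bf(3) insert vec.span_mono[of F K] by auto
      have "b = x - f" using bf by simp
      then have "b \<in> vec.span K" using vec.span_diff[OF xK fK] by simp
      then have "b \<in> vec.span (B \<inter> K)" using assms(3) bf by auto
      then have "b \<in> vec.span (K - {x})"
        using vec.span_mono[of "B \<inter> K" "K - {x}"] insert by auto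
      moreover have "f \<in> vec.span (K - {x})"
        using bf(3) vec.span_mono[of F "K - {x}"] insert by auto
      ultimately have "x \<in> vec.span (K - {x})" using bf(1) vec.span_add by blast
      then show False using assms(2) insert(4) unfolding vec.dependent_def by auto
    qed
    then show ?case using insert vec.independent_insertI by auto
  qed
  from this[OF fin] show ?thesis by simp
qed

text \<open>Coordinates with respect to \<open>S\<close> are unique, so those of a common element
  are supported in both subsets.\<close>

lemma independent_span_Int:
  assumes "vec.independent S" "A \<subseteq> S" "B \<subseteq> S"
  shows "vec.span A \<inter> vec.span B \<subseteq> vec.span (A \<inter> B :: ('a::field^'n) set)"
proof
  fix x assume x: "x \<in> vec.span A \<inter> vec.span B"
  have rA: "vec.representation S x = vec.representation A x"
    using vec.representation_extend[OF assms(1) _ assms(2)] x by auto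
  have rB: "vec.representation S x = vec.representation B x"
    using vec.representation_extend[OF assms(1) _ assms(3)] x by auto
  have iA: "vec.independent A" using assms vec.independent_mono by blast
  have "x = (\<Sum>b | vec.representation A x b \<noteq> 0. vec.representation A x b *s b)"
    using vec.sum_nonzero_representation_eq[OF iA] x by auto
  moreover have in_AB: "b \<in> A \<inter> B" if "vec.representation A x b \<noteq> 0" for b
    using that vec.representation_ne_zero[of A x b] vec.representation_ne_zero[of B x b] rA rB by auto
  have "(\<Sum>b | vec.representation A x b \<noteq> 0. vec.representation A x b *s b) \<in> vec.span (A \<inter> B)"
    by (intro vec.span_sum vec.span_scale vec.span_base in_AB) simp
  ultimately show "x \<in> vec.span (A \<inter> B)" by simp
qed

text \<open>The members of the chain are treated by increasing dimension; the vectors already inside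
  \<open>X\<close> are completed to a basis of \<open>X\<close>. The hypothesis on
  \<open>vec.span B \<inter> X\<close> is what keeps the new vectors independent of those of
  \<open>B\<close> outside \<open>X\<close>.\<close>

lemma extend_basis_chain:
  assumes "finite XX" "\<And>X. X \<in> XX \<Longrightarrow> vec.subspace X" "\<And>X Y. X \<in> XX \<Longrightarrow> Y \<in> XX \<Longrightarrow> X \<subseteq> Y \<or> Y \<subseteq> X"
    "vec.independent B" "\<And>X. X \<in> XX \<Longrightarrow> vec.span B \<inter> X \<subseteq> vec.span (B \<inter> X)"
  shows "\<exists>C. B \<subseteq> C \<and> vec.independent C \<and> C \<subseteq> B \<union> \<Union>XX \<and> (\<forall>X\<in>XX. X \<subseteq> vec.span (C \<inter> X :: ('a::field^'n) set))"
  using assms(1-3,5)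
proof (induction XX rule: finite_ranking_induct[where f = vec.dim])
  case empty
  show ?case by (rule exI[of _ B]) (simp add: assms(4))
next
  case (insert X XX)
  have sub: "Z \<subseteq> X" if "Z \<in> XX" for Z
  proof -
    have "Z \<subseteq> X \<or> X \<subseteq> Z" by (rule insert.prems(2)) (use that in auto)
    moreover have "X = Z" if "X \<subseteq> Z"
      by (rule vec.subspace_dim_equal[OF insert.prems(1) insert.prems(1) that insert.hyps(2)]) (simp_all add: \<open>Z \<in> XX\<close>)
    ultimately show ?thesis by blast
  qed
  have "\<exists>C. B \<subseteq> C \<and> vec.independent C \<and> C \<subseteq> B \<union> \<Union>XX \<and> (\<forall>X\<in>XX. X \<subseteq> vec.span (C \<inter> X))"
    by (rule insert.IH[OF insert.prems]) simp_all
  then obtain C where C: "B \<subseteq> C" "vec.independent C" "C \<subseteq> B \<union> \<Union>XX" "\<forall>X\<in>XX. X \<subseteq> vec.span (C \<inter> X)"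
    by (elim exE conjE)
  have sX: "vec.subspace X" using insert.prems by auto
  have "vec.independent (C \<inter> X)" using C(2) vec.independent_mono by blast
  then obtain K where K: "C \<inter> X \<subseteq> K" "K \<subseteq> X" "vec.independent K" "X \<subseteq> vec.span K"
    using vec.maximal_independent_subset_extend[of "C \<inter> X" X] by auto
  have KX: "vec.span K = X" using K sX vec.span_minimal by blast
  have "vec.span C \<inter> vec.span K \<subseteq> vec.span (C \<inter> K)"
  proof
    fix v assume v: "v \<in> vec.span C \<inter> vec.span K"
    have "C = (C \<inter> X) \<union> (C - X)" by auto
    then have "v \<in> vec.span ((C \<inter> X) \<union> (C - X))" using v by auto
    then obtain a b where ab: "v = a + b" "a \<in> vec.span (C \<inter> X)" "b \<in> vec.span (C - X)"
      unfolding vec.span_Un by auto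
    have "C - X \<subseteq> B" using C(3) sub by auto
    then have bB: "b \<in> vec.span B" using ab(3) vec.span_mono by blast
    have "a \<in> X" using ab(2) sX vec.span_minimal[of "C \<inter> X" X] by auto
    then have "b \<in> X" using ab(1) v KX sX vec.subspace_diff[of X v a] by auto
    then have "b \<in> vec.span (B \<inter> X)" using bB insert.prems(3)[of X] by auto
    then have "b \<in> vec.span (C \<inter> X)" using vec.span_mono[of "B \<inter> X" "C \<inter> X"] C(1) by auto
    then have "v \<in> vec.span (C \<inter> X)" using ab vec.span_add by auto
    then show "v \<in> vec.span (C \<inter> K)" using vec.span_mono[of "C \<inter> X" "C \<inter> K"] K(1) by auto
  qed
  then have ind: "vec.independent (C \<union> K)" using independent_Un_of_Int C(2) K(3) by blast
  have "Y \<subseteq> vec.span ((C \<union> K) \<inter> Y)" if "Y \<in> insert X XX" for Y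
  proof (cases "Y = X")
    case True
    then show ?thesis using K(2,4) vec.span_mono[of K "(C \<union> K) \<inter> X"] by auto
  next
    case False
    then show ?thesis using bspec[OF C(4), of Y] that vec.span_mono[of "C \<inter> Y" "(C \<union> K) \<inter> Y"] by auto
  qed
  then show ?case using ind C(1,3) K(2) by (intro exI[of _ "C \<union> K"]) auto
qed

text \<open>A form of the Bruhat decomposition.\<close>

lemma common_basis_aux:
  assumes "finite YY" "\<And>X. X \<in> YY \<Longrightarrow> vec.subspace X" "\<And>X Y. X \<in> YY \<Longrightarrow> Y \<in> YY \<Longrightarrow> X \<subseteq> Y \<or> Y \<subseteq> X"
    "finite XX" "\<And>X. X \<in> XX \<Longrightarrow> vec.subspace X" "\<And>X Y. X \<in> XX \<Longrightarrow> Y \<in> XX \<Longrightarrow> X \<subseteq> Y \<or> Y \<subseteq> X"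
  shows "\<exists>B W. vec.independent B \<and> W \<in> insert {0} YY \<and> B \<subseteq> W \<and> (\<forall>Y\<in>YY. Y \<subseteq> vec.span (B \<inter> Y))
     \<and> (\<forall>X\<in>XX. W \<inter> X \<subseteq> vec.span (B \<inter> X :: ('a::field^'n) set))"
  using assms(1-3)
proof (induction YY rule: finite_ranking_induct[where f = vec.dim])
  case empty
  show ?case by (intro exI[of _ "{}"] exI[of _ "{0}"]) (auto simp: vec.span_zero vec.independent_empty)
next
  case (insert Y YY)
  have sub: "Z \<subseteq> Y" if "Z \<in> YY" for Z
  proof -
    have "Z \<subseteq> Y \<or> Y \<subseteq> Z" by (rule insert.prems(2)) (use that in auto)
    moreover have "Y = Z" if "Y \<subseteq> Z"
      by (rule vec.subspace_dim_equal[OF insert.prems(1) insert.prems(1) that insert.hyps(2)]) (simp_all add: \<open>Z \<in> YY\<close>)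
    ultimately show ?thesis by blast
  qed
  have sY: "vec.subspace Y" using insert.prems by auto
  have "\<exists>B W. vec.independent B \<and> W \<in> insert {0} YY \<and> B \<subseteq> W \<and> (\<forall>Y\<in>YY. Y \<subseteq> vec.span (B \<inter> Y))
     \<and> (\<forall>X\<in>XX. W \<inter> X \<subseteq> vec.span (B \<inter> X))"
    by (rule insert.IH[OF insert.prems]) simp_all
  then obtain B W where B: "vec.independent B" "W \<in> insert {0} YY" "B \<subseteq> W"
    "\<forall>Y\<in>YY. Y \<subseteq> vec.span (B \<inter> Y)" "\<forall>X\<in>XX. W \<inter> X \<subseteq> vec.span (B \<inter> X)" by (elim exE conjE)
  have WY: "W \<subseteq> Y" using B(2) sub sY vec.subspace_0 by auto
  have sW: "vec.subspace W" using B(2) insert.prems(1) by auto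
  have sB: "vec.span B \<subseteq> W" using vec.span_minimal[OF B(3) sW] .
  \<comment> \<open>In the passage from the member \<open>W\<close> of one flag to the next larger
    member \<open>Y\<close>, the basis is extended along the traces of the other flag on
    \<open>Y\<close>, so it remains adapted to both.\<close>
  let ?ZZ = "insert Y ((\<lambda>X. X \<inter> Y) ` XX)"
  have "\<exists>C. B \<subseteq> C \<and> vec.independent C \<and> C \<subseteq> B \<union> \<Union>?ZZ \<and> (\<forall>X\<in>?ZZ. X \<subseteq> vec.span (C \<inter> X))"
  proof (rule extend_basis_chain)
    show "finite ?ZZ" using assms(4) by simp
    show "vec.subspace X" if "X \<in> ?ZZ" for X using that sY assms(5) vec.subspace_inter by auto
    show "X \<subseteq> X' \<or> X' \<subseteq> X" if "X \<in> ?ZZ" "X' \<in> ?ZZ" for X X' using that assms(6) by blast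
    show "vec.independent B" by fact
    show "vec.span B \<inter> X \<subseteq> vec.span (B \<inter> X)" if Xin: "X \<in> ?ZZ" for X
    proof (cases "X = Y")
      case True
      have "B \<inter> Y = B" using B(3) WY by auto
      then show ?thesis using True by auto
    next
      case False
      then have "X \<in> (\<lambda>X. X \<inter> Y) ` XX" using Xin by simp
      then obtain X' where X': "X = X' \<inter> Y" "X' \<in> XX" by (rule imageE)
      have "B \<inter> X = B \<inter> X'" using X' B(3) WY by auto
      then show ?thesis using X' sB bspec[OF B(5), of X'] by auto
    qed
  qed
  then obtain C where C: "B \<subseteq> C" "vec.independent C" "C \<subseteq> B \<union> \<Union>?ZZ" "\<forall>X\<in>?ZZ. X \<subseteq> vec.span (C \<inter> X)"
    by (elim exE conjE)
  have CY: "C \<subseteq> Y" using C(3) B(3) WY by auto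
  show ?case
  proof (intro exI conjI ballI)
    show "vec.independent C" by fact
    show "Y \<in> insert {0} (insert Y YY)" by simp
    show "C \<subseteq> Y" by fact
    show "Z \<subseteq> vec.span (C \<inter> Z)" if "Z \<in> insert Y YY" for Z
    proof (cases "Z = Y")
      case True then show ?thesis using bspec[OF C(4), of Y] by simp
    next
      case False
      then show ?thesis using bspec[OF B(4), of Z] that vec.span_mono[of "B \<inter> Z" "C \<inter> Z"] C(1) by auto
    qed
    show "Y \<inter> X \<subseteq> vec.span (C \<inter> X)" if "X \<in> XX" for X
      using bspec[OF C(4), of "X \<inter> Y"] that vec.span_mono[of "C \<inter> (X \<inter> Y)" "C \<inter> X"] by auto
  qed
qed

lemma common_basis:
  assumes "finite YY" "\<And>X. X \<in> YY \<Longrightarrow> vec.subspace X" "\<And>X Y. X \<in> YY \<Longrightarrow> Y \<in> YY \<Longrightarrow> X \<subseteq> Y \<or> Y \<subseteq> X"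
    "finite XX" "\<And>X. X \<in> XX \<Longrightarrow> vec.subspace X" "\<And>X Y. X \<in> XX \<Longrightarrow> Y \<in> XX \<Longrightarrow> X \<subseteq> Y \<or> Y \<subseteq> X"
  obtains B where "vec.independent B" "vec.span B = UNIV"
    "\<And>X. X \<in> XX \<union> YY \<Longrightarrow> vec.span (B \<inter> X) = (X :: ('a::field^'n) set)"
proof -
  have "\<exists>B W. vec.independent B \<and> W \<in> insert {0} (insert UNIV YY) \<and> B \<subseteq> W \<and> (\<forall>Y\<in>insert UNIV YY. Y \<subseteq> vec.span (B \<inter> Y))
     \<and> (\<forall>X\<in>insert UNIV XX. W \<inter> X \<subseteq> vec.span (B \<inter> X))"
  proof (rule common_basis_aux)
    show "X \<subseteq> Y \<or> Y \<subseteq> X" if "X \<in> insert UNIV YY" "Y \<in> insert UNIV YY" for X Y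
      using that assms(3) by blast
    show "X \<subseteq> Y \<or> Y \<subseteq> X" if "X \<in> insert UNIV XX" "Y \<in> insert UNIV XX" for X Y
      using that assms(6) by blast
  qed (use assms in auto)
  then obtain B W where B: "vec.independent B" "B \<subseteq> W" "\<forall>Y\<in>insert UNIV YY. Y \<subseteq> vec.span (B \<inter> Y)"
    "\<forall>X\<in>insert UNIV XX. W \<inter> X \<subseteq> vec.span (B \<inter> X)" "W \<in> insert {0} (insert UNIV YY)" by (elim exE conjE)
  have sp: "vec.span B = UNIV" using bspec[OF B(3), of UNIV] by auto
  have "vec.subspace W" using B(5) assms(2) by auto
  then have W: "W = UNIV" using sp vec.span_minimal[OF B(2)] by auto
  have "vec.span (B \<inter> X) = X" if X: "X \<in> XX \<union> YY" for X
  proof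
    show "vec.span (B \<inter> X) \<subseteq> X" using X assms(2,5) by (intro vec.span_minimal) auto
    show "X \<subseteq> vec.span (B \<inter> X)" using X bspec[OF B(3), of X] bspec[OF B(4), of X] W by auto
  qed
  then show ?thesis using that B(1) sp by blast
qed

section \<open>Eigenvectors modulo a subspace\<close>

definition peval :: "(('n::finite) cvec \<Rightarrow> 'n cvec) \<Rightarrow> complex poly \<Rightarrow> 'n cvec \<Rightarrow> 'n cvec" where
  "peval D p x = (\<Sum>k\<le>degree p. coeff p k *s (D ^^ k) x)"

lemma peval_sum: assumes "degree p \<le> N" shows "peval D p x = (\<Sum>k\<le>N. coeff p k *s (D ^^ k) x)"
  unfolding peval_def using assms
  by (intro sum.mono_neutral_left) (auto simp: coeff_eq_0)

lemma peval_root: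
  assumes "clin D"
  shows "peval D ([:-z, 1:] * q) x = D (peval D q x) - z *s peval D q x"
proof -
  define N where "N = degree q"
  have c: "coeff ([:-z, 1:] * q) (Suc k) = coeff q k - z * coeff q (Suc k)" for k by simp
  have c0: "coeff ([:-z, 1:] * q) 0 = - z * coeff q 0" by simp
  have d: "degree ([:-z, 1:] * q) \<le> Suc N"
    using degree_mult_le[of "[:-z, 1:]" q] by (simp add: N_def)
  have "peval D ([:-z, 1:] * q) x = (\<Sum>k\<le>Suc N. coeff ([:-z, 1:] * q) k *s (D ^^ k) x)"
    by (rule peval_sum[OF d])
  also have "\<dots> = (- z * coeff q 0) *s x + (\<Sum>k\<le>N. (coeff q k - z * coeff q (Suc k)) *s (D ^^ Suc k) x)"
    by (simp only: sum.atMost_Suc_shift c c0) simp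
  also have "\<dots> = (\<Sum>k\<le>N. coeff q k *s (D ^^ Suc k) x) - ((z * coeff q 0) *s x + (\<Sum>k\<le>N. (z * coeff q (Suc k)) *s (D ^^ Suc k) x))"
    by (simp add: vec.scale_left_diff_distrib sum_subtractf)
  also have "(z * coeff q 0) *s x + (\<Sum>k\<le>N. (z * coeff q (Suc k)) *s (D ^^ Suc k) x)
     = (\<Sum>k\<le>Suc N. (z * coeff q k) *s (D ^^ k) x)"
    by (simp only: sum.atMost_Suc_shift) simp
  also have "\<dots> = z *s peval D q x"
    by (simp add: peval_sum[of q "Suc N"] N_def vec.scale_sum_right vec.scale_right_distrib)
  also have "(\<Sum>k\<le>N. coeff q k *s (D ^^ Suc k) x) = D (peval D q x)"
    using assms by (simp add: peval_def N_def clin_sum clin_scale)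
  finally show ?thesis .
qed

text \<open>The iterates of \<open>x\<close> up to the dimension satisfy a linear relation. A
  coincidence of two iterates is treated apart, because the set of iterates would forget it.\<close>

lemma exists_annihilating_poly:
  fixes x :: "('n::finite) cvec"
  shows "\<exists>p. p \<noteq> 0 \<and> peval D p x = 0"
proof (cases "inj_on (\<lambda>k. (D ^^ k) x) {..CARD('n)}")
  case False
  then obtain i j where ij: "i < j" "(D ^^ i) x = (D ^^ j) x"
    unfolding inj_on_def by (metis linorder_neqE_nat)
  let ?p = "monom (1::complex) j - monom 1 i"
  have "coeff ?p j = 1" using ij by simp
  then have "?p \<noteq> 0" by (metis coeff_0 zero_neq_one)
  have d: "degree ?p \<le> j" using ij by (intro degree_diff_le) (auto simp: degree_monom_eq)
  have "peval D ?p x = (\<Sum>k\<le>j. (if k = j then (D ^^ k) x else 0) - (if k = i then (D ^^ k) x else 0))"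
    unfolding peval_sum[OF d] by (intro sum.cong) (auto simp: vec.scale_left_diff_distrib)
  also have "\<dots> = 0" using ij by (simp add: sum_subtractf)
  finally show ?thesis using \<open>?p \<noteq> 0\<close> by blast
next
  case True
  let ?f = "\<lambda>k. (D ^^ k) x"
  let ?S = "?f ` {..CARD('n)}"
  have "card ?S = Suc CARD('n)" using True by (simp add: card_image)
  then have "vec.dependent ?S"
    using vec.independent_card_le_dim[of ?S UNIV] by (auto simp: card_cart_basis vec.dim_UNIV)
  then obtain u v where u: "v \<in> ?S" "u v \<noteq> 0" "(\<Sum>v\<in>?S. u v *s v) = 0"
    using vec.dependent_finite[of ?S] by auto
  let ?p = "\<Sum>k\<le>CARD('n). monom (u (?f k)) k"
  have c: "coeff ?p k = (if k \<le> CARD('n) then u (?f k) else 0)" for k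
    by (simp add: coeff_sum)
  obtain k where k: "k \<le> CARD('n)" "v = ?f k" using u(1) by auto
  have "coeff ?p k \<noteq> 0" using c k u(2) by auto
  then have p0: "?p \<noteq> 0" by (metis coeff_0)
  have d: "degree ?p \<le> CARD('n)" using c by (intro degree_le) auto
  have "peval D ?p x = (\<Sum>k\<le>CARD('n). u (?f k) *s ?f k)"
    unfolding peval_sum[OF d] by (intro sum.cong) (auto simp: c)
  also have "\<dots> = 0" using u(3) True by (simp add: sum.reindex)
  finally show ?thesis using p0 by blast
qed

text \<open>Take a nonzero polynomial \<open>p\<close> of least degree that sends some
  \<open>x0\<close> of \<open>V\<close> into \<open>W\<close>, and split off a root
  \<open>z\<close>. The cofactor applied to \<open>x0\<close> is outside \<open>W\<close> by
  minimality, and \<open>D - z\<close> sends it into \<open>W\<close>.\<close>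

lemma eigenvector_quotient:
  assumes D: "clin D" and W: "vec.subspace W" and V: "vec.subspace V" "\<And>x. x \<in> V \<Longrightarrow> D x \<in> V" "\<not> V \<subseteq> W"
  obtains x z where "x \<in> V" "x \<notin> W" "D x - z *s x \<in> W"
proof -
  obtain x0 where x0: "x0 \<in> V" "x0 \<notin> W" using V by auto
  have DV: "(D ^^ k) x \<in> V" if "x \<in> V" for k x using that V(2) by (induction k) auto
  have pV: "peval D p x0 \<in> V" for p
    unfolding peval_def by (intro vec.subspace_sum vec.subspace_scale V(1) DV x0)
  define P where "P p \<longleftrightarrow> p \<noteq> 0 \<and> peval D p x0 \<in> W" for p
  have "\<exists>p. P p" using exists_annihilating_poly[of D x0] vec.subspace_0[OF W] P_def by auto
  then obtain p where p: "P p" and min: "\<And>q. degree q < degree p \<Longrightarrow> \<not> P q"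
    using arg_min_natI[of P _ degree] arg_min_nat_le[of P _ degree] by (metis linorder_not_le)
  have "degree p \<noteq> 0"
  proof
    assume "degree p = 0"
    then obtain a where a: "p = [:a:]" using degree_eq_zeroE by blast
    then have "a \<noteq> 0" "a *s x0 \<in> W" using p by (auto simp: P_def peval_def)
    then have "inverse a *s (a *s x0) \<in> W" using W vec.subspace_scale by blast
    then show False using x0 \<open>a \<noteq> 0\<close> by simp
  qed
  then have "\<not> constant (poly p)" by (simp add: constant_degree)
  then obtain z where "poly p z = 0" using fundamental_theorem_of_algebra by blast
  then obtain q where q: "p = [:-z, 1:] * q" using poly_eq_0_iff_dvd by (metis dvdE)
  have q0: "q \<noteq> 0" using p q by (auto simp: P_def)
  then have "degree p = Suc (degree q)" unfolding q by (subst degree_mult_eq) auto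
  then have "\<not> P q" using min by simp
  then have 1: "peval D q x0 \<notin> W" using q0 by (simp add: P_def)
  have "D (peval D q x0) - z *s peval D q x0 \<in> W"
    using p peval_root[OF D, of z q x0] q by (simp add: P_def)
  then show ?thesis using that 1 pV by blast
qed

text \<open>A decreasing filtration by weight. The index type is left free because bases get indexed
  by the dimension type, by natural numbers, or by their own vectors through
  \<open>id\<close>.\<close>

definition Fil :: "('i \<Rightarrow> ('n::finite) cvec) \<Rightarrow> ('i \<Rightarrow> real) \<Rightarrow> 'i set \<Rightarrow> real \<Rightarrow> 'n cvec set" where
  "Fil v w I s = vec.span {v k |k. k \<in> I \<and> s \<le> w k}"

lemma subspace_Fil [simp]: "vec.subspace (Fil v w I s)" by (simp add: Fil_def)
lemma Fil_antimono: "s \<le> t \<Longrightarrow> Fil v w I t \<subseteq> Fil v w I s"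
  unfolding Fil_def by (intro vec.span_mono) auto
lemma Fil_base: "k \<in> I \<Longrightarrow> s \<le> w k \<Longrightarrow> v k \<in> Fil v w I s"
  unfolding Fil_def by (intro vec.span_base) auto

lemma triangular_invariant:
  assumes "clin D" "\<And>k. k < m \<Longrightarrow> D (e k) - lam k *s e k \<in> vec.span (e ` {..<k::nat})"
    "x \<in> vec.span (e ` {..<m})"
  shows "D x \<in> vec.span (e ` {..<m})"
proof -
  have "D (e k) \<in> vec.span (e ` {..<m})" if "k < m" for k
  proof -
    have "e ` {..<k} \<subseteq> e ` {..<m}" using that by auto
    then have "D (e k) - lam k *s e k \<in> vec.span (e ` {..<m})"
      using assms(2)[OF that] vec.span_mono by blast
    moreover have "lam k *s e k \<in> vec.span (e ` {..<m})" using that by (intro vec.span_scale vec.span_base) auto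
    ultimately have "D (e k) - lam k *s e k + lam k *s e k \<in> vec.span (e ` {..<m})" by (rule vec.span_add)
    then show ?thesis by simp
  qed
  then have "e ` {..<m} \<subseteq> {x. D x \<in> vec.span (e ` {..<m})}" by auto
  moreover have "vec.subspace {x. D x \<in> vec.span (e ` {..<m})}"
    using assms(1) by (intro vec.subspaceI)
      (auto simp: clin_zero clin_add clin_scale vec.span_zero vec.span_add vec.span_scale)
  ultimately show ?thesis using assms(3) vec.span_minimal by blast
qed

context hermitian begin

text \<open>A partial orthonormal Schur basis of \<open>D\<close>, filled from the highest weights
  downwards. The comparison conditions express that each \<open>F s\<close> either contains
  everything built so far or is already exhausted, and then it is spanned by the vectors of weight
  at least \<open>s\<close>.\<close>

definition schur_upto :: "('n cvec \<Rightarrow> 'n cvec) \<Rightarrow> (real \<Rightarrow> 'n cvec set) \<Rightarrow> nat \<Rightarrow> (nat \<Rightarrow> 'n cvec) \<Rightarrow> (nat \<Rightarrow> complex) \<Rightarrow> (nat \<Rightarrow> real) \<Rightarrow> bool" where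
  "schur_upto D F m e lam ws \<longleftrightarrow>
     (\<forall>i<m. \<forall>j<m. gh (e i) (e j) = (if i = j then 1 else 0)) \<and>
     (\<forall>k<m. D (e k) - lam k *s e k \<in> vec.span (e ` {..<k})) \<and>
     (\<forall>k<m. \<forall>s. e k \<in> F s \<longleftrightarrow> s \<le> ws k) \<and>
     (\<forall>s. F s \<subseteq> vec.span (e ` {..<m}) \<or> vec.span (e ` {..<m}) \<subseteq> F s) \<and>
     (\<forall>s. F s \<subseteq> vec.span (e ` {..<m}) \<longrightarrow> F s \<subseteq> vec.span {e k |k. k < m \<and> s \<le> ws k}) \<and>
     (\<forall>j k. j < k \<longrightarrow> k < m \<longrightarrow> ws k \<le> ws j)"

lemma schur_uptoD_all:
  assumes "schur_upto D F m e lam ws"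
  shows "\<forall>i<m. \<forall>j<m. gh (e i) (e j) = (if i = j then 1 else 0)"
    "\<forall>k<m. D (e k) - lam k *s e k \<in> vec.span (e ` {..<k})"
    "\<forall>k<m. \<forall>s. e k \<in> F s \<longleftrightarrow> s \<le> ws k"
    "\<forall>s. F s \<subseteq> vec.span (e ` {..<m}) \<or> vec.span (e ` {..<m}) \<subseteq> F s"
    "\<forall>s. F s \<subseteq> vec.span (e ` {..<m}) \<longrightarrow> F s \<subseteq> vec.span {e k |k. k < m \<and> s \<le> ws k}"
    "\<forall>j k. j < k \<longrightarrow> k < m \<longrightarrow> ws k \<le> ws j"
  using assms unfolding schur_upto_def by - (elim conjE, assumption)+

lemmas schur_uptoD =
  schur_uptoD_all(1)[rule_format] schur_uptoD_all(2)[rule_format] schur_uptoD_all(3)[rule_format]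
  schur_uptoD_all(4)[rule_format] schur_uptoD_all(5)[rule_format] schur_uptoD_all(6)[rule_format]

lemma schur_upto_ons:
  assumes "schur_upto D F m e lam ws"
  shows "ons (e ` {..<m})" "inj_on e {..<m}"
proof -
  have o: "gh (e i) (e j) = (if i = j then 1 else 0)" if "i < m" "j < m" for i j
    by (rule schur_uptoD(1)[OF assms that])
  show i: "inj_on e {..<m}"
  proof (rule inj_onI)
    fix i j assume "i \<in> {..<m}" "j \<in> {..<m}" "e i = e j"
    then show "i = j" using o[of i j] o[of j j] by (auto split: if_splits)
  qed
  show "ons (e ` {..<m})" using o i unfolding ons_def inj_on_def by auto
qed

text \<open>The next vector is taken from the highest piece of the filtration not yet contained in
  the span \<open>W\<close> of the previous ones: an eigenvector modulo \<open>W\<close>,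
  orthonormalised against them. When \<open>m\<close> reaches the dimension, every piece is spanned
  by basis vectors.\<close>

lemma schur_upto_exists:
  fixes v :: "'i \<Rightarrow> 'n cvec"
  assumes D: "clin D" and fin: "finite I" and sp: "vec.span (v ` I) = UNIV"
    and inv: "\<And>s x. x \<in> Fil v w I s \<Longrightarrow> D x \<in> Fil v w I s"
  shows "m \<le> CARD('n) \<Longrightarrow> \<exists>e lam ws. schur_upto D (Fil v w I) m e lam ws"
proof (induction m)
  case 0
  have "Fil v w I s \<subseteq> {0} \<longrightarrow> Fil v w I s \<subseteq> vec.span {}" for s by simp
  then show ?case by (auto simp: schur_upto_def vec.subspace_0)
next
  case (Suc m)
  let ?F = "Fil v w I"
  obtain e lam ws where H: "schur_upto D ?F m e lam ws" using Suc by auto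
  note os = schur_upto_ons[OF H]
  note ort = schur_uptoD(1)[OF H] and tri = schur_uptoD(2)[OF H] and wt = schur_uptoD(3)[OF H]
    and comp = schur_uptoD(4)[OF H] and adp = schur_uptoD(5)[OF H] and dec = schur_uptoD(6)[OF H]
  define W where "W = vec.span (e ` {..<m})"
  have sW: "vec.subspace W" by (simp add: W_def)
  have DW: "D x \<in> W" if "x \<in> W" for x
    using triangular_invariant[OF D tri] that unfolding W_def by blast
  have ind: "vec.independent (e ` {..<m})" using os(1) ons_independent by blast
  have "vec.dim W = m" unfolding W_def vec.dim_span
    using vec.dim_eq_card_independent[OF ind] os(2) by (simp add: card_image)
  moreover have "vec.dim (UNIV :: 'n cvec set) = CARD('n)" by (simp add: vec.dim_UNIV card_cart_basis)
  ultimately have WU: "W \<noteq> UNIV" using Suc.prems by (metis Suc_n_not_le_n)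
  define S where "S = {t \<in> w ` I. \<not> ?F t \<subseteq> W}"
  have finS: "finite S" using fin by (simp add: S_def)
  have "S \<noteq> {}"
  proof
    assume "S = {}"
    then have "v k \<in> W" if "k \<in> I" for k
      using that Fil_base[of k I "w k" w v] by (auto simp: S_def)
    then have "vec.span (v ` I) \<subseteq> W" using sW by (intro vec.span_minimal) auto
    then show False using sp WU by auto
  qed
  define s0 where "s0 = Max S"
  have s0: "s0 \<in> S" using finS \<open>S \<noteq> {}\<close> by (simp add: s0_def)
  then have nF: "\<not> ?F s0 \<subseteq> W" by (simp add: S_def)
  have big: "?F s \<subseteq> W" if "s > s0" for s
    unfolding Fil_def[of v w I s]
  proof (rule vec.span_minimal[OF _ sW], safe)
    fix k assume k: "k \<in> I" "s \<le> w k"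
    have "w k \<notin> S" using k(2) that Max_ge[OF finS, of "w k"] unfolding s0_def by linarith
    then have "?F (w k) \<subseteq> W" using k by (auto simp: S_def)
    then show "v k \<in> W" using Fil_base[of k I "w k" w v] k by auto
  qed
  have WF: "W \<subseteq> ?F s0" using comp[of s0] nF by (auto simp: W_def)
  obtain x z where x: "x \<in> ?F s0" "x \<notin> W" "D x - z *s x \<in> W"
    using eigenvector_quotient[OF D sW subspace_Fil inv nF] by blast
  obtain y where y: "ons (insert y (e ` {..<m}))" "y \<notin> e ` {..<m}"
    "vec.span (insert y (e ` {..<m})) = vec.span (insert x (e ` {..<m}))"
    and yW: "\<And>W. vec.subspace W \<Longrightarrow> e ` {..<m} \<subseteq> W \<Longrightarrow> x \<in> W \<Longrightarrow> y \<in> W"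
    and ya: "\<exists>a. a \<noteq> 0 \<and> y - a *s x \<in> vec.span (e ` {..<m})"
    using ons_insert[OF os(1), of x] x(2) unfolding W_def by metis
  have eW: "e ` {..<m} \<subseteq> W" unfolding W_def by (rule vec.span_superset)
  have yF: "y \<in> ?F s0" by (rule yW[OF subspace_Fil _ x(1)]) (use eW WF in auto)
  have ynW: "y \<notin> W"
  proof
    assume "y \<in> W"
    moreover have "vec.independent (insert y (e ` {..<m}))" using y(1) ons_independent by blast
    ultimately show False using y(2) vec.independent_insert[of y "e ` {..<m}"] by (auto simp: W_def)
  qed
  obtain a where a: "y - a *s x \<in> W" using ya by (auto simp: W_def)
  have "D y - z *s y = (D (y - a *s x) - z *s (y - a *s x)) + a *s (D x - z *s x)"
    using D by (simp add: clin_diff clin_scale vec.scale_right_diff_distrib mult.commute)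
  also have "\<dots> \<in> W" by (intro vec.subspace_add vec.subspace_diff vec.subspace_scale sW DW a x(3))
  finally have Dy: "D y - z *s y \<in> W" .
  define e' where "e' = e(m := y)"
  define lam' where "lam' = lam(m := z)"
  define ws' where "ws' = ws(m := s0)"
  have im: "e' ` {..<k} = e ` {..<k}" if "k \<le> m" for k using that by (auto simp: e'_def)
  have imS: "e' ` {..<Suc m} = insert y (e ` {..<m})"
    using im[of m] by (auto simp: lessThan_Suc e'_def)
  have WS: "W \<subseteq> vec.span (e' ` {..<Suc m})" unfolding W_def imS by (intro vec.span_mono) auto
  have wsm: "s0 \<le> ws k" if "k < m" for k
    using wt[OF that, of s0] WF eW that by auto
  have "schur_upto D ?F (Suc m) e' lam' ws'"
    unfolding schur_upto_def
  proof (intro conjI allI impI)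
    fix i j assume ij: "i < Suc m" "j < Suc m"
    have "gh y y = 1" "\<And>i. i < m \<Longrightarrow> gh y (e i) = 0 \<and> gh (e i) y = 0"
      using y(1,2) unfolding ons_def by force+
    then show "gh (e' i) (e' j) = (if i = j then 1 else 0)"
      using ij ort by (auto simp: e'_def less_Suc_eq)
  next
    fix k assume k: "k < Suc m"
    show "D (e' k) - lam' k *s e' k \<in> vec.span (e' ` {..<k})"
      using k Dy tri[of k] im[of k] by (cases "k = m") (auto simp: e'_def lam'_def W_def)
  next
    fix k s assume k: "k < Suc m"
    show "e' k \<in> ?F s \<longleftrightarrow> s \<le> ws' k"
    proof (cases "k = m")
      case True
      have "y \<in> ?F s \<longleftrightarrow> s \<le> s0"
        using big[of s] ynW yF Fil_antimono[of s s0 v w I] by (cases "s \<le> s0") auto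
      then show ?thesis using True by (simp add: e'_def ws'_def)
    next
      case False then show ?thesis using wt[of k s] k by (simp add: e'_def ws'_def)
    qed
  next
    fix s
    show "?F s \<subseteq> vec.span (e' ` {..<Suc m}) \<or> vec.span (e' ` {..<Suc m}) \<subseteq> ?F s"
    proof (cases "s \<le> s0")
      case True
      have "insert y (e ` {..<m}) \<subseteq> ?F s" using yF WF eW Fil_antimono[OF True, of v w I] by auto
      then have "vec.span (e' ` {..<Suc m}) \<subseteq> ?F s" unfolding imS by (intro vec.span_minimal) auto
      then show ?thesis by simp
    next
      case False then show ?thesis using big[of s] WS by auto
    qed
  next
    fix s assume sub: "?F s \<subseteq> vec.span (e' ` {..<Suc m})"
    show "?F s \<subseteq> vec.span {e' k |k. k < Suc m \<and> s \<le> ws' k}"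
    proof (cases "?F s \<subseteq> W")
      case True
      have "{e k |k. k < m \<and> s \<le> ws k} \<subseteq> {e' k |k. k < Suc m \<and> s \<le> ws' k}"
        by (force simp: e'_def ws'_def)
      then show ?thesis using adp[of s] True vec.span_mono unfolding W_def by blast
    next
      case False
      then have "s \<le> s0" using big[of s] by force
      then have "e' ` {..<Suc m} \<subseteq> {e' k |k. k < Suc m \<and> s \<le> ws' k}"
        using wsm by (force simp: ws'_def less_Suc_eq)
      then show ?thesis using sub vec.span_mono by blast
    qed
  next
    fix j k assume "j < k" "k < Suc m"
    then show "ws' k \<le> ws' j" using dec[of j k] wsm[of j] by (auto simp: ws'_def)
  qed
  then show ?case by blast
qed

end

text \<open>Back substitution: on the span of the vectors with eigenvalue other than
  \<open>z\<close> the map \<open>D - z\<close> is triangular with nonzero diagonal, hence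
  onto.\<close>

lemma triangular_solve:
  assumes D: "clin D" and v: "\<And>k. k < m \<Longrightarrow> D (v k) - lam k *s v k \<in> vec.span {v j |j. j < k \<and> lam j = lam k}"
  shows "k \<le> m \<Longrightarrow> b \<in> vec.span {v j |j. j < k \<and> lam j \<noteq> z} \<Longrightarrow>
    \<exists>u \<in> vec.span {v j |j. j < (k::nat) \<and> lam j \<noteq> z}. D u - z *s u = b"
proof (induction k arbitrary: b)
  case 0
  then show ?case using D by (auto simp: clin_zero)
next
  case (Suc k)
  let ?U = "\<lambda>k. vec.span {v j |j. j < k \<and> lam j \<noteq> z}"
  have mono: "?U k \<subseteq> ?U (Suc k)" by (intro vec.span_mono) auto
  show ?case
  proof (cases "lam k = z")
    case True
    then have "{v j |j. j < Suc k \<and> lam j \<noteq> z} = {v j |j. j < k \<and> lam j \<noteq> z}"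
      by (auto simp: less_Suc_eq)
    then show ?thesis using Suc by auto
  next
    case False
    then have "{v j |j. j < Suc k \<and> lam j \<noteq> z} = insert (v k) {v j |j. j < k \<and> lam j \<noteq> z}"
      by (auto simp: less_Suc_eq)
    then have "b \<in> vec.span (insert (v k) {v j |j. j < k \<and> lam j \<noteq> z})" using Suc.prems(2) by simp
    then obtain c where c: "b - c *s v k \<in> ?U k" unfolding vec.span_breakdown_eq ..
    \<comment> \<open>\<open>D - z\<close> sends this vector to \<open>c *s v k\<close> up to
      earlier vectors, which are left to the induction.\<close>
    define u0 where "u0 = (c / (lam k - z)) *s v k"
    have u0: "u0 \<in> ?U (Suc k)" unfolding u0_def using False
      by (intro vec.span_scale vec.span_base) auto
    have eq: "D u0 - z *s u0 = c *s v k + (c / (lam k - z)) *s (D (v k) - lam k *s v k)"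
    proof -
      define r where "r = c / (lam k - z)"
      have ceq: "r * (lam k - z) = c" using False by (simp add: r_def)
      have u0r: "u0 = r *s v k" by (simp add: u0_def r_def)
      have "D u0 - z *s u0 = (r * (lam k - z)) *s v k + r *s (D (v k) - lam k *s v k)"
        using D by (simp add: u0r clin_scale vec.scale_right_diff_distrib vec.scale_left_diff_distrib
            right_diff_distrib mult.commute)
      then show ?thesis unfolding ceq r_def[symmetric] .
    qed
    have Dv: "D (v k) - lam k *s v k \<in> ?U k"
      using v[of k] Suc.prems(1) False vec.span_mono[of "{v j |j. j < k \<and> lam j = lam k}" "{v j |j. j < k \<and> lam j \<noteq> z}"]
      by force
    then have "(b - c *s v k) - (c / (lam k - z)) *s (D (v k) - lam k *s v k) \<in> ?U k"
      by (intro vec.span_diff[OF c] vec.span_scale[OF Dv])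
    from Suc.IH[OF Suc_leD[OF Suc.prems(1)] this]
    obtain u where u: "u \<in> ?U k" "D u - z *s u = (b - c *s v k) - (c / (lam k - z)) *s (D (v k) - lam k *s v k)"
      by (elim bexE)
    have "D (u0 + u) - z *s (u0 + u) = (D u0 - z *s u0) + (D u - z *s u)"
      using D by (simp add: clin_add vec.scale_right_distrib)
    also have "\<dots> = b" unfolding eq u(2) by simp
    finally have "D (u0 + u) - z *s (u0 + u) = b" .
    moreover have "u0 + u \<in> ?U (Suc k)" using u(1) mono by (intro vec.span_add u0) auto
    ultimately show ?thesis by (rule bexI)
  qed
qed

lemma span_triangular:
  assumes "\<And>k. k < m \<Longrightarrow> v k - e k \<in> vec.span (e ` {..<k::nat})"
  shows "m' \<le> m \<Longrightarrow> vec.span (v ` {..<m'}) = vec.span (e ` {..<m'} :: ('a::field^'n) set)"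
proof (induction m')
  case (Suc k)
  have 1: "v k - e k \<in> vec.span (e ` {..<k})" using assms Suc by auto
  have "vec.span (v ` {..<Suc k}) = {x. \<exists>c. x - c *s v k \<in> vec.span (v ` {..<k})}"
    by (simp add: lessThan_Suc vec.span_insert)
  also have "\<dots> = {x. \<exists>c. x - c *s v k \<in> vec.span (e ` {..<k})}" using Suc by simp
  also have "\<dots> = {x. \<exists>c. x - c *s e k \<in> vec.span (e ` {..<k})}"
  proof -
    have "x - c *s v k \<in> vec.span (e ` {..<k}) \<longleftrightarrow> x - c *s e k \<in> vec.span (e ` {..<k})" for x c
    proof -
      have "x - c *s e k = (x - c *s v k) + c *s (v k - e k)"
        by (simp add: vec.scale_right_diff_distrib)
      moreover have "c *s (v k - e k) \<in> vec.span (e ` {..<k})" using 1 vec.span_scale by blast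
      ultimately show ?thesis by (metis vec.span_add_eq2)
    qed
    then show ?thesis by simp
  qed
  also have "\<dots> = vec.span (e ` {..<Suc k})" by (simp add: lessThan_Suc vec.span_insert)
  finally show ?case .
qed simp

text \<open>A unipotent change of basis, so the flag and with it the filtration weights survive. The
  component of \<open>(D - lam m) (e m)\<close> along the other eigenvalues is removed by solving
  for it with \<open>triangular_solve\<close>.\<close>

lemma generalized_eigenbasis:
  assumes D: "clin D" and e: "\<And>k. k < m \<Longrightarrow> D (e k) - lam k *s e k \<in> vec.span (e ` {..<k::nat})"
  shows "\<exists>v. (\<forall>k<m. v k - e k \<in> vec.span (e ` {..<k})) \<and>
    (\<forall>k<m. D (v k) - lam k *s v k \<in> vec.span {v j |j. j < k \<and> lam j = lam k})"
  using e
proof (induction m)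
  case 0 then show ?case by simp
next
  case (Suc m)
  have "\<exists>v. (\<forall>k<m. v k - e k \<in> vec.span (e ` {..<k})) \<and>
    (\<forall>k<m. D (v k) - lam k *s v k \<in> vec.span {v j |j. j < k \<and> lam j = lam k})"
    by (rule Suc.IH) (rule Suc.prems, simp)
  then obtain v where v: "\<forall>k<m. v k - e k \<in> vec.span (e ` {..<k})"
    "\<forall>k<m. D (v k) - lam k *s v k \<in> vec.span {v j |j. j < k \<and> lam j = lam k}" by (elim exE conjE)
  note v1 = v(1)[rule_format] and v2 = v(2)[rule_format]
  let ?z = "lam m"
  have sp: "vec.span (v ` {..<m}) = vec.span (e ` {..<m})" by (rule span_triangular[OF v1 order_refl])
  have "v ` {..<m} = {v j |j. j < m \<and> lam j = ?z} \<union> {v j |j. j < m \<and> lam j \<noteq> ?z}" by auto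
  then have "D (e m) - ?z *s e m \<in> vec.span ({v j |j. j < m \<and> lam j = ?z} \<union> {v j |j. j < m \<and> lam j \<noteq> ?z})"
    using Suc.prems[of m] sp by simp
  then obtain a b where ab: "D (e m) - ?z *s e m = a + b" "a \<in> vec.span {v j |j. j < m \<and> lam j = ?z}"
    "b \<in> vec.span {v j |j. j < m \<and> lam j \<noteq> ?z}" unfolding vec.span_Un by (elim CollectE exE conjE)
  have "\<exists>u\<in>vec.span {v j |j. j < m \<and> lam j \<noteq> ?z}. D u - ?z *s u = b"
    by (rule triangular_solve[OF D _ order_refl ab(3)]) (rule v2)
  then obtain u where u: "u \<in> vec.span {v j |j. j < m \<and> lam j \<noteq> ?z}" "D u - ?z *s u = b"
    by (elim bexE)
  define v' where "v' = v(m := e m - u)"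
  have sets: "{v' j |j. j < k \<and> P j} = {v j |j. j < k \<and> P j}" if "k \<le> m" for k P
  proof -
    have "v' j = v j" if "j < k" for j using that \<open>k \<le> m\<close> by (simp add: v'_def)
    then show ?thesis by (metis (no_types, lifting))
  qed
  have "{v j |j. j < m \<and> lam j \<noteq> ?z} \<subseteq> v ` {..<m}" by auto
  from subsetD[OF vec.span_mono[OF this] u(1)] have "u \<in> vec.span (v ` {..<m})" .
  then have um: "- u \<in> vec.span (e ` {..<m})" using sp vec.span_neg by blast
  show ?case
  proof (intro exI[of _ v'] conjI allI impI)
    fix k assume "k < Suc m"
    then show "v' k - e k \<in> vec.span (e ` {..<k})" using v1[of k] um by (cases "k = m") (auto simp: v'_def)
  next
    fix k assume k: "k < Suc m"
    show "D (v' k) - lam k *s v' k \<in> vec.span {v' j |j. j < k \<and> lam j = lam k}"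
    proof (cases "k = m")
      case True
      have "D (e m - u) - ?z *s (e m - u) = (D (e m) - ?z *s e m) - (D u - ?z *s u)"
        using D by (simp add: clin_diff vec.scale_right_diff_distrib)
      also have "\<dots> = a" using ab u by simp
      finally show ?thesis using True ab(2) sets[of k] by (simp add: v'_def)
    next
      case False
      then show ?thesis using v2[of k] k sets[of k] by (simp add: v'_def)
    qed
  qed
qed

text \<open>\<open>D - z\<close> is injective modulo the generalized eigenspace of \<open>z\<close>.
  By induction on the last vector occurring in \<open>y\<close>: its coefficient is either attached
  to the eigenvalue \<open>z\<close> and can be subtracted, or is forced to vanish by
  independence.\<close>

lemma generalized_eigenspace_stable:
  assumes D: "clin D" and v: "\<And>k. k < m \<Longrightarrow> D (v k) - lam k *s v k \<in> vec.span {v j |j. j < k \<and> lam j = lam k}"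
    and ind: "inj_on v {..<m}" "vec.independent (v ` {..<m})"
    and y: "D y - z *s y \<in> vec.span {v j |j. j < m \<and> lam j = z}"
  shows "k \<le> m \<Longrightarrow> y \<in> vec.span (v ` {..<k::nat}) \<Longrightarrow> y \<in> vec.span {v j |j. j < m \<and> lam j = z}"
  using y
proof (induction k arbitrary: y)
  case 0 then show ?case by (auto simp: vec.span_zero)
next
  case (Suc k)
  let ?V = "vec.span {v j |j. j < m \<and> lam j = z}"
  obtain c where c: "y - c *s v k \<in> vec.span (v ` {..<k})"
    using Suc.prems(2) by (auto simp: lessThan_Suc vec.span_breakdown_eq)
  define y' where "y' = y - c *s v k"
  have y: "y = c *s v k + y'" by (simp add: y'_def)
  have y': "y' \<in> vec.span (v ` {..<k})" using c by (simp add: y'_def)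
  have eq: "D y - z *s y = c *s (D (v k) - lam k *s v k) + (c * (lam k - z)) *s v k + (D y' - z *s y')"
    using D by (simp add: y clin_add clin_scale vec.scale_right_distrib vec.scale_right_diff_distrib
        vec.scale_left_diff_distrib right_diff_distrib)
  show ?case
  proof (cases "lam k = z")
    case True
    have "D (v k) - lam k *s v k \<in> ?V"
    proof -
      have "{v j |j. j < k \<and> lam j = lam k} \<subseteq> {v j |j. j < m \<and> lam j = z}" using Suc.prems(1) True by auto
      then show ?thesis using v[of k] Suc.prems(1) vec.span_mono by (meson Suc_le_lessD subsetD)
    qed
    then have cD: "c *s (D (v k) - lam k *s v k) \<in> ?V" by (rule vec.span_scale)
    have "D y' - z *s y' = (D y - z *s y) - c *s (D (v k) - lam k *s v k)"
      using eq True by simp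
    then have "D y' - z *s y' \<in> ?V" using vec.span_diff[OF Suc.prems(3) cD] by (simp only:)
    then have y'V: "y' \<in> ?V" by (rule Suc.IH[OF Suc_leD[OF Suc.prems(1)] y'])
    have "c *s v k \<in> ?V" using True Suc.prems(1) by (intro vec.span_scale vec.span_base) auto
    from vec.span_add[OF this y'V] show ?thesis unfolding y .
  next
    case False
    have inv: "D x \<in> vec.span (v ` {..<k})" if "x \<in> vec.span (v ` {..<k})" for x
    proof (rule triangular_invariant[OF D _ that])
      fix j assume j: "j < k"
      have "{v i |i. i < j \<and> lam i = lam j} \<subseteq> v ` {..<j}" by auto
      then show "D (v j) - lam j *s v j \<in> vec.span (v ` {..<j})"
        using v[of j] Suc.prems(1) j vec.span_mono by (meson Suc_le_lessD less_trans subsetD)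
    qed
    let ?S = "v ` ({..<m} - {k})"
    have "v ` {..<k} \<subseteq> ?S" "{v j |j. j < m \<and> lam j = z} \<subseteq> ?S" using Suc.prems(1) False by auto
    note sub = this[THEN vec.span_mono]
    have "{v i |i. i < k \<and> lam i = lam k} \<subseteq> v ` {..<k}" by auto
    then have Dv: "D (v k) - lam k *s v k \<in> vec.span (v ` {..<k})"
      using v[of k] Suc.prems(1) vec.span_mono by (meson Suc_le_lessD subsetD)
    have "(D y - z *s y) - c *s (D (v k) - lam k *s v k) - (D y' - z *s y') \<in> vec.span ?S"
      by (intro vec.span_diff[OF vec.span_diff] vec.span_scale
          subsetD[OF sub(2) Suc.prems(3)] subsetD[OF sub(1) Dv]
          subsetD[OF sub(1) vec.span_diff[OF inv[OF y'] vec.span_scale[OF y']]])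
    moreover have "(D y - z *s y) - c *s (D (v k) - lam k *s v k) - (D y' - z *s y') = (c * (lam k - z)) *s v k"
      unfolding eq by simp
    ultimately have 1: "(c * (lam k - z)) *s v k \<in> vec.span ?S" by simp
    have "?S = v ` {..<m} - {v k}" using ind(1) Suc.prems(1) by (auto simp: inj_on_def)
    then have "v k \<notin> vec.span ?S" using ind(2) Suc.prems(1) unfolding vec.dependent_def by auto
    moreover have "v k \<in> vec.span ?S" if "c \<noteq> 0"
    proof -
      define r where "r = c * (lam k - z)"
      have "r \<noteq> 0" using that False by (simp add: r_def)
      then have "inverse r *s (r *s v k) = v k" by simp
      then show ?thesis using vec.span_scale[OF 1, of "inverse r"] by (simp only: r_def)
    qed
    ultimately have "c = 0" by blast
    then have yy': "y = y'" using y by simp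
    show ?thesis by (rule Suc.IH[OF Suc_leD[OF Suc.prems(1)] _ Suc.prems(3)]) (use y' yy' in \<open>simp only:\<close>)
  qed
qed

section \<open>Optimal weighted filtrations\<close>

lemma scaleR_vec_eq: "r *\<^sub>R x = complex_of_real r *s (x :: ('n::finite) cvec)"
  by (simp add: vec_eq_iff complex_eq_iff)

lemma norm_smult_vec: "norm (c *s (x :: ('n::finite) cvec)) = cmod c * norm x"
  by (simp add: norm_vec_def norm_mult L2_set_right_distrib)

lemma clin_bounded_linear: assumes "clin f" shows "bounded_linear f"
  unfolding linear_conv_bounded_linear[symmetric]
  using assms by (intro linearI) (simp_all add: clin_add clin_scale scaleR_vec_eq)

lemma clin_funpow: "clin f \<Longrightarrow> clin (f ^^ k)"
proof (induction k)
  case (Suc k)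
  then have "clin (\<lambda>x. f ((f ^^ k) x))" by (intro clin_compose[of f "f ^^ k"])
  then show ?case by (simp add: o_def)
qed (simp add: id_def)

lemma closed_complex_subspace: assumes "vec.subspace (W :: ('n::finite) cvec set)" shows "closed W"
proof (rule closed_subspace)
  show "subspace W" using assms
    by (intro subspaceI) (auto simp: scaleR_vec_eq vec.subspace_0 vec.subspace_add vec.subspace_scale)
qed

text \<open>Leibniz rule for divided powers. Division by factorials absorbs the binomial
  coefficients and leaves the terms of a Cauchy product.\<close>

lemma deriv_power_bracket:
  assumes br: "bilin br" and A: "clin A" and der: "\<And>x y. A (br x y) = br (A x) y + br x (A y)"
  defines "T \<equiv> \<lambda>k x. (1 / fact k) *s (A ^^ k) x"
  shows "T k (br x y) = (\<Sum>i\<le>k. br (T i x) (T (k - i) y))"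
proof (induction k)
  case 0
  then show ?case by (simp add: T_def)
next
  case (Suc k)
  have TS: "A (T i x) = of_nat (Suc i) *s T (Suc i) x" for i x
    using A by (simp add: T_def clin_scale del: of_nat_Suc)
  have "of_nat (Suc k) *s T (Suc k) (br x y) = A (T k (br x y))" by (simp add: TS)
  also have "\<dots> = (\<Sum>i\<le>k. br (A (T i x)) (T (k - i) y)) + (\<Sum>i\<le>k. br (T i x) (A (T (k - i) y)))"
    unfolding Suc using A by (simp add: clin_sum der sum.distrib)
  also have "(\<Sum>i\<le>k. br (A (T i x)) (T (k - i) y)) = (\<Sum>i\<le>Suc k. of_nat i *s br (T i x) (T (Suc k - i) y))"
    by (subst sum.atMost_Suc_shift) (simp add: TS bilin_scale_left[OF br] del: of_nat_Suc)
  also have "(\<Sum>i\<le>k. br (T i x) (A (T (k - i) y))) = (\<Sum>i\<le>Suc k. of_nat (Suc k - i) *s br (T i x) (T (Suc k - i) y))"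
    by (simp add: TS bilin_scale_right[OF br] Suc_diff_le del: of_nat_Suc of_nat_diff)
  also have "(\<Sum>i\<le>Suc k. of_nat i *s br (T i x) (T (Suc k - i) y)) + \<dots>
     = (\<Sum>i\<le>Suc k. of_nat (Suc k) *s br (T i x) (T (Suc k - i) y))"
    unfolding sum.distrib[symmetric]
  proof (intro sum.cong refl)
    fix i assume i: "i \<in> {..Suc k}"
    have "complex_of_nat (Suc k) = of_nat i + of_nat (Suc k - i)" using i by (metis atMost_iff le_add_diff_inverse of_nat_add)
    then show "of_nat i *s br (T i x) (T (Suc k - i) y) + of_nat (Suc k - i) *s br (T i x) (T (Suc k - i) y)
      = of_nat (Suc k) *s br (T i x) (T (Suc k - i) y)"
      by (simp only: vec.scale_left_distrib)
  qed
  also have "\<dots> = of_nat (Suc k) *s (\<Sum>i\<le>Suc k. br (T i x) (T (Suc k - i) y))"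
    by (simp only: vec.scale_sum_right)
  finally show ?case by (metis of_nat_eq_0_iff nat.distinct(1) vec.scale_cancel_left)
qed

lemma bilin_component:
  assumes "bilin br"
  shows "br x y $ c = (\<Sum>a\<in>UNIV. \<Sum>b\<in>UNIV. (x $ a * y $ b) * br (axis a 1) (axis b 1) $ c)"
proof -
  have "br x y = br (\<Sum>a\<in>UNIV. x $ a *s axis a 1) (\<Sum>b\<in>UNIV. y $ b *s axis b 1)"
    by (simp only: basis_expansion)
  also have "\<dots> = (\<Sum>a\<in>UNIV. \<Sum>b\<in>UNIV. (x $ a * y $ b) *s br (axis a 1) (axis b 1))"
    unfolding bilin_sum_left[OF assms] bilin_scale_left[OF assms]
    by (simp add: bilin_sum_right[OF assms] bilin_scale_right[OF assms] vec.scale_sum_right)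
  finally show ?thesis by simp
qed

text \<open>The exponential of a small multiple of a derivation is an automorphism.\<close>

lemma derivation_invariant:
  fixes br :: "('n::finite) cvec \<Rightarrow> 'n cvec \<Rightarrow> 'n cvec"
  assumes br: "bilin br" and A: "clin A" and der: "\<And>x y. A (br x y) = br (A x) y + br x (A y)"
    and W: "vec.subspace W"
    and aut: "\<And>P x. clin P \<Longrightarrow> bij P \<Longrightarrow> (\<And>x y. P (br x y) = br (P x) (P y)) \<Longrightarrow> x \<in> W \<Longrightarrow> P x \<in> W"
    and x: "x \<in> W"
  shows "A x \<in> W"
proof -
  obtain K where K: "K > 0" "\<And>x. norm (A x) \<le> norm x * K"
    using bounded_linear.pos_bounded[OF clin_bounded_linear[OF A]] by blast
  have Kp: "norm ((A ^^ k) x) \<le> K ^ k * norm x" for k x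
  proof (induction k)
    case (Suc k)
    have "norm (A ((A ^^ k) x)) \<le> norm ((A ^^ k) x) * K" by (rule K)
    also have "\<dots> \<le> K ^ k * norm x * K" using Suc K(1) by (intro mult_right_mono) auto
    finally show ?case by (simp add: mult.commute mult.left_commute)
  qed simp
  \<comment> \<open>The terms of the series of \<open>exp (t A) x\<close>; its sum is
    \<open>G t x\<close>.\<close>
  define T where "T t k x = (t ^ k) *s ((1 / fact k) *s (A ^^ k) x)" for t :: complex and k x
  define G where "G t x = (\<Sum>k. T t k x)" for t x
  have Tb: "norm (T t k x) \<le> (cmod t * K) ^ k /\<^sub>R fact k * norm x" for t k x
  proof -
    have "norm (T t k x) = cmod t ^ k * (1 / fact k) * norm ((A ^^ k) x)"
      by (simp add: T_def norm_smult_vec norm_power norm_divide)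
    also have "\<dots> \<le> cmod t ^ k * (1 / fact k) * (K ^ k * norm x)"
      using Kp by (intro mult_left_mono) auto
    also have "\<dots> = (cmod t * K) ^ k /\<^sub>R fact k * norm x"
      by (simp add: power_mult_distrib field_simps)
    finally show ?thesis .
  qed
  have es: "(\<lambda>k. (cmod t * K) ^ k /\<^sub>R fact k * norm x) sums (exp (cmod t * K) * norm x)" for t x
    by (intro sums_mult2 exp_converges)
  have sN: "summable (\<lambda>k. norm (T t k x))" for t x
    by (rule summable_comparison_test'[OF sums_summable[OF es[of t x]], of 0]) (use Tb in auto)
  have sT: "summable (\<lambda>k. T t k x)" for t x by (rule summable_norm_cancel[OF sN])
  \<comment> \<open>Remainders are dominated termwise by those of the scalar exponential. The case
    \<open>n = 1\<close> yields injectivity for small \<open>t\<close>, the case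
    \<open>n = 2\<close> the derivative at zero.\<close>
  have tail: "norm (G t x - (\<Sum>k<n. T t k x)) \<le> (exp (cmod t * K) - (\<Sum>k<n. (cmod t * K) ^ k /\<^sub>R fact k)) * norm x" for t x n
  proof -
    have "G t x - (\<Sum>k<n. T t k x) = (\<Sum>k. T t (k + n) x)"
      unfolding G_def by (rule suminf_minus_initial_segment[symmetric, OF sT])
    moreover have "norm (\<Sum>k. T t (k + n) x) \<le> (\<Sum>k. (cmod t * K) ^ (k + n) /\<^sub>R fact (k + n) * norm x)"
      by (rule norm_suminf_le[OF Tb]) (rule summable_ignore_initial_segment[OF sums_summable[OF es]])
    moreover have "(\<Sum>k. (cmod t * K) ^ (k + n) /\<^sub>R fact (k + n) * norm x)
       = exp (cmod t * K) * norm x - (\<Sum>k<n. (cmod t * K) ^ k /\<^sub>R fact k * norm x)"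
      by (subst suminf_minus_initial_segment[OF sums_summable[OF es]]) (simp only: sums_unique[OF es, symmetric])
    ultimately show ?thesis by (simp add: left_diff_distrib sum_distrib_right)
  qed
  have cT: "clin (T t k)" for t k
    unfolding T_def using clin_funpow[OF A] by (intro clin_smult)
  have cG: "clin (G t)" for t
  proof (rule clinI)
    show "G t (x + y) = G t x + G t y" for x y
      unfolding G_def clin_add[OF cT] by (rule suminf_add[symmetric, OF sT sT])
    show "G t (a *s x) = a *s G t x" for a x
      unfolding G_def clin_scale[OF cT]
      by (rule bounded_linear.suminf[symmetric, OF clin_bounded_linear[OF clin_smult[OF clin_ident]] sT])
  qed
  have hom: "G t (br x y) = br (G t x) (G t y)" for t x y
  proof -
    have leib: "T t k (br x y) = (\<Sum>i\<le>k. br (T t i x) (T t (k - i) y))" for k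
    proof -
      have "T t k (br x y) = t ^ k *s (\<Sum>i\<le>k. br ((1 / fact i) *s (A ^^ i) x) ((1 / fact (k - i)) *s (A ^^ (k - i)) y))"
        unfolding T_def by (simp only: deriv_power_bracket[OF br A der])
      also have "\<dots> = (\<Sum>i\<le>k. br (T t i x) (T t (k - i) y))"
        unfolding vec.scale_sum_right
      proof (intro sum.cong refl)
        fix i assume "i \<in> {..k}"
        then have "t ^ k = t ^ i * t ^ (k - i)" by (simp flip: power_add)
        then show "t ^ k *s br ((1 / fact i) *s (A ^^ i) x) ((1 / fact (k - i)) *s (A ^^ (k - i)) y) = br (T t i x) (T t (k - i) y)"
          unfolding T_def bilin_scale_left[OF br] bilin_scale_right[OF br] vec.scale_scale by (simp add: mult_ac)
      qed
      finally show ?thesis .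
    qed
    have comp: "(\<lambda>k. T t k x $ a) sums (G t x $ a)" for x a
      unfolding G_def by (rule bounded_linear.sums[OF bounded_linear_vec_nth summable_sums[OF sT]])
    have compN: "summable (\<lambda>k. norm (T t k x $ a))" for x a
      by (rule summable_comparison_test'[OF sN[of t x], of 0])
        (simp add: Finite_Cartesian_Product.norm_nth_le)
    have "G t (br x y) $ c = br (G t x) (G t y) $ c" for c
    proof -
      have "(\<lambda>k. \<Sum>i\<le>k. T t i x $ a * T t (k - i) y $ b) sums (G t x $ a * G t y $ b)" for a b
        using Cauchy_product_sums[OF compN[of x a] compN[of y b]] sums_unique[OF comp[of x a]] sums_unique[OF comp[of y b]]
        by simp
      then have "(\<lambda>k. \<Sum>a\<in>UNIV. \<Sum>b\<in>UNIV. (\<Sum>i\<le>k. T t i x $ a * T t (k - i) y $ b) * br (axis a 1) (axis b 1) $ c)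
         sums (\<Sum>a\<in>UNIV. \<Sum>b\<in>UNIV. (G t x $ a * G t y $ b) * br (axis a 1) (axis b 1) $ c)"
        by (intro sums_sum sums_mult2)
      moreover have "(\<Sum>a\<in>UNIV. \<Sum>b\<in>UNIV. (\<Sum>i\<le>k. T t i x $ a * T t (k - i) y $ b) * br (axis a 1) (axis b 1) $ c)
         = T t k (br x y) $ c" for k
      proof -
        have "T t k (br x y) $ c = (\<Sum>i\<le>k. \<Sum>a\<in>UNIV. \<Sum>b\<in>UNIV. (T t i x $ a * T t (k - i) y $ b) * br (axis a 1) (axis b 1) $ c)"
          unfolding leib sum_component by (intro sum.cong refl bilin_component[OF br])
        also have "\<dots> = (\<Sum>a\<in>UNIV. \<Sum>i\<le>k. \<Sum>b\<in>UNIV. (T t i x $ a * T t (k - i) y $ b) * br (axis a 1) (axis b 1) $ c)"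
          by (rule sum.swap)
        also have "\<dots> = (\<Sum>a\<in>UNIV. \<Sum>b\<in>UNIV. \<Sum>i\<le>k. (T t i x $ a * T t (k - i) y $ b) * br (axis a 1) (axis b 1) $ c)"
          by (intro sum.cong refl sum.swap)
        finally show ?thesis by (simp only: sum_distrib_right)
      qed
      ultimately have "(\<lambda>k. T t k (br x y) $ c) sums (br (G t x) (G t y) $ c)"
        unfolding bilin_component[OF br, of "G t x" "G t y"] by (simp only:)
      then show ?thesis using comp sums_unique2 by blast
    qed
    then show ?thesis by (simp add: vec_eq_iff)
  qed
  have GW: "G t x \<in> W" if t: "cmod t * K \<le> 1/2" for t
  proof (rule aut[OF cG _ hom x])
    have "inj (G t)"
    proof (rule injI)
      fix y z assume "G t y = G t z"
      then have 0: "G t (y - z) = 0" using clin_diff[OF cG] by simp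
      have "T t 0 (y - z) = y - z" by (simp add: T_def)
      then have "norm (y - z) \<le> (exp (cmod t * K) - 1) * norm (y - z)"
        using tail[of t "y - z" 1] 0 by (simp add: norm_minus_commute)
      \<comment> \<open>The bound \<open>1/2\<close> on \<open>cmod t * K\<close> keeps
        \<open>G t\<close> at distance less than 1 from the identity, so it is injective.\<close>
      moreover have "exp (cmod t * K) - 1 \<le> 3/4"
      proof -
        have "exp (cmod t * K) \<le> exp (1/2)" using t by simp
        also have "\<dots> \<le> 1 + 1/2 + (1/2)\<^sup>2" by (rule exp_bound) auto
        finally show ?thesis by (simp add: power2_eq_square)
      qed
      then have "(exp (cmod t * K) - 1) * norm (y - z) \<le> 3/4 * norm (y - z)" by (intro mult_right_mono) auto
      ultimately have "norm (y - z) \<le> 0" by linarith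
      then show "y = z" by simp
    qed
    moreover have "surj (G t)"
      using vec.linear_inj_imp_surj[OF cG[unfolded clin_linear] calculation] .
    ultimately show "bij (G t)" by (simp add: bij_def)
  qed
  \<comment> \<open>Difference quotients of the exponential at \<open>t = 1 / (n + 1)\<close>. For
    large \<open>n\<close> they lie in \<open>W\<close>, and they tend to \<open>A x\<close>;
    subspaces are closed.\<close>
  define y where "y n = (of_nat (Suc n)) *s (G (1 / of_nat (Suc n)) x - x)" for n
  have bnd: "norm (y n - A x) \<le> K\<^sup>2 * norm x * inverse (real (Suc n))" if n: "real (Suc n) \<ge> 2 * K" for n
  proof -
    let ?t = "1 / of_nat (Suc n) :: complex"
    have ct: "cmod ?t * K = K / real (Suc n)" by (simp add: norm_divide del: of_nat_Suc)
    have half: "K / real (Suc n) \<le> 1/2" using n K(1) by (simp add: field_simps del: of_nat_Suc)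
    have "(\<Sum>k<2. T ?t k x) = x + ?t *s A x" by (simp add: T_def numeral_2_eq_2)
    then have "of_nat (Suc n) *s (G ?t x - (\<Sum>k<2. T ?t k x)) = y n - A x"
      by (simp add: y_def vec.scale_right_diff_distrib vec.scale_right_distrib del: of_nat_Suc)
    then have "norm (y n - A x) = real (Suc n) * norm (G ?t x - (\<Sum>k<2. T ?t k x))"
      by (metis norm_of_nat norm_smult_vec)
    also have "\<dots> \<le> real (Suc n) * ((exp (K / real (Suc n)) - (1 + K / real (Suc n))) * norm x)"
      using tail[of ?t x 2] unfolding ct by (intro mult_left_mono) (simp_all add: eval_nat_numeral)
    also have "\<dots> \<le> real (Suc n) * ((K / real (Suc n))\<^sup>2 * norm x)"
      using exp_bound[of "K / real (Suc n)"] half K(1)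
      by (intro mult_left_mono mult_right_mono) auto
    also have "\<dots> = K\<^sup>2 * norm x * inverse (real (Suc n))"
      by (simp add: power2_eq_square field_simps del: of_nat_Suc)
    finally show ?thesis .
  qed
  obtain N where N: "real N \<ge> 2 * K" using real_arch_simple by blast
  have lim: "(\<lambda>n. y (n + N)) \<longlonglongrightarrow> A x"
  proof (rule LIM_zero_cancel, rule Lim_null_comparison)
    show "\<forall>\<^sub>F n in sequentially. norm (y (n + N) - A x) \<le> K\<^sup>2 * norm x * inverse (real (Suc (n + N)))"
      using N by (intro always_eventually allI bnd) auto
    have "(\<lambda>n. inverse (real (Suc (n + N)))) \<longlonglongrightarrow> 0"
      using LIMSEQ_ignore_initial_segment[OF LIMSEQ_inverse_real_of_nat, of N] by simp
    from tendsto_mult_left[OF this, of "K\<^sup>2 * norm x"]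
    show "(\<lambda>n. K\<^sup>2 * norm x * inverse (real (Suc (n + N)))) \<longlonglongrightarrow> 0" by simp
  qed
  have "y (n + N) \<in> W" for n
  proof -
    have "cmod (1 / of_nat (Suc (n + N))) * K \<le> 1/2"
      using N K(1) by (simp add: norm_divide field_simps del: of_nat_Suc)
    then have "G (1 / of_nat (Suc (n + N))) x \<in> W" by (rule GW)
    then show ?thesis unfolding y_def using x W by (intro vec.subspace_scale vec.subspace_diff)
  qed
  then show ?thesis using closed_sequentially[OF closed_complex_subspace[OF W] _ lim] by blast
qed

section \<open>Weighted bases and their filtrations\<close>

definition fam :: "('i \<Rightarrow> ('n::finite) cvec) \<Rightarrow> 'i set \<Rightarrow> bool" where
  "fam v I \<longleftrightarrow> finite I \<and> inj_on v I \<and> vec.independent (v ` I) \<and> vec.span (v ` I) = UNIV"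

lemma fam_card: fixes v :: "'i \<Rightarrow> ('n::finite) cvec" assumes "fam v I" shows "card I = CARD('n)"
proof -
  have "card (v ` I) = vec.dim (UNIV :: 'n cvec set)"
    using assms by (intro vec.basis_card_eq_dim) (auto simp: fam_def)
  also have "\<dots> = CARD('n)" by (simp add: vec.dim_UNIV card_cart_basis)
  finally show ?thesis using assms by (simp add: fam_def card_image)
qed

lemma fam_reindex: assumes "fam v I" "bij_betw h J I" shows "fam (v \<circ> h) J"
proof -
  have "(v \<circ> h) ` J = v ` I" using assms(2) by (metis bij_betw_def image_comp)
  moreover have "inj_on (v \<circ> h) J" using assms by (metis bij_betw_def comp_inj_on fam_def)
  moreover have "finite J" using assms by (metis bij_betw_finite fam_def)
  ultimately show ?thesis using assms(1) by (simp add: fam_def)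
qed

lemma Fil_reindex: assumes "bij_betw h J I" shows "Fil (v \<circ> h) (w \<circ> h) J s = Fil v w I s"
proof -
  have "{(v \<circ> h) k |k. k \<in> J \<and> s \<le> (w \<circ> h) k} = {v k |k. k \<in> I \<and> s \<le> w k}"
    using assms unfolding bij_betw_def by auto
  then show ?thesis by (simp add: Fil_def)
qed

lemma fam_in_Fil:
  assumes "fam v I"
  shows "x \<in> Fil v w I s \<longleftrightarrow> (\<forall>k\<in>I. vec.representation (v ` I) x (v k) \<noteq> 0 \<longrightarrow> s \<le> w k)"
proof
  let ?A = "{v k |k. k \<in> I \<and> s \<le> w k}"
  have ind: "vec.independent (v ` I)" and inj: "inj_on v I" and sp: "vec.span (v ` I) = UNIV" using assms by (auto simp: fam_def)
  have A: "?A \<subseteq> v ` I" by auto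
  show "\<forall>k\<in>I. vec.representation (v ` I) x (v k) \<noteq> 0 \<longrightarrow> s \<le> w k" if x: "x \<in> Fil v w I s"
  proof (intro ballI impI)
    fix k assume k: "k \<in> I" "vec.representation (v ` I) x (v k) \<noteq> 0"
    have "vec.representation (v ` I) x = vec.representation ?A x"
      using vec.representation_extend[OF ind _ A] x by (simp add: Fil_def)
    then have "v k \<in> ?A" using k(2) vec.representation_ne_zero[of ?A x "v k"] by simp
    then show "s \<le> w k" using inj k(1) by (auto simp: inj_on_def)
  qed
  show "x \<in> Fil v w I s" if r: "\<forall>k\<in>I. vec.representation (v ` I) x (v k) \<noteq> 0 \<longrightarrow> s \<le> w k"
  proof -
    have "x = (\<Sum>b | vec.representation (v ` I) x b \<noteq> 0. vec.representation (v ` I) x b *s b)"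
      using vec.sum_nonzero_representation_eq[OF ind] sp by auto
    moreover have "b \<in> ?A" if "vec.representation (v ` I) x b \<noteq> 0" for b
    proof -
      have "b \<in> v ` I" using that vec.representation_ne_zero by blast
      then show ?thesis using that r by auto
    qed
    then have "(\<Sum>b | vec.representation (v ` I) x b \<noteq> 0. vec.representation (v ` I) x b *s b) \<in> vec.span ?A"
      by (intro vec.span_sum vec.span_scale vec.span_base) simp
    ultimately show ?thesis by (simp add: Fil_def)
  qed
qed

lemma fam_dim_Fil: assumes "fam v I" shows "vec.dim (Fil v w I s) = card {k\<in>I. s \<le> w k}"
proof -
  have eq: "{v k |k. k \<in> I \<and> s \<le> w k} = v ` {k\<in>I. s \<le> w k}" by auto
  have "vec.independent (v ` {k\<in>I. s \<le> w k})"
    using assms vec.independent_mono[of "v ` I" "v ` {k\<in>I. s \<le> w k}"] by (auto simp: fam_def)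
  then have "vec.dim (Fil v w I s) = card (v ` {k\<in>I. s \<le> w k})"
    unfolding Fil_def eq by (rule vec.dim_span_eq_card_independent)
  also have "\<dots> = card {k\<in>I. s \<le> w k}"
    using assms by (intro card_image) (auto simp: fam_def inj_on_def)
  finally show ?thesis .
qed

text \<open>The multiplicity of each weight is the difference of two consecutive counts.\<close>

lemma sum_weights_eq:
  fixes w :: "'i \<Rightarrow> real" and w' :: "'j \<Rightarrow> real"
  assumes "finite I" "finite J" "\<And>s. card {k\<in>I. s \<le> w k} = card {k\<in>J. s \<le> w' k}"
  shows "(\<Sum>i\<in>I. g (w i)) = (\<Sum>j\<in>J. g (w' j) :: real)"
proof -
  let ?T = "w ` I \<union> w' ` J"
  have finT: "finite ?T" using assms by simp
  have "card {k\<in>I. w k = t} = card {k\<in>J. w' k = t}" for t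
  proof -
    \<comment> \<open>Every weight above \<open>t\<close> is at least \<open>t'\<close>; the entry
      \<open>t + 1\<close> keeps the set nonempty when no weight exceeds \<open>t\<close>.\<close>
    define t' where "t' = Min (insert (t + 1) {r\<in>?T. t < r})"
    have t': "t < t'" unfolding t'_def using finT by (subst Min_gr_iff) auto
    have gap: "r \<ge> t'" if "r \<in> ?T" "t < r" for r
      unfolding t'_def using finT that by (intro Min_le) auto
    have 1: "{k\<in>I. w k = t} = {k\<in>I. t \<le> w k} - {k\<in>I. t' \<le> w k}"
    proof (intro equalityI subsetI)
      fix k assume "k \<in> {k\<in>I. t \<le> w k} - {k\<in>I. t' \<le> w k}"
      then show "k \<in> {k\<in>I. w k = t}" using gap[of "w k"] by force
    qed (use t' in auto)
    have 2: "{k\<in>J. w' k = t} = {k\<in>J. t \<le> w' k} - {k\<in>J. t' \<le> w' k}"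
    proof (intro equalityI subsetI)
      fix k assume "k \<in> {k\<in>J. t \<le> w' k} - {k\<in>J. t' \<le> w' k}"
      then show "k \<in> {k\<in>J. w' k = t}" using gap[of "w' k"] by force
    qed (use t' in auto)
    have "card {k\<in>I. w k = t} = card {k\<in>I. t \<le> w k} - card {k\<in>I. t' \<le> w k}"
      unfolding 1 using assms(1) t' by (intro card_Diff_subset) auto
    moreover have "card {k\<in>J. w' k = t} = card {k\<in>J. t \<le> w' k} - card {k\<in>J. t' \<le> w' k}"
      unfolding 2 using assms(2) t' by (intro card_Diff_subset) auto
    ultimately show ?thesis using assms(3) by simp
  qed
  then have "(\<Sum>t\<in>?T. \<Sum>i\<in>{k\<in>I. w k = t}. g t) = (\<Sum>t\<in>?T. \<Sum>i\<in>{k\<in>J. w' k = t}. g t)" by simp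
  moreover have "(\<Sum>t\<in>?T. \<Sum>i\<in>{k\<in>I. w k = t}. g t) = (\<Sum>t\<in>?T. \<Sum>i\<in>{k\<in>I. w k = t}. g (w i))"
    by (intro sum.cong refl) auto
  moreover have "(\<Sum>t\<in>?T. \<Sum>i\<in>{k\<in>J. w' k = t}. g t) = (\<Sum>t\<in>?T. \<Sum>i\<in>{k\<in>J. w' k = t}. g (w' i))"
    by (intro sum.cong refl) auto
  moreover have "(\<Sum>t\<in>?T. \<Sum>i\<in>{k\<in>I. w k = t}. g (w i)) = (\<Sum>i\<in>I. g (w i))"
    by (intro sum.group assms(1) finT) auto
  moreover have "(\<Sum>t\<in>?T. \<Sum>i\<in>{k\<in>J. w' k = t}. g (w' i)) = (\<Sum>i\<in>J. g (w' i))"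
    by (intro sum.group assms(2) finT) auto
  ultimately show ?thesis by simp
qed

text \<open>The dimensions of the pieces are the counts of \<open>sum_weights_eq\<close>. Hence the
  cost of a weighted basis belongs to its filtration.\<close>

lemma Fil_sum_eq:
  assumes "fam v I" "fam v' J" "\<And>s. Fil v w I s = Fil v' w' J s"
  shows "(\<Sum>i\<in>I. g (w i)) = (\<Sum>j\<in>J. g (w' j) :: real)"
  using assms fam_dim_Fil[OF assms(1), of w] fam_dim_Fil[OF assms(2), of w']
  by (intro sum_weights_eq) (auto simp: fam_def)

lemma quadratic_pos_imp_zero:
  fixes p q :: real
  assumes "\<And>t. \<bar>t\<bar> < 1 \<Longrightarrow> 0 \<le> t * p + t\<^sup>2 * q"
  shows "p = 0"
proof (rule ccontr)
  assume p: "p \<noteq> 0"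
  \<comment> \<open>Small enough for the linear term to beat the quadratic one at the parameter
    \<open>- sgn p * a\<close>.\<close>
  define a where "a = \<bar>p\<bar> / (2 * (\<bar>p\<bar> + \<bar>q\<bar>))"
  have a: "0 < a" "a < 1" "a * \<bar>q\<bar> < \<bar>p\<bar>"
  proof -
    have d: "0 < \<bar>p\<bar> + \<bar>q\<bar>" using p by linarith
    have "\<bar>p\<bar> / (2 * X) * X = \<bar>p\<bar> / 2" if "X > 0" for X using that by simp
    from this[OF d] have e: "a * (\<bar>p\<bar> + \<bar>q\<bar>) = \<bar>p\<bar> / 2" unfolding a_def .
    show a0: "0 < a" using d p by (simp add: a_def)
    have "a * \<bar>p\<bar> \<ge> 0" "a * \<bar>q\<bar> \<ge> 0" using a0 by simp_all
    then show "a * \<bar>q\<bar> < \<bar>p\<bar>" using e p unfolding distrib_left by linarith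
    have "a * \<bar>p\<bar> < 1 * \<bar>p\<bar>" using e p \<open>a * \<bar>q\<bar> \<ge> 0\<close> unfolding distrib_left by linarith
    then show "a < 1" using p by simp
  qed
  define t where "t = - sgn p * a"
  have "\<bar>t\<bar> < 1" using a p by (simp add: t_def abs_mult)
  then have "0 \<le> t * p + t\<^sup>2 * q" by (rule assms)
  also have "t * p = - a * \<bar>p\<bar>" by (simp add: t_def abs_sgn algebra_simps)
  also have "t\<^sup>2 = a\<^sup>2" using p by (simp add: t_def power_mult_distrib sgn_if)
  also have "- a * \<bar>p\<bar> + a\<^sup>2 * q \<le> - a * \<bar>p\<bar> + a\<^sup>2 * \<bar>q\<bar>" by (simp add: mult_left_mono)
  also have "\<dots> = a * (a * \<bar>q\<bar> - \<bar>p\<bar>)" by (simp add: power2_eq_square algebra_simps)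
  also have "\<dots> < 0" using a by (intro mult_pos_neg) auto
  finally show False by simp
qed

locale weighted_filtrations =
  fixes br :: "('n::finite) cvec \<Rightarrow> 'n cvec \<Rightarrow> 'n cvec" and gam :: real
  assumes br: "bilin br" and gam: "gam > 0"
begin

definition adm :: "('i \<Rightarrow> 'n cvec) \<Rightarrow> ('i \<Rightarrow> real) \<Rightarrow> 'i set \<Rightarrow> bool" where
  "adm v w I \<longleftrightarrow> fam v I \<and> (\<forall>i\<in>I. \<forall>j\<in>I. br (v i) (v j) \<in> Fil v w I (w i + w j))"

definition cost :: "('i \<Rightarrow> real) \<Rightarrow> 'i set \<Rightarrow> real" where
  "cost w I = (\<Sum>i\<in>I. (w i - gam)\<^sup>2)"

text \<open>A definition cannot quantify over index types, so the competitors are indexed by the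
  dimension type. By \<open>opt_le\<close> the inequality then holds for every index type.\<close>

definition opt :: "('i \<Rightarrow> 'n cvec) \<Rightarrow> ('i \<Rightarrow> real) \<Rightarrow> 'i set \<Rightarrow> bool" where
  "opt v w I \<longleftrightarrow> adm v w I \<and> (\<forall>(v' :: 'n \<Rightarrow> 'n cvec) w'. adm v' w' UNIV \<longrightarrow> cost w I \<le> cost w' UNIV)"

lemma adm_fam: "adm v w I \<Longrightarrow> fam v I" by (simp add: adm_def)
lemma opt_adm: "opt v w I \<Longrightarrow> adm v w I" by (simp add: opt_def)
lemma opt_fam: "opt v w I \<Longrightarrow> fam v I" by (simp add: opt_def adm_def)

lemma opt_le:
  fixes v' :: "'j \<Rightarrow> 'n cvec"
  assumes "opt v w I" "adm v' w' J" shows "cost w I \<le> cost w' J"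
proof -
  have f: "fam v' J" using assms(2) by (rule adm_fam)
  then have "finite J" "card (UNIV :: 'n set) = card J" using fam_card[OF f] by (auto simp: fam_def)
  then obtain h where h: "bij_betw h (UNIV :: 'n set) J" using finite_same_card_bij[OF finite] by blast
  have "br ((v' \<circ> h) i) ((v' \<circ> h) j) \<in> Fil (v' \<circ> h) (w' \<circ> h) UNIV ((w' \<circ> h) i + (w' \<circ> h) j)" for i j
    unfolding Fil_reindex[OF h] using assms(2) h by (auto simp: adm_def bij_betw_def)
  then have "adm (v' \<circ> h) (w' \<circ> h) UNIV" using fam_reindex[OF f h] by (simp add: adm_def)
  then have "cost w I \<le> cost (w' \<circ> h) UNIV" using assms(1) by (simp add: opt_def)
  also have "cost (w' \<circ> h) UNIV = cost w' J"
    unfolding cost_def using sum.reindex_bij_betw[OF h, of "\<lambda>i. (w' i - gam)\<^sup>2"] by simp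
  finally show ?thesis .
qed

lemma adm_mult:
  assumes "adm v w I" "x \<in> Fil v w I s" "y \<in> Fil v w I t"
  shows "br x y \<in> Fil v w I (s + t)"
proof -
  have 1: "br (v i) y \<in> Fil v w I (s + t)" if i: "i \<in> I" "s \<le> w i" for i
  proof -
    have "vec.subspace {y. br (v i) y \<in> Fil v w I (s + t)}"
      by (intro vec.subspaceI) (auto simp: bilin_simps[OF br] vec.subspace_0 vec.subspace_add vec.subspace_scale)
    moreover have "v j \<in> {y. br (v i) y \<in> Fil v w I (s + t)}" if "j \<in> I" "t \<le> w j" for j
    proof -
      have "br (v i) (v j) \<in> Fil v w I (w i + w j)" using assms(1) i that by (auto simp: adm_def)
      then show ?thesis using Fil_antimono[of "s + t" "w i + w j" v w I] i that by auto
    qed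
    ultimately have "Fil v w I t \<subseteq> {y. br (v i) y \<in> Fil v w I (s + t)}"
      unfolding Fil_def[of v w I t] by (intro vec.span_minimal) auto
    then show ?thesis using assms(3) by auto
  qed
  have "vec.subspace {x. br x y \<in> Fil v w I (s + t)}"
    by (intro vec.subspaceI) (auto simp: bilin_simps[OF br] vec.subspace_0 vec.subspace_add vec.subspace_scale)
  then have "Fil v w I s \<subseteq> {x. br x y \<in> Fil v w I (s + t)}"
    unfolding Fil_def[of v w I s] using 1 by (intro vec.span_minimal) auto
  then show ?thesis using assms(2) by auto
qed

text \<open>For a fixed basis the admissible weights form a closed polyhedral cone that depends only
  on which structure constants are nonzero. There are finitely many patterns, so the union over all
  bases is closed and contains a point nearest to the constant vector \<open>gam\<close>.\<close>

lemma opt_exists: "\<exists>(v :: 'n \<Rightarrow> 'n cvec) w. opt v w UNIV"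
proof -
  define WW where "WW = {w :: real ^ 'n. \<exists>v :: 'n \<Rightarrow> 'n cvec. adm v (($) w) UNIV}"
  define C where "C T = {w :: real ^ 'n. \<forall>(i, j, k) \<in> T. w $ i + w $ j \<le> w $ k}" for T
  define TT where "TT v = {(i, j, k). vec.representation (range v) (br (v i) (v j)) (v k) \<noteq> 0}" for v :: "'n \<Rightarrow> 'n cvec"
  have admC: "adm v (($) w) UNIV \<longleftrightarrow> w \<in> C (TT v)" if "fam v UNIV" for v w
    using that by (auto simp: adm_def fam_in_Fil C_def TT_def)
  have "WW = \<Union> (C ` (TT ` {v. fam v UNIV}))"
  proof -
    have "adm v (($) w) UNIV \<longleftrightarrow> fam v UNIV \<and> w \<in> C (TT v)" for v w using admC adm_fam by blast
    then show ?thesis by (auto simp: WW_def)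
  qed
  moreover have "finite (C ` (TT ` {v. fam v UNIV}))" 
    by (rule finite_imageI, rule finite_subset[OF subset_UNIV finite])
  moreover have "closed (C T)" for T
  proof -
    have "C T = (\<Inter>(i, j, k) \<in> T. {w. w $ i + w $ j \<le> w $ k})" by (auto simp: C_def)
    also have "closed \<dots>" by (intro closed_INT ballI) (auto intro!: closed_Collect_le continuous_intros split: prod.splits)
    finally show ?thesis .
  qed
  ultimately have cl: "closed WW" by (simp only:) (rule closed_Union, auto)
  have "\<exists>v :: 'n \<Rightarrow> 'n cvec. fam v UNIV"
  proof -
    have "finite (cart_basis :: 'n cvec set)" "card (UNIV :: 'n set) = card (cart_basis :: 'n cvec set)"
      by (simp_all add: finite_cart_basis card_cart_basis)
    then obtain v where v: "bij_betw v (UNIV :: 'n set) (cart_basis :: 'n cvec set)"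
      using finite_same_card_bij[OF finite] by blast
    then have "fam v UNIV" using independent_cart_basis by (auto simp: fam_def bij_betw_def)
    then show ?thesis by blast
  qed
  then obtain v :: "'n \<Rightarrow> 'n cvec" where v: "fam v UNIV" by blast
  have "(0 :: real ^ 'n) \<in> C (TT v)" by (simp add: C_def)
  then have "0 \<in> WW" using admC[OF v] by (auto simp: WW_def)
  then obtain w where w: "w \<in> WW" "\<And>y. y \<in> WW \<Longrightarrow> dist (\<chi> i. gam) w \<le> dist (\<chi> i. gam) y"
    using distance_attains_inf[OF cl, of "\<chi> i. gam"] by auto
  have d: "cost (($) y) UNIV = (dist (\<chi> i. gam) y)\<^sup>2" for y :: "real ^ 'n"
    by (simp add: cost_def dist_vec_def L2_set_def dist_real_def sum_nonneg power2_commute)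
  obtain v where v: "adm (v :: 'n \<Rightarrow> 'n cvec) (($) w) UNIV" using w(1) by (auto simp: WW_def)
  have "opt v (($) w) UNIV"
    unfolding opt_def
  proof (intro conjI allI impI v)
    fix v' :: "'n \<Rightarrow> 'n cvec" and w' assume a: "adm v' w' UNIV"
    have eq: "($) (\<chi> i. w' i) = w'" by (simp add: fun_eq_iff)
    then have "(\<chi> i. w' i) \<in> WW" using a by (auto simp: WW_def)
    then have "cost (($) w) UNIV \<le> cost (($) (\<chi> i. w' i)) UNIV"
      unfolding d using w(2) by (intro power_mono) auto
    then show "cost (($) w) UNIV \<le> cost w' UNIV" unfolding eq .
  qed
  then show ?thesis by blast
qed

text \<open>Each piece is zero or equals the piece at the next weight that occurs, so compatibility
  at the finitely many weights gives it at every \<open>s\<close>. The weight of \<open>b\<close> is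
  the largest one whose piece contains \<open>b\<close>.\<close>

lemma adapted_weights:
  assumes f: "fam v I" and B: "vec.independent B"
    and ad: "\<And>t. t \<in> w ` I \<Longrightarrow> vec.span (B \<inter> Fil v w I t) = Fil v w I t"
  obtains a where "\<And>b s. b \<in> B \<Longrightarrow> b \<in> Fil v w I s \<longleftrightarrow> s \<le> a b"
    "\<And>s. Fil id a B s = Fil v w I s" "\<And>s. vec.span (B \<inter> Fil v w I s) = Fil v w I s"
proof -
  let ?F = "Fil v w I"
  have fin: "finite I" using f by (simp add: fam_def)
  have ne: "I \<noteq> {}" using fam_card[OF f] by (metis card.empty zero_less_card_finite less_irrefl)
  have ad': "vec.span (B \<inter> ?F s) = ?F s" "?F s = {0} \<and> (\<forall>t\<in>w`I. t < s) \<or> (\<exists>t\<in>w`I. s \<le> t \<and> ?F s = ?F t \<and> (\<forall>r\<in>w`I. s \<le> r \<longrightarrow> t \<le> r))" for s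
  proof -
    have *: "?F s = {0} \<and> (\<forall>t\<in>w`I. t < s) \<or> (\<exists>t\<in>w`I. s \<le> t \<and> ?F s = ?F t \<and> (\<forall>r\<in>w`I. s \<le> r \<longrightarrow> t \<le> r))"
    proof (cases "\<exists>k\<in>I. s \<le> w k")
      case False
      then have "{v k |k. k \<in> I \<and> s \<le> w k} = {}" by auto
      then have "?F s = {0}" unfolding Fil_def by (simp only: vec.span_empty)
      then show ?thesis using False by auto
    next
      case True
      let ?t = "Min {t \<in> w ` I. s \<le> t}"
      have t: "?t \<in> {t \<in> w ` I. s \<le> t}" using True fin by (intro Min_in) auto
      have mn: "?t \<le> r" if "r \<in> w ` I" "s \<le> r" for r using that fin by (intro Min_le) auto
      have "{v k |k. k \<in> I \<and> s \<le> w k} = {v k |k. k \<in> I \<and> ?t \<le> w k}"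
        using mn t by fastforce
      then have "?F s = ?F ?t" by (simp add: Fil_def)
      then show ?thesis using t mn by auto
    qed
    show "?F s = {0} \<and> (\<forall>t\<in>w`I. t < s) \<or> (\<exists>t\<in>w`I. s \<le> t \<and> ?F s = ?F t \<and> (\<forall>r\<in>w`I. s \<le> r \<longrightarrow> t \<le> r))" by (rule *)
    show "vec.span (B \<inter> ?F s) = ?F s"
      using *
    proof
      assume "?F s = {0} \<and> (\<forall>t\<in>w`I. t < s)"
      moreover have "vec.span (B \<inter> ?F s) \<subseteq> ?F s" by (intro vec.span_minimal) auto
      ultimately show ?thesis using vec.span_zero by auto
    next
      assume "\<exists>t\<in>w`I. s \<le> t \<and> ?F s = ?F t \<and> (\<forall>r\<in>w`I. s \<le> r \<longrightarrow> t \<le> r)"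
      then show ?thesis using ad by auto
    qed
  qed
  define a where "a b = Max {t \<in> w ` I. b \<in> ?F t}" for b
  have Fmin: "?F (Min (w ` I)) = UNIV"
  proof -
    have "Min (w ` I) \<le> w k" if "k \<in> I" for k using fin that by simp
    then have "{v k |k. k \<in> I \<and> Min (w ` I) \<le> w k} = v ` I" by auto
    then show ?thesis using f by (simp add: Fil_def fam_def)
  qed
  have am: "a b \<in> w ` I \<and> b \<in> ?F (a b)" for b
  proof -
    have "Min (w ` I) \<in> {t \<in> w ` I. b \<in> ?F t}" using fin ne Fmin by simp
    then have "{t \<in> w ` I. b \<in> ?F t} \<noteq> {}" by blast
    then have "a b \<in> {t \<in> w ` I. b \<in> ?F t}" unfolding a_def using fin by (intro Max_in) auto
    then show ?thesis by auto
  qed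
  have ab: "b \<in> ?F t \<longleftrightarrow> t \<le> a b" if "t \<in> w ` I" for b t
  proof
    show "t \<le> a b" if "b \<in> ?F t" unfolding a_def using fin that \<open>t \<in> w ` I\<close> by (intro Max_ge) auto
    show "b \<in> ?F t" if "t \<le> a b" using am[of b] Fil_antimono[OF that, of v w I] by auto
  qed
  have key: "b \<in> ?F s \<longleftrightarrow> s \<le> a b" if b: "b \<in> B" for b s
    using ad'(2)[of s]
  proof
    assume h: "?F s = {0} \<and> (\<forall>t\<in>w`I. t < s)"
    have "b \<noteq> 0" using b B vec.dependent_zero by blast
    moreover have "a b < s" using h am by blast
    ultimately show ?thesis using h by auto
  next
    assume "\<exists>t\<in>w`I. s \<le> t \<and> ?F s = ?F t \<and> (\<forall>r\<in>w`I. s \<le> r \<longrightarrow> t \<le> r)"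
    then obtain t where t: "t \<in> w ` I" "s \<le> t" "?F s = ?F t" "\<And>r. r \<in> w ` I \<Longrightarrow> s \<le> r \<Longrightarrow> t \<le> r" by blast
    then show ?thesis using ab[OF t(1), of b] am[of b] t(4)[of "a b"] by auto
  qed
  have "Fil id a B s = ?F s" for s
  proof -
    have "{id k |k. k \<in> B \<and> s \<le> a k} = B \<inter> ?F s" using key by auto
    then show ?thesis using ad'(1)[of s] by (simp only: Fil_def)
  qed
  then show ?thesis using that key ad'(1) by blast
qed

text \<open>Strict convexity of the cost. In a basis adapted to both filtrations a bracket lies in
  two spans of basis vectors, hence in the span of the common ones, on which the averaged weights
  satisfy the required inequality. The midpoint is therefore admissible, and the parallelogram
  identity makes it strictly cheaper unless the weights agree.\<close>

lemma opt_unique: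
  assumes o: "opt v w I" and o': "opt v' w' I'"
  shows "Fil v w I s = Fil v' w' I' s"
proof -
  let ?F = "Fil v w I" and ?F' = "Fil v' w' I'"
  have chain: "X \<subseteq> Y \<or> Y \<subseteq> X" if "X \<in> Fil u x J ` S" "Y \<in> Fil u x J ` S" for X Y u x J S
  proof -
    from that(1) obtain s where "X = Fil u x J s" by (rule imageE)
    moreover from that(2) obtain t where "Y = Fil u x J t" by (rule imageE)
    ultimately have "X = Fil u x J s" "Y = Fil u x J t" by simp_all
    then show ?thesis using Fil_antimono[of s t u x J] Fil_antimono[of t s u x J] by (meson linear)
  qed
  note f = opt_fam[OF o] and f' = opt_fam[OF o']
  have fin: "finite I" "finite I'" using f f' by (auto simp: fam_def)
  obtain B where B: "vec.independent B" "vec.span B = UNIV"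
    "\<And>X. X \<in> ?F ` w ` I \<union> ?F' ` w' ` I' \<Longrightarrow> vec.span (B \<inter> X) = X"
  proof (rule common_basis[of "?F' ` w' ` I'" "?F ` w ` I"])
    show "X \<subseteq> Y \<or> Y \<subseteq> X" if "X \<in> ?F ` w ` I" "Y \<in> ?F ` w ` I" for X Y using chain[OF that] .
    show "X \<subseteq> Y \<or> Y \<subseteq> X" if "X \<in> ?F' ` w' ` I'" "Y \<in> ?F' ` w' ` I'" for X Y using chain[OF that] .
  qed (use fin in auto)
  obtain a where a: "\<And>b s. b \<in> B \<Longrightarrow> b \<in> ?F s \<longleftrightarrow> s \<le> a b" "\<And>s. Fil id a B s = ?F s" "\<And>s. vec.span (B \<inter> ?F s) = ?F s"
    using adapted_weights[OF f B(1)] B(3) by (metis (no_types, lifting) UnI1 image_eqI)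
  obtain a' where a': "\<And>b s. b \<in> B \<Longrightarrow> b \<in> ?F' s \<longleftrightarrow> s \<le> a' b" "\<And>s. Fil id a' B s = ?F' s" "\<And>s. vec.span (B \<inter> ?F' s) = ?F' s"
    using adapted_weights[OF f' B(1)] B(3) by (metis (no_types, lifting) UnI2 image_eqI)
  have finB: "finite B" using B(1) vec.finiteI_independent by blast
  have fB: "fam id B" using B finB by (simp add: fam_def)
  define m where "m b = (a b + a' b) / 2" for b
  have "br x y \<in> Fil id m B (m x + m y)" if xy: "x \<in> B" "y \<in> B" for x y
  proof -
    have "br x y \<in> ?F (a x + a y)" using a(1) xy by (intro adm_mult[OF opt_adm[OF o]]) auto
    moreover have "br x y \<in> ?F' (a' x + a' y)" using a'(1) xy by (intro adm_mult[OF opt_adm[OF o']]) auto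
    ultimately have "br x y \<in> vec.span (B \<inter> ?F (a x + a y)) \<inter> vec.span (B \<inter> ?F' (a' x + a' y))"
      by (simp only: a(3) a'(3) Int_iff simp_thms)
    also have "\<dots> \<subseteq> vec.span ((B \<inter> ?F (a x + a y)) \<inter> (B \<inter> ?F' (a' x + a' y)))"
      by (rule independent_span_Int[OF B(1)]) auto
    also have "\<dots> \<subseteq> Fil id m B (m x + m y)"
      unfolding Fil_def[of id m]
    proof (intro vec.span_mono subsetI)
      fix z assume z: "z \<in> (B \<inter> ?F (a x + a y)) \<inter> (B \<inter> ?F' (a' x + a' y))"
      then have "a x + a y \<le> a z" "a' x + a' y \<le> a' z" using a(1) a'(1) by auto
      then have "m x + m y \<le> m z" unfolding m_def by argo
      then show "z \<in> {id k |k. k \<in> B \<and> m x + m y \<le> m k}" using z by auto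
    qed
    finally show ?thesis .
  qed
  then have "adm id m B" using fB by (simp add: adm_def)
  then have le: "cost w I \<le> cost m B" "cost w' I' \<le> cost m B" using opt_le o o' by blast+
  have ca: "cost a B = cost w I" unfolding cost_def by (rule Fil_sum_eq[OF fB f a(2)])
  have ca': "cost a' B = cost w' I'" unfolding cost_def by (rule Fil_sum_eq[OF fB f' a'(2)])
  have "cost m B = (\<Sum>b\<in>B. (a b - gam)\<^sup>2 / 2 + (a' b - gam)\<^sup>2 / 2 - (a b - a' b)\<^sup>2 / 4)"
    unfolding cost_def m_def by (intro sum.cong refl) (simp add: power2_eq_square field_simps)
  also have "\<dots> = cost a B / 2 + cost a' B / 2 - (\<Sum>b\<in>B. (a b - a' b)\<^sup>2) / 4"
    by (simp add: cost_def sum.distrib sum_subtractf sum_divide_distrib)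
  finally have "(\<Sum>b\<in>B. (a b - a' b)\<^sup>2) \<le> 0" using le ca ca' by simp
  moreover have "(\<Sum>b\<in>B. (a b - a' b)\<^sup>2) \<ge> 0" by (intro sum_nonneg) simp
  ultimately have "(\<Sum>b\<in>B. (a b - a' b)\<^sup>2) = 0" by simp
  then have "a b = a' b" if "b \<in> B" for b using that finB by (simp add: sum_nonneg_eq_0_iff)
  then have "{id k |k. k \<in> B \<and> s \<le> a k} = {id k |k. k \<in> B \<and> s \<le> a' k}" by auto
  then have "Fil id a B s = Fil id a' B s" by (simp only: Fil_def)
  then show ?thesis using a(2) a'(2) by simp
qed

text \<open>An automorphism transports an optimal filtration to another one of the same cost, so
  uniqueness makes it invariant; \<open>derivation_invariant\<close> passes to derivations.\<close>

lemma opt_derivation_invariant: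
  assumes o: "opt v w I" and A: "clin A" "\<And>x y. A (br x y) = br (A x) y + br x (A y)"
    and x: "x \<in> Fil v w I s"
  shows "A x \<in> Fil v w I s"
proof (rule derivation_invariant[OF br A subspace_Fil _ x])
  fix P x assume P: "clin P" "bij P" "\<And>x y. P (br x y) = br (P x) (P y)" and x: "x \<in> Fil v w I s"
  note lin = P(1)[unfolded clin_linear]
  note f = opt_fam[OF o]
  have inj: "inj P" using P(2) by (simp add: bij_def)
  have Fil: "Fil (P \<circ> v) w I t = P ` Fil v w I t" for t
  proof -
    have "{(P \<circ> v) k |k. k \<in> I \<and> t \<le> w k} = P ` {v k |k. k \<in> I \<and> t \<le> w k}" by auto
    then show ?thesis unfolding Fil_def by (simp only: vec.linear_span_image[OF lin])
  qed
  have "fam (P \<circ> v) I"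
    unfolding fam_def
  proof (intro conjI)
    show "finite I" using f by (simp add: fam_def)
    show "inj_on (P \<circ> v) I" using f inj by (simp add: fam_def comp_inj_on inj_on_subset)
    show "vec.independent ((P \<circ> v) ` I)"
      unfolding image_comp[symmetric] using f by (intro vec.linear_independent_injective_image[OF lin] inj_on_subset[OF inj]) (auto simp: fam_def)
    have "vec.span ((P \<circ> v) ` I) = P ` UNIV"
      unfolding image_comp[symmetric] vec.linear_span_image[OF lin] using f by (simp add: fam_def)
    then show "vec.span ((P \<circ> v) ` I) = UNIV" using P(2) by (simp add: bij_def)
  qed
  moreover have "br ((P \<circ> v) i) ((P \<circ> v) j) \<in> Fil (P \<circ> v) w I (w i + w j)" if "i \<in> I" "j \<in> I" for i j
    unfolding Fil comp_apply P(3)[symmetric] using opt_adm[OF o] that by (intro imageI) (auto simp: adm_def)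
  ultimately have "opt (P \<circ> v) w I" using o by (simp add: opt_def adm_def)
  from opt_unique[OF this o, of s] have "P ` Fil v w I s = Fil v w I s" unfolding Fil .
  then show "P x \<in> Fil v w I s" using x by auto
qed

text \<open>Scaling the weights by \<open>1 + t\<close> preserves admissibility; this is the
  resulting first-order condition.\<close>

lemma opt_scale:
  assumes o: "opt v w I" shows "(\<Sum>i\<in>I. (w i)\<^sup>2) = gam * (\<Sum>i\<in>I. w i)"
proof -
  let ?A = "\<Sum>i\<in>I. (w i)\<^sup>2" and ?B = "\<Sum>i\<in>I. w i"
  have "0 \<le> t * (2 * ?A - 2 * gam * ?B) + t\<^sup>2 * ?A" if t: "\<bar>t\<bar> < 1" for t
  proof -
    have pos: "1 + t > 0" using t by auto
    have "Fil v (\<lambda>i. (1 + t) * w i) I ((1 + t) * s) = Fil v w I s" for s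
      unfolding Fil_def using pos by (simp add: mult_le_cancel_left_pos)
    then have "adm v (\<lambda>i. (1 + t) * w i) I"
      using opt_adm[OF o] by (simp add: adm_def flip: distrib_left)
    then have "cost w I \<le> cost (\<lambda>i. (1 + t) * w i) I" by (rule opt_le[OF o])
    also have "cost (\<lambda>i. (1 + t) * w i) I = cost w I + (t * (2 * ?A - 2 * gam * ?B) + t\<^sup>2 * ?A)"
    proof -
      have "((1 + t) * w i - gam)\<^sup>2 = (w i - gam)\<^sup>2 + (t * (2 * (w i)\<^sup>2 - 2 * gam * w i) + t\<^sup>2 * (w i)\<^sup>2)" for i
        by (simp add: power2_eq_square algebra_simps)
      then show ?thesis by (simp add: cost_def sum.distrib sum_distrib_left sum_subtractf right_diff_distrib mult.assoc)
    qed
    finally show ?thesis by simp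
  qed
  then have "2 * ?A - 2 * gam * ?B = 0" by (rule quadratic_pos_imp_zero)
  then show ?thesis by simp
qed

text \<open>If the least weight \<open>a\<close> were negative, replacing it by \<open>a / 2\<close>
  would lower the cost. It stays admissible because inner derivations preserve the filtration: a
  bracket has weight at least that of either factor, which covers every sum containing
  \<open>a / 2\<close>.\<close>

lemma opt_nonneg:
  assumes o: "opt v w I" and skew: "\<And>x y. br x y = - br y x"
    and jac: "\<And>x y z. br x (br y z) = br (br x y) z + br y (br x z)" and i: "i \<in> I"
  shows "w i \<ge> 0"
proof (rule ccontr)
  assume neg: "\<not> w i \<ge> 0"
  note f = opt_fam[OF o]
  have fin: "finite I" using f by (simp add: fam_def)
  define a where "a = Min (w ` I)"
  have al: "a \<le> w k" if "k \<in> I" for k using fin that by (simp add: a_def)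
  have a0: "a < 0" using al[OF i] neg by simp
  have "a \<in> w ` I" unfolding a_def using fin i by (intro Min_in) auto
  then obtain k0 where k0: "k0 \<in> I" "w k0 = a" by auto
  define w' where "w' k = (if w k = a then a / 2 else w k)" for k
  have ge: "w k \<le> w' k" for k using a0 by (simp add: w'_def)
  have adc: "br (v i) (v j) \<in> Fil v w I (w j)" if "i \<in> I" "j \<in> I" for i j
    by (rule opt_derivation_invariant[OF o _ jac Fil_base]) (use that br in \<open>auto simp: bilin_def\<close>)
  have "br (v i) (v j) \<in> Fil v w' I (w' i + w' j)" if ij: "i \<in> I" "j \<in> I" for i j
    unfolding fam_in_Fil[OF f]
  proof (intro ballI impI)
    fix k assume k: "k \<in> I" "vec.representation (v ` I) (br (v i) (v j)) (v k) \<noteq> 0"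
    have 1: "w i + w j \<le> w k" using opt_adm[OF o] ij k by (simp add: adm_def fam_in_Fil[OF f])
    have 2: "w j \<le> w k" using adc[OF ij] k by (simp add: fam_in_Fil[OF f])
    have "br (v i) (v j) \<in> Fil v w I (w i)"
      using adc[OF ij(2,1)] skew[of "v i" "v j"] vec.subspace_neg[OF subspace_Fil] by metis
    then have 3: "w i \<le> w k" using k by (simp add: fam_in_Fil[OF f])
    have "w' i + w' j \<le> w k" using 1 2 3 al[OF ij(1)] al[OF ij(2)] al[OF k(1)] a0 by (auto simp: w'_def)
    then show "w' i + w' j \<le> w' k" using ge[of k] by linarith
  qed
  then have "adm v w' I" using f by (simp add: adm_def)
  then have "cost w I \<le> cost w' I" by (rule opt_le[OF o])
  moreover have "cost w' I < cost w I"
    unfolding cost_def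
  proof (rule sum_strict_mono_ex1[OF fin])
    have *: "(a / 2 - gam)\<^sup>2 < (a - gam)\<^sup>2"
    proof -
      have "(gam - a / 2)\<^sup>2 < (gam - a)\<^sup>2" using a0 gam by (intro power_strict_mono) auto
      then show ?thesis by (simp add: power2_commute)
    qed
    show "\<forall>k\<in>I. (w' k - gam)\<^sup>2 \<le> (w k - gam)\<^sup>2" using * by (auto simp: w'_def)
    show "\<exists>k\<in>I. (w' k - gam)\<^sup>2 < (w k - gam)\<^sup>2" using * k0 by (auto simp: w'_def intro!: bexI[of _ k0])
  qed
  ultimately show False by simp
qed


end


text \<open>\<open>D - (lam i + lam j)\<close> acts on a bracket by \<open>D - lam i\<close> on the
  first and \<open>D - lam j\<close> on the second factor. Both results involve only smaller
  indices, and \<open>generalized_eigenspace_stable\<close> returns to the bracket itself.\<close>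

lemma eigenspace_mult:
  fixes vv :: "nat \<Rightarrow> ('n::finite) cvec"
  assumes br: "bilin br" and D: "clin D" "\<And>x y. D (br x y) = br (D x) y + br x (D y)"
    and vv: "\<forall>k<m. D (vv k) - lam k *s vv k \<in> vec.span {vv j |j. j < k \<and> lam j = lam k}"
    and ind: "vec.independent (vv ` {..<m})" "inj_on vv {..<m}" and sp: "vec.span (vv ` {..<m}) = UNIV"
  shows "i < m \<Longrightarrow> j < m \<Longrightarrow> br (vv i) (vv j) \<in> vec.span {vv k |k. k < m \<and> lam k = lam i + lam j}"
proof (induction "i + j" arbitrary: i j rule: less_induct)
  case less
  let ?V = "vec.span {vv k |k. k < m \<and> lam k = lam i + lam j}"
  have sV: "vec.subspace {x. br x y \<in> ?V}" "vec.subspace {x. br y x \<in> ?V}" for y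
    by (intro vec.subspaceI; auto simp: bilin_simps[OF br] vec.span_zero vec.span_add vec.span_scale)+
  have "{vv k |k. k < i \<and> lam k = lam i} \<subseteq> {x. br x (vv j) \<in> ?V}"
  proof safe
    fix k assume k: "k < i" "lam k = lam i"
    show "br (vv k) (vv j) \<in> ?V" using less.hyps[of k j] less.prems k by simp
  qed
  then have 1: "br (D (vv i) - lam i *s vv i) (vv j) \<in> ?V"
    using vec.span_minimal[OF _ sV(1)] vv less.prems by blast
  have "{vv k |k. k < j \<and> lam k = lam j} \<subseteq> {x. br (vv i) x \<in> ?V}"
  proof safe
    fix k assume k: "k < j" "lam k = lam j"
    show "br (vv i) (vv k) \<in> ?V" using less.hyps[of i k] less.prems k by simp
  qed
  then have 2: "br (vv i) (D (vv j) - lam j *s vv j) \<in> ?V"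
    using vec.span_minimal[OF _ sV(2)] vv less.prems by blast
  have "D (br (vv i) (vv j)) - (lam i + lam j) *s br (vv i) (vv j)
     = br (D (vv i) - lam i *s vv i) (vv j) + br (vv i) (D (vv j) - lam j *s vv j)"
    by (simp add: D(2) bilin_simps[OF br] vec.scale_left_distrib)
  then have 3: "D (br (vv i) (vv j)) - (lam i + lam j) *s br (vv i) (vv j) \<in> ?V"
    using vec.span_add[OF 1 2] by (simp only:)
  show ?case
    by (rule generalized_eigenspace_stable[OF D(1) _ ind(2,1) 3 order_refl]) (use vv sp in auto)
qed

locale hermitian_lie = hermitian gh for gh :: "('n::finite) cvec \<Rightarrow> 'n cvec \<Rightarrow> complex" +
  fixes br :: "'n cvec \<Rightarrow> 'n cvec \<Rightarrow> 'n cvec"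
  assumes cla: "complex_lie_algebra br"
begin

lemma br_skew: "br x y = - br y x" and br_cyc: "br x (br y z) + br y (br z x) + br z (br x y) = 0"
  using cla unfolding complex_lie_algebra_def by blast+

lemma br_clin_left: "clin (\<lambda>x. br x y)"
  using cla unfolding complex_lie_algebra_def by (intro clinI) blast+

lemma br_clin: "clin (br x)"
proof -
  have "br x = (\<lambda>y. - br y x)" using br_skew by blast
  then show ?thesis using clin_uminus[OF br_clin_left[of x]] by simp
qed

lemma br_bilin: "bilin br" by (simp add: bilin_def br_clin br_clin_left)

lemmas br_simps = bilin_simps[OF br_bilin]

lemma br_self [simp]: "br x x = 0"
proof -
  have "br x x = - br x x" by (rule br_skew)
  then have "(2::complex) *s br x x = 0"
    by (metis add.right_inverse one_add_one vec.scale_left_distrib vec.scale_one)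
  then show ?thesis by simp
qed

lemma br_jacobi: "br x (br y z) = br (br x y) z + br y (br x z)"
proof -
  have "br x (br y z) = (br x (br y z) + br y (br z x) + br z (br x y)) - br y (br z x) - br z (br x y)" by simp
  also have "\<dots> = - br y (br z x) - br z (br x y)" unfolding br_cyc by simp
  also have "br y (br z x) = - br y (br x z)" by (subst br_skew[of z x]) (simp only: br_simps)
  also have "br z (br x y) = - br (br x y) z" by (rule br_skew)
  finally show ?thesis by simp
qed

text \<open>The weights minimise the distance to the constant weight \<open>gam\<close> among all weighted multiplicative filtrations.\<close>

lemma optimal_weights:
  assumes gam: "gam > 0" and D: "clin D" "\<And>x y. D (br x y) = br (D x) y + br x (D y)"
  obtains E and wt :: "'n cvec \<Rightarrow> real" where "onb UNIV E"
    "\<And>x y z. x \<in> E \<Longrightarrow> y \<in> E \<Longrightarrow> z \<in> E \<Longrightarrow> gh (br x y) z \<noteq> 0 \<Longrightarrow> wt x + wt y \<le> wt z"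
    "\<And>x. x \<in> E \<Longrightarrow> 0 \<le> wt x"
    "(\<Sum>x\<in>E. (wt x)\<^sup>2) = gam * (\<Sum>x\<in>E. wt x)"
    "(\<Sum>x\<in>E. wt x * Re (gh (D x) x)) = gam * (\<Sum>x\<in>E. Re (gh (D x) x))"
proof -
  interpret W: weighted_filtrations br gam by unfold_locales (rule br_bilin, rule gam)
  obtain v :: "'n \<Rightarrow> 'n cvec" and w where o: "W.opt v w UNIV" using W.opt_exists by blast
  let ?F = "Fil v w UNIV"
  note f = W.opt_fam[OF o]
  define m where "m = CARD('n)"
  have inv: "D x \<in> ?F s" if "x \<in> ?F s" for x s
    by (rule W.opt_derivation_invariant[OF o D that])
  \<comment> \<open>Two bases of one flag: \<open>e\<close> is orthonormal and shows the trace of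
    \<open>D\<close> on its diagonal, while the generalized eigenvectors \<open>vv\<close> obtained
    from it grade the bracket. Both carry the weights \<open>ws\<close>.\<close>
  obtain e lam ws where sch: "schur_upto D ?F m e lam ws"
    using schur_upto_exists[OF D(1) finite _ inv] f unfolding fam_def m_def by blast
  note S = schur_uptoD[OF sch] and ons_e = schur_upto_ons(1)[OF sch] and inj_e = schur_upto_ons(2)[OF sch]
  have cardE: "card (e ` {..<m}) = CARD('n)" using inj_e by (simp add: card_image m_def)
  have spE: "vec.span (e ` {..<m}) = UNIV"
  proof -
    have "vec.dim (UNIV :: 'n cvec set) \<le> card (e ` {..<m})" by (simp add: cardE vec.dim_UNIV card_cart_basis)
    then show ?thesis using vec.card_ge_dim_independent[of "e ` {..<m}" UNIV] ons_independent[OF ons_e] by auto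
  qed
  have onbE: "onb UNIV (e ` {..<m})" using ons_e spE by (simp add: onb_def)
  have fe: "fam e {..<m}" using inj_e spE ons_independent[OF ons_e] by (simp add: fam_def)
  have Fe: "Fil e ws {..<m} s = ?F s" for s
  proof
    show "?F s \<subseteq> Fil e ws {..<m} s" using S(5)[of s] spE by (simp add: Fil_def)
    show "Fil e ws {..<m} s \<subseteq> ?F s"
      unfolding Fil_def[of e] using S(3) by (intro vec.span_minimal) auto
  qed
  obtain vv where vv: "\<forall>k<m. vv k - e k \<in> vec.span (e ` {..<k})"
    "\<forall>k<m. D (vv k) - lam k *s vv k \<in> vec.span {vv j |j. j < k \<and> lam j = lam k}"
    using generalized_eigenbasis[OF D(1) S(2)] by blast
  have spv: "vec.span (vv ` {..<m'}) = vec.span (e ` {..<m'})" if "m' \<le> m" for m'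
    using span_triangular[of m vv e m'] vv(1) that by blast
  have "vec.independent (vv ` {..<m}) \<and> inj_on vv {..<m}"
  proof -
    have "vec.dim (UNIV :: 'n cvec set) \<le> card (vv ` {..<m})"
      using vec.dim_le_card[of UNIV "vv ` {..<m}"] spv[of m] spE by simp
    then have c: "card (vv ` {..<m}) = m"
      using card_image_le[of "{..<m}" vv] by (simp add: m_def vec.dim_UNIV card_cart_basis)
    then have "inj_on vv {..<m}" by (intro eq_card_imp_inj_on) auto
    moreover have "vec.independent (vv ` {..<m})"
      using c spv[of m] spE by (intro vec.card_le_dim_spanning[of _ UNIV]) (auto simp: m_def vec.dim_UNIV card_cart_basis)
    ultimately show ?thesis by simp
  qed
  then have indv: "vec.independent (vv ` {..<m})" "inj_on vv {..<m}" by auto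
  have fv: "fam vv {..<m}" using indv spv[of m] spE by (simp add: fam_def)
  have vF: "vv k \<in> ?F (ws k)" if k: "k < m" for k
  proof -
    have "e ` {..<k} \<subseteq> ?F (ws k)" using S(3,6) k by (auto intro: order.strict_trans)
    then have "vv k - e k \<in> ?F (ws k)" using vv(1) k vec.span_minimal[OF _ subspace_Fil] by blast
    moreover have "e k \<in> ?F (ws k)" using S(3)[OF k] by simp
    ultimately have "vv k - e k + e k \<in> ?F (ws k)" by (intro vec.subspace_add subspace_Fil)
    then show ?thesis by simp
  qed
  have Fv: "Fil vv ws {..<m} s = ?F s" for s
  proof (rule vec.subspace_dim_equal)
    show "Fil vv ws {..<m} s \<subseteq> ?F s"
      unfolding Fil_def[of vv]
    proof (intro vec.span_minimal subspace_Fil subsetI)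
      fix x assume "x \<in> {vv k |k. k \<in> {..<m} \<and> s \<le> ws k}"
      then show "x \<in> ?F s" using vF Fil_antimono[of s _ v w UNIV] by blast
    qed
    show "vec.dim (?F s) \<le> vec.dim (Fil vv ws {..<m} s)"
      unfolding Fe[of s, symmetric] fam_dim_Fil[OF fe] fam_dim_Fil[OF fv] by simp
  qed auto
  let ?V = "\<lambda>z. vec.span {vv j |j. j < m \<and> lam j = z}"
  have Veig: "D (vv k) - lam k *s vv k \<in> ?V (lam k)" if "k < m" for k
  proof -
    have "{vv j |j. j < k \<and> lam j = lam k} \<subseteq> {vv j |j. j < m \<and> lam j = lam k}" using that by auto
    then show ?thesis using vv(2) that vec.span_mono by blast
  qed
  have eigmult: "br (vv i) (vv j) \<in> ?V (lam i + lam j)" if "i < m" "j < m" for i j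
    using eigenspace_mult[OF br_bilin D vv(2) indv _ that] spv[of m] spE by simp
  \<comment> \<open>Brackets respect both the filtration and the eigenvalue grading, and in the
    basis \<open>vv\<close> both conditions hold on the same vectors. So the shifted weights are
    admissible for every real \<open>t\<close>, and the first variation at \<open>t = 0\<close>
    vanishes.\<close>
  have adm_t: "W.adm vv (\<lambda>k. ws k + t * Re (lam k)) {..<m}" for t
    unfolding W.adm_def
  proof (intro conjI ballI fv)
    fix i j assume ij: "i \<in> {..<m}" "j \<in> {..<m}"
    let ?A = "{vv k |k. k \<in> {..<m} \<and> ws i + ws j \<le> ws k}" and ?B = "{vv k |k. k < m \<and> lam k = lam i + lam j}"
    have "br (vv i) (vv j) \<in> Fil vv ws {..<m} (ws i + ws j)"
      unfolding Fv using ij vF by (intro W.adm_mult[OF W.opt_adm[OF o]]) auto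
    then have "br (vv i) (vv j) \<in> vec.span ?A \<inter> vec.span ?B"
      using eigmult ij by (simp add: Fil_def)
    also have "\<dots> \<subseteq> vec.span (?A \<inter> ?B)" by (rule independent_span_Int[OF indv(1)]) auto
    also have "\<dots> \<subseteq> Fil vv (\<lambda>k. ws k + t * Re (lam k)) {..<m} (ws i + t * Re (lam i) + (ws j + t * Re (lam j)))"
      unfolding Fil_def
    proof (intro vec.span_mono subsetI)
      fix x assume x: "x \<in> ?A \<inter> ?B"
      from x obtain k where k1: "x = vv k" "k < m" "ws i + ws j \<le> ws k" by auto
      from x obtain k' where k2: "x = vv k'" "k' < m" "lam k' = lam i + lam j" by auto
      note k = k1 k2
      then have "k = k'" using indv(2) by (auto simp: inj_on_def)
      then have "ws i + t * Re (lam i) + (ws j + t * Re (lam j)) \<le> ws k + t * Re (lam k)"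
        using k by (simp add: distrib_left)
      then show "x \<in> {vv k |k. k \<in> {..<m} \<and> ws i + t * Re (lam i) + (ws j + t * Re (lam j)) \<le> ws k + t * Re (lam k)}"
        using k by auto
    qed
    finally show "br (vv i) (vv j) \<in> Fil vv (\<lambda>k. ws k + t * Re (lam k)) {..<m} (ws i + t * Re (lam i) + (ws j + t * Re (lam j)))" .
  qed
  have costs: "W.cost ws {..<m} = W.cost w UNIV" unfolding W.cost_def by (rule Fil_sum_eq[OF fe f Fe])
  have var: "(\<Sum>k<m. Re (lam k) * (ws k - gam)) = 0"
  proof -
    have "0 \<le> t * (2 * (\<Sum>k<m. Re (lam k) * (ws k - gam))) + t\<^sup>2 * (\<Sum>k<m. (Re (lam k))\<^sup>2)" for t
    proof -
      have "W.cost w UNIV \<le> W.cost (\<lambda>k. ws k + t * Re (lam k)) {..<m}" by (rule W.opt_le[OF o adm_t])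
      also have "\<dots> = W.cost ws {..<m} + (t * (2 * (\<Sum>k<m. Re (lam k) * (ws k - gam))) + t\<^sup>2 * (\<Sum>k<m. (Re (lam k))\<^sup>2))"
      proof -
        have "(ws k + t * Re (lam k) - gam)\<^sup>2 = (ws k - gam)\<^sup>2 + (t * (2 * (Re (lam k) * (ws k - gam))) + t\<^sup>2 * (Re (lam k))\<^sup>2)" for k
          by (simp add: power2_eq_square algebra_simps)
        then show ?thesis by (simp add: W.cost_def sum.distrib sum_distrib_left)
      qed
      finally show ?thesis using costs by simp
    qed
    then have "2 * (\<Sum>k<m. Re (lam k) * (ws k - gam)) = 0" by (rule quadratic_pos_imp_zero)
    then show ?thesis by simp
  qed
  have diag: "gh (D (e k)) (e k) = lam k" if k: "k < m" for k
  proof -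
    have "gh x (e k) = 0" if "x \<in> vec.span (e ` {..<k})" for x
    proof -
      have "vec.subspace {x. gh x (e k) = 0}" by (intro vec.subspaceI) (auto simp: gh_simps)
      moreover have "e ` {..<k} \<subseteq> {x. gh x (e k) = 0}" using S(1)[OF _ k] k by auto
      ultimately show ?thesis using that vec.span_minimal by blast
    qed
    then have "gh (D (e k) - lam k *s e k) (e k) = 0" using S(2)[OF k] by blast
    then show ?thesis using S(1)[OF k k] by (simp add: gh_simps)
  qed
  define wt where "wt x = ws (the_inv_into {..<m} e x)" for x
  have wte: "wt (e k) = ws k" if "k < m" for k
    using that inj_e by (simp add: wt_def the_inv_into_f_f)
  have F0: "?F 0 = UNIV"
  proof -
    have "0 \<le> w k" for k by (rule W.opt_nonneg[OF o br_skew br_jacobi]) simp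
    then have "{v k |k. k \<in> UNIV \<and> 0 \<le> w k} = range v" by auto
    then show ?thesis using f by (simp add: Fil_def fam_def)
  qed
  have wpos: "0 \<le> ws k" if "k < m" for k using S(3)[OF that, of 0] F0 by simp
  have wsc: "(\<Sum>k<m. (ws k)\<^sup>2) = gam * (\<Sum>k<m. ws k)"
  proof -
    have "(\<Sum>k<m. (ws k)\<^sup>2) = (\<Sum>k\<in>UNIV. (w k)\<^sup>2)" by (rule Fil_sum_eq[OF fe f Fe])
    moreover have "(\<Sum>k<m. ws k) = (\<Sum>k\<in>UNIV. w k)" by (rule Fil_sum_eq[OF fe f Fe])
    ultimately show ?thesis using W.opt_scale[OF o] by simp
  qed
  have re: "(\<Sum>x\<in>e ` {..<m}. g x) = (\<Sum>k<m. g (e k))" for g :: "'n cvec \<Rightarrow> real"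
    using sum.reindex[OF inj_e, of g] by simp
  show ?thesis
  proof (rule that[OF onbE, of wt])
    fix x y z assume "x \<in> e ` {..<m}" "y \<in> e ` {..<m}" "z \<in> e ` {..<m}" and nz: "gh (br x y) z \<noteq> 0"
    then obtain i j k where ijk: "x = e i" "i < m" "y = e j" "j < m" "z = e k" "k < m" by auto
    have "br x y \<in> ?F (ws i + ws j)"
      using S(3) ijk by (intro W.adm_mult[OF W.opt_adm[OF o]]) auto
    then have b: "br x y \<in> Fil e ws {..<m} (ws i + ws j)" by (simp only: Fe)
    show "wt x + wt y \<le> wt z"
    proof (rule ccontr)
      assume "\<not> wt x + wt y \<le> wt z"
      then have lt: "ws k < ws i + ws j" using ijk wte by simp
      have "vec.subspace {u. gh u z = 0}" by (intro vec.subspaceI) (auto simp: gh_simps)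
      moreover have "{e l |l. l \<in> {..<m} \<and> ws i + ws j \<le> ws l} \<subseteq> {u. gh u z = 0}"
        using S(1) ijk lt by force
      ultimately have "gh (br x y) z = 0" using b vec.span_minimal unfolding Fil_def by blast
      then show False using nz by simp
    qed
  next
    show "0 \<le> wt x" if "x \<in> e ` {..<m}" for x using that wte wpos by auto
    show "(\<Sum>x\<in>e ` {..<m}. (wt x)\<^sup>2) = gam * (\<Sum>x\<in>e ` {..<m}. wt x)"
      using wsc by (simp add: re wte)
    show "(\<Sum>x\<in>e ` {..<m}. wt x * Re (gh (D x) x)) = gam * (\<Sum>x\<in>e ` {..<m}. Re (gh (D x) x))"
      using var by (simp add: re wte diag algebra_simps sum_subtractf sum_distrib_left)
  qed
qed

end

section \<open>The moment map of a bracket\<close>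

text \<open>The infinitesimal action on brackets, that is the derivative at the identity of
  \<open>g (om (inverse g x) (inverse g y))\<close>. Derivations of \<open>om\<close> are exactly
  the linear maps with \<open>act A om = 0\<close>.\<close>

definition act :: "(('n::finite) cvec \<Rightarrow> 'n cvec) \<Rightarrow> ('n cvec \<Rightarrow> 'n cvec \<Rightarrow> 'n cvec) \<Rightarrow> 'n cvec \<Rightarrow> 'n cvec \<Rightarrow> 'n cvec" where
  "act A om x y = A (om x y) - om (A x) y - om x (A y)"

lemma bilinI:
  "(\<And>x y z. om (x + y) z = om x z + om y z) \<Longrightarrow> (\<And>x y z. om z (x + y) = om z x + om z y) \<Longrightarrow>
   (\<And>a x z. om (a *s x) z = a *s om x z) \<Longrightarrow> (\<And>a x z. om z (a *s x) = a *s om z x) \<Longrightarrow> bilin om"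
  by (simp add: bilin_def lin_on_def)

lemma bilin_act: assumes "clin A" "bilin om" shows "bilin (act A om)"
  by (rule bilinI) (simp_all add: act_def bilin_simps[OF assms(2)] clin_add[OF assms(1)] clin_scale[OF assms(1)]
      vec.scale_right_diff_distrib)

lemma act_comm:
  assumes "clin A" "clin C" "bilin om"
  shows "act (\<lambda>x. A (C x) - C (A x)) om x y = act A (act C om) x y - act C (act A om) x y"
  by (simp add: act_def bilin_simps[OF assms(3)] clin_diff[OF assms(1)] clin_diff[OF assms(2)])

lemma bilin_eq_zero:
  assumes "bilin om" "vec.span B = UNIV" "\<And>i j. i \<in> B \<Longrightarrow> j \<in> B \<Longrightarrow> om i j = 0"
  shows "om x y = 0"
proof -
  have "vec.subspace {y. om x y = 0}" "vec.subspace {x. om x y = 0}" for x y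
    by (intro vec.subspaceI; simp add: bilin_simps[OF assms(1)])+
  note s = this
  have "vec.span B \<subseteq> {y. om i y = 0}" if "i \<in> B" for i
    using assms(3)[OF that] by (intro vec.span_minimal s) auto
  then have "vec.span B \<subseteq> {x. om x y = 0}" using assms(2) by (intro vec.span_minimal s) auto
  then show ?thesis using assms(2) by auto
qed

section \<open>The moment map and its trace identity\<close>

context hermitian begin

definition bas :: "'n cvec set" where "bas = set (some_ub gh UNIV)"

lemma onb_bas: "onb UNIV bas" unfolding bas_def by (rule some_ub) simp
lemma finite_bas [simp]: "finite bas" by (simp add: bas_def)
lemma span_bas: "vec.span bas = UNIV" using onb_bas by (simp add: onb_def)

text \<open>The quadratic part of the Ricci-type formula \<open>hcf_K_formula\<close>, free of
  traces of \<open>ad\<close>. It is defined for every bilinear map on the whole space, so that it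
  also applies to the bracket of an ideal extended by zero.\<close>

definition mom :: "('n cvec \<Rightarrow> 'n cvec \<Rightarrow> 'n cvec) \<Rightarrow> 'n cvec \<Rightarrow> 'n cvec \<Rightarrow> complex" where
  "mom om x y = - (1/2) * (\<Sum>i\<in>bas. gh (om x i) (om y i)) + (1/4) * (\<Sum>i\<in>bas. \<Sum>j\<in>bas. gh x (om i j) * gh (om i j) y)"

lemma mom_onb:
  assumes om: "bilin om" and S: "onb UNIV S"
  shows "mom om x y = - (1/2) * (\<Sum>i\<in>S. gh (om x i) (om y i)) + (1/4) * (\<Sum>i\<in>S. \<Sum>j\<in>S. gh x (om i j) * gh (om i j) y)"
proof -
  have "sesq (\<lambda>i j. gh (om x i) (om y j))"
    unfolding sesq_def by (simp add: bilin_simps[OF om] gh_simps)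
  from sesq_indep[OF this onb_bas S]
  have 1: "(\<Sum>i\<in>bas. gh (om x i) (om y i)) = (\<Sum>i\<in>S. gh (om x i) (om y i))" .
  have "sesq (\<lambda>j j'. gh x (om i j') * gh (om i j) y)" for i
    unfolding sesq_def by (simp add: bilin_simps[OF om] gh_simps algebra_simps)
  from sesq_indep[OF this onb_bas S]
  have 2: "(\<Sum>j\<in>bas. gh x (om i j) * gh (om i j) y) = (\<Sum>j\<in>S. gh x (om i j) * gh (om i j) y)" for i .
  have "sesq (\<lambda>i i'. \<Sum>j\<in>S. gh x (om i' j) * gh (om i j) y)"
    unfolding sesq_def by (simp add: bilin_simps[OF om] gh_simps algebra_simps sum.distrib sum_distrib_left)
  from sesq_indep[OF this onb_bas S]
  have 3: "(\<Sum>i\<in>bas. \<Sum>j\<in>S. gh x (om i j) * gh (om i j) y) = (\<Sum>i\<in>S. \<Sum>j\<in>S. gh x (om i j) * gh (om i j) y)" .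
  show ?thesis unfolding mom_def 1 2 3 ..
qed

lemma mom_add_left: "bilin om \<Longrightarrow> mom om (x + y) z = mom om x z + mom om y z"
  and mom_scale_left: "bilin om \<Longrightarrow> mom om (a *s x) z = a * mom om x z"
  by (simp_all add: mom_def bilin_simps gh_simps sum.distrib sum_distrib_left algebra_simps)

lemma mom_cnj: "mom om y x = cnj (mom om x y)"
  unfolding mom_def complex_cnj_add complex_cnj_mult cnj_sum
  by (simp add: gh_cnj[symmetric] mult.commute)

lemma mom_add_right: "bilin om \<Longrightarrow> mom om z (x + y) = mom om z x + mom om z y"
  by (subst (1 2 3) mom_cnj) (simp add: mom_add_left)
lemma mom_scale_right: "bilin om \<Longrightarrow> mom om z (a *s x) = cnj a * mom om z x"
  by (subst (1 2) mom_cnj) (simp add: mom_scale_left)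

lemma sesq_mom: "bilin om \<Longrightarrow> sesq (mom om)"
  by (simp add: sesq_def mom_add_left mom_scale_left mom_add_right mom_scale_right)

definition ipb :: "('n cvec \<Rightarrow> 'n cvec \<Rightarrow> 'n cvec) \<Rightarrow> ('n cvec \<Rightarrow> 'n cvec \<Rightarrow> 'n cvec) \<Rightarrow> complex" where
  "ipb om nu = (\<Sum>i\<in>bas. \<Sum>j\<in>bas. gh (om i j) (nu i j))"

lemma sesq_lin: "clin E \<Longrightarrow> sesq (\<lambda>x y. gh (E x) y)"
  by (simp add: sesq_def clin_add clin_scale gh_simps)

text \<open>The defining property of a moment map. The two terms of \<open>act E om\<close> in which
  \<open>E\<close> acts on an argument coincide by skew symmetry, which accounts for the
  coefficients \<open>-1/2\<close> and \<open>1/4\<close> in \<open>mom\<close>.\<close>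

lemma mom_trace:
  assumes om: "bilin om" and skew: "\<And>x y. om x y = - om y x" and E: "clin E"
  shows "(\<Sum>k\<in>bas. mom om (E k) k) = (1/4) * ipb (act E om) om"
proof -
  have "(\<Sum>k\<in>bas. \<Sum>i\<in>bas. \<Sum>j\<in>bas. gh (E k) (om i j) * gh (om i j) k) = (\<Sum>i\<in>bas. \<Sum>k\<in>bas. \<Sum>j\<in>bas. gh (E k) (om i j) * gh (om i j) k)"
    by (rule sum.swap)
  also have "\<dots> = (\<Sum>i\<in>bas. \<Sum>j\<in>bas. \<Sum>k\<in>bas. gh (E k) (om i j) * gh (om i j) k)"
    by (intro sum.cong refl sum.swap)
  also have "\<dots> = (\<Sum>i\<in>bas. \<Sum>j\<in>bas. gh (E (om i j)) (om i j))"
  proof (intro sum.cong refl)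
    fix i j
    have "gh (E (om i j)) (om i j) = (\<Sum>k\<in>bas. gh (om i j) k * gh (E k) (om i j))"
      by (rule sesq_expand_left[OF sesq_lin[OF E] onb_bas]) simp
    then show "(\<Sum>k\<in>bas. gh (E k) (om i j) * gh (om i j) k) = gh (E (om i j)) (om i j)"
      by (simp add: mult.commute)
  qed
  finally have 1: "(\<Sum>k\<in>bas. \<Sum>i\<in>bas. \<Sum>j\<in>bas. gh (E k) (om i j) * gh (om i j) k) = (\<Sum>i\<in>bas. \<Sum>j\<in>bas. gh (E (om i j)) (om i j))" .
  have "(\<Sum>i\<in>bas. \<Sum>j\<in>bas. gh (om i (E j)) (om i j)) = (\<Sum>j\<in>bas. \<Sum>i\<in>bas. gh (om i (E j)) (om i j))" by (rule sum.swap)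
  also have "\<dots> = (\<Sum>j\<in>bas. \<Sum>i\<in>bas. gh (om (E j) i) (om j i))"
  proof (intro sum.cong refl)
    fix i j
    have "gh (om i (E j)) (om i j) = gh (- om (E j) i) (- om j i)" by (simp only: skew[of i])
    then show "gh (om i (E j)) (om i j) = gh (om (E j) i) (om j i)" by simp
  qed
  finally have 2: "(\<Sum>i\<in>bas. \<Sum>j\<in>bas. gh (om i (E j)) (om i j)) = (\<Sum>j\<in>bas. \<Sum>i\<in>bas. gh (om (E j) i) (om j i))" .
  have "ipb (act E om) om = (\<Sum>i\<in>bas. \<Sum>j\<in>bas. gh (E (om i j)) (om i j)) - 2 * (\<Sum>i\<in>bas. \<Sum>j\<in>bas. gh (om (E i) j) (om i j))"
    unfolding ipb_def act_def gh_diff_left sum_subtractf 2 by simp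
  moreover have "(\<Sum>k\<in>bas. mom om (E k) k) = - (1/2) * (\<Sum>k\<in>bas. \<Sum>i\<in>bas. gh (om (E k) i) (om k i))
     + (1/4) * (\<Sum>k\<in>bas. \<Sum>i\<in>bas. \<Sum>j\<in>bas. gh (E k) (om i j) * gh (om i j) k)"
    unfolding mom_def sum.distrib sum_distrib_left[symmetric] ..
  then have "(\<Sum>k\<in>bas. mom om (E k) k) = (1/4) * ((\<Sum>i\<in>bas. \<Sum>j\<in>bas. gh (E (om i j)) (om i j))
     - 2 * (\<Sum>i\<in>bas. \<Sum>j\<in>bas. gh (om (E i) j) (om i j)))"
    unfolding 1 by (simp add: algebra_simps)
  ultimately show ?thesis by simp
qed

lemma ipb_adj:
  assumes om: "bilin om" and nu: "bilin nu" and A: "clin A"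
  shows "ipb (act A om) nu = ipb om (act (adj A) nu)"
proof -
  have 1: "(\<Sum>j\<in>bas. gh (om i (A j)) (nu i j)) = (\<Sum>j\<in>bas. gh (om i j) (nu i (adj A j)))" for i
  proof -
    have "sesq (\<lambda>x y. gh (om i x) (nu i y))"
      unfolding sesq_def by (simp add: bilin_simps[OF om] bilin_simps[OF nu] gh_simps)
    from sesq_adj[OF this onb_bas A] show ?thesis .
  qed
  have 2: "(\<Sum>i\<in>bas. gh (om (A i) j) (nu i j)) = (\<Sum>i\<in>bas. gh (om i j) (nu (adj A i) j))" for j
  proof -
    have "sesq (\<lambda>x y. gh (om x j) (nu y j))"
      unfolding sesq_def by (simp add: bilin_simps[OF om] bilin_simps[OF nu] gh_simps)
    from sesq_adj[OF this onb_bas A] show ?thesis .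
  qed
  have "(\<Sum>i\<in>bas. \<Sum>j\<in>bas. gh (om (A i) j) (nu i j)) = (\<Sum>j\<in>bas. \<Sum>i\<in>bas. gh (om (A i) j) (nu i j))" by (rule sum.swap)
  also have "\<dots> = (\<Sum>j\<in>bas. \<Sum>i\<in>bas. gh (om i j) (nu (adj A i) j))" unfolding 2 ..
  also have "\<dots> = (\<Sum>i\<in>bas. \<Sum>j\<in>bas. gh (om i j) (nu (adj A i) j))" by (rule sum.swap)
  finally show ?thesis
    unfolding ipb_def act_def gh_diff_left gh_diff_right sum_subtractf gh_adj'[OF A] 1 by simp
qed

lemma ipb_zero:
  assumes om: "bilin om" and z: "ipb om om = 0" shows "om x y = 0"
proof (rule bilin_eq_zero[OF om span_bas])
  have "(\<Sum>i\<in>bas. \<Sum>j\<in>bas. gh (om i j) (om i j)) = (\<Sum>p\<in>bas \<times> bas. gh (om (fst p) (snd p)) (om (fst p) (snd p)))"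
    by (simp add: sum.cartesian_product split_def)
  then have z': "(\<Sum>p\<in>bas \<times> bas. gh (om (fst p) (snd p)) (om (fst p) (snd p))) = 0" using z by (simp add: ipb_def)
  show "om i j = 0" if "i \<in> bas" "j \<in> bas" for i j
    using cmod_zero_of_sum[OF _ z', of "(i, j)"] that by simp
qed

lemma ipb_nonneg: "Re (ipb om om) \<ge> 0"
  unfolding ipb_def Re_sum by (intro sum_nonneg gh_nonneg)
lemma ipb_real: "Im (ipb om om) = 0"
proof -
  have "Im (gh x x) = 0" for x using gh_self_real[of x] by (metis Im_complex_of_real)
  then show ?thesis unfolding ipb_def Im_sum by simp
qed

text \<open>The action of a commutator is the commutator of the actions, and one half drops out
  because \<open>A\<close> is a derivation; then \<open>A\<close> moves to the other side as its
  adjoint. With \<open>C = adj A\<close> the result is a squared norm.\<close>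

lemma mom_trace_comm:
  assumes om: "bilin om" and skew: "\<And>x y. om x y = - om y x" and A: "clin A" and C: "clin C"
    and z: "\<And>x y. act A om x y = 0"
  shows "(\<Sum>k\<in>bas. mom om (A (C k) - C (A k)) k) = (1/4) * ipb (act C om) (act (adj A) om)"
proof -
  have "(\<Sum>k\<in>bas. mom om (A (C k) - C (A k)) k) = (1/4) * ipb (act (\<lambda>x. A (C x) - C (A x)) om) om"
    using mom_trace[OF om skew, of "\<lambda>x. A (C x) - C (A x)"] A C by (simp add: clin_sub clin_compose)
  also have "act (\<lambda>x. A (C x) - C (A x)) om = act A (act C om)"
    using z by (intro ext) (simp add: act_comm[OF A C om], simp add: act_def clin_zero[OF C])
  also have "ipb (act A (act C om)) om = ipb (act C om) (act (adj A) om)"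
    by (rule ipb_adj[OF bilin_act[OF C om] om A])
  finally show ?thesis .
qed

lemma trace_comm:
  assumes "clin f" "clin g" "onb UNIV S"
  shows "(\<Sum>k\<in>S. gh (f (g k)) k) = (\<Sum>k\<in>S. gh (g (f k)) k)"
  using sesq_adj[OF sesq_lin[OF assms(1)] assms(3,2)] by (simp add: gh_adj'[OF assms(2)])

lemma trace_step:
  assumes "vec.subspace V" "vec.subspace W" "W \<subseteq> V" "clin g" "\<And>x. x \<in> V \<Longrightarrow> g x \<in> W"
  shows "ctr gh V g = ctr gh W g"
proof -
  obtain S where S: "onb W S" using onb_exists assms(2) by blast
  obtain T where T: "S \<subseteq> T" "onb V T" using onb_extend[OF S assms(3,1)] by blast
  have perp: "gh x t = 0" if t: "t \<in> T - S" and x: "x \<in> W" for t x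
  proof -
    have "gh x t = (\<Sum>e\<in>S. gh x e * gh e t)" by (rule gh_expand_left[OF S x])
    also have "\<dots> = 0"
    proof (intro sum.neutral ballI)
      fix e assume "e \<in> S"
      then have "gh e t = 0" using T(1) t onb_gh[OF T(2), of e t] by auto
      then show "gh x e * gh e t = 0" by simp
    qed
    finally show ?thesis .
  qed
  have "(\<Sum>e\<in>T. gh (g e) e) = (\<Sum>e\<in>S. gh (g e) e)"
    using T onb_finite[OF T(2)] perp assms(5) onb_in[OF T(2)]
    by (intro sum.mono_neutral_right) auto
  then show ?thesis using ctr_onb[OF S assms(4)] ctr_onb[OF T(2) assms(4)] by simp
qed

text \<open>A map that sends each piece into the next has its trace carried down to the zero
  space.\<close>

lemma trace_strict_zero:
  assumes W: "\<And>k. vec.subspace (W k)" "\<And>k. W (Suc k) \<subseteq> W k" "W (K::nat) = {0}"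
    and g: "clin g" "\<And>k x. x \<in> W k \<Longrightarrow> g x \<in> W (Suc k)"
  shows "ctr gh (W 0) g = 0"
proof -
  have "ctr gh (W 0) g = ctr gh (W k) g" for k
  proof (induction k)
    case (Suc k)
    then show ?case using trace_step[OF W(1) W(1) W(2) g, of k] by simp
  qed simp
  then have "ctr gh (W 0) g = ctr gh {0} g" using W(3) by metis
  also obtain S where S: "onb {0} S" using onb_exists[of "{0}"] by auto
  have "ctr gh {0} g = 0" 
    unfolding ctr_onb[OF S g(1)]
  proof (intro sum.neutral ballI)
    fix e assume "e \<in> S"
    then have "e = 0" using onb_in[OF S] by blast
    then show "gh (g e) e = 0" by simp
  qed
  finally show ?thesis .
qed

text \<open>Compare the Hilbert-Schmidt norms of the two off-diagonal blocks.\<close>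

lemma complement_invariant:
  assumes fin: "finite I" and A: "\<And>i. i \<in> I \<Longrightarrow> clin (A i)"
    and P: "\<And>x. (\<Sum>i\<in>I. A i (adj (A i) x) - adj (A i) (A i x)) = 0"
    and W: "vec.subspace W" "\<And>i x. i \<in> I \<Longrightarrow> x \<in> W \<Longrightarrow> A i x \<in> W"
    and i: "i \<in> I" and y: "\<And>x. x \<in> W \<Longrightarrow> gh y x = 0" and x: "x \<in> W"
  shows "gh (A i y) x = 0"
proof -
  obtain S where S: "onb W S" using onb_exists W(1) by blast
  obtain T where T: "S \<subseteq> T" "onb UNIV T" using onb_extend[OF S subset_UNIV vec.subspace_UNIV] by blast
  note finT = onb_finite[OF T(2)] and finS = onb_finite[OF S]
  define q where "q i l k = (cmod (gh (A i l) k))\<^sup>2" for i l k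
  have "(\<Sum>k\<in>S. \<Sum>i\<in>I. gh (A i (adj (A i) k)) k - gh (adj (A i) (A i k)) k) = (\<Sum>k\<in>S. gh (\<Sum>i\<in>I. A i (adj (A i) k) - adj (A i) (A i k)) k)"
    by (simp add: gh_sum_left gh_diff_left)
  also have "\<dots> = 0" by (simp add: P)
  finally have "(\<Sum>i\<in>I. \<Sum>k\<in>S. gh (A i (adj (A i) k)) k - gh (adj (A i) (A i k)) k) = 0" by (subst sum.swap)
  \<comment> \<open>Invariance of \<open>W\<close> removes the block from \<open>W\<close> to its
    complement. In the trace over \<open>W\<close> the diagonal blocks cancel as well, and the
    squared norm of the block from the complement to \<open>W\<close> remains.\<close>
  moreover have "(\<Sum>k\<in>S. gh (A i (adj (A i) k)) k - gh (adj (A i) (A i k)) k) = of_real (\<Sum>k\<in>S. \<Sum>l\<in>T - S. q i l k)" if i: "i \<in> I" for i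
  proof -
    have "gh (A i (adj (A i) k)) k = (\<Sum>l\<in>T. of_real (q i l k))" for k
    proof -
      have "gh (A i (adj (A i) k)) k = gh (adj (A i) k) (adj (A i) k)" by (simp add: gh_adj'[OF A[OF i]])
      also have "\<dots> = (\<Sum>l\<in>T. of_real ((cmod (gh (adj (A i) k) l))\<^sup>2))" by (rule norm_expand[OF T(2)]) simp
      also have "\<dots> = (\<Sum>l\<in>T. of_real (q i l k))"
      proof (intro sum.cong refl)
        fix l
        have "cmod (gh (adj (A i) k) l) = cmod (cnj (gh (A i l) k))" unfolding gh_adj[OF A[OF i]] gh_cnj[of k "A i l", symmetric] ..
        then show "complex_of_real ((cmod (gh (adj (A i) k) l))\<^sup>2) = complex_of_real (q i l k)" by (simp add: q_def)
      qed
      finally show ?thesis .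
    qed
    then have 1: "(\<Sum>k\<in>S. gh (A i (adj (A i) k)) k) = of_real (\<Sum>k\<in>S. \<Sum>l\<in>T. q i l k)" by simp
    have "gh (adj (A i) (A i k)) k = (\<Sum>l\<in>S. of_real (q i k l))" if k: "k \<in> S" for k
      unfolding gh_adj[OF A[OF i]] q_def by (rule norm_expand[OF S W(2)[OF i onb_in[OF S k]]])
    then have "(\<Sum>k\<in>S. gh (adj (A i) (A i k)) k) = of_real (\<Sum>k\<in>S. \<Sum>l\<in>S. q i k l)" by simp
    also have "(\<Sum>k\<in>S. \<Sum>l\<in>S. q i k l) = (\<Sum>k\<in>S. \<Sum>l\<in>S. q i l k)" by (rule sum.swap)
    finally have 2: "(\<Sum>k\<in>S. gh (adj (A i) (A i k)) k) = of_real (\<Sum>k\<in>S. \<Sum>l\<in>S. q i l k)" .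
    have "(\<Sum>l\<in>T. q i l k) = (\<Sum>l\<in>T - S. q i l k) + (\<Sum>l\<in>S. q i l k)" for k
      using sum.subset_diff[OF T(1) finT, of "\<lambda>l. q i l k"] .
    then have "(\<Sum>k\<in>S. \<Sum>l\<in>T. q i l k) = (\<Sum>k\<in>S. \<Sum>l\<in>T - S. q i l k) + (\<Sum>k\<in>S. \<Sum>l\<in>S. q i l k)"
      by (simp add: sum.distrib)
    then show ?thesis unfolding sum_subtractf 1 2 by simp
  qed
  ultimately have "complex_of_real (\<Sum>i\<in>I. \<Sum>k\<in>S. \<Sum>l\<in>T - S. q i l k) = 0" by simp
  then have z: "(\<Sum>i\<in>I. \<Sum>k\<in>S. \<Sum>l\<in>T - S. q i l k) = 0" by (simp only: of_real_eq_0_iff)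
  have qn: "q i l k \<ge> 0" for i l k by (simp add: q_def)
  have z1: "(\<Sum>k\<in>S. \<Sum>l\<in>T - S. q i l k) = 0"
    using z i fin by (subst (asm) sum_nonneg_eq_0_iff) (auto intro!: sum_nonneg qn)
  have z2: "q i l k = 0" if "k \<in> S" "l \<in> T - S" for k l
  proof -
    have "(\<Sum>l\<in>T - S. q i l k) = 0"
      using z1 that(1) finS by (subst (asm) sum_nonneg_eq_0_iff) (auto intro!: sum_nonneg qn)
    then show ?thesis using that(2) finT by (subst (asm) sum_nonneg_eq_0_iff) (auto intro!: qn)
  qed
  have Ak: "gh (A i y) k = 0" if k: "k \<in> S" for k
  proof -
    have "gh (A i y) k = (\<Sum>l\<in>T. gh y l * gh (A i l) k)"
      by (rule sesq_expand_left[OF sesq_lin[OF A[OF i]] T(2)]) simp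
    also have "\<dots> = 0"
    proof (intro sum.neutral ballI)
      fix l assume "l \<in> T"
      then show "gh y l * gh (A i l) k = 0" using y[OF onb_in[OF S]] z2[OF k, of l] by (cases "l \<in> S") (auto simp: q_def)
    qed
    finally show ?thesis .
  qed
  have "gh (A i y) x = (\<Sum>e\<in>S. gh (A i y) e * gh e x)" by (rule gh_expand_right[OF S x])
  also have "\<dots> = 0" using Ak by simp
  finally show ?thesis .
qed

end

section \<open>The curvature of a left-invariant metric\<close>

context hermitian begin

definition ip :: "'n cvec \<Rightarrow> 'n cvec \<Rightarrow> real" where "ip x y = Re (gh x y)"

lemma ip_add_left: "ip (x + y) z = ip x z + ip y z"
  and ip_add_right: "ip z (x + y) = ip z x + ip z y"
  and ip_scale_left [simp]: "ip (r *\<^sub>R x) y = r * ip x y"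
  and ip_scale_right [simp]: "ip x (r *\<^sub>R y) = r * ip x y"
  and ip_diff_left: "ip (x - y) z = ip x z - ip y z"
  and ip_diff_right: "ip z (x - y) = ip z x - ip z y"
  and ip_minus_left [simp]: "ip (- x) y = - ip x y"
  and ip_minus_right [simp]: "ip x (- y) = - ip x y"
  and ip_sum_left: "ip (sum f I) y = (\<Sum>i\<in>I. ip (f i) y)"
  and ip_sum_right: "ip y (sum f I) = (\<Sum>i\<in>I. ip y (f i))"
  by (simp_all add: ip_def gh_simps scaleR_vec_eq)

lemma ip_commute: "ip x y = ip y x"
proof -
  have "Re (gh x y) = Re (cnj (gh y x))" by (rule arg_cong[OF gh_cnj])
  then show ?thesis by (simp add: ip_def)
qed

definition rset :: "'n cvec set \<Rightarrow> 'n cvec set \<Rightarrow> bool" where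
  "rset V F \<longleftrightarrow> finite F \<and> span F = V \<and> (\<forall>x\<in>F. \<forall>y\<in>F. ip x y = (if x = y then 1 else 0))"

lemma rset_in: "rset V F \<Longrightarrow> f \<in> F \<Longrightarrow> f \<in> V"
  unfolding rset_def using span_base by blast

lemma rset_expand: assumes "rset V F" "x \<in> V" shows "x = (\<Sum>f\<in>F. ip x f *\<^sub>R f)"
proof -
  have fin: "finite F" and sp: "span F = V" using assms(1) by (auto simp: rset_def)
  obtain c where c: "x = (\<Sum>f\<in>F. c f *\<^sub>R f)" using assms(2) span_finite[OF fin] sp by auto
  have "ip x g = c g" if g: "g \<in> F" for g
  proof -
    have "ip x g = (\<Sum>f\<in>F. c f * ip f g)" unfolding c ip_sum_left by simp
    also have "\<dots> = (\<Sum>f\<in>F. if f = g then c f else 0)"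
      using assms(1) g by (intro sum.cong refl) (auto simp: rset_def)
    also have "\<dots> = c g" using fin g by simp
    finally show ?thesis .
  qed
  then show ?thesis using c by simp
qed

lemma rset_indep:
  fixes b :: "'n cvec \<Rightarrow> 'n cvec \<Rightarrow> real"
  assumes b: "\<And>x y z. b (x + y) z = b x z + b y z" "\<And>x y z. b z (x + y) = b z x + b z y"
    "\<And>r x y. b (r *\<^sub>R x) y = r * b x y" "\<And>r x y. b x (r *\<^sub>R y) = r * b x y"
    and F: "rset V F" and G: "rset V G"
  shows "(\<Sum>f\<in>F. b f f) = (\<Sum>g\<in>G. b g g)"
proof -
  have b0: "b 0 y = 0" "b y 0 = 0" for y using b(3)[of 0 0 y] b(4)[of y 0 0] by simp_all
  have bl: "b (sum h I) y = (\<Sum>i\<in>I. b (h i) y)" for h :: "'n cvec \<Rightarrow> 'n cvec" and I y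
    by (induction I rule: infinite_finite_induct) (auto simp: b b0)
  have brt: "b y (sum h I) = (\<Sum>i\<in>I. b y (h i))" for h :: "'n cvec \<Rightarrow> 'n cvec" and I y
    by (induction I rule: infinite_finite_induct) (auto simp: b b0)
  have 1: "b f y = (\<Sum>g\<in>G. ip f g * b g y)" if "f \<in> V" for f y
    by (subst rset_expand[OF G that]) (simp only: bl b)
  have 2: "b y g = (\<Sum>f\<in>F. ip g f * b y f)" if "g \<in> V" for g y
    by (subst rset_expand[OF F that]) (simp only: brt b)
  have "(\<Sum>f\<in>F. b f f) = (\<Sum>f\<in>F. \<Sum>g\<in>G. ip f g * b g f)"
    by (intro sum.cong refl 1 rset_in[OF F])
  also have "\<dots> = (\<Sum>g\<in>G. \<Sum>f\<in>F. ip f g * b g f)" by (rule sum.swap)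
  also have "\<dots> = (\<Sum>g\<in>G. b g g)"
  proof (intro sum.cong refl)
    fix g assume "g \<in> G"
    show "(\<Sum>f\<in>F. ip f g * b g f) = b g g"
      unfolding 2[OF rset_in[OF G \<open>g \<in> G\<close>], of g] by (simp only: ip_commute)
  qed
  finally show ?thesis .
qed

lemma smult_i_i: "\<i> *s (\<i> *s x) = - (x :: 'n cvec)"
  by (simp add: vec.scale_minus_left[of 1, simplified])

lemma onb_rset:
  assumes S: "onb V S"
  shows "rset V (S \<union> (*s) \<i> ` S)" "S \<inter> (*s) \<i> ` S = {}" "inj_on ((*s) \<i>) S"
proof -
  have o: "gh x y = (if x = y then 1 else 0)" if "x \<in> S" "y \<in> S" for x y using onb_gh[OF S that] .
  show inj: "inj_on ((*s) \<i>) S" by (rule inj_onI) simp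
  show disj: "S \<inter> (*s) \<i> ` S = {}"
  proof (rule ccontr)
    assume "S \<inter> (*s) \<i> ` S \<noteq> {}"
    then obtain e where e: "e \<in> S" "\<i> *s e \<in> S" by auto
    then show False using o[of "\<i> *s e" e] o[of e e] by (auto split: if_splits)
  qed
  have sV: "vec.subspace V" by (rule onb_subspace[OF S])
  have rV: "subspace V" using sV by (intro subspaceI) (auto simp: scaleR_vec_eq vec.subspace_0 vec.subspace_add vec.subspace_scale)
  have "span (S \<union> (*s) \<i> ` S) = V"
  proof
    show "span (S \<union> (*s) \<i> ` S) \<subseteq> V"
      using onb_in[OF S] sV by (intro span_minimal rV) (auto simp: vec.subspace_scale)
    show "V \<subseteq> span (S \<union> (*s) \<i> ` S)"
    proof
      fix x assume x: "x \<in> V"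
      have cs: "c *s e = Re c *\<^sub>R e + Im c *\<^sub>R (\<i> *s e)" for c and e :: "'n cvec"
      proof -
        have "of_real (Re c) + of_real (Im c) * \<i> = c" by (simp add: complex_eq_iff)
        then have "c *s e = (of_real (Re c) + of_real (Im c) * \<i>) *s e" by (simp only:)
        then show ?thesis by (simp add: scaleR_vec_eq vec.scale_left_distrib)
      qed
      have "x = (\<Sum>e\<in>S. gh x e *s e)" by (rule onb_expand[OF S x])
      also have "\<dots> = (\<Sum>e\<in>S. Re (gh x e) *\<^sub>R e + Im (gh x e) *\<^sub>R (\<i> *s e))"
        by (intro sum.cong refl cs)
      finally have "x = (\<Sum>e\<in>S. Re (gh x e) *\<^sub>R e + Im (gh x e) *\<^sub>R (\<i> *s e))" .
      moreover have "\<dots> \<in> span (S \<union> (*s) \<i> ` S)"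
        by (intro span_sum span_add span_scale span_base) auto
      ultimately show "x \<in> span (S \<union> (*s) \<i> ` S)" by simp
    qed
  qed
  moreover have "ip x y = (if x = y then 1 else 0)" if xy: "x \<in> S \<union> (*s) \<i> ` S" "y \<in> S \<union> (*s) \<i> ` S" for x y
  proof -
    have m: "ip e e' = (if e = e' then 1 else 0)" "ip (\<i> *s e) (\<i> *s e') = (if \<i> *s e = \<i> *s e' then 1 else 0)"
      "ip e (\<i> *s e') = (if e = \<i> *s e' then 1 else 0)" "ip (\<i> *s e) e' = (if \<i> *s e = e' then 1 else 0)"
      if "e \<in> S" "e' \<in> S" for e e'
    proof -
      have ne: "e \<noteq> \<i> *s e'" "e' \<noteq> \<i> *s e" using disj that by blast+
      show "ip e e' = (if e = e' then 1 else 0)" "ip (\<i> *s e) (\<i> *s e') = (if \<i> *s e = \<i> *s e' then 1 else 0)"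
        "ip e (\<i> *s e') = (if e = \<i> *s e' then 1 else 0)" "ip (\<i> *s e) e' = (if \<i> *s e = e' then 1 else 0)"
        using o[OF that] ne ne(2)[symmetric] by (auto simp: ip_def)
    qed
    show ?thesis using xy m by auto
  qed
  ultimately show "rset V (S \<union> (*s) \<i> ` S)" using onb_finite[OF S] by (simp add: rset_def)
qed

text \<open>The vectors \<open>e\<close> and \<open>\<i> *s e\<close> form a real orthonormal basis.
  In such a sum, real parts of sesquilinear terms double and real parts of complex bilinear terms
  cancel.\<close>

lemma sum_onb_rset:
  assumes S: "onb V S" and V: "rset V F"
    and b: "\<And>x y z. b (x + y) z = b x z + b y z" "\<And>x y z. b z (x + y) = b z x + b z y"
    "\<And>r x y. b (r *\<^sub>R x) y = r * b x y" "\<And>r x y. b x (r *\<^sub>R y) = r * b x y"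
  shows "(\<Sum>f\<in>F. b f f) = (\<Sum>e\<in>S. b e e + b (\<i> *s e) (\<i> *s e) :: real)"
proof -
  have "(\<Sum>f\<in>F. b f f) = (\<Sum>f\<in>S \<union> (*s) \<i> ` S. b f f)"
    by (rule rset_indep[OF b V onb_rset(1)[OF S]])
  also have "\<dots> = (\<Sum>f\<in>S. b f f) + (\<Sum>f\<in>(*s) \<i> ` S. b f f)"
    using onb_rset(2)[OF S] onb_finite[OF S] by (intro sum.union_disjoint) auto
  also have "(\<Sum>f\<in>(*s) \<i> ` S. b f f) = (\<Sum>e\<in>S. b (\<i> *s e) (\<i> *s e))"
    using onb_rset(3)[OF S] by (simp add: sum.reindex)
  finally show ?thesis by (simp add: sum.distrib)
qed

lemma rset_some_ronb:
  assumes "vec.subspace V"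
  shows "rset V (set (some_ronb gh V))" "distinct (some_ronb gh V)"
proof -
  obtain S where S: "onb V S" using onb_exists assms by blast
  let ?F = "S \<union> (*s) \<i> ` S"
  have F: "rset V ?F" by (rule onb_rset(1)[OF S])
  obtain fs where fs: "set fs = ?F" "distinct fs" using finite_distinct_list[of ?F] F by (auto simp: rset_def)
  have "real_onb gh V fs"
    unfolding real_onb_def
  proof (intro conjI allI impI)
    show "set fs \<subseteq> V" using rset_in[OF F] fs by auto
    show "span (set fs) = V" using F fs by (simp add: rset_def)
    fix i j assume ij: "i < length fs" "j < length fs"
    then have "fs ! i \<in> ?F" "fs ! j \<in> ?F" using fs(1) nth_mem by blast+
    then have "ip (fs ! i) (fs ! j) = (if fs ! i = fs ! j then 1 else 0)" using F unfolding rset_def by blast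
    then show "Re (gh (fs ! i) (fs ! j)) = (if i = j then 1 else 0)"
      using fs(2) ij by (simp add: ip_def nth_eq_iff_index_eq)
  qed
  then have r: "real_onb gh V (some_ronb gh V)" unfolding some_ronb_def by (rule someI)
  have o: "ip (some_ronb gh V ! i) (some_ronb gh V ! j) = (if i = j then 1 else 0)"
    if "i < length (some_ronb gh V)" "j < length (some_ronb gh V)" for i j
    using r that unfolding real_onb_def ip_def by blast
  show d: "distinct (some_ronb gh V)"
    unfolding distinct_conv_nth using o by (metis zero_neq_one)
  show "rset V (set (some_ronb gh V))"
    unfolding rset_def
  proof (intro conjI ballI)
    show "span (set (some_ronb gh V)) = V" using r by (simp add: real_onb_def)
    fix x y assume "x \<in> set (some_ronb gh V)" "y \<in> set (some_ronb gh V)"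
    then obtain i j where "x = some_ronb gh V ! i" "i < length (some_ronb gh V)" "y = some_ronb gh V ! j" "j < length (some_ronb gh V)"
      by (auto simp: in_set_conv_nth)
    then show "ip x y = (if x = y then 1 else 0)" using o d by (simp add: nth_eq_iff_index_eq)
  qed simp
qed

end

section \<open>The Ricci tensor of left-invariant fields and the tensor \<open>K\<close>\<close>

context hermitian_lie begin

lemma br_scaleR_left: "br (r *\<^sub>R x) y = r *\<^sub>R br x y" and br_scaleR_right: "br x (r *\<^sub>R y) = r *\<^sub>R br x y"
  by (simp_all add: scaleR_vec_eq br_simps)

text \<open>Products of the terms of the Koszul formula match termwise only after symmetrisation in
  the two summation indices.\<close>

lemma sum_sym_cong:
  fixes T U :: "'a \<Rightarrow> 'a \<Rightarrow> real"
  assumes "\<And>a b. a \<in> F \<Longrightarrow> b \<in> F \<Longrightarrow> T a b + T b a = U a b + U b a"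
  shows "(\<Sum>a\<in>F. \<Sum>b\<in>F. T a b) = (\<Sum>a\<in>F. \<Sum>b\<in>F. U a b)"
proof -
  have d: "2 * (\<Sum>a\<in>F. \<Sum>b\<in>F. T a b) = (\<Sum>a\<in>F. \<Sum>b\<in>F. T a b + T b a)" for T :: "'a \<Rightarrow> 'a \<Rightarrow> real"
    unfolding sum.distrib using sum.swap[of T F F] by simp
  have "2 * (\<Sum>a\<in>F. \<Sum>b\<in>F. T a b) = 2 * (\<Sum>a\<in>F. \<Sum>b\<in>F. U a b)"
    unfolding d using assms by simp
  then show ?thesis by simp
qed

lemma ctr_br_bracket:
  assumes V: "lie_subalgebra br V" and x: "x \<in> V" "y \<in> V"
  shows "ctr gh V (br (br x y)) = 0"
proof -
  have sV: "vec.subspace V" and c: "\<And>x y. x \<in> V \<Longrightarrow> y \<in> V \<Longrightarrow> br x y \<in> V" using V by (auto simp: lie_subalgebra_def)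
  obtain S where S: "onb V S" using onb_exists sV by blast
  have e: "gh (br x (br y e)) e = (\<Sum>t\<in>S. gh (br y e) t * gh (br x t) e)" if "y \<in> V" "e \<in> S" for x y e
    using sesq_expand_left[OF sesq_lin[OF br_clin] S c[OF that(1) onb_in[OF S that(2)]]] .
  have "(\<Sum>e\<in>S. gh (br x (br y e)) e) = (\<Sum>e\<in>S. \<Sum>t\<in>S. gh (br y e) t * gh (br x t) e)"
    by (intro sum.cong refl e x)
  also have "\<dots> = (\<Sum>t\<in>S. \<Sum>e\<in>S. gh (br y e) t * gh (br x t) e)" by (rule sum.swap)
  also have "\<dots> = (\<Sum>t\<in>S. gh (br y (br x t)) t)"
    by (intro sum.cong refl) (simp add: e[OF x(1)] mult.commute)
  finally have "(\<Sum>e\<in>S. gh (br x (br y e)) e) = (\<Sum>t\<in>S. gh (br y (br x t)) t)" .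
  moreover have "br (br x y) e = br x (br y e) - br y (br x e)" for e using br_jacobi[of x y e] by simp
  ultimately show ?thesis unfolding ctr_onb[OF S br_clin] by (simp add: gh_diff_left sum_subtractf)
qed

text \<open>The vector dual to the trace form \<open>x \<mapsto> tr (ad x)\<close> on
  \<open>V\<close>, as \<open>gh_tvec\<close> confirms.\<close>

definition tvec :: "'n cvec set \<Rightarrow> 'n cvec" where
  "tvec V = (\<Sum>e\<in>set (some_ub gh V). cnj (ctr gh V (br e)) *s e)"

lemma clin_ctr: assumes "vec.subspace V"
  shows "ctr gh V (br (x + y)) = ctr gh V (br x) + ctr gh V (br y)" "ctr gh V (br (a *s x)) = a * ctr gh V (br x)"
  using some_ub(1)[OF assms] by (simp_all add: ctr_onb br_clin br_simps gh_add_left sum.distrib sum_distrib_left)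

lemma tvec_in: "vec.subspace V \<Longrightarrow> tvec V \<in> V"
  unfolding tvec_def by (intro vec.subspace_sum vec.subspace_scale) (auto intro: onb_in[OF some_ub(1)])

lemma gh_tvec: assumes V: "vec.subspace V" and x: "x \<in> V" shows "gh x (tvec V) = ctr gh V (br x)"
proof -
  note u = some_ub(1)[OF V]
  have s: "ctr gh V (br (\<Sum>i\<in>I. f i)) = (\<Sum>i\<in>I. ctr gh V (br (f i)))" for I and f :: "'n cvec \<Rightarrow> 'n cvec"
  proof (induction I rule: infinite_finite_induct)
    case (insert i I) then show ?case by (simp add: clin_ctr[OF V])
  qed (use clin_ctr(2)[OF V, of 0] in auto)
  have "ctr gh V (br x) = ctr gh V (br (\<Sum>e\<in>set (some_ub gh V). gh x e *s e))" using onb_expand[OF u x] by simp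
  also have "\<dots> = (\<Sum>e\<in>set (some_ub gh V). gh x e * ctr gh V (br e))" by (simp add: s clin_ctr[OF V])
  finally show ?thesis unfolding tvec_def gh_sum_right by (simp add: mult.commute)
qed

text \<open>The classical formula for a left-invariant metric: a norm term, a bracket term, the
  Killing form and the symmetrised \<open>ad\<close> of the trace vector. Each real sum is converted
  into a complex one over \<open>S\<close> by \<open>sum_onb_rset\<close>.\<close>

lemma ricci_formula:
  assumes V: "lie_subalgebra br V" and Y: "Y \<in> V" and Z: "Z \<in> V" and S: "onb V S"
  shows "ricci gh br V Y Z = Re (- (\<Sum>e\<in>S. gh (br Y e) (br Z e)) + (1/2) * (\<Sum>e\<in>S. \<Sum>e'\<in>S. gh Y (br e e') * gh (br e e') Z)
     - (\<Sum>e\<in>S. gh (br Y (br Z e)) e) - gh (br (tvec V) Y) Z - gh Y (br (tvec V) Z))"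
proof -
  have sV: "vec.subspace V" and cV: "\<And>x y. x \<in> V \<Longrightarrow> y \<in> V \<Longrightarrow> br x y \<in> V" using V by (auto simp: lie_subalgebra_def)
  define F where "F = set (some_ronb gh V)"
  have F: "rset V F" and dF: "distinct (some_ronb gh V)" using rset_some_ronb[OF sV] by (auto simp: F_def)
  note inF = rset_in[OF F]
  let ?L = "lc_conn gh br V"
  have Ldef: "?L x y = (\<Sum>f\<in>F. ((ip (br x y) f - ip (br y f) x + ip (br f x) y) / 2) *\<^sub>R f)" for x y
    using dF by (simp add: lc_conn_def F_def ip_def sum_list_distinct_conv_sum_set)
  have LV: "?L x y \<in> V" for x y
    unfolding Ldef scaleR_vec_eq using inF sV by (intro vec.subspace_sum vec.subspace_scale) auto
  have ipL: "ip (?L x y) z = (ip (br x y) z - ip (br y z) x + ip (br z x) y) / 2" if z: "z \<in> V" for x y z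
  proof -
    define c where "c z = (ip (br x y) z - ip (br y z) x + ip (br z x) y) / 2" for z
    have csum: "c (sum h I) = (\<Sum>i\<in>I. c (h i))" for h :: "'n cvec \<Rightarrow> 'n cvec" and I
      unfolding c_def ip_sum_left ip_sum_right br_simps
      by (simp only: sum_divide_distrib[symmetric] sum.distrib sum_subtractf)
    have csc: "c (r *\<^sub>R z) = r * c z" for r z by (simp add: c_def br_scaleR_left br_scaleR_right algebra_simps)
    have "c z = c (\<Sum>f\<in>F. ip z f *\<^sub>R f)" using rset_expand[OF F z] by (rule arg_cong)
    then have "c z = (\<Sum>f\<in>F. ip z f * c f)" by (simp only: csum csc)
    moreover have "ip (?L x y) z = (\<Sum>f\<in>F. c f * ip f z)" unfolding Ldef ip_sum_left c_def by simp
    ultimately show ?thesis by (simp add: c_def[symmetric] ip_commute[of z] mult.commute)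
  qed
  have eqV: "x = y" if "x \<in> V" "y \<in> V" "\<And>z. z \<in> V \<Longrightarrow> ip x z = ip y z" for x y
  proof -
    have "x = (\<Sum>f\<in>F. ip x f *\<^sub>R f)" by (rule rset_expand[OF F that(1)])
    also have "\<dots> = (\<Sum>f\<in>F. ip y f *\<^sub>R f)" using that(3) inF by (intro sum.cong refl) simp
    also have "\<dots> = y" by (rule rset_expand[OF F that(2), symmetric])
    finally show ?thesis .
  qed
  have skewL: "ip (?L x y) z = - ip y (?L x z)" if "y \<in> V" "z \<in> V" for x y z
  proof -
    have "ip (?L x z) y = (ip (br x z) y - ip (br z y) x + ip (br y x) z) / 2" by (rule ipL[OF that(1)])
    moreover have "br x z = - br z x" "br z y = - br y z" "br y x = - br x y" by (rule br_skew)+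
    ultimately show ?thesis unfolding ipL[OF that(2)] ip_commute[of y] by simp
  qed
  have tors: "?L Y f = ?L f Y + br Y f" if f: "f \<in> F" for f
  proof (rule eqV[OF LV])
    show "?L f Y + br Y f \<in> V" using LV cV[OF Y inF[OF f]] sV vec.subspace_add by blast
    fix z assume z: "z \<in> V"
    have "br f Y = - br Y f" "br z Y = - br Y z" "br z f = - br f z" by (rule br_skew)+
    then show "ip (?L Y f) z = ip (?L f Y + br Y f) z" unfolding ip_add_left ipL[OF z] by (simp add: field_simps)
  qed
  \<comment> \<open>The real trace of \<open>ad w\<close>, which is twice the real part of the
    complex one; the divergence of a left-invariant field \<open>w\<close> is
    \<open>- tau w\<close>.\<close>
  define tau where "tau w = (\<Sum>f\<in>F. ip (br w f) f)" for w
  have T1: "(\<Sum>f\<in>F. ip (?L f w) f) = - tau w" for w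
  proof -
    have "ip (?L f w) f = - ip (br w f) f" if f: "f \<in> F" for f
      unfolding ipL[OF inF[OF f]] by (subst br_skew[of f w]) (simp add: ip_def)
    then show ?thesis by (simp add: tau_def sum_negf)
  qed
  have expL: "ip u v = (\<Sum>b\<in>F. ip u b * ip v b)" if "v \<in> V" for u v
    by (subst rset_expand[OF F that]) (simp add: ip_sum_right mult.commute)
  \<comment> \<open>Matrix entries of \<open>ad Z\<close> and \<open>ad Y\<close>, and components of
    brackets along \<open>Z\<close> and \<open>Y\<close>. The Koszul formula writes the connection
    in these; \<open>ze\<close> and \<open>ye\<close> are antisymmetric in their indices.\<close>
  define z y ze ye where "z a b = ip (br Z a) b" and "y a b = ip (br Y a) b" and "ze a b = ip (br a b) Z" and "ye a b = ip (br a b) Y" for a b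
  have GZ: "ip (?L a Z) b = - (z a b + z b a + ze a b) / 2" if "b \<in> F" for a b
    unfolding ipL[OF inF[OF that]] z_def ze_def
    by (subst br_skew[of a Z], subst br_skew[of b a]) simp
  have GY: "ip (?L a Y) b = - (y a b + y b a + ye a b) / 2" if "b \<in> F" for a b
    unfolding ipL[OF inF[OF that]] y_def ye_def
    by (subst br_skew[of a Y], subst br_skew[of b a]) simp
  have ze: "ze b a = - ze a b" and ye: "ye b a = - ye a b" for a b
    unfolding ze_def ye_def by (subst br_skew, simp)+
  have "ricci gh br V Y Z = (\<Sum>f\<in>F. ip (?L f (?L Y Z) - ?L Y (?L f Z) - ?L (br f Y) Z) f)"
    using dF by (simp add: ricci_def riem_curv_def F_def ip_def sum_list_distinct_conv_sum_set)
  \<comment> \<open>Metric compatibility shifts the derivative along \<open>Y\<close> from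
    \<open>?L f Z\<close> to \<open>f\<close>, and vanishing torsion then trades it for a derivative
    of \<open>Y\<close> and a bracket.\<close>
  also have "\<dots> = (\<Sum>f\<in>F. ip (?L f (?L Y Z)) f) + (\<Sum>f\<in>F. ip (?L f Z) (?L f Y) + ip (?L f Z) (br Y f) + ip (?L (br Y f) Z) f)"
  proof -
    have "ip (?L f (?L Y Z) - ?L Y (?L f Z) - ?L (br f Y) Z) f
       = ip (?L f (?L Y Z)) f + (ip (?L f Z) (?L f Y) + ip (?L f Z) (br Y f) + ip (?L (br Y f) Z) f)" if f: "f \<in> F" for f
    proof -
      have "ip (?L Y (?L f Z)) f = - ip (?L f Z) (?L f Y + br Y f)"
        using skewL[OF LV inF[OF f]] tors[OF f] by simp
      moreover have "ip (?L (br f Y) Z) f = - ip (?L (br Y f) Z) f"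
        unfolding ipL[OF inF[OF f]] br_skew[of f Y] by (simp add: br_simps field_simps)
      ultimately show ?thesis by (simp add: ip_diff_left ip_add_right)
    qed
    then show ?thesis by (simp add: sum.distrib[symmetric])
  qed
  also have "(\<Sum>f\<in>F. ip (?L f Z) (?L f Y) + ip (?L f Z) (br Y f) + ip (?L (br Y f) Z) f)
     = (\<Sum>a\<in>F. \<Sum>b\<in>F. ip (?L a Z) b * ip (?L a Y) b + ip (?L a Z) b * y a b + y a b * ip (?L b Z) a)"
  proof (intro sum.cong refl)
    fix a assume a: "a \<in> F"
    have aV: "br Y a \<in> V" by (rule cV[OF Y inF[OF a]])
    have "ip (?L (br Y a) Z) a = (\<Sum>b\<in>F. y a b * ip (?L b Z) a)"
    proof -
      define c where "c x = (ip (br x Z) a - ip (br Z a) x + ip (br a x) Z) / 2" for x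
      have csum: "c (sum h I) = (\<Sum>i\<in>I. c (h i))" for h :: "'n cvec \<Rightarrow> 'n cvec" and I
        unfolding c_def ip_sum_left ip_sum_right br_simps
        by (simp only: sum_divide_distrib[symmetric] sum.distrib sum_subtractf)
      have csc: "c (r *\<^sub>R x) = r * c x" for r x by (simp add: c_def br_scaleR_left br_scaleR_right algebra_simps)
      have "c (br Y a) = c (\<Sum>f\<in>F. ip (br Y a) f *\<^sub>R f)" using rset_expand[OF F aV] by (rule arg_cong)
      then have "c (br Y a) = (\<Sum>f\<in>F. ip (br Y a) f * c f)" by (simp only: csum csc)
      then show ?thesis unfolding ipL[OF inF[OF a]] c_def y_def .
    qed
    moreover have "ip (?L a Z) (?L a Y) = (\<Sum>b\<in>F. ip (?L a Z) b * ip (?L a Y) b)" by (rule expL[OF LV])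
    moreover have "ip (?L a Z) (br Y a) = (\<Sum>b\<in>F. ip (?L a Z) b * y a b)" unfolding y_def by (rule expL[OF aV])
    ultimately show "ip (?L a Z) (?L a Y) + ip (?L a Z) (br Y a) + ip (?L (br Y a) Z) a
      = (\<Sum>b\<in>F. ip (?L a Z) b * ip (?L a Y) b + ip (?L a Z) b * y a b + y a b * ip (?L b Z) a)"
      by (simp add: sum.distrib)
  qed
  also have "\<dots> = (\<Sum>a\<in>F. \<Sum>b\<in>F. - (1/2) * (y a b * z a b) - (1/2) * (z a b * y b a) + (1/4) * (ye a b * ze a b))"
  proof (rule sum_sym_cong)
    fix a b assume a: "a \<in> F" and b: "b \<in> F"
    have zba: "ze b a = - ze a b" "ye b a = - ye a b" by (rule ze, rule ye)
    show "(ip (?L a Z) b * ip (?L a Y) b + ip (?L a Z) b * y a b + y a b * ip (?L b Z) a)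
        + (ip (?L b Z) a * ip (?L b Y) a + ip (?L b Z) a * y b a + y b a * ip (?L a Z) b)
      = (- (1/2) * (y a b * z a b) - (1/2) * (z a b * y b a) + (1/4) * (ye a b * ze a b))
        + (- (1/2) * (y b a * z b a) - (1/2) * (z b a * y a b) + (1/4) * (ye b a * ze b a))"
      unfolding GZ[OF a] GZ[OF b] GY[OF a] GY[OF b] zba by (simp add: field_simps)
  qed
  also have "\<dots> = - (1/2) * (\<Sum>a\<in>F. \<Sum>b\<in>F. y a b * z a b) - (1/2) * (\<Sum>a\<in>F. \<Sum>b\<in>F. z a b * y b a) + (1/4) * (\<Sum>a\<in>F. \<Sum>b\<in>F. ye a b * ze a b)"
    by (simp add: sum.distrib sum_subtractf sum_distrib_left sum_negf)
  also have "(\<Sum>a\<in>F. \<Sum>b\<in>F. y a b * z a b) = (\<Sum>a\<in>F. ip (br Y a) (br Z a))"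
    unfolding y_def z_def by (intro sum.cong refl expL[symmetric] cV Z inF)
  also have "(\<Sum>a\<in>F. \<Sum>b\<in>F. z a b * y b a) = (\<Sum>a\<in>F. ip (br Y (br Z a)) a)"
  proof (intro sum.cong refl)
    fix a assume a: "a \<in> F"
    have "br Y (br Z a) = (\<Sum>b\<in>F. ip (br Z a) b *\<^sub>R br Y b)"
      by (subst rset_expand[OF F cV[OF Z inF[OF a]]]) (simp only: br_simps br_scaleR_right)
    then show "(\<Sum>b\<in>F. z a b * y b a) = ip (br Y (br Z a)) a" unfolding z_def y_def by (simp add: ip_sum_left)
  qed
  also have "(\<Sum>a\<in>F. ip (br Y a) (br Z a)) = (\<Sum>e\<in>S. ip (br Y e) (br Z e) + ip (br Y (\<i> *s e)) (br Z (\<i> *s e)))"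
    by (rule sum_onb_rset[OF S F]) (simp_all add: br_simps br_scaleR_right ip_add_left ip_add_right)
  also have "\<dots> = 2 * Re (\<Sum>e\<in>S. gh (br Y e) (br Z e))"
    by (simp add: br_simps ip_def sum_distrib_left)
  also have "(\<Sum>a\<in>F. ip (br Y (br Z a)) a) = (\<Sum>e\<in>S. ip (br Y (br Z e)) e + ip (br Y (br Z (\<i> *s e))) (\<i> *s e))"
    by (rule sum_onb_rset[OF S F]) (simp_all add: br_simps br_scaleR_right ip_add_left ip_add_right)
  also have "\<dots> = 2 * Re (\<Sum>e\<in>S. gh (br Y (br Z e)) e)"
    by (simp add: br_simps ip_def sum_distrib_left)
  also have "(\<Sum>a\<in>F. \<Sum>b\<in>F. ye a b * ze a b) = 2 * Re (\<Sum>e\<in>S. \<Sum>e'\<in>S. gh Y (br e e') * gh (br e e') Z)"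
  proof -
    have inner: "(\<Sum>b\<in>F. ip (br a b) Y * ip (br a b) Z) = (\<Sum>e\<in>S. ip (br a e) Y * ip (br a e) Z + ip (br a (\<i> *s e)) Y * ip (br a (\<i> *s e)) Z)" for a
      by (rule sum_onb_rset[OF S F]) (simp_all add: br_simps br_scaleR_right ip_add_left algebra_simps)
    define q where "q a a' = (\<Sum>e\<in>S. ip (br a e) Y * ip (br a' e) Z + ip (br a (\<i> *s e)) Y * ip (br a' (\<i> *s e)) Z)" for a a'
    have ir: "\<i> *s (r *\<^sub>R v) = r *\<^sub>R (\<i> *s v)" for r :: real and v :: "'n cvec"
      by (simp add: vec_eq_iff scaleR_conv_of_real[where 'a=complex])
    have "(\<Sum>a\<in>F. \<Sum>b\<in>F. ye a b * ze a b) = (\<Sum>a\<in>F. q a a)" unfolding ye_def ze_def inner q_def ..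
    also have "\<dots> = (\<Sum>e\<in>S. q e e + q (\<i> *s e) (\<i> *s e))"
      by (rule sum_onb_rset[OF S F, of q])
        (simp_all add: q_def br_simps br_scaleR_left ir ip_add_left sum.distrib sum_distrib_left algebra_simps)
    also have "\<dots> = (\<Sum>e\<in>S. \<Sum>e'\<in>S. 2 * Re (gh Y (br e e') * gh (br e e') Z))"
    proof (intro sum.cong refl)
      fix e
      have "ip v Y * ip v Z + ip (\<i> *s v) Y * ip (\<i> *s v) Z + (ip (\<i> *s v) Y * ip (\<i> *s v) Z + ip (\<i> *s (\<i> *s v)) Y * ip (\<i> *s (\<i> *s v)) Z)
         = 2 * Re (gh Y v * gh v Z)" for v
        unfolding smult_i_i gh_cnj[of Y v] by (simp add: ip_def)
      then show "q e e + q (\<i> *s e) (\<i> *s e) = (\<Sum>e'\<in>S. 2 * Re (gh Y (br e e') * gh (br e e') Z))"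
        unfolding q_def br_simps sum.distrib[symmetric] by simp
    qed
    finally show ?thesis by (simp add: sum_distrib_left)
  qed
  also have "(\<Sum>f\<in>F. ip (?L f (?L Y Z)) f) = - (ip (br (tvec V) Y) Z + ip (br (tvec V) Z) Y)"
  proof -
    have "tau w = 2 * ip w (tvec V)" if w: "w \<in> V" for w
    proof -
      have "tau w = (\<Sum>e\<in>S. ip (br w e) e + ip (br w (\<i> *s e)) (\<i> *s e))"
        unfolding tau_def by (rule sum_onb_rset[OF S F]) (simp_all add: br_simps br_scaleR_right ip_add_left ip_add_right)
      also have "\<dots> = 2 * Re (ctr gh V (br w))"
        by (simp add: ctr_onb[OF S br_clin] br_simps ip_def sum_distrib_left)
      finally show ?thesis using gh_tvec[OF sV w] by (simp add: ip_def)
    qed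
    then have "tau (?L Y Z) = ip (br Y Z) (tvec V) - ip (br Z (tvec V)) Y + ip (br (tvec V) Y) Z"
      using LV[of Y Z] ipL[OF tvec_in[OF sV], of Y Z] by simp
    also have "ip (br Y Z) (tvec V) = 0"
      using gh_tvec[OF sV cV[OF Y Z]] ctr_br_bracket[OF V Y Z] by (simp add: ip_def)
    also have "br Z (tvec V) = - br (tvec V) Z" by (rule br_skew)
    finally show ?thesis unfolding T1 by simp
  qed
  also have "ip (br (tvec V) Z) Y = ip Y (br (tvec V) Z)" by (rule ip_commute)
  finally show ?thesis by (simp add: ip_def)
qed

text \<open>Write the Ricci tensor as the real part of \<open>h - b\<close>, with \<open>h\<close>
  sesquilinear and \<open>b\<close>, the Killing form, complex bilinear. Taking the (1,1)-part
  cancels \<open>b\<close> and leaves \<open>h / 2\<close>.\<close>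

lemma hcf_K_formula:
  assumes V: "lie_subalgebra br V" and X: "X \<in> V" and Y: "Y \<in> V" and S: "onb V S"
  shows "hcf_K gh br V X Y = - (1/2) * (\<Sum>e\<in>S. gh (br X e) (br Y e))
     + (1/4) * (\<Sum>e\<in>S. \<Sum>e'\<in>S. gh X (br e e') * gh (br e e') Y)
     - (1/2) * (gh (br (tvec V) X) Y + gh X (br (tvec V) Y))
     + (1/2) * (ctr gh V (br X) * cnj (ctr gh V (br Y)))"
proof -
  have sV: "vec.subspace V" using V by (simp add: lie_subalgebra_def)
  define h where "h X Y = - (\<Sum>e\<in>S. gh (br X e) (br Y e)) + (1/2) * (\<Sum>e\<in>S. \<Sum>e'\<in>S. gh X (br e e') * gh (br e e') Y)
     - gh (br (tvec V) X) Y - gh X (br (tvec V) Y)" for X Y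
  define b where "b X Y = (\<Sum>e\<in>S. gh (br X (br Y e)) e)" for X Y
  have r: "ricci gh br V X Y = Re (h X Y - b X Y)" if "X \<in> V" "Y \<in> V" for X Y
    unfolding ricci_formula[OF V that S] h_def b_def by (rule arg_cong[where f = Re]) simp
  have h: "h (\<i> *s X) Y = \<i> * h X Y" "h X (\<i> *s Y) = - \<i> * h X Y" for X Y
    by (simp_all add: h_def br_simps sum_distrib_left algebra_simps sum_negf)
  have b: "b (\<i> *s X) Y = \<i> * b X Y" "b X (\<i> *s Y) = \<i> * b X Y" for X Y
    by (simp_all add: b_def br_simps sum_distrib_left)
  have i: "\<i> *s X \<in> V" "\<i> *s Y \<in> V" using X Y vec.subspace_scale[OF sV] by auto
  have "ric11 gh br V X Y = h X Y / 2"
    unfolding ric11_def r[OF X Y] r[OF i] r[OF X i(2)] r[OF i(1) Y] h b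
    by (simp add: complex_eq_iff)
  moreover have "(- A + (1/2) * B - C - D) / 2 + E / 2 = - (1/2) * A + (1/4) * B - (1/2) * (C + D) + (1/2) * E"
    for A B C D E :: complex by (simp add: field_simps)
  ultimately show ?thesis unfolding hcf_K_def h_def by (simp only:)
qed

end

section \<open>Nilpotent ideals\<close>

context hermitian_lie begin

definition ad_nilp :: "'n cvec \<Rightarrow> bool" where
  "ad_nilp x \<longleftrightarrow> (\<exists>N. \<forall>v. (br x ^^ N) v = 0)"

text \<open>Cartan's trick: the map acting on the generalized \<open>z\<close>-eigenspace of \<open>ad x\<close> as the conjugate
  of \<open>z\<close> is again a derivation, and the trace of its product with \<open>ad x\<close> is the sum of the squared moduli of
  the eigenvalues.\<close>

lemma ad_nilp_if_trace_zero:
  assumes tr0: "\<And>y. clin y \<Longrightarrow> (\<And>u v. y (br u v) = br (y u) v + br u (y v)) \<Longrightarrow> (\<Sum>k\<in>bas. gh (br x (y k)) k) = 0"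
  shows "ad_nilp x"
proof -
  let ?D = "br x"
  define m where "m = CARD('n)"
  have "\<exists>v :: 'n \<Rightarrow> 'n cvec. vec.span (range v) = UNIV"
  proof -
    have "finite (cart_basis :: 'n cvec set)" "card (UNIV :: 'n set) = card (cart_basis :: 'n cvec set)"
      by (simp_all add: finite_cart_basis card_cart_basis)
    then obtain v where v: "bij_betw v (UNIV :: 'n set) (cart_basis :: 'n cvec set)"
      using finite_same_card_bij[OF finite] by blast
    then have "vec.span (range v) = UNIV" by (simp add: bij_betw_def)
    then show ?thesis by blast
  qed
  then obtain v :: "'n \<Rightarrow> 'n cvec" where v: "vec.span (range v) = UNIV" by blast
  \<comment> \<open>With all weights zero the filtration is trivial, and
    \<open>schur_upto_exists\<close> becomes ordinary Schur triangularisation.\<close>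
  have Fv: "Fil v (\<lambda>_. 0) UNIV s = (if s \<le> 0 then UNIV else {0})" for s
    using v by (simp add: Fil_def full_SetCompr_eq)
  have inv: "?D z \<in> Fil v (\<lambda>_. 0) UNIV s" if "z \<in> Fil v (\<lambda>_. 0) UNIV s" for z s
    using that by (cases "s \<le> 0") (simp_all add: Fv br_simps)
  have "m \<le> CARD('n)" by (simp add: m_def)
  from schur_upto_exists[OF br_clin finite v inv this]
  obtain e lam ws where sch: "schur_upto ?D (Fil v (\<lambda>_. 0) UNIV) m e lam ws" by blast
  note S = schur_uptoD[OF sch] and ons_e = schur_upto_ons(1)[OF sch] and inj_e = schur_upto_ons(2)[OF sch]
  have cardE: "card (e ` {..<m}) = CARD('n)" using inj_e by (simp add: card_image m_def)
  have spE: "vec.span (e ` {..<m}) = UNIV"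
  proof -
    have "vec.dim (UNIV :: 'n cvec set) \<le> card (e ` {..<m})" by (simp add: cardE vec.dim_UNIV card_cart_basis)
    then show ?thesis using vec.card_ge_dim_independent[of "e ` {..<m}" UNIV] ons_independent[OF ons_e] by auto
  qed
  have onbE: "onb UNIV (e ` {..<m})" using ons_e spE by (simp add: onb_def)
  obtain vv where vv: "\<forall>k<m. vv k - e k \<in> vec.span (e ` {..<k})"
    "\<forall>k<m. ?D (vv k) - lam k *s vv k \<in> vec.span {vv j |j. j < k \<and> lam j = lam k}"
    using generalized_eigenbasis[OF br_clin S(2)] by blast
  have spv: "vec.span (vv ` {..<m'}) = vec.span (e ` {..<m'})" if "m' \<le> m" for m'
    using span_triangular[of m vv e m'] vv(1) that by blast
  have spV: "vec.span (vv ` {..<m}) = UNIV" using spv[of m] spE by simp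
  have dimU: "vec.dim (UNIV :: 'n cvec set) = m" by (simp add: m_def vec.dim_UNIV card_cart_basis)
  have "vec.dim (UNIV :: 'n cvec set) \<le> card (vv ` {..<m})"
    using vec.dim_le_card[of UNIV "vv ` {..<m}"] spV by simp
  then have c: "card (vv ` {..<m}) = m"
    using card_image_le[of "{..<m}" vv] dimU by simp
  then have indv: "inj_on vv {..<m}" by (intro eq_card_imp_inj_on) auto
  have indv2: "vec.independent (vv ` {..<m})"
    using c spV dimU by (intro vec.card_le_dim_spanning[of _ UNIV]) auto
  let ?B = "vv ` {..<m}"
  define y where "y u = (\<Sum>k<m. (cnj (lam k) * vec.representation ?B u (vv k)) *s vv k)" for u
  have cy: "clin y"
  proof (rule clinI)
    show "y (a + b) = y a + y b" for a b
      using vec.representation_add[OF indv2, of b a] spV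
      by (simp add: y_def distrib_left vec.scale_left_distrib sum.distrib)
    show "y (a *s b) = a *s y b" for a b
      using vec.representation_scale[OF indv2, of b a] spV
      by (simp add: y_def vec.scale_sum_right mult.left_commute)
  qed
  have yv: "y (vv k) = cnj (lam k) *s vv k" if k: "k < m" for k
  proof -
    have r: "vec.representation ?B (vv k) (vv j) = (if j = k then 1 else 0)" if "j < m" for j
      using vec.representation_basis[OF indv2, of "vv k"] k that indv by (auto simp: inj_on_def)
    have "y (vv k) = (\<Sum>j<m. (if j = k then cnj (lam k) *s vv k else 0))"
      unfolding y_def by (intro sum.cong refl) (auto simp: r)
    then show ?thesis using k by simp
  qed
  have ysp: "y u = cnj z *s u" if "u \<in> vec.span {vv k |k. k < m \<and> lam k = z}" for u z
  proof -
    have "vec.subspace {u. y u = cnj z *s u}"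
      by (intro vec.subspaceI) (auto simp: clin_zero[OF cy] clin_add[OF cy] clin_scale[OF cy] vec.scale_right_distrib mult.commute)
    moreover have "{vv k |k. k < m \<and> lam k = z} \<subseteq> {u. y u = cnj z *s u}" using yv by auto
    ultimately show ?thesis using that vec.span_minimal by blast
  qed
  have yder: "y (br u w) = br (y u) w + br u (y w)" for u w
  proof -
    have "act y br u w = 0"
    proof (rule bilin_eq_zero[OF bilin_act[OF cy br_bilin] spV])
      fix i j assume "i \<in> ?B" "j \<in> ?B"
      then obtain k l where kl: "i = vv k" "k < m" "j = vv l" "l < m" by auto
      have "br i j \<in> vec.span {vv n |n. n < m \<and> lam n = lam k + lam l}"
        using eigenspace_mult[OF br_bilin br_clin br_jacobi vv(2) indv2 indv spV kl(2,4)] kl by simp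
      then show "act y br i j = 0"
        unfolding act_def using ysp[of "br i j"] yv kl by (simp add: br_simps vec.scale_left_distrib)
    qed
    then show ?thesis by (simp add: act_def algebra_simps)
  qed
  have ylow: "y u \<in> vec.span (e ` {..<k})" if "k \<le> m" "u \<in> vec.span (e ` {..<k})" for u k
  proof -
    have "vec.subspace {u. y u \<in> vec.span (vv ` {..<k})}"
      by (intro vec.subspaceI) (auto simp: clin_zero[OF cy] clin_add[OF cy] clin_scale[OF cy] vec.span_zero vec.span_add vec.span_scale)
    moreover have "vv ` {..<k} \<subseteq> {u. y u \<in> vec.span (vv ` {..<k})}"
    proof safe
      fix j assume "j < k"
      then have "y (vv j) = cnj (lam j) *s vv j" "vv j \<in> vec.span (vv ` {..<k})"
        using yv that(1) by (auto intro: vec.span_base)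
      then show "y (vv j) \<in> vec.span (vv ` {..<k})" by (simp only: vec.span_scale)
    qed
    ultimately have "vec.span (vv ` {..<k}) \<subseteq> {u. y u \<in> vec.span (vv ` {..<k})}" by (rule vec.span_minimal[rotated])
    then show ?thesis using spv[OF that(1)] that(2) by auto
  qed
  have Dlow: "?D u \<in> vec.span (e ` {..<k})" if "k \<le> m" "u \<in> vec.span (e ` {..<k})" for u k
    by (rule triangular_invariant[OF br_clin S(2) that(2)]) (use that(1) in auto)
  have perp: "gh u (e k) = 0" if "k < m" "u \<in> vec.span (e ` {..<k})" for u k
  proof -
    have "vec.subspace {u. gh u (e k) = 0}" by (intro vec.subspaceI) (auto simp: gh_simps)
    moreover have "e ` {..<k} \<subseteq> {u. gh u (e k) = 0}" using S(1)[OF _ that(1)] that(1) by auto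
    ultimately show ?thesis using that(2) vec.span_minimal by blast
  qed
  \<comment> \<open>The bases \<open>vv\<close> and \<open>e\<close> span the same flag, so
    \<open>y\<close> is triangular in \<open>e\<close> like \<open>ad x\<close>, and the diagonal of
    the product is the product of the diagonals.\<close>
  have diag: "gh (br x (y (e k))) (e k) = cnj (lam k) * lam k" if k: "k < m" for k
  proof -
    define r where "r = e k - vv k"
    have r: "r \<in> vec.span (e ` {..<k})" using vv(1) k vec.span_neg[of "vv k - e k"] by (simp add: r_def)
    have ek: "e k = vv k + r" by (simp add: r_def)
    have "y (e k) = cnj (lam k) *s vv k + y r" unfolding ek clin_add[OF cy] yv[OF k] ..
    also have "\<dots> = cnj (lam k) *s e k + (y r - cnj (lam k) *s r)" by (simp add: ek vec.scale_right_distrib)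
    finally have yk: "y (e k) = cnj (lam k) *s e k + (y r - cnj (lam k) *s r)" .
    have low: "y r - cnj (lam k) *s r \<in> vec.span (e ` {..<k})"
      using k by (intro vec.span_diff vec.span_scale r ylow) auto
    have 1: "gh (br x (y r - cnj (lam k) *s r)) (e k) = 0" using k by (intro perp Dlow low) auto
    have "gh (br x (e k) - lam k *s e k) (e k) = 0" by (rule perp[OF k S(2)[OF k]])
    then have 2: "gh (br x (e k)) (e k) = lam k" using S(1)[OF k k] by (simp add: gh_simps)
    show ?thesis
      unfolding yk bilin_add_right[OF br_bilin] bilin_scale_right[OF br_bilin] gh_add_left gh_scale_left 1 2 by simp
  qed
  have "(\<Sum>k\<in>bas. gh (br x (y k)) k) = (\<Sum>k\<in>e ` {..<m}. gh (br x (y k)) k)"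
    by (rule sesq_indep[OF sesq_lin[OF clin_compose[OF br_clin cy]] onb_bas onbE])
  also have "\<dots> = (\<Sum>k<m. gh (br x (y (e k))) (e k))" using inj_e by (simp add: sum.reindex)
  also have "\<dots> = (\<Sum>k<m. cnj (lam k) * lam k)" using diag by simp
  also have "\<dots> = of_real (\<Sum>k<m. (cmod (lam k))\<^sup>2)"
    unfolding of_real_sum complex_norm_square by (intro sum.cong refl mult.commute)
  finally have "of_real (\<Sum>k<m. (cmod (lam k))\<^sup>2) = (0::complex)" using tr0[OF cy yder] by simp
  then have "(\<Sum>k<m. (cmod (lam k))\<^sup>2) = 0" by (simp only: of_real_eq_0_iff)
  then have lam0: "lam k = 0" if "k < m" for k using that by (simp add: sum_nonneg_eq_0_iff)
  \<comment> \<open>With all eigenvalues zero the triangular form is strict, so \<open>ad x\<close>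
    moves the flag down by one.\<close>
  have step: "br x u \<in> vec.span (e ` {..<k})" if u: "u \<in> vec.span (e ` {..<Suc k})" and k: "k < m" for u k
  proof -
    have "vec.subspace {u. br x u \<in> vec.span (e ` {..<k})}"
      by (intro vec.subspaceI) (auto simp: br_simps vec.span_zero vec.span_add vec.span_scale)
    moreover have "e ` {..<Suc k} \<subseteq> {u. br x u \<in> vec.span (e ` {..<k})}"
    proof safe
      fix j assume j: "j < Suc k"
      then have "br x (e j) \<in> vec.span (e ` {..<j})" using S(2)[of j] lam0[of j] k by simp
      moreover have "e ` {..<j} \<subseteq> e ` {..<k}" using j by auto
      ultimately show "br x (e j) \<in> vec.span (e ` {..<k})" using vec.span_mono by blast
    qed
    ultimately show ?thesis using u vec.span_minimal by blast
  qed
  have "(br x ^^ j) u \<in> vec.span (e ` {..<m - j})" if "j \<le> m" for j u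
    using that
  proof (induction j)
    case 0 then show ?case using spE by simp
  next
    case (Suc j)
    then have "(br x ^^ j) u \<in> vec.span (e ` {..<Suc (m - Suc j)})" by (simp add: Suc_diff_Suc)
    then show ?case using step[of _ "m - Suc j"] Suc.prems by simp
  qed
  from this[of m] have "\<forall>u. (br x ^^ m) u = 0" by simp
  then show ?thesis unfolding ad_nilp_def by blast
qed

text \<open>Not the lower central series of \<open>K\<close>: the recursion starts from the whole
  algebra and applies \<open>ad\<close> of elements of \<open>K\<close> repeatedly. If it reaches
  zero, all long enough products of such maps vanish.\<close>

fun lcs :: "'n cvec set \<Rightarrow> nat \<Rightarrow> 'n cvec set" where
  "lcs K 0 = UNIV"
| "lcs K (Suc i) = vec.span {br k v |k v. k \<in> K \<and> v \<in> lcs K i}"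

lemma subspace_lcs [simp]: "vec.subspace (lcs K i)" by (cases i) auto

lemma lcs_br: "k \<in> K \<Longrightarrow> v \<in> lcs K i \<Longrightarrow> br k v \<in> lcs K (Suc i)"
  by (auto intro: vec.span_base)

lemma lcs_minimal:
  assumes "vec.subspace W" "\<And>k v. k \<in> K \<Longrightarrow> v \<in> lcs K i \<Longrightarrow> br k v \<in> W"
  shows "lcs K (Suc i) \<subseteq> W"
  unfolding lcs.simps by (rule vec.span_minimal) (use assms in auto)

lemma lcs_Suc_subset: "lcs K (Suc i) \<subseteq> lcs K i"
proof (induction i)
  case (Suc i)
  show ?case by (rule lcs_minimal) (use Suc lcs_br in auto)
qed simp

lemma lcs_antimono: "i \<le> j \<Longrightarrow> lcs K j \<subseteq> lcs K i"
  by (rule lift_Suc_antimono_le[of "lcs K"]) (rule lcs_Suc_subset)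

text \<open>By the Jacobi identity, \<open>ad x\<close> passes through a product of maps
  \<open>ad k\<close> up to replacing one factor \<open>k\<close> by \<open>br x k\<close>.\<close>

lemma lcs_normalized:
  assumes x: "\<And>k. k \<in> K \<Longrightarrow> br x k \<in> K" shows "v \<in> lcs K i \<Longrightarrow> br x v \<in> lcs K i"
proof (induction i arbitrary: v)
  case (Suc i)
  have "vec.subspace {v. br x v \<in> lcs K (Suc i)}"
    by (intro vec.subspaceI) (auto simp: br_simps vec.subspace_0[OF subspace_lcs] vec.subspace_add[OF subspace_lcs]
        vec.subspace_scale[OF subspace_lcs] simp del: lcs.simps)
  then have "lcs K (Suc i) \<subseteq> {v. br x v \<in> lcs K (Suc i)}"
  proof (rule lcs_minimal)
    fix k v assume kv: "k \<in> K" "v \<in> lcs K i"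
    have "br (br x k) v \<in> lcs K (Suc i)" by (rule lcs_br[OF x[OF kv(1)] kv(2)])
    moreover have "br k (br x v) \<in> lcs K (Suc i)" by (rule lcs_br[OF kv(1) Suc.IH[OF kv(2)]])
    ultimately show "br k v \<in> {v. br x v \<in> lcs K (Suc i)}"
      unfolding mem_Collect_eq br_jacobi[of x k v] by (rule vec.subspace_add[OF subspace_lcs])
  qed
  then show ?case using Suc.prems by blast
qed simp

text \<open>Elements of \<open>K\<close> lower \<open>lcs K i\<close> by a step, so modulo
  \<open>lcs K (Suc i)\<close> only powers of \<open>ad x\<close> survive. These vanish after
  \<open>p\<close> further steps, and the next piece is reached.\<close>

lemma lcs_insert:
  assumes K: "vec.subspace K" and xK: "\<And>k. k \<in> K \<Longrightarrow> br x k \<in> K" and N: "lcs K N = {0}" and p: "\<And>v. (br x ^^ p) v = 0"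
  shows "\<exists>M. lcs (vec.span (insert x K)) M = {0}"
proof -
  let ?K = "vec.span (insert x K)"
  have dec: "\<exists>k c. y = k + c *s x \<and> k \<in> K" if "y \<in> ?K" for y
  proof -
    have "\<exists>c. y - c *s x \<in> vec.span K" using that by (simp only: vec.span_breakdown_eq)
    then obtain c where "y - c *s x \<in> K" using K by (auto simp: vec.span_eq_iff[THEN iffD2])
    then show ?thesis by (intro exI[of _ "y - c *s x"] exI[of _ c]) simp
  qed
  have powV: "(br x ^^ j) v \<in> lcs K i" if "v \<in> lcs K i" for i j v
    using that by (induction j) (auto intro: lcs_normalized[OF xK])
  have "\<exists>n. lcs ?K n \<subseteq> lcs K i" for i
  proof (induction i)
    case (Suc i)
    then obtain n where n: "lcs ?K n \<subseteq> lcs K i" by blast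
    \<comment> \<open>The pieces interpolating between \<open>lcs K i\<close> and
      \<open>lcs K (Suc i)\<close>, by powers of \<open>ad x\<close>.\<close>
    define Z where "Z j = {(br x ^^ j) u + b |u b. u \<in> lcs K i \<and> b \<in> lcs K (Suc i)}" for j
    have cp: "clin (br x ^^ j)" for j by (rule clin_funpow[OF br_clin])
    have sZ: "vec.subspace (Z j)" for j
    proof (rule vec.subspaceI)
      show "0 \<in> Z j" unfolding Z_def
        using vec.subspace_0[OF subspace_lcs] clin_zero[OF cp] by (metis (mono_tags, lifting) add_0 mem_Collect_eq)
      show "a + b \<in> Z j" if ab: "a \<in> Z j" "b \<in> Z j" for a b
      proof -
        obtain u1 b1 where 1: "a = (br x ^^ j) u1 + b1" "u1 \<in> lcs K i" "b1 \<in> lcs K (Suc i)" using ab(1) unfolding Z_def by blast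
        obtain u2 b2 where 2: "b = (br x ^^ j) u2 + b2" "u2 \<in> lcs K i" "b2 \<in> lcs K (Suc i)" using ab(2) unfolding Z_def by blast
        have "a + b = (br x ^^ j) (u1 + u2) + (b1 + b2)" using 1 2 by (simp add: clin_add[OF cp])
        moreover have "u1 + u2 \<in> lcs K i" "b1 + b2 \<in> lcs K (Suc i)" using 1 2 vec.subspace_add[OF subspace_lcs] by blast+
        ultimately show ?thesis unfolding Z_def by blast
      qed
      show "c *s a \<in> Z j" if a: "a \<in> Z j" for a c
      proof -
        obtain u1 b1 where 1: "a = (br x ^^ j) u1 + b1" "u1 \<in> lcs K i" "b1 \<in> lcs K (Suc i)" using a unfolding Z_def by blast
        have "c *s a = (br x ^^ j) (c *s u1) + c *s b1" using 1 by (simp add: clin_scale[OF cp] vec.scale_right_distrib)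
        moreover have "c *s u1 \<in> lcs K i" "c *s b1 \<in> lcs K (Suc i)" using 1 vec.subspace_scale[OF subspace_lcs] by blast+
        ultimately show ?thesis unfolding Z_def by blast
      qed
    qed
    have "lcs ?K (n + j) \<subseteq> Z j" for j
    proof (induction j)
      case 0
      have "u \<in> Z 0" if "u \<in> lcs K i" for u
      proof -
        have "u = (br x ^^ 0) u + 0" by simp
        then show ?thesis unfolding Z_def using that vec.subspace_0[OF subspace_lcs] by blast
      qed
      then show ?case using n by auto
    next
      case (Suc j)
      have "lcs ?K (Suc (n + j)) \<subseteq> Z (Suc j)"
      proof (rule lcs_minimal[OF sZ])
        fix y v assume y: "y \<in> ?K" and v: "v \<in> lcs ?K (n + j)"
        obtain k c where k: "y = k + c *s x" "k \<in> K" using dec[OF y] by blast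
        have "v \<in> Z j" using v Suc by blast
        then obtain u b where u: "v = (br x ^^ j) u + b" "u \<in> lcs K i" "b \<in> lcs K (Suc i)" unfolding Z_def by blast
        have 1: "br k ((br x ^^ j) u) \<in> lcs K (Suc i)" by (rule lcs_br[OF k(2) powV[OF u(2)]])
        have 2: "br k b \<in> lcs K (Suc i)" using lcs_br[OF k(2) u(3)] lcs_Suc_subset by blast
        have 3: "br x b \<in> lcs K (Suc i)" by (rule lcs_normalized[OF xK u(3)])
        have "br y v = (br x ^^ Suc j) (c *s u) + (br k ((br x ^^ j) u) + br k b + c *s br x b)"
          unfolding k u by (simp add: br_simps clin_scale[OF cp] vec.scale_right_distrib)
        moreover have "br k ((br x ^^ j) u) + br k b + c *s br x b \<in> lcs K (Suc i)"
          by (intro vec.subspace_add vec.subspace_scale subspace_lcs 1 2 3)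
        moreover have "c *s u \<in> lcs K i" by (rule vec.subspace_scale[OF subspace_lcs u(2)])
        ultimately show "br y v \<in> Z (Suc j)" unfolding Z_def by blast
      qed
      then show ?case by simp
    qed
    from this[of p] have "lcs ?K (n + p) \<subseteq> lcs K (Suc i)" unfolding Z_def p by auto
    then show ?case by blast
  qed simp
  then obtain n where "lcs ?K n \<subseteq> {0}" using N by metis
  then have "lcs ?K n = {0}" using vec.subspace_0[OF subspace_lcs] by auto
  then show ?thesis by blast
qed

text \<open>Measure an element of \<open>I\<close> outside \<open>K\<close> by how far it shifts the
  series \<open>lcs K\<close>, and take one of maximal shift up to \<open>2 * N\<close>. Bracketing
  with \<open>k\<close> in \<open>K\<close> increases the shift, so the result falls into
  \<open>K\<close>.\<close>

lemma engel_step: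
  assumes K: "vec.subspace K" "K \<subseteq> I" "\<And>x y. x \<in> K \<Longrightarrow> y \<in> K \<Longrightarrow> br x y \<in> K" "lcs K N = {0}"
    and I: "\<And>x y. y \<in> I \<Longrightarrow> br x y \<in> I" and ne: "K \<noteq> I"
  obtains x where "x \<in> I" "x \<notin> K" "\<And>k. k \<in> K \<Longrightarrow> br x k \<in> K"
proof -
  \<comment> \<open>The shift is \<open>i - N\<close>, so that \<open>i = 0\<close> is automatic: up
    to depth \<open>N\<close> the truncated target is the whole space, and below it the source is
    zero. At \<open>i = 2 * N\<close> the element annihilates everything.\<close>
  define Q where "Q i x \<longleftrightarrow> x \<in> I \<and> x \<notin> K \<and> (\<forall>a. \<forall>v\<in>lcs K a. br x v \<in> lcs K (a + i - N))" for i x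
  have Q0: "\<exists>x. Q 0 x"
  proof -
    obtain x where x: "x \<in> I" "x \<notin> K" using K(2) ne by blast
    have "br x v \<in> lcs K (a - N)" if v: "v \<in> lcs K a" for a v
    proof (cases "a \<le> N")
      case False
      then have "lcs K a \<subseteq> {0}" using lcs_antimono[of N a K] K(4) by simp
      then have "v = 0" using v by auto
      then show ?thesis by (simp add: br_simps vec.subspace_0)
    qed simp
    then show ?thesis using x by (auto simp: Q_def)
  qed
  define i where "i = Max {i. i \<le> 2 * N \<and> (\<exists>x. Q i x)}"
  have "i \<in> {i. i \<le> 2 * N \<and> (\<exists>x. Q i x)}" unfolding i_def by (rule Max_in) (use Q0 in auto)
  then obtain x where i: "i \<le> 2 * N" and x: "Q i x" by auto
  have mx: "j \<le> i" if "j \<le> 2 * N" "Q j z" for j z unfolding i_def using that by (intro Max_ge) auto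
  have xI: "x \<in> I" "x \<notin> K" and xv: "\<And>a v. v \<in> lcs K a \<Longrightarrow> br x v \<in> lcs K (a + i - N)" using x by (auto simp: Q_def)
  have "br k x \<in> K" if k: "k \<in> K" for k
  proof (rule ccontr)
    assume n: "br k x \<notin> K"
    show False
    proof (cases "i = 2 * N")
      case True
      have "br x k \<in> lcs K (0 + i - N)" by (rule xv) simp
      then have "br x k = 0" using True K(4) by (simp add: mult_2)
      then have "br k x = 0" using br_skew[of k x] by simp
      then show False using n vec.subspace_0[OF K(1)] by simp
    next
      case False
      have "br (br k x) v \<in> lcs K (a + Suc i - N)" if v: "v \<in> lcs K a" for a v
      proof -
        have "br k (br x v) \<in> lcs K (Suc (a + i - N))" by (rule lcs_br[OF k xv[OF v]])
        then have 1: "br k (br x v) \<in> lcs K (a + Suc i - N)" by (rule subsetD[OF lcs_antimono, rotated]) simp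
        have 2: "br x (br k v) \<in> lcs K (a + Suc i - N)" using xv[OF lcs_br[OF k v]] by simp
        have "br (br k x) v = br k (br x v) - br x (br k v)" using br_jacobi[of k x v] by simp
        then show ?thesis using vec.subspace_diff[OF subspace_lcs 1 2] by simp
      qed
      then have "Q (Suc i) (br k x)" using n I[OF xI(1)] by (simp add: Q_def)
      then show False using mx[of "Suc i"] i False by auto
    qed
  qed
  then have "br x k \<in> K" if "k \<in> K" for k
    using that br_skew[of x k] vec.subspace_neg[OF K(1)] by metis
  then show ?thesis using that xI by blast
qed

text \<open>Take a subalgebra of \<open>I\<close> of maximal dimension among those with vanishing
  \<open>lcs\<close>. If it were proper, \<open>engel_step\<close> would give an element normalising
  it, and \<open>lcs_insert\<close> would enlarge it.\<close>

theorem engel: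
  assumes I: "vec.subspace I" "\<And>x y. y \<in> I \<Longrightarrow> br x y \<in> I" and nil: "\<And>x. x \<in> I \<Longrightarrow> ad_nilp x"
  shows "nilpotent_lie br I"
proof -
  define P where "P K \<longleftrightarrow> vec.subspace K \<and> K \<subseteq> I \<and> (\<forall>x\<in>K. \<forall>y\<in>K. br x y \<in> K) \<and> (\<exists>N. lcs K N = {0})" for K
  have l0: "lcs {0} 1 \<subseteq> {0}" unfolding One_nat_def by (rule lcs_minimal) (auto simp: br_simps)
  then have "lcs {0} 1 = {0}" using vec.subspace_0[OF subspace_lcs] by blast
  then have "\<exists>N. lcs {0} N = {0}" by blast
  then have "P {0}" using vec.subspace_0[OF I(1)] by (auto simp: P_def br_simps)
  have "vec.dim K \<le> CARD('n)" for K :: "'n cvec set"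
    using vec.dim_subset[OF subset_UNIV, of K] by (simp add: vec.dim_UNIV card_cart_basis)
  then have "\<forall>K. P K \<longrightarrow> vec.dim K < Suc CARD('n)" by (simp add: less_Suc_eq_le)
  from ex_has_greatest_nat[OF \<open>P {0}\<close> this]
  obtain K where K: "P K" and mx: "\<And>K'. P K' \<Longrightarrow> vec.dim K' \<le> vec.dim K" by blast
  obtain N where N: "lcs K N = {0}" using K by (auto simp: P_def)
  have sK: "vec.subspace K" "K \<subseteq> I" and Kc: "\<And>x y. x \<in> K \<Longrightarrow> y \<in> K \<Longrightarrow> br x y \<in> K" using K by (auto simp: P_def)
  have "K = I"
  proof (rule ccontr)
    assume "K \<noteq> I"
    then obtain x where x: "x \<in> I" "x \<notin> K" "\<And>k. k \<in> K \<Longrightarrow> br x k \<in> K"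
      using engel_step[OF sK Kc N I(2)] by blast
    obtain p where p: "\<And>v. (br x ^^ p) v = 0" using nil[OF x(1)] by (auto simp: ad_nilp_def)
    let ?K = "vec.span (insert x K)"
    have dec: "\<exists>k c. y = k + c *s x \<and> k \<in> K" if "y \<in> ?K" for y
    proof -
      have "\<exists>c. y - c *s x \<in> vec.span K" using that by (simp only: vec.span_breakdown_eq)
      then obtain c where "y - c *s x \<in> K" using sK(1) by (auto simp: vec.span_eq_iff[THEN iffD2])
      then show ?thesis by (intro exI[of _ "y - c *s x"] exI[of _ c]) simp
    qed
    have "br y z \<in> ?K" if yz: "y \<in> ?K" "z \<in> ?K" for y z
    proof -
      obtain k c where k: "y = k + c *s x" "k \<in> K" using dec[OF yz(1)] by blast
      obtain l d where l: "z = l + d *s x" "l \<in> K" using dec[OF yz(2)] by blast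
      have "br k x = - br x k" by (rule br_skew)
      then have "br y z = br k l + c *s br x l - d *s br x k" unfolding k l by (simp add: br_simps)
      also have "\<dots> \<in> K" by (intro vec.subspace_add vec.subspace_diff vec.subspace_scale sK(1) Kc x(3) k l)
      finally show ?thesis by (intro vec.span_base) simp
    qed
    moreover have "?K \<subseteq> I" using x(1) sK(2) by (intro vec.span_minimal I(1)) auto
    ultimately have "P ?K" using lcs_insert[OF sK(1) x(3) N p] by (auto simp: P_def)
    then have "vec.dim ?K \<le> vec.dim K" by (rule mx)
    moreover have "vec.dim K < vec.dim ?K"
    proof (rule vec.dim_psubset)
      have "K \<subset> ?K" using x(2) vec.span_base[of _ "insert x K"] by auto
      then show "vec.span K \<subset> vec.span ?K" using sK(1) by (simp add: vec.span_eq_iff[THEN iffD2] vec.span_span)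
    qed
    ultimately show False by simp
  qed
  then have N: "lcs I N = {0}" using N by simp
  have sub: "lower_central br I k \<subseteq> lcs I k" for k
  proof (induction k)
    case (Suc k)
    then show ?case unfolding lower_central.simps lcs.simps by (intro vec.span_mono) auto
  qed simp
  have "vec.subspace (lower_central br I N)" using I(1) by (cases N) auto
  then have "lower_central br I N = {0}" using sub[of N] N vec.subspace_0 by auto
  then show ?thesis unfolding nilpotent_lie_def by blast
qed

end

section \<open>Splitting off an ideal\<close>

context hermitian begin

lemma sesq_eq_on_onb:
  assumes "sesq b" "onb UNIV S" "\<And>k l. k \<in> S \<Longrightarrow> l \<in> S \<Longrightarrow> b k l = 0"
  shows "b x y = 0"
proof -
  have "b k y = 0" if "k \<in> S" for k
    using sesq_expand_right[OF assms(1,2), of y k] assms(3)[OF that] by simp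
  then show ?thesis using sesq_expand_left[OF assms(1,2), of x y] by simp
qed

lemma adj_adj: "clin f \<Longrightarrow> adj (adj f) x = f x"
  by (rule adjI[OF clin_adj]) (simp add: gh_adj')

lemma clin_zero_on_onb: assumes "clin f" "onb UNIV S" "\<And>k. k \<in> S \<Longrightarrow> f k = 0" shows "f x = 0"
proof -
  have "f x = f (\<Sum>k\<in>S. gh x k *s k)" using onb_expand[OF assms(2), of x] by simp
  also have "\<dots> = (\<Sum>k\<in>S. gh x k *s f k)" by (simp add: clin_sum[OF assms(1)] clin_scale[OF assms(1)])
  finally show ?thesis using assms(3) by simp
qed

definition perp :: "'n cvec set \<Rightarrow> 'n cvec set" where "perp V = {x. \<forall>y\<in>V. gh x y = 0}"

lemma perpD: "x \<in> perp V \<Longrightarrow> y \<in> V \<Longrightarrow> gh x y = 0" by (simp add: perp_def)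
lemma perpD': "x \<in> perp V \<Longrightarrow> y \<in> V \<Longrightarrow> gh y x = 0" using gh_cnj[of y x] by (simp add: perp_def)

lemma subspace_perp: "vec.subspace (perp V)"
  by (intro vec.subspaceI) (auto simp: perp_def gh_simps)

lemma diff_prj_perp: "vec.subspace V \<Longrightarrow> x - prj V x \<in> perp V"
  by (simp add: perp_def gh_diff_left gh_prj)

lemma onb_perp:
  assumes V: "onb V Sv" and W: "onb (perp V) Sw"
  shows "onb UNIV (Sv \<union> Sw)" "Sv \<inter> Sw = {}"
proof -
  have o: "gh x y = 0" "gh y x = 0" if "x \<in> Sv" "y \<in> Sw" for x y
    using perpD[OF onb_in[OF W that(2)] onb_in[OF V that(1)]] perpD'[OF onb_in[OF W that(2)] onb_in[OF V that(1)]] by auto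
  show disj: "Sv \<inter> Sw = {}"
  proof (rule ccontr)
    assume "Sv \<inter> Sw \<noteq> {}"
    then obtain x where x: "x \<in> Sv" "x \<in> Sw" by auto
    then show False using o[OF x] onb_gh[OF V x(1) x(1)] by simp
  qed
  have "ons (Sv \<union> Sw)"
    using o onb_gh[OF V] onb_gh[OF W] disj unfolding ons_def by (metis Un_iff disjoint_iff)
  moreover have "x \<in> vec.span (Sv \<union> Sw)" for x
  proof -
    have "prj V x \<in> vec.span Sv" using prj_in[OF onb_subspace[OF V], of x] V by (simp add: onb_def)
    moreover have "x - prj V x \<in> vec.span Sw" using diff_prj_perp[OF onb_subspace[OF V], of x] W by (simp add: onb_def)
    moreover have "x = prj V x + (x - prj V x)" by simp
    ultimately show ?thesis unfolding vec.span_Un by blast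
  qed
  ultimately show "onb UNIV (Sv \<union> Sw)" by (auto simp: onb_def)
qed

end

section \<open>The trace form, the modified soliton equation and nilpotent ideals\<close>

context hermitian_lie begin

abbreviation th :: "'n cvec \<Rightarrow> complex" where "th x \<equiv> ctr gh UNIV (br x)"

abbreviation H :: "'n cvec" where "H \<equiv> tvec UNIV"

lemma gh_H: "gh x H = th x" by (rule gh_tvec) auto
lemma gh_H': "gh H x = cnj (th x)" using gh_H[of x] gh_cnj[of H x] by simp

lemma subalgebra_UNIV: "lie_subalgebra br UNIV" by (simp add: lie_subalgebra_def)
lemma th_bracket: "th (br x y) = 0" by (rule ctr_br_bracket[OF subalgebra_UNIV]) auto

text \<open>\<open>ad (D x)\<close> is the commutator of \<open>D\<close> and
  \<open>ad x\<close>.\<close>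

lemma th_derivation:
  assumes D: "clin D" "\<And>x y. D (br x y) = br (D x) y + br x (D y)"
  shows "th (D x) = 0"
proof -
  have "br (D x) k = D (br x k) - br x (D k)" for k using D(2)[of x k] by simp
  then have "(\<Sum>k\<in>bas. gh (br (D x) k) k) = (\<Sum>k\<in>bas. gh (D (br x k)) k) - (\<Sum>k\<in>bas. gh (br x (D k)) k)"
    by (simp add: gh_diff_left sum_subtractf)
  also have "\<dots> = 0" using trace_comm[OF D(1) br_clin onb_bas, of x] by simp
  finally show ?thesis by (simp add: ctr_onb[OF onb_bas br_clin])
qed

text \<open>The tensor \<open>mom br + \<onehalf> \<theta> \<otimes> \<theta>\<close> differs from \<open>K\<close> by the symmetric part of the
  inner derivation \<open>ad H\<close>, which a semi-algebraic soliton can absorb into \<open>D\<close>.\<close>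

lemma semi_alg_soliton_iff:
  "semi_alg_soliton gh br UNIV c \<longleftrightarrow>
    (\<exists>D. clin D \<and> (\<forall>x y. D (br x y) = br (D x) y + br x (D y)) \<and>
      (\<forall>x y. mom br x y + (1/2) * (th x * cnj (th y)) = of_real c * gh x y + (1/2) * (gh (D x) y + gh x (D y))))"
    (is "?L \<longleftrightarrow> ?R")
proof -
  have K: "hcf_K gh br UNIV x y = mom br x y - (1/2) * (gh (br H x) y + gh x (br H y)) + (1/2) * (th x * cnj (th y))" for x y
    using hcf_K_formula[OF subalgebra_UNIV _ _ onb_bas, of x y] by (simp add: mom_def)
  have der: "is_derivation br UNIV D \<longleftrightarrow> clin D \<and> (\<forall>x y. D (br x y) = br (D x) y + br x (D y))" for D
    by (auto simp: is_derivation_def lin_on_def)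
  show ?thesis
  proof
    assume ?L
    then obtain D where D: "clin D" "\<And>x y. D (br x y) = br (D x) y + br x (D y)"
      and e: "\<And>x y. hcf_K gh br UNIV x y = of_real c * gh x y + (gh (D x) y + gh (adj D x) y) / 2"
      unfolding semi_alg_soliton_def der by blast
    have "mom br x y + (1/2) * (th x * cnj (th y)) = of_real c * gh x y + (1/2) * (gh (D x + br H x) y + gh x (D y + br H y))" for x y
      using e[of x y] by (simp add: K gh_adj[OF D(1)] gh_add_left gh_add_right field_simps)
    moreover have "clin (\<lambda>x. D x + br H x)" by (intro clin_plus D br_clin)
    moreover have "D (br x y) + br H (br x y) = br (D x + br H x) y + br x (D y + br H y)" for x y
      by (simp add: D(2) br_jacobi[of H x y] br_simps)
    ultimately show ?R by blast
  next
    assume ?R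
    then obtain D where D: "clin D" "\<And>x y. D (br x y) = br (D x) y + br x (D y)"
      and e: "\<And>x y. mom br x y + (1/2) * (th x * cnj (th y)) = of_real c * gh x y + (1/2) * (gh (D x) y + gh x (D y))"
      by blast
    define D' where "D' x = D x - br H x" for x
    have c': "clin D'" unfolding D'_def by (intro clin_sub D br_clin)
    have "D' (br x y) = br (D' x) y + br x (D' y)" for x y
      by (simp add: D'_def D(2) br_jacobi[of H x y] br_simps)
    then have "is_derivation br UNIV D'" using c' der by blast
    moreover have "hcf_K gh br UNIV x y = of_real c * gh x y + (gh (D' x) y + gh (adj D' x) y) / 2" for x y
      using e[of x y] by (simp add: K gh_adj[OF c'] D'_def gh_diff_left gh_diff_right field_simps)
    ultimately show ?L unfolding semi_alg_soliton_def by blast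
  qed
qed

text \<open>On an abelian ideal the negative term only involves brackets of an element of
  \<open>S\<close> with one of \<open>T - S\<close>, and these lie in the ideal. The positive term
  contains each of them in both orders, besides the brackets within \<open>T - S\<close>; with the
  coefficients \<open>1/2\<close> and \<open>1/4\<close> it outweighs the negative one.\<close>

lemma abelian_ideal_mom_nonneg:
  assumes V: "vec.subspace V" "\<And>x y. y \<in> V \<Longrightarrow> br x y \<in> V" "\<And>x y. x \<in> V \<Longrightarrow> y \<in> V \<Longrightarrow> br x y = 0"
    and S: "onb V S"
  shows "0 \<le> (\<Sum>z\<in>S. Re (mom br z z))"
proof -
  obtain T where T: "S \<subseteq> T" "onb UNIV T" using onb_extend[OF S subset_UNIV vec.subspace_UNIV] by blast
  note fS = onb_finite[OF S] and fT = onb_finite[OF T(2)]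
  define q where "q x y z = (cmod (gh (br x y) z))\<^sup>2" for x y z
  have q0: "q x y z \<ge> 0" for x y z by (simp add: q_def)
  have Re1: "Re (gh x x) = (\<Sum>z\<in>S. (cmod (gh x z))\<^sup>2)" if "x \<in> V" for x
    by (subst norm_expand[OF S that]) simp
  have m: "Re (mom br z z) = - (1/2) * (\<Sum>e\<in>T. Re (gh (br z e) (br z e))) + (1/4) * (\<Sum>e\<in>T. \<Sum>e'\<in>T. q e e' z)" for z
  proof -
    have "gh z v * gh v z = of_real ((cmod (gh v z))\<^sup>2)" for v using gh_mult_cnj[of v z] by (simp add: mult.commute)
    then show ?thesis unfolding mom_onb[OF br_bilin T(2)] q_def by simp
  qed
  have "(\<Sum>z\<in>S. \<Sum>e\<in>T. Re (gh (br z e) (br z e))) = (\<Sum>z\<in>S. \<Sum>e\<in>T - S. \<Sum>z'\<in>S. q z e z')"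
  proof (rule sum.cong[OF refl])
    fix z assume z: "z \<in> S"
    have zV: "z \<in> V" by (rule onb_in[OF S z])
    have "(\<Sum>e\<in>T. Re (gh (br z e) (br z e))) = (\<Sum>e\<in>T - S. Re (gh (br z e) (br z e)))"
      using fT T(1) V(3)[OF zV onb_in[OF S]] by (intro sum.mono_neutral_right) auto
    also have "\<dots> = (\<Sum>e\<in>T - S. \<Sum>z'\<in>S. q z e z')"
    proof (rule sum.cong[OF refl])
      fix e
      have "br z e = - br e z" by (rule br_skew)
      then have "br z e \<in> V" using V(2)[OF zV, of e] vec.subspace_neg[OF V(1)] by simp
      then show "Re (gh (br z e) (br z e)) = (\<Sum>z'\<in>S. q z e z')" unfolding q_def by (rule Re1)
    qed
    finally show "(\<Sum>e\<in>T. Re (gh (br z e) (br z e))) = (\<Sum>e\<in>T - S. \<Sum>z'\<in>S. q z e z')" .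
  qed
  also have "\<dots> = (\<Sum>z\<in>S. \<Sum>z'\<in>S. \<Sum>e\<in>T - S. q z e z')" by (intro sum.cong refl sum.swap)
  also have "\<dots> = (\<Sum>z'\<in>S. \<Sum>z\<in>S. \<Sum>e\<in>T - S. q z e z')" by (rule sum.swap)
  finally have 1: "(\<Sum>z\<in>S. \<Sum>e\<in>T. Re (gh (br z e) (br z e))) = (\<Sum>z\<in>S. \<Sum>a\<in>S. \<Sum>e\<in>T - S. q a e z)" .
  have qs: "q x y z = q y x z" for x y z unfolding q_def by (subst br_skew) simp
  have 2: "2 * (\<Sum>a\<in>S. \<Sum>e\<in>T - S. q a e z) \<le> (\<Sum>e\<in>T. \<Sum>e'\<in>T. q e e' z)" for z
  proof -
    have "(\<Sum>e\<in>T. \<Sum>e'\<in>T. q e e' z) = (\<Sum>e\<in>T - S. \<Sum>e'\<in>T. q e e' z) + (\<Sum>e\<in>S. \<Sum>e'\<in>T. q e e' z)"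
      by (rule sum.subset_diff[OF T(1) fT])
    moreover have "(\<Sum>e\<in>S. \<Sum>e'\<in>T. q e e' z) \<ge> (\<Sum>e\<in>S. \<Sum>e'\<in>T - S. q e e' z)"
      by (intro sum_mono sum_mono2 fT q0) auto
    moreover have "(\<Sum>e\<in>T - S. \<Sum>e'\<in>T. q e e' z) \<ge> (\<Sum>e\<in>T - S. \<Sum>e'\<in>S. q e e' z)"
      using T(1) by (intro sum_mono sum_mono2 fT q0)
    moreover have "(\<Sum>e\<in>T - S. \<Sum>e'\<in>S. q e e' z) = (\<Sum>a\<in>S. \<Sum>e\<in>T - S. q a e z)"
      by (subst sum.swap) (simp only: qs)
    ultimately show ?thesis by linarith
  qed
  have "(\<Sum>z\<in>S. Re (mom br z z)) = - (1/2) * (\<Sum>z\<in>S. \<Sum>a\<in>S. \<Sum>e\<in>T - S. q a e z) + (1/4) * (\<Sum>z\<in>S. \<Sum>e\<in>T. \<Sum>e'\<in>T. q e e' z)"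
    unfolding m 1[symmetric] by (simp add: sum.distrib sum_distrib_left sum_negf sum_subtractf)
  moreover have "2 * (\<Sum>z\<in>S. \<Sum>a\<in>S. \<Sum>e\<in>T - S. q a e z) \<le> (\<Sum>z\<in>S. \<Sum>e\<in>T. \<Sum>e'\<in>T. q e e' z)"
    unfolding sum_distrib_left[of 2] by (intro sum_mono) (use 2 in \<open>simp add: sum_distrib_left\<close>)
  ultimately show ?thesis by linarith
qed

lemma lower_central_ideal:
  assumes N: "vec.subspace N" "\<And>x y. y \<in> N \<Longrightarrow> br x y \<in> N"
  shows "vec.subspace (lower_central br N k) \<and> (\<forall>x. \<forall>y\<in>lower_central br N k. br x y \<in> lower_central br N k)
    \<and> lower_central br N k \<subseteq> N \<and> lower_central br N (Suc k) \<subseteq> lower_central br N k"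
proof (induction k)
  case 0
  have "{br x y |x y. x \<in> N \<and> y \<in> N} \<subseteq> N" using N(2) by blast
  then have "lower_central br N (Suc 0) \<subseteq> N" using vec.span_minimal[OF _ N(1)] by simp
  then show ?case using N by auto
next
  case (Suc k)
  let ?L = "lower_central br N"
  have sub: "vec.subspace (?L (Suc k))" by simp
  have id: "br x y \<in> ?L (Suc k)" if "y \<in> ?L (Suc k)" for x y
  proof -
    have s: "vec.subspace {y. br x y \<in> ?L (Suc k)}"
      by (intro vec.subspaceI) (auto simp: br_simps vec.span_zero vec.span_add vec.span_scale)
    have "{br a b |a b. a \<in> N \<and> b \<in> ?L k} \<subseteq> {y. br x y \<in> ?L (Suc k)}"
    proof safe
      fix a b assume a: "a \<in> N" and b: "b \<in> ?L k"
      have "br (br x a) b \<in> {br a b |a b. a \<in> N \<and> b \<in> ?L k}" "br a (br x b) \<in> {br a b |a b. a \<in> N \<and> b \<in> ?L k}"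
        using a b N(2)[OF a] Suc by blast+
      then have "br (br x a) b \<in> ?L (Suc k)" "br a (br x b) \<in> ?L (Suc k)"
        unfolding lower_central.simps by (auto intro: vec.span_base)
      then show "br x (br a b) \<in> ?L (Suc k)" unfolding br_jacobi[of x a b] by (rule vec.subspace_add[OF sub])
    qed
    then have "?L (Suc k) \<subseteq> {y. br x y \<in> ?L (Suc k)}"
      unfolding lower_central.simps(2)[of br N k] using s by (intro vec.span_minimal) (simp_all only: lower_central.simps)
    then show ?thesis using that by blast
  qed
  have sub2: "?L (Suc k) \<subseteq> N" using Suc by blast
  have "{br a b |a b. a \<in> N \<and> b \<in> ?L (Suc k)} \<subseteq> ?L (Suc k)" using id by blast
  then have "?L (Suc (Suc k)) \<subseteq> ?L (Suc k)" unfolding lower_central.simps(2)[of br N "Suc k"] by (rule vec.span_minimal[OF _ sub])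
  then show ?case using sub sub2 id by blast
qed

lemma lower_central_br: "x \<in> N \<Longrightarrow> y \<in> lower_central br N k \<Longrightarrow> br x y \<in> lower_central br N (Suc k)"
  by (auto intro: vec.span_base)

text \<open>\<open>f\<close> keeps each term of the lower central series and \<open>ad x\<close>
  lowers it, so the composite is strictly triangular.\<close>

lemma nilpotent_trace_zero:
  assumes N: "vec.subspace N" "\<And>x y. y \<in> N \<Longrightarrow> br x y \<in> N" "nilpotent_lie br N"
    and f: "clin f" "\<And>k x. x \<in> lower_central br N k \<Longrightarrow> f x \<in> lower_central br N k" and x: "x \<in> N"
  shows "ctr gh N (\<lambda>y. br x (f y)) = 0"
proof -
  obtain K where K: "lower_central br N K = {0}" using N(3) by (auto simp: nilpotent_lie_def)
  have "ctr gh (lower_central br N 0) (\<lambda>y. br x (f y)) = 0"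
    by (rule trace_strict_zero[where W = "lower_central br N", OF _ _ K clin_compose[OF br_clin f(1)]])
      (use lower_central_ideal[OF N(1,2)] lower_central_br[OF x] f(2) in blast)+
  then show ?thesis by simp
qed

lemma nilpotent_th_zero:
  assumes N: "vec.subspace N" "\<And>x y. y \<in> N \<Longrightarrow> br x y \<in> N" "nilpotent_lie br N" and x: "x \<in> N"
  shows "ctr gh N (br x) = 0" "th x = 0"
proof -
  show 1: "ctr gh N (br x) = 0" using nilpotent_trace_zero[OF N clin_ident _ x] by simp
  have "br x y \<in> N" for y
    using N(2)[OF x, of y] br_skew[of x y] vec.subspace_neg[OF N(1)] by simp
  then show "th x = 0" using trace_step[OF _ N(1) _ br_clin, of UNIV x] 1 by simp
qed

end

text \<open>The setting common to both directions: an ideal whose orthogonal complement is a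
  subalgebra. The basis \<open>Sw\<close> is a parameter because condition (3) concerns every
  unitary basis of the complement.\<close>

locale ideal_split = hermitian_lie gh br for gh :: "('n::finite) cvec \<Rightarrow> 'n cvec \<Rightarrow> complex" and br +
  fixes V Sw :: "'n cvec set"
  assumes sV: "vec.subspace V" and ideal: "\<And>x y. y \<in> V \<Longrightarrow> br x y \<in> V"
    and Wc: "\<And>x y. x \<in> perp V \<Longrightarrow> y \<in> perp V \<Longrightarrow> br x y \<in> perp V"
    and Sw: "onb (perp V) Sw"
begin

abbreviation "W \<equiv> perp V"
abbreviation "p \<equiv> prj V"

definition Sv where "Sv = set (some_ub gh V)"

lemma Sv: "onb V Sv" unfolding Sv_def by (rule some_ub[OF sV])
lemma SvSw: "onb UNIV (Sv \<union> Sw)" "Sv \<inter> Sw = {}" by (rule onb_perp[OF Sv Sw])+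
lemma fin: "finite Sv" "finite Sw" using onb_finite[OF Sv] onb_finite[OF Sw] by auto
lemma sW: "vec.subspace W" by (rule subspace_perp)
lemma pV: "p x \<in> V" and pid: "x \<in> V \<Longrightarrow> p x = x" and pW: "x \<in> W \<Longrightarrow> p x = 0" and cp: "clin p"
  using prj_in[OF sV] prj_id[OF sV] prj_zero[OF sV] clin_prj[OF sV] perpD by auto
lemma ideal': "x \<in> V \<Longrightarrow> br x y \<in> V"
  using ideal[of x y] br_skew[of x y] vec.subspace_neg[OF sV] by simp
lemma qW: "x - p x \<in> W" by (rule diff_prj_perp[OF sV])

lemma sum_split: "(\<Sum>e\<in>Sv \<union> Sw. f e) = (\<Sum>e\<in>Sv. f e) + (\<Sum>e\<in>Sw. f e :: complex)"
  by (rule sum.union_disjoint) (use fin SvSw in auto)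

text \<open>The bracket of \<open>V\<close>, and in \<open>A\<close> the restriction of
  \<open>ad i\<close> to \<open>V\<close>, both extended by zero on the complement; traces and
  moment maps of \<open>V\<close> can then be taken in the ambient space.\<close>

definition om where "om x y = br (p x) (p y)"
definition A where "A i x = br i (p x)"

lemma bilin_om: "bilin om"
  by (rule bilinI) (simp_all add: om_def clin_add[OF cp] clin_scale[OF cp] br_simps)
lemma om_skew: "om x y = - om y x" unfolding om_def by (rule br_skew)
lemma clin_A: "clin (A i)" unfolding A_def by (rule clin_compose[OF br_clin cp])
lemma A_V: "A i x \<in> V" unfolding A_def by (rule ideal[OF pV])
lemma A_W: "x \<in> W \<Longrightarrow> A i x = 0" by (simp add: A_def pW br_simps)
lemma act_A: "act (A i) om x y = 0"
  using br_jacobi[of i "p x" "p y"] by (simp add: act_def A_def om_def pid[OF ideal[OF pV]])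

lemma adjA_V: "adj (A i) x \<in> V"
proof -
  have "adj (A i) x - p (adj (A i) x) = 0"
  proof (rule eq_by_gh)
    fix z
    have "gh (adj (A i) x - p (adj (A i) x)) z = gh (adj (A i) x) (z - p z)"
      by (simp add: gh_diff_left gh_diff_right gh_prj_self[OF sV])
    also have "\<dots> = gh x (A i (z - p z))" by (rule gh_adj[OF clin_A])
    also have "\<dots> = 0" using A_W[OF qW] by simp
    finally show "gh (adj (A i) x - p (adj (A i) x)) z = gh 0 z" by simp
  qed
  then have "adj (A i) x = p (adj (A i) x)" by simp
  then show ?thesis using pV[of "adj (A i) x"] by simp
qed

text \<open>The operator of condition (3), extended by zero on the complement; \<open>P_eq\<close>
  gives the identification on \<open>V\<close>.\<close>

definition P where "P x = (\<Sum>i\<in>Sw. A i (adj (A i) x) - adj (A i) (A i x))"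

lemma clin_P: "clin P"
  unfolding P_def by (intro clin_setsum clin_sub clin_compose[OF clin_A clin_adj] clin_compose[OF clin_adj clin_A])
lemma P_V: "P x \<in> V" unfolding P_def by (intro vec.subspace_sum vec.subspace_diff sV A_V adjA_V)
lemma gh_P: "gh (P x) y = (\<Sum>i\<in>Sw. gh (adj (A i) x) (adj (A i) y) - gh (A i x) (A i y))"
  by (simp add: P_def gh_sum_left gh_diff_left gh_adj[OF clin_A] gh_adj'[OF clin_A])
lemma P_sym: "gh (P x) y = gh x (P y)"
proof -
  have "gh (A i (adj (A i) x)) y = gh x (A i (adj (A i) y))" for i
    using gh_adj[OF clin_A[of i], of x "adj (A i) y"] gh_adj'[OF clin_A[of i], of "adj (A i) x" y] by simp
  then show ?thesis
    by (simp add: P_def gh_sum_left gh_sum_right gh_diff_left gh_diff_right gh_adj[OF clin_A] gh_adj'[OF clin_A])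
qed

lemma mom_om: assumes "x \<in> V" "y \<in> V"
  shows "mom om x y = - (1/2) * (\<Sum>e\<in>Sv. gh (br x e) (br y e)) + (1/4) * (\<Sum>e\<in>Sv. \<Sum>e'\<in>Sv. gh x (br e e') * gh (br e e') y)"
proof -
  have v: "p e = e" if "e \<in> Sv" for e using pid onb_in[OF Sv that] by simp
  have w: "p e = 0" if "e \<in> Sw" for e using pW onb_in[OF Sw that] by simp
  show ?thesis
    unfolding mom_onb[OF bilin_om SvSw(1)] sum_split om_def by (simp add: v w br_simps pid assms)
qed

lemma mom_om_p: "mom om x y = mom om x (p y)"
proof -
  have "gh (om i j) y = gh (om i j) (p y)" for i j
    using gh_prj[OF sV, of "om i j" y] gh_cnj[of "om i j"] ideal[OF pV] unfolding om_def by (metis)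
  then show ?thesis unfolding mom_def by (simp add: om_def pid[OF pV])
qed

lemma adj_A_expand: "gh (adj (A i) x) (adj (A i) y) = (\<Sum>e\<in>Sv. gh x (br i e) * gh (br i e) y)"
proof -
  have "gh (adj (A i) x) (adj (A i) y) = (\<Sum>e\<in>Sv. gh (adj (A i) x) e * gh e (adj (A i) y))"
    by (rule gh_expand_left[OF Sv adjA_V])
  also have "\<dots> = (\<Sum>e\<in>Sv. gh x (br i e) * gh (br i e) y)"
    by (intro sum.cong refl) (simp add: gh_adj[OF clin_A] gh_adj'[OF clin_A] A_def pid onb_in[OF Sv])
  finally show ?thesis .
qed

text \<open>Beyond the moment map of \<open>V\<close> there are the pairs with one vector in the
  complement. They contribute \<open>A i (adj (A i) x)\<close> through the positive term, where both
  orders occur, and \<open>- adj (A i) (A i x)\<close> through the negative one.\<close>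

lemma mom_VV: assumes "x \<in> V" "y \<in> V" shows "mom br x y = mom om x y + (1/2) * gh (P x) y"
proof -
  have z: "gh x (br e e') = 0" if "e \<in> Sw" "e' \<in> Sw" for e e'
    using perpD'[OF Wc[OF onb_in[OF Sw that(1)] onb_in[OF Sw that(2)]] assms(1)] .
  have s: "(\<Sum>e\<in>Sv. \<Sum>e'\<in>Sw. gh x (br e e') * gh (br e e') y) = (\<Sum>e\<in>Sw. \<Sum>e'\<in>Sv. gh x (br e e') * gh (br e e') y)"
  proof (subst sum.swap, intro sum.cong refl)
    fix e e' show "gh x (br e' e) * gh (br e' e) y = gh x (br e e') * gh (br e e') y"
      unfolding br_skew[of e' e] by simp
  qed
  have a: "(\<Sum>i\<in>Sw. gh (A i x) (A i y)) = (\<Sum>e\<in>Sw. gh (br x e) (br y e))"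
  proof (intro sum.cong refl)
    fix e show "gh (A e x) (A e y) = gh (br x e) (br y e)"
      unfolding A_def pid[OF assms(1)] pid[OF assms(2)] br_skew[of e] by simp
  qed
  show ?thesis
    unfolding mom_om[OF assms] mom_onb[OF br_bilin SvSw(1)] sum_split sum.distrib s gh_P sum_subtractf adj_A_expand a
    using z by (simp add: field_simps)
qed

lemma mom_WW: assumes "x \<in> W" "y \<in> W"
  shows "mom br x y = - (1/2) * (\<Sum>e\<in>Sw. gh (br x e) (br y e)) + (1/4) * (\<Sum>e\<in>Sw. \<Sum>e'\<in>Sw. gh x (br e e') * gh (br e e') y)
    - (1/2) * (\<Sum>e\<in>Sv. gh (br x e) (br y e))"
proof -
  have z: "gh x (br e e') = 0" if "e \<in> Sv \<or> e' \<in> Sv" for e e'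
    using perpD[OF assms(1)] that ideal ideal' onb_in[OF Sv] by blast
  show ?thesis
    unfolding mom_onb[OF br_bilin SvSw(1)] sum_split sum.distrib
    using z by (simp add: field_simps)
qed

text \<open>No bracket of basis vectors meets both \<open>W\<close> and \<open>V\<close>, since each
  lies in one of them; in the other sum only the basis vectors of \<open>V\<close>
  contribute.\<close>

lemma mom_WV: assumes "x \<in> W" "y \<in> V"
  shows "mom br x y = - (1/2) * (\<Sum>e\<in>Sv. gh (br x e) (br y e))"
proof -
  have z: "gh x (br e e') = 0" if "e \<in> Sv \<or> e' \<in> Sv" for e e'
    using perpD[OF assms(1)] that ideal ideal' onb_in[OF Sv] by blast
  have z2: "gh (br e e') y = 0" if "e \<in> Sw" "e' \<in> Sw" for e e'
    using perpD[OF Wc[OF onb_in[OF Sw that(1)] onb_in[OF Sw that(2)]] assms(2)] .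
  have z3: "gh (br x e) (br y e) = 0" if "e \<in> Sw" for e
    using perpD[OF Wc[OF assms(1) onb_in[OF Sw that]] ideal'[OF assms(2)]] .
  show ?thesis
    unfolding mom_onb[OF br_bilin SvSw(1)] sum_split sum.distrib
    using z z2 z3 by simp
qed

lemma subalgebra_V: "lie_subalgebra br V" and subalgebra_W: "lie_subalgebra br W"
  using sV ideal sW Wc by (auto simp: lie_subalgebra_def)

lemma tvec_zero: assumes "vec.subspace U" "\<And>x. x \<in> U \<Longrightarrow> ctr gh U (br x) = 0" shows "tvec U = 0"
proof -
  have "gh (tvec U) (tvec U) = 0" using gh_tvec[OF assms(1) tvec_in[OF assms(1)]] assms(2)[OF tvec_in[OF assms(1)]] by simp
  then show ?thesis by simp
qed

lemma hcf_K_V: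
  assumes "\<And>x. x \<in> V \<Longrightarrow> ctr gh V (br x) = 0" "x \<in> V" "y \<in> V"
  shows "hcf_K gh br V x y = mom om x y"
  using hcf_K_formula[OF subalgebra_V assms(2,3) Sv] tvec_zero[OF sV assms(1)]
  by (simp add: mom_om assms br_simps)

lemma hcf_K_W:
  assumes "\<And>x. x \<in> W \<Longrightarrow> ctr gh W (br x) = 0" "x \<in> W" "y \<in> W"
  shows "hcf_K gh br W x y = mom br x y + (1/2) * (\<Sum>e\<in>Sv. gh (br x e) (br y e))"
  using hcf_K_formula[OF subalgebra_W assms(2,3) Sw] tvec_zero[OF sW assms(1)]
  by (simp add: mom_WW assms br_simps)

lemma hadj_A: assumes "x \<in> V" shows "hadj gh V (br i) x = adj (A i) x"
proof (rule gh_eqI[OF sV hadj_in[OF sV] adjA_V])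
  fix z assume z: "z \<in> V"
  have "lin_on V (br i)" using br_clin[of i] by (simp add: lin_on_def)
  then show "gh (hadj gh V (br i) x) z = gh (adj (A i) x) z"
    by (simp add: gh_hadj[OF sV _ z] gh_adj[OF clin_A] A_def pid[OF z])
qed

lemma P_eq: assumes "x \<in> V" shows "P x = (\<Sum>i\<in>Sw. br i (hadj gh V (br i) x) - hadj gh V (br i) (br i x))"
  unfolding P_def using assms by (intro sum.cong refl) (simp add: hadj_A ideal A_def pid adjA_V)

text \<open>Translates the trace in condition (4) into the sum that occurs in \<open>mom_WW\<close>,
  by moving the adjoint with \<open>sesq_adj\<close>.\<close>

lemma T_eq: assumes "x \<in> W" "y \<in> W"
  shows "ctr gh V (\<lambda>u. br x (hadj gh V (br y) u)) = (\<Sum>e\<in>Sv. gh (br x e) (br y e))"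
proof -
  have "ctr gh V (\<lambda>u. br x (hadj gh V (br y) u)) = (\<Sum>e\<in>Sv. gh (br x (hadj gh V (br y) e)) e)"
    by (rule ctr_onb[OF Sv clin_compose[OF br_clin clin_hadj[OF sV]]])
  also have "\<dots> = (\<Sum>e\<in>Sv \<union> Sw. gh (A x (adj (A y) e)) e)"
  proof -
    have "gh (A x (adj (A y) e)) e = 0" if "e \<in> Sw" for e
      using perpD'[OF onb_in[OF Sw that] A_V] .
    then show ?thesis unfolding sum_split
      by (simp add: hadj_A onb_in[OF Sv] A_def pid adjA_V)
  qed
  also have "\<dots> = (\<Sum>e\<in>Sv \<union> Sw. gh (A x e) (A y e))"
  proof -
    have "sesq (\<lambda>u v. gh (A x u) v)" by (rule sesq_lin[OF clin_A])
    from sesq_adj[OF this SvSw(1) clin_adj, of "A y"] show ?thesis by (simp add: adj_adj[OF clin_A])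
  qed
  also have "\<dots> = (\<Sum>e\<in>Sv. gh (br x e) (br y e))"
  proof -
    have "gh (A x e) (A y e) = 0" if "e \<in> Sw" for e using A_W[OF onb_in[OF Sw that]] by simp
    then show ?thesis unfolding sum_split by (simp add: A_def pid onb_in[OF Sv])
  qed
  finally show ?thesis .
qed

end

section \<open>From solitons to the structure conditions\<close>

text \<open>The data delivered by \<open>soliton_structure\<close>: the derivation of the soliton
  has been replaced by a self-adjoint one, \<open>b\<close>, that vanishes on the
  complement.\<close>

locale soliton_split = ideal_split gh br V Sw for gh :: "('n::finite) cvec \<Rightarrow> 'n cvec \<Rightarrow> complex" and br V Sw +
  fixes b :: "'n cvec \<Rightarrow> 'n cvec" and c :: real
  assumes c: "c < 0" and cb: "clin b" and bder: "\<And>x y. b (br x y) = br (b x) y + br x (b y)"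
    and bsym: "\<And>x y. gh (b x) y = gh x (b y)"
    and sol: "\<And>x y. mom br x y + (1/2) * (th x * cnj (th y)) = of_real c * gh x y + gh (b x) y"
    and nilV: "nilpotent_lie br V" and bV: "\<And>x. b x \<in> V" and bW: "\<And>x. x \<in> perp V \<Longrightarrow> b x = 0"
    and thV: "\<And>x. x \<in> V \<Longrightarrow> th x = 0"

context hermitian_lie begin

text \<open>Let \<open>?X\<close> be the squared distance of the symmetric part of \<open>D\<close>
  from the diagonal matrix of the weights, \<open>?Y\<close> the defect of the grading and
  \<open>?Z\<close> the weighted squares of the traces. The two pairings give
  \<open>?X + ?Y / 4 + ?Z / 2 = 0\<close> with all three nonnegative.\<close>

lemma soliton_weights:
  assumes c: "c < 0" and D: "clin D" "\<And>x y. D (br x y) = br (D x) y + br x (D y)"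
    and sol: "\<And>x y. mom br x y + (1/2) * (th x * cnj (th y)) = of_real c * gh x y + (1/2) * (gh (D x) y + gh x (D y))"
  obtains E and wt :: "'n cvec \<Rightarrow> real" where "onb UNIV E" "\<And>x. x \<in> E \<Longrightarrow> 0 \<le> wt x"
    "\<And>x y z. x \<in> E \<Longrightarrow> y \<in> E \<Longrightarrow> z \<in> E \<Longrightarrow> gh (br x y) z \<noteq> 0 \<Longrightarrow> wt x + wt y = wt z"
    "\<And>x. x \<in> E \<Longrightarrow> wt x \<noteq> 0 \<Longrightarrow> th x = 0"
    "\<And>x y. x \<in> E \<Longrightarrow> y \<in> E \<Longrightarrow> (1/2) * (gh (D x) y + gh x (D y)) = (if x = y then of_real (wt x) else 0)"
proof -
  have "0 < - c" using c by simp
  then obtain E and wt :: "'n cvec \<Rightarrow> real" where E: "onb UNIV E"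
    and grad: "\<And>x y z. x \<in> E \<Longrightarrow> y \<in> E \<Longrightarrow> z \<in> E \<Longrightarrow> gh (br x y) z \<noteq> 0 \<Longrightarrow> wt x + wt y \<le> wt z"
    and wt0: "\<And>x. x \<in> E \<Longrightarrow> 0 \<le> wt x"
    and w1: "(\<Sum>x\<in>E. (wt x)\<^sup>2) = - c * (\<Sum>x\<in>E. wt x)"
    and w2: "(\<Sum>x\<in>E. wt x * Re (gh (D x) x)) = - c * (\<Sum>x\<in>E. Re (gh (D x) x))"
    using optimal_weights[OF _ D] by blast
  note fE = onb_finite[OF E]
  define q where "q x y z = (cmod (gh (br x y) z))\<^sup>2" for x y z
  define d where "d k = Re (gh (D k) k)" for k
  define T where "T k = (cmod (th k))\<^sup>2" for k
  have qs: "q x y z = q y x z" for x y z unfolding q_def by (subst br_skew) simp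
  have m: "Re (mom br z z) = - (1/2) * (\<Sum>x\<in>E. \<Sum>y\<in>E. q z x y) + (1/4) * (\<Sum>x\<in>E. \<Sum>y\<in>E. q x y z)" for z
  proof -
    have 1: "gh z v * gh v z = of_real ((cmod (gh v z))\<^sup>2)" for v using gh_mult_cnj[of v z] by (simp add: mult.commute)
    have 2: "gh v v = (\<Sum>e\<in>E. of_real ((cmod (gh v e))\<^sup>2))" for v by (rule norm_expand[OF E UNIV_I])
    show ?thesis unfolding mom_onb[OF br_bilin E] 1 2 q_def by simp
  qed
  \<comment> \<open>This is \<open>mom_trace\<close> for the diagonal operator of the weights,
    written in the basis \<open>E\<close>.\<close>
  have i: "(\<Sum>k\<in>E. wt k * Re (mom br k k)) = (1/4) * (\<Sum>x\<in>E. \<Sum>y\<in>E. \<Sum>z\<in>E. (wt z - wt x - wt y) * q x y z)"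
  proof -
    have a2: "(\<Sum>x\<in>E. \<Sum>y\<in>E. \<Sum>z\<in>E. wt y * q x y z) = (\<Sum>x\<in>E. \<Sum>y\<in>E. \<Sum>z\<in>E. wt x * q x y z)"
      by (subst sum.swap) (simp only: qs)
    have "(\<Sum>x\<in>E. \<Sum>y\<in>E. \<Sum>z\<in>E. wt z * q x y z) = (\<Sum>x\<in>E. \<Sum>z\<in>E. \<Sum>y\<in>E. wt z * q x y z)"
      by (intro sum.cong[OF refl] sum.swap)
    also have "\<dots> = (\<Sum>z\<in>E. \<Sum>x\<in>E. \<Sum>y\<in>E. wt z * q x y z)" by (rule sum.swap)
    finally have a3: "(\<Sum>x\<in>E. \<Sum>y\<in>E. \<Sum>z\<in>E. wt z * q x y z) = (\<Sum>z\<in>E. \<Sum>x\<in>E. \<Sum>y\<in>E. wt z * q x y z)" .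
    have "(\<Sum>k\<in>E. wt k * Re (mom br k k)) = - (1/2) * (\<Sum>x\<in>E. \<Sum>y\<in>E. \<Sum>z\<in>E. wt x * q x y z) + (1/4) * (\<Sum>z\<in>E. \<Sum>x\<in>E. \<Sum>y\<in>E. wt z * q x y z)"
      unfolding m by (simp add: distrib_left right_diff_distrib sum.distrib sum_distrib_left sum_negf sum_subtractf mult.left_commute)
    then show ?thesis
      unfolding left_diff_distrib sum_subtractf a3 a2 by simp
  qed
  have diag: "Re (mom br k k) = c + d k - (1/2) * T k" if "k \<in> E" for k
  proof -
    have "Re (th k * cnj (th k)) = T k" unfolding T_def cmod_power2 by (simp add: power2_eq_square)
    moreover have "gh k (D k) = cnj (gh (D k) k)" by (rule gh_cnj)
    ultimately show ?thesis using arg_cong[OF sol[of k k], of Re] onb_gh[OF E that that] by (simp add: d_def)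
  qed
  have pos: "0 \<le> (wt z - wt x - wt y) * q x y z" if "x \<in> E" "y \<in> E" "z \<in> E" for x y z
    using grad[OF that] by (cases "gh (br x y) z = 0") (simp_all add: q_def)
  have i2: "(\<Sum>k\<in>E. wt k * (c + d k)) = (1/4) * (\<Sum>x\<in>E. \<Sum>y\<in>E. \<Sum>z\<in>E. (wt z - wt x - wt y) * q x y z) + (1/2) * (\<Sum>k\<in>E. wt k * T k)"
  proof -
    have "(\<Sum>k\<in>E. wt k * Re (mom br k k)) = (\<Sum>k\<in>E. wt k * (c + d k) - (1/2) * (wt k * T k))"
      by (intro sum.cong refl) (simp add: diag algebra_simps)
    then show ?thesis unfolding i by (simp add: sum_subtractf sum_distrib_left)
  qed
  define a where "a k l = gh (D k) l" for k l
  \<comment> \<open>The pairing with \<open>D\<close>: the left side vanishes as \<open>D\<close> is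
    a derivation, and the trace term because \<open>th\<close> vanishes on the image of
    \<open>D\<close>.\<close>
  have ii: "c * (\<Sum>k\<in>E. d k) + (1/2) * (\<Sum>k\<in>E. \<Sum>l\<in>E. Re (a k l * a l k)) + (1/2) * (\<Sum>k\<in>E. \<Sum>l\<in>E. (cmod (a k l))\<^sup>2) = 0"
  proof -
    have "sesq (\<lambda>x y. mom br (D x) y)" using sesq_mom[OF br_bilin] D(1) unfolding sesq_def lin_on_def by simp
    then have "(\<Sum>k\<in>E. mom br (D k) k) = (\<Sum>k\<in>bas. mom br (D k) k)" by (rule sesq_indep[OF _ E onb_bas])
    also have "\<dots> = (1/4) * ipb (act D br) br" by (rule mom_trace[OF br_bilin br_skew D(1)])
    also have "\<dots> = 0" by (simp add: ipb_def act_def D(2))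
    finally have 0: "(\<Sum>k\<in>E. mom br (D k) k) = 0" .
    have 1: "mom br (D k) k = of_real c * gh (D k) k + (1/2) * (gh (D (D k)) k + gh (D k) (D k))" for k
      using sol[of "D k" k] th_derivation[OF D, of k] by simp
    have 2: "gh (D (D k)) k = (\<Sum>l\<in>E. a k l * a l k)" for k
      using sesq_expand_left[OF sesq_lin[OF D(1)] E UNIV_I, of "D k" k] by (simp add: a_def)
    have 3: "gh (D k) (D k) = (\<Sum>l\<in>E. of_real ((cmod (a k l))\<^sup>2))" for k
      unfolding a_def by (rule norm_expand[OF E UNIV_I])
    have "Re (\<Sum>k\<in>E. mom br (D k) k) = c * (\<Sum>k\<in>E. d k) + (1/2) * (\<Sum>k\<in>E. \<Sum>l\<in>E. Re (a k l * a l k)) + (1/2) * (\<Sum>k\<in>E. \<Sum>l\<in>E. (cmod (a k l))\<^sup>2)"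
      unfolding 1 2 3 d_def by (simp add: sum.distrib sum_distrib_left distrib_left sum_subtractf sum_divide_distrib add_divide_distrib diff_divide_distrib)
    then show ?thesis unfolding 0 by simp
  qed
  define s where "s k l = (1/2) * (a k l + cnj (a l k)) - (if k = l then of_real (wt k) else 0)" for k l
  let ?X = "\<Sum>k\<in>E. \<Sum>l\<in>E. (cmod (s k l))\<^sup>2"
  have s2: "(cmod (s k l))\<^sup>2 = (1/4) * ((cmod (a k l))\<^sup>2 + (cmod (a l k))\<^sup>2 + 2 * Re (a k l * a l k))
      + (if k = l then (wt k)\<^sup>2 - 2 * (wt k * d k) else 0)" for k l
    unfolding s_def cmod_power2 by (cases "k = l") (simp_all add: power2_eq_square field_simps d_def a_def)
  have "(\<Sum>k\<in>E. \<Sum>l\<in>E. (cmod (s k l))\<^sup>2) = (1/4) * ((\<Sum>k\<in>E. \<Sum>l\<in>E. (cmod (a k l))\<^sup>2) + (\<Sum>k\<in>E. \<Sum>l\<in>E. (cmod (a l k))\<^sup>2)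
      + 2 * (\<Sum>k\<in>E. \<Sum>l\<in>E. Re (a k l * a l k))) + ((\<Sum>k\<in>E. (wt k)\<^sup>2) - 2 * (\<Sum>k\<in>E. wt k * d k))"
    unfolding s2 sum.distrib sum_distrib_left[symmetric] by (simp add: sum.delta fE sum_subtractf sum_distrib_left)
  also have "(\<Sum>k\<in>E. \<Sum>l\<in>E. (cmod (a l k))\<^sup>2) = (\<Sum>k\<in>E. \<Sum>l\<in>E. (cmod (a k l))\<^sup>2)" by (rule sum.swap)
  finally have s3: "?X = (1/4) * ((\<Sum>k\<in>E. \<Sum>l\<in>E. (cmod (a k l))\<^sup>2) + (\<Sum>k\<in>E. \<Sum>l\<in>E. (cmod (a k l))\<^sup>2)
      + 2 * (\<Sum>k\<in>E. \<Sum>l\<in>E. Re (a k l * a l k))) + ((\<Sum>k\<in>E. (wt k)\<^sup>2) - 2 * (\<Sum>k\<in>E. wt k * d k))" .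
  have iii: "(\<Sum>k\<in>E. \<Sum>l\<in>E. (cmod (s k l))\<^sup>2) = - (\<Sum>k\<in>E. wt k * (c + d k))"
  proof -
    have "(\<Sum>k\<in>E. wt k * (c + d k)) = c * (\<Sum>k\<in>E. wt k) + (\<Sum>k\<in>E. wt k * d k)"
      by (simp add: distrib_left sum.distrib sum_distrib_left mult.commute)
    then show ?thesis using ii w1 w2[folded d_def] s3 by argo
  qed
  let ?Y = "\<Sum>x\<in>E. \<Sum>y\<in>E. \<Sum>z\<in>E. (wt z - wt x - wt y) * q x y z"
  let ?Z = "\<Sum>k\<in>E. wt k * T k"
  have nn: "0 \<le> ?X" "0 \<le> ?Y" "0 \<le> ?Z" using pos wt0 by (auto intro!: sum_nonneg simp: T_def)
  then have zero: "?X = 0" "?Y = 0" "?Z = 0" using iii i2 by linarith+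
  have "s k l = 0" if k: "k \<in> E" and l: "l \<in> E" for k l
  proof -
    have "(\<Sum>l\<in>E. (cmod (s k l))\<^sup>2) = 0" using zero(1) k by (subst (asm) sum_nonneg_eq_0_iff[OF fE]) (auto intro: sum_nonneg)
    then show ?thesis using l by (subst (asm) sum_nonneg_eq_0_iff[OF fE]) auto
  qed
  then have g5: "(1/2) * (gh (D x) y + gh x (D y)) = (if x = y then of_real (wt x) else 0)" if "x \<in> E" "y \<in> E" for x y
    using that gh_cnj[of x "D y"] by (simp add: s_def a_def)
  have g4: "th x = 0" if "x \<in> E" "wt x \<noteq> 0" for x
  proof -
    have "wt x * T x = 0" using zero(3) that wt0 by (subst (asm) sum_nonneg_eq_0_iff[OF fE]) (auto simp: T_def)
    then show ?thesis using that by (simp add: T_def)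
  qed
  have g3: "wt x + wt y = wt z" if x: "x \<in> E" and y: "y \<in> E" and z: "z \<in> E" and nz: "gh (br x y) z \<noteq> 0" for x y z
  proof -
    have "(\<Sum>y\<in>E. \<Sum>z\<in>E. (wt z - wt x - wt y) * q x y z) = 0" using zero(2) x pos by (subst (asm) sum_nonneg_eq_0_iff[OF fE]) (auto intro!: sum_nonneg)
    then have "(\<Sum>z\<in>E. (wt z - wt x - wt y) * q x y z) = 0" using y x pos by (subst (asm) sum_nonneg_eq_0_iff[OF fE]) (auto intro!: sum_nonneg)
    then have "(wt z - wt x - wt y) * q x y z = 0" using z x y pos by (subst (asm) sum_nonneg_eq_0_iff[OF fE]) auto
    then show ?thesis using nz by (simp add: q_def)
  qed
  show ?thesis by (rule that[OF E wt0 g3 g4 g5])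
qed

text \<open>The zero weight space complements the sum of the positive weight spaces, which is a
  nilpotent ideal; it will turn out to be the nilradical.\<close>

lemma soliton_structure:
  assumes c: "c < 0" and sas: "semi_alg_soliton gh br UNIV c"
  obtains V b where "vec.subspace V" "\<And>Sw. onb (perp V) Sw \<Longrightarrow> soliton_split gh br V Sw b c"
proof -
  obtain D where D: "clin D" "\<And>x y. D (br x y) = br (D x) y + br x (D y)"
    and sol: "\<And>x y. mom br x y + (1/2) * (th x * cnj (th y)) = of_real c * gh x y + (1/2) * (gh (D x) y + gh x (D y))"
    using sas unfolding semi_alg_soliton_iff by blast
  obtain E and wt :: "'n cvec \<Rightarrow> real" where E: "onb UNIV E" and wt0: "\<And>x. x \<in> E \<Longrightarrow> 0 \<le> wt x"
    and gr: "\<And>x y z. x \<in> E \<Longrightarrow> y \<in> E \<Longrightarrow> z \<in> E \<Longrightarrow> gh (br x y) z \<noteq> 0 \<Longrightarrow> wt x + wt y = wt z"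
    and th0: "\<And>x. x \<in> E \<Longrightarrow> wt x \<noteq> 0 \<Longrightarrow> th x = 0"
    and DE: "\<And>x y. x \<in> E \<Longrightarrow> y \<in> E \<Longrightarrow> (1/2) * (gh (D x) y + gh x (D y)) = (if x = y then of_real (wt x) else 0)"
    using soliton_weights[OF c D sol] by blast
  note fE = onb_finite[OF E]
  have ex: "x = (\<Sum>e\<in>E. gh x e *s e)" for x by (rule onb_expand[OF E UNIV_I])
  have z0: "x = 0" if "\<And>e. e \<in> E \<Longrightarrow> gh x e = 0" for x using ex[of x] that by simp
  \<comment> \<open>The diagonal operator with the weights as eigenvalues; \<open>bD\<close> below
    identifies it with the symmetric part of \<open>D\<close>.\<close>
  define b where "b x = (\<Sum>e\<in>E. (of_real (wt e) * gh x e) *s e)" for x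
  have cb: "clin b"
    by (rule clinI) (simp_all add: b_def gh_simps algebra_simps sum.distrib vec.scale_sum_right vec.scale_left_distrib)
  have bgh: "gh (b x) e = of_real (wt e) * gh x e" if "e \<in> E" for x e
  proof -
    have "gh (b x) e = (\<Sum>k\<in>E. of_real (wt k) * gh x k * gh k e)" by (simp add: b_def gh_sum_left)
    also have "\<dots> = (\<Sum>k\<in>E. if k = e then of_real (wt k) * gh x k else 0)"
      by (intro sum.cong refl) (simp add: onb_gh[OF E _ that])
    finally show ?thesis using that fE by simp
  qed
  have be: "b e = of_real (wt e) *s e" if "e \<in> E" for e
  proof -
    have "b e - of_real (wt e) *s e = 0"
    proof (rule z0)
      fix k assume "k \<in> E"
      then show "gh (b e - of_real (wt e) *s e) k = 0" by (simp add: gh_diff_left bgh onb_gh[OF E that])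
    qed
    then show ?thesis by simp
  qed
  have bsym: "gh (b x) y = gh x (b y)" for x y
  proof -
    have "gh (b x) y = (\<Sum>e\<in>E. gh (b x) e * gh e y)" by (rule gh_expand_left[OF E UNIV_I])
    also have "\<dots> = (\<Sum>e\<in>E. gh x e * gh e (b y))"
    proof (intro sum.cong refl)
      fix e assume e: "e \<in> E"
      have "gh e (b y) = of_real (wt e) * gh e y" using bgh[OF e, of y] gh_cnj[of e "b y"] gh_cnj[of e y] by simp
      then show "gh (b x) e * gh e y = gh x e * gh e (b y)" by (simp add: bgh[OF e])
    qed
    also have "\<dots> = gh x (b y)" by (rule gh_expand_left[OF E UNIV_I, symmetric])
    finally show ?thesis .
  qed
  have bder: "b (br x y) = br (b x) y + br x (b y)" for x y
  proof -
    have "act b br x y = 0"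
    proof (rule bilin_eq_zero[OF bilin_act[OF cb br_bilin]])
      show "vec.span E = UNIV" using E by (simp add: onb_def)
      fix i j assume i: "i \<in> E" and j: "j \<in> E"
      show "act b br i j = 0"
      proof (rule z0)
        fix e assume e: "e \<in> E"
        have "gh (act b br i j) e = (of_real (wt e) - of_real (wt i) - of_real (wt j)) * gh (br i j) e"
          by (simp add: act_def gh_diff_left gh_add_left bgh[OF e] be[OF i] be[OF j] br_simps algebra_simps)
        also have "\<dots> = of_real (wt e - wt i - wt j) * gh (br i j) e" by simp
        also have "\<dots> = 0"
        proof (cases "gh (br i j) e = 0")
          case False
          then have "wt e - wt i - wt j = 0" using gr[OF i j e] by linarith
          then show ?thesis by (simp only: of_real_0 mult_zero_left)
        qed simp
        finally show "gh (act b br i j) e = 0" .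
      qed
    qed
    then show ?thesis by (simp add: act_def algebra_simps)
  qed
  have bD: "gh (b x) y = (1/2) * (gh (D x) y + gh x (D y))" for x y
  proof -
    have "sesq (\<lambda>x y. gh (b x) y - (1/2) * (gh (D x) y + gh x (D y)))"
      unfolding sesq_def by (simp add: clin_add[OF cb] clin_scale[OF cb] clin_add[OF D(1)] clin_scale[OF D(1)] gh_simps algebra_simps)
    from sesq_eq_on_onb[OF this E, of x y] show ?thesis
      using DE by (simp add: bgh onb_gh[OF E])
  qed
  have bsol: "mom br x y + (1/2) * (th x * cnj (th y)) = of_real c * gh x y + gh (b x) y" for x y
    unfolding sol bD ..
  have brex: "gh (br x y) e = (\<Sum>k\<in>E. \<Sum>l\<in>E. gh x k * gh y l * gh (br k l) e)" for x y e
  proof -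
    have "br x y = br (\<Sum>k\<in>E. gh x k *s k) y" using ex[of x] by simp
    also have "\<dots> = (\<Sum>k\<in>E. gh x k *s br k y)" by (simp add: clin_sum[OF br_clin_left] br_simps)
    also have "\<dots> = (\<Sum>k\<in>E. gh x k *s br k (\<Sum>l\<in>E. gh y l *s l))" using ex[of y] by simp
    also have "\<dots> = (\<Sum>k\<in>E. \<Sum>l\<in>E. (gh x k * gh y l) *s br k l)"
      by (simp add: clin_sum[OF br_clin] br_simps vec.scale_sum_right)
    finally show ?thesis by (simp add: gh_sum_left)
  qed
  define F where "F t = {x. \<forall>e\<in>E. wt e < t \<longrightarrow> gh x e = 0}" for t :: real
  have sF: "vec.subspace (F t)" for t by (intro vec.subspaceI) (auto simp: F_def gh_simps)
  have Fbr: "br x y \<in> F (t + u)" if x: "x \<in> F t" and y: "y \<in> F u" for x y t u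
    unfolding F_def
  proof (intro CollectI ballI impI)
    fix e assume e: "e \<in> E" and lt: "wt e < t + u"
    have "gh (br x y) e = (\<Sum>k\<in>E. \<Sum>l\<in>E. gh x k * gh y l * gh (br k l) e)" by (rule brex)
    also have "\<dots> = 0"
    proof (intro sum.neutral ballI)
      fix k l assume k: "k \<in> E" and l: "l \<in> E"
      show "gh x k * gh y l * gh (br k l) e = 0"
      proof (rule ccontr)
        assume n: "gh x k * gh y l * gh (br k l) e \<noteq> 0"
        have "t \<le> wt k" using x k n unfolding F_def by force
        moreover have "u \<le> wt l" using y l n unfolding F_def by force
        moreover have "wt k + wt l = wt e" using gr[OF k l e] n by simp
        ultimately show False using lt by simp
      qed
    qed
    finally show "gh (br x y) e = 0" .
  qed
  have F0: "x \<in> F 0" for x using wt0 by (force simp: F_def)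
  \<comment> \<open>A positive lower bound for the nonzero weights; the entry 1 below covers the
    case that all weights vanish.\<close>
  obtain w0 where w0: "w0 > 0" "\<And>e. e \<in> E \<Longrightarrow> wt e \<noteq> 0 \<Longrightarrow> w0 \<le> wt e"
  proof
    let ?M = "insert 1 (wt ` {e\<in>E. wt e \<noteq> 0})"
    have f: "finite ?M" using fE by simp
    have "0 < x" if "x \<in> ?M" for x using that wt0 by force
    then show "0 < Min ?M" using f by (subst Min_gr_iff) auto
    show "Min ?M \<le> wt e" if "e \<in> E" "wt e \<noteq> 0" for e using that f by (intro Min_le) auto
  qed
  let ?V = "F w0"
  have V: "x \<in> ?V \<longleftrightarrow> (\<forall>e\<in>E. wt e = 0 \<longrightarrow> gh x e = 0)" for x
    using w0 by (force simp: F_def)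
  have W: "x \<in> perp ?V \<longleftrightarrow> (\<forall>e\<in>E. wt e \<noteq> 0 \<longrightarrow> gh x e = 0)" for x
  proof
    assume x: "x \<in> perp ?V"
    have "e \<in> ?V" if e: "e \<in> E" "wt e \<noteq> 0" for e
      unfolding V using e by (auto simp: onb_gh[OF E e(1)])
    then show "\<forall>e\<in>E. wt e \<noteq> 0 \<longrightarrow> gh x e = 0" using perpD[OF x] by blast
  next
    assume x: "\<forall>e\<in>E. wt e \<noteq> 0 \<longrightarrow> gh x e = 0"
    have "gh x y = 0" if y: "y \<in> ?V" for y
    proof -
      have "gh x y = (\<Sum>e\<in>E. gh x e * gh e y)" by (rule gh_expand_left[OF E UNIV_I])
      also have "\<dots> = 0"
      proof (intro sum.neutral ballI)
        fix e assume "e \<in> E"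
        then show "gh x e * gh e y = 0" using x y[unfolded V] gh_cnj[of e y] by (cases "wt e = 0") auto
      qed
      finally show ?thesis .
    qed
    then show "x \<in> perp ?V" by (simp add: perp_def)
  qed
  \<comment> \<open>Every bracket with an element of \<open>?V\<close> raises the weight by at least
    \<open>w0\<close>, and the weights are bounded.\<close>
  have lc: "lower_central br ?V k \<subseteq> F (real (Suc k) * w0)" for k
  proof (induction k)
    case (Suc k)
    have "{br x y |x y. x \<in> ?V \<and> y \<in> lower_central br ?V k} \<subseteq> F (real (Suc (Suc k)) * w0)"
    proof safe
      fix x y assume "x \<in> ?V" "y \<in> lower_central br ?V k"
      then have "br x y \<in> F (w0 + real (Suc k) * w0)" using Suc.IH by (intro Fbr) auto
      then show "br x y \<in> F (real (Suc (Suc k)) * w0)" by (simp add: algebra_simps)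
    qed
    then show ?case unfolding lower_central.simps by (rule vec.span_minimal[OF _ sF])
  qed simp
  have nil: "nilpotent_lie br ?V"
  proof -
    obtain k where k: "sum wt E < real k * w0" using reals_Archimedean3[OF w0(1)] by blast
    have lt: "wt e < real (Suc k) * w0" if "e \<in> E" for e
    proof -
      have "wt e \<le> sum wt E" using member_le_sum[of e E wt] that wt0 fE by auto
      also have "\<dots> < real k * w0" by (rule k)
      also have "\<dots> \<le> real (Suc k) * w0" using w0(1) by simp
      finally show ?thesis .
    qed
    have "x = 0" if "x \<in> F (real (Suc k) * w0)" for x
      by (rule z0) (use that lt in \<open>auto simp: F_def\<close>)
    moreover have "0 \<in> lower_central br ?V k" using vec.subspace_0[OF sF] by (cases k) (auto intro: vec.span_zero)
    ultimately have "lower_central br ?V k = {0}" using lc[of k] by blast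
    then show ?thesis unfolding nilpotent_lie_def by blast
  qed
  have Vi: "br x y \<in> ?V" if "y \<in> ?V" for x y using Fbr[OF F0[of x] that] by simp
  have Vb: "b x \<in> ?V" for x unfolding V by (simp add: bgh)
  have Wb: "b x = 0" if "x \<in> perp ?V" for x
    by (rule z0) (use that[unfolded W] in \<open>auto simp: bgh\<close>)
  have Vth: "th x = 0" if x: "x \<in> ?V" for x
  proof -
    have "th x = gh x H" by (rule gh_H[symmetric])
    also have "\<dots> = (\<Sum>e\<in>E. gh x e * gh e H)" by (rule gh_expand_left[OF E UNIV_I])
    also have "\<dots> = 0" using x[unfolded V] th0 by (intro sum.neutral) (auto simp: gh_H)
    finally show ?thesis .
  qed
  have Wbr: "br x y \<in> perp ?V" if x: "x \<in> perp ?V" and y: "y \<in> perp ?V" for x y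
    unfolding W
  proof (intro ballI impI)
    fix e assume e: "e \<in> E" "wt e \<noteq> 0"
    have "gh (br x y) e = (\<Sum>k\<in>E. \<Sum>l\<in>E. gh x k * gh y l * gh (br k l) e)" by (rule brex)
    also have "\<dots> = 0"
    proof (intro sum.neutral ballI)
      fix k l assume k: "k \<in> E" and l: "l \<in> E"
      show "gh x k * gh y l * gh (br k l) e = 0"
        using x[unfolded W] y[unfolded W] gr[OF k l e(1)] e(2) k l
        by (cases "wt k = 0"; cases "wt l = 0"; cases "gh (br k l) e = 0") auto
    qed
    finally show "gh (br x y) e = 0" .
  qed
  have "soliton_split gh br ?V Sw b c" if "onb (perp ?V) Sw" for Sw
    by unfold_locales (fact that sF Vi Vb Wb Vth Wbr c cb bder bsym bsol nil)+
  then show ?thesis by (rule that[OF sF])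
qed

end

context ideal_split begin

lemma br_W_expand: "x \<in> W \<Longrightarrow> br x y = (\<Sum>i\<in>Sw. gh x i *s br i y)"
  using arg_cong[OF onb_expand[OF Sw, of x], of "\<lambda>u. br u y"] by (simp add: clin_sum[OF br_clin_left] br_simps)

end

context soliton_split begin

lemma b_comm: "i \<in> W \<Longrightarrow> b (br i x) = br i (b x)"
  using bder[of i x] by (simp add: bW br_simps)
lemma b_p: "b (p x) = b x"
  using bW[OF qW[of x]] by (simp add: clin_diff[OF cb])
lemma bA: "i \<in> W \<Longrightarrow> b (A i x) = A i (b x)"
  by (simp add: A_def b_comm b_p pid[OF bV])

lemma mom_om_eq: "x \<in> V \<Longrightarrow> y \<in> V \<Longrightarrow> mom om x y = of_real c * gh x y + gh (b x) y - (1/2) * gh (P x) y"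
  using sol[of x y] by (simp add: mom_VV thV eq_diff_eq)

text \<open>If \<open>b\<close> commutes with \<open>A'\<close>, the trace of
  \<open>b [A', C]\<close> is that of \<open>[A', b C]\<close>.\<close>

lemma tr_b_comm:
  assumes "clin A'" "clin C" "\<And>x. b (A' x) = A' (b x)"
  shows "(\<Sum>k\<in>bas. gh (b (A' (C k) - C (A' k))) k) = 0"
proof -
  have "(\<Sum>k\<in>bas. gh (A' (b (C k))) k) = (\<Sum>k\<in>bas. gh (b (C (A' k))) k)"
    by (rule trace_comm[OF assms(1) clin_compose[OF cb assms(2)] onb_bas])
  then show ?thesis by (simp add: clin_diff[OF cb] assms(3) gh_diff_left sum_subtractf)
qed

lemma tr_comm:
  assumes "clin A'" "clin C"
  shows "(\<Sum>k\<in>bas. gh (A' (C k) - C (A' k)) k) = 0"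
  using trace_comm[OF assms onb_bas] by (simp add: gh_diff_left sum_subtractf)

text \<open>On \<open>V\<close> the soliton equation reads \<open>mom om = c + b - P / 2\<close>.
  Paired with \<open>P\<close>, the terms in \<open>c\<close> and \<open>b\<close> vanish as traces
  of commutators, the left side becomes a sum of squared norms, and the right side is
  \<open>-1/2\<close> times the squared norm of \<open>P\<close>.\<close>

lemma P_zero: "P x = 0"
proof -
  have e: "mom om (P k) k = of_real c * gh (P k) k + gh (b (P k)) k - (1/2) * gh (P k) (P k)" for k
  proof -
    have *: "gh v (p k) = gh v k" if "v \<in> V" for v using gh_prj_self[OF sV, of v k] by (simp add: pid[OF that])
    have "mom om (P k) k = mom om (P k) (p k)" by (rule mom_om_p)
    also have "\<dots> = of_real c * gh (P k) k + gh (b (P k)) k - (1/2) * gh (P (P k)) k"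
      by (simp add: mom_om_eq[OF P_V pV] * P_V bV)
    finally show ?thesis by (simp add: P_sym[of "P k"])
  qed
  have Pi: "P k = (\<Sum>i\<in>Sw. A i (adj (A i) k) - adj (A i) (A i k))" for k by (rule P_def)
  have 1: "(\<Sum>k\<in>bas. gh (P k) k) = 0"
    unfolding Pi gh_sum_left by (subst sum.swap) (simp add: tr_comm[OF clin_A clin_adj])
  have 2: "(\<Sum>k\<in>bas. gh (b (P k)) k) = 0"
    unfolding Pi clin_sum[OF cb] gh_sum_left
    by (subst sum.swap, intro sum.neutral ballI tr_b_comm[OF clin_A clin_adj] bA onb_in[OF Sw])
  have 3: "(\<Sum>k\<in>bas. mom om (P k) k) = (\<Sum>i\<in>Sw. (1/4) * ipb (act (adj (A i)) om) (act (adj (A i)) om))"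
    unfolding Pi sesq_sum_left[OF sesq_mom[OF bilin_om]]
    by (subst sum.swap) (simp add: mom_trace_comm[OF bilin_om om_skew clin_A clin_adj act_A])
  have "0 \<le> Re (\<Sum>k\<in>bas. mom om (P k) k)" unfolding 3 by (auto intro!: sum_nonneg ipb_nonneg)
  moreover have "(\<Sum>k\<in>bas. mom om (P k) k) = - (1/2) * (\<Sum>k\<in>bas. gh (P k) (P k))"
    unfolding e sum.distrib sum_subtractf sum_distrib_left[symmetric] 1 2 by simp
  ultimately have "(\<Sum>k\<in>bas. Re (gh (P k) (P k))) \<le> 0" by simp
  moreover have "0 \<le> Re (gh (P k) (P k))" for k by (rule gh_nonneg)
  ultimately have "Re (gh (P k) (P k)) = 0" if "k \<in> bas" for k
    using sum_nonneg_eq_0_iff[OF finite_bas, of "\<lambda>k. Re (gh (P k) (P k))"] that by (meson antisym sum_nonneg)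
  then have "P k = 0" if "k \<in> bas" for k using that by simp
  then show ?thesis using clin_zero_on_onb[OF clin_P onb_bas] by blast
qed

text \<open>Complete reducibility of \<open>W\<close> acting on \<open>V\<close>: by
  \<open>P_zero\<close>, orthogonal complements in \<open>V\<close> of invariant subspaces are
  invariant.\<close>

lemma A_complement:
  assumes X: "vec.subspace X" "\<And>i x. i \<in> W \<Longrightarrow> x \<in> X \<Longrightarrow> br i x \<in> X" "X \<subseteq> V"
    and u: "u \<in> W" and y: "y \<in> V" "\<And>x. x \<in> X \<Longrightarrow> gh y x = 0" and x: "x \<in> X"
  shows "gh (br u y) x = 0"
proof -
  have "gh (br i y) x = 0" if i: "i \<in> Sw" for i
  proof -
    have "gh (A i y) x = 0"
    proof (rule complement_invariant[where I = Sw and A = A and W = X])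
      show "(\<Sum>i\<in>Sw. A i (adj (A i) x) - adj (A i) (A i x)) = 0" for x using P_zero[of x] by (simp add: P_def)
      show "A i x \<in> X" if "i \<in> Sw" "x \<in> X" for i x
        using X(2)[OF onb_in[OF Sw that(1)] that(2)] pid[of x] X(3) that(2) by (auto simp: A_def)
    qed (use fin clin_A X i y x in auto)
    then show ?thesis by (simp add: A_def pid[OF y(1)])
  qed
  then show ?thesis unfolding br_W_expand[OF u] by (simp add: gh_sum_left)
qed

text \<open>Elements of \<open>N \<inter> W\<close> act on \<open>V\<close> nilpotently, as members
  of a nilpotent ideal, and by complete reducibility they act by zero. The last nonzero
  \<open>?L k \<inter> W\<close> is then the abelian ideal that contradicts
  \<open>c < 0\<close>.\<close>

lemma V_maximal:
  assumes N: "lie_ideal br UNIV N" "nilpotent_lie br N" and VN: "V \<subseteq> N"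
  shows "N = V"
proof (rule ccontr)
  assume neq: "N \<noteq> V"
  have sN: "vec.subspace N" and iN: "\<And>x y. y \<in> N \<Longrightarrow> br x y \<in> N" using N(1) by (auto simp: lie_ideal_def)
  let ?L = "lower_central br N"
  note L = lower_central_ideal[OF sN iN]
  obtain K where K: "?L K = {0}" using N(2) by (auto simp: nilpotent_lie_def)
  \<comment> \<open>Downwards along the lower central series of \<open>N\<close>: the part
    \<open>y\<close> of \<open>x\<close> orthogonal to the next piece \<open>?X\<close> is sent by
    \<open>u\<close> into \<open>?X\<close> and also into the orthogonal complement of
    \<open>?X\<close>.\<close>
  have kill: "br u x = 0" if u: "u \<in> N" "u \<in> W" and x: "x \<in> V" for u x
  proof -
    have "\<forall>x\<in>?L k \<inter> V. br u x = 0" if "k \<le> K" for k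
      using that
    proof (induction rule: inc_induct)
      case base
      then show ?case using K by (auto simp: br_simps)
    next
      case (step n)
      let ?X = "?L (Suc n) \<inter> V"
      have sX: "vec.subspace ?X" using L sV by (auto intro: vec.subspace_inter)
      show ?case
      proof
        fix x assume x: "x \<in> ?L n \<inter> V"
        define y where "y = x - prj ?X x"
        have pX: "prj ?X x \<in> ?X" by (rule prj_in[OF sX])
        have yL: "y \<in> ?L n" unfolding y_def by (rule vec.subspace_diff) (use L x pX in blast)+
        have yV: "y \<in> V" unfolding y_def by (rule vec.subspace_diff) (use sV x pX in blast)+
        have "br u y \<in> ?X" using lower_central_br[OF u(1) yL] ideal[OF yV] by blast
        moreover have "gh (br u y) z = 0" if z: "z \<in> ?X" for z
        proof (rule A_complement[OF sX _ _ u(2) yV _ z])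
          show "br i x \<in> ?X" if "x \<in> ?X" for i x using that L ideal by blast
          show "gh y x = 0" if "x \<in> ?X" for x
            using perpD[OF diff_prj_perp[OF sX] that] by (simp add: y_def)
        qed auto
        ultimately have "br u y = 0" using gh_eq0 by blast
        moreover have "br u (prj ?X x) = 0" using step.IH pX by blast
        ultimately show "br u x = 0" using br_simps by (simp add: y_def clin_diff[OF br_clin])
      qed
    qed
    then show ?thesis using x VN by force
  qed
  obtain x where x: "x \<in> N" "x \<notin> V" using neq VN by blast
  have "x - p x \<in> ?L 0 \<inter> W"
    using qW[of x] vec.subspace_diff[OF sN x(1), of "p x"] pV[of x] VN by auto
  moreover have "x - p x \<noteq> 0" using x(2) pV[of x] by auto
  ultimately have "?L 0 \<inter> W \<noteq> {0}" by blast
  moreover have "\<not> (?L K \<inter> W \<noteq> {0})" unfolding K using vec.subspace_0[OF sW] by auto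
  ultimately obtain k where k: "?L k \<inter> W \<noteq> {0}" "?L (Suc k) \<inter> W = {0}"
    using nat_induct[of "\<lambda>k. ?L k \<inter> W \<noteq> {0}" K] by metis
  let ?U = "?L k \<inter> W"
  have sU: "vec.subspace ?U" using L sW by (auto intro: vec.subspace_inter)
  have UN: "?U \<subseteq> N" using L by blast
  obtain S where S: "onb ?U S" using onb_exists[OF sU] .
  \<comment> \<open>The component of \<open>z\<close> in \<open>V\<close> acts by zero according to
    \<open>kill\<close>, and the component in \<open>W\<close> preserves both \<open>?L k\<close>
    and \<open>W\<close>.\<close>
  have id: "br z y \<in> ?U" if y: "y \<in> ?U" for z y
  proof -
    have "br (p z) y = 0" using kill[of y "p z"] y UN pV[of z] br_skew[of "p z" y] by auto
    then have "br z y = br (z - p z) y" by (simp add: clin_diff[OF br_clin_left])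
    moreover have "br (z - p z) y \<in> ?U" using Wc[OF qW[of z], of y] y L by blast
    ultimately show ?thesis by simp
  qed
  have ab: "br x y = 0" if "x \<in> ?U" "y \<in> ?U" for x y
  proof -
    have "br x y \<in> ?L (Suc k) \<inter> W" using lower_central_br[of x N y k] Wc[of x y] UN that by blast
    then show ?thesis using k(2) by blast
  qed
  have "0 \<le> (\<Sum>z\<in>S. Re (mom br z z))" by (rule abelian_ideal_mom_nonneg[OF sU id ab S])
  moreover have "Re (mom br z z) < 0" if z: "z \<in> S" for z
  proof -
    have "b z = 0" using bW onb_in[OF S z] by blast
    then have "mom br z z + (1/2) * (th z * cnj (th z)) = of_real c" using sol[of z z] onb_gh[OF S z z] by simp
    then have "Re (mom br z z + (1/2) * (th z * cnj (th z))) = c" by simp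
    moreover have "Re (mom br z z + (1/2) * (th z * cnj (th z))) = Re (mom br z z) + (1/2) * (cmod (th z))\<^sup>2"
      unfolding cmod_power2 by (simp add: power2_eq_square)
    moreover have "0 \<le> (cmod (th z))\<^sup>2" by simp
    ultimately show ?thesis using c by linarith
  qed
  moreover have "S \<noteq> {}"
  proof
    assume "S = {}"
    then have "?U = {0}" using S by (simp add: onb_def)
    then show False using k(1) by simp
  qed
  ultimately show False using sum_strict_mono[OF onb_finite[OF S], of "\<lambda>z. Re (mom br z z)" "\<lambda>_. 0"] by simp
qed

lemma H_W: "H \<in> W" using thV by (simp add: perp_def gh_H')

text \<open>The equation is tested against the commutator of \<open>ad X\<close> and its adjoint.
  The terms in \<open>c\<close> and \<open>b\<close> have trace zero since \<open>b\<close> commutes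
  with \<open>ad X\<close>, and the term in \<open>th\<close> vanishes since \<open>X\<close>
  commutes with \<open>H\<close>; the squared norm given by \<open>mom_trace_comm\<close> is
  therefore zero.\<close>

lemma adj_br_derivation:
  assumes X: "X \<in> W" and XH: "br X H = 0"
  shows "adj (br X) (br x y) = br (adj (br X) x) y + br x (adj (br X) y)"
proof -
  let ?A = "br X" and ?C = "adj (br X)"
  have z: "act ?A br x y = 0" for x y using br_jacobi[of X x y] by (simp add: act_def)
  have m: "mom br x y = of_real c * gh x y + gh (b x) y - (1/2) * (th x * cnj (th y))" for x y
    using sol[of x y] by (simp add: algebra_simps)
  have "(\<Sum>k\<in>bas. th (?A (?C k) - ?C (?A k)) * cnj (th k)) = - gh (?C (?A H)) H"
  proof -
    have "th (?A (?C k) - ?C (?A k)) * cnj (th k) = - (gh H k * gh (?C (?A k)) H)" for k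
    proof -
      have "th (?A (?C k) - ?C (?A k)) = gh (?A (?C k) - ?C (?A k)) H" by (rule gh_H[symmetric])
      also have "\<dots> = th (?A (?C k)) - gh (?C (?A k)) H" unfolding gh_diff_left gh_H[of "?A (?C k)"] ..
      also have "\<dots> = - gh (?C (?A k)) H" by (simp add: th_bracket)
      finally show ?thesis by (simp add: gh_H')
    qed
    moreover have "gh (?C (?A H)) H = (\<Sum>k\<in>bas. gh H k * gh (?C (?A k)) H)"
      by (rule sesq_expand_left[OF sesq_lin[OF clin_compose[OF clin_adj br_clin]] onb_bas UNIV_I])
    ultimately show ?thesis by (simp add: sum_negf)
  qed
  also have "\<dots> = 0" using XH by (simp add: clin_zero[OF clin_adj])
  finally have "(\<Sum>k\<in>bas. mom br (?A (?C k) - ?C (?A k)) k) = 0"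
    unfolding m sum_subtractf sum.distrib sum_distrib_left[symmetric]
    using tr_comm[OF br_clin clin_adj, of X "br X"] tr_b_comm[OF br_clin clin_adj b_comm[OF X], of "br X"] by simp
  then have "ipb (act ?C br) (act ?C br) = 0"
    using mom_trace_comm[OF br_bilin br_skew br_clin clin_adj z, of "br X"] by simp
  then have "act ?C br x y = 0" by (rule ipb_zero[OF bilin_act[OF clin_adj br_bilin]])
  then show ?thesis by (simp add: act_def algebra_simps)
qed

lemma adj_br_W: assumes "i \<in> W" "x \<in> W" shows "adj (br i) x \<in> W"
  using perpD[OF assms(2) ideal] by (simp add: perp_def gh_adj[OF br_clin])

section \<open>The Killing form and its radical\<close>

definition killing where "killing x y = (\<Sum>k\<in>bas. gh (br x (br y k)) k)"

lemma killing_sym: "killing x y = killing y x"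
  unfolding killing_def by (rule trace_comm[OF br_clin br_clin onb_bas])
text \<open>\<open>ad (D y)\<close> is the commutator of \<open>D\<close> and \<open>ad y\<close>;
  cyclicity gathers the terms into the trace of \<open>D\<close> composed with
  \<open>ad (br y x)\<close>.\<close>

lemma killing_derivation:
  assumes D: "clin D" "\<And>x y. D (br x y) = br (D x) y + br x (D y)"
  shows "killing x (D y) = (\<Sum>k\<in>bas. gh (D (br (br y x) k)) k)"
proof -
  have 1: "br (D y) k = D (br y k) - br y (D k)" for k using D(2)[of y k] by simp
  have 2: "(\<Sum>k\<in>bas. gh (br x (D (br y k))) k) = (\<Sum>k\<in>bas. gh (D (br y (br x k))) k)"
    by (rule trace_comm[OF br_clin clin_compose[OF D(1) br_clin] onb_bas])
  have 3: "(\<Sum>k\<in>bas. gh (br x (br y (D k))) k) = (\<Sum>k\<in>bas. gh (D (br x (br y k))) k)"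
    by (rule trace_comm[OF clin_compose[OF br_clin br_clin] D(1) onb_bas])
  have 4: "br (br y x) k = br y (br x k) - br x (br y k)" for k using br_jacobi[of y x k] by simp
  show ?thesis
    unfolding killing_def 1 4 clin_diff[OF br_clin] clin_diff[OF D(1)] gh_diff_left sum_subtractf 2 3 ..
qed

text \<open>Let \<open>J\<close> be the radical of the Killing form. By
  \<open>killing_derivation\<close>, a bracket of \<open>J\<close> with anything has zero trace
  against every derivation, hence is ad-nilpotent by \<open>ad_nilp_if_trace_zero\<close>. By
  \<open>engel\<close> these brackets span a nilpotent ideal.\<close>

lemma ideal_of_killing_radical:
  assumes nil: "is_nilradical br V" and x: "\<And>y. killing x y = 0"
  shows "br x y \<in> V"
proof -
  \<comment> \<open>Invariance of the Killing form is \<open>killing_derivation\<close> for inner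
    derivations, applied twice.\<close>
  have cyc: "killing y (br z x) = killing x (br y z)" for x y z
  proof -
    have 1: "killing y (br z x) = killing z (br x y)" for x y z
      using killing_derivation[OF br_clin br_jacobi, of y z x] by (simp add: killing_def)
    show ?thesis using 1[of y z x] 1[of z x y] by simp
  qed
  define J where "J = {x. \<forall>y. killing x y = 0}"
  have J: "br z x \<in> J" if x: "x \<in> J" for z x
  proof -
    have "killing (br z x) y = 0" for y
      using x unfolding killing_sym[of "br z x"] cyc[of y z x] by (simp add: J_def)
    then show ?thesis by (simp add: J_def)
  qed
  define I where "I = vec.span {br x y |x y. x \<in> J}"
  have iI: "br z x \<in> I" if x: "x \<in> I" for z x
  proof -
    have "vec.subspace {x. br z x \<in> I}"
      unfolding I_def by (intro vec.subspaceI) (auto simp: br_simps vec.span_zero vec.span_add vec.span_scale)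
    moreover have "{br x y |x y. x \<in> J} \<subseteq> {x. br z x \<in> I}"
    proof safe
      fix x y assume x: "x \<in> J"
      have "br (br z x) y \<in> I" "br x (br z y) \<in> I" using x J[OF x, of z] unfolding I_def by (auto intro: vec.span_base)
      then show "br z (br x y) \<in> I" unfolding br_jacobi[of z x y] I_def by (rule vec.span_add)
    qed
    ultimately have "I \<subseteq> {x. br z x \<in> I}" unfolding I_def by (intro vec.span_minimal)
    then show ?thesis using x by blast
  qed
  have nilI: "ad_nilp x" if x: "x \<in> I" for x
  proof (rule ad_nilp_if_trace_zero)
    fix D assume D: "clin D" "\<And>u v. D (br u v) = br (D u) v + br u (D v)"
    have "vec.subspace {x. (\<Sum>k\<in>bas. gh (br x (D k)) k) = 0}"
      by (intro vec.subspaceI) (auto simp: br_simps gh_simps sum.distrib sum_distrib_left[symmetric])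
    moreover have "{br x y |x y. x \<in> J} \<subseteq> {x. (\<Sum>k\<in>bas. gh (br x (D k)) k) = 0}"
    proof safe
      fix u v assume u: "u \<in> J"
      have "br (br u v) (D k) = - br (br v u) (D k)" for k
        using br_skew[of u v] clin_minus[OF br_clin_left, of "br v u" "D k"] by simp
      then have "(\<Sum>k\<in>bas. gh (br (br u v) (D k)) k) = - (\<Sum>k\<in>bas. gh (br (br v u) (D k)) k)" by (simp add: sum_negf)
      also have "(\<Sum>k\<in>bas. gh (br (br v u) (D k)) k) = (\<Sum>k\<in>bas. gh (D (br (br v u) k)) k)"
        by (rule trace_comm[OF br_clin D(1) onb_bas])
      also have "\<dots> = killing u (D v)" by (rule killing_derivation[OF D, symmetric])
      finally show "(\<Sum>k\<in>bas. gh (br (br u v) (D k)) k) = 0" using u by (simp add: J_def)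
    qed
    ultimately have "I \<subseteq> {x. (\<Sum>k\<in>bas. gh (br x (D k)) k) = 0}" unfolding I_def by (intro vec.span_minimal)
    then show "(\<Sum>k\<in>bas. gh (br x (D k)) k) = 0" using x by blast
  qed
  have sI: "vec.subspace I" by (simp add: I_def)
  have "I \<subseteq> V" using nil engel[OF sI iI nilI] sI iI unfolding is_nilradical_def lie_ideal_def by blast
  moreover have "br x y \<in> I" using x by (auto simp: I_def J_def intro!: vec.span_base)
  ultimately show ?thesis by blast
qed

text \<open>Pairing the soliton equation with \<open>H\<close> shows that \<open>adj (ad H)\<close>, a derivation, takes values in
  the radical of the Killing form.\<close>

lemma H_central_W:
  assumes nil: "is_nilradical br V" and Y: "Y \<in> W"
  shows "br Y H = 0"
proof -
  let ?d = "adj (br H)"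
  have der: "?d (br x y) = br (?d x) y + br x (?d y)" for x y
    by (rule adj_br_derivation[OF H_W br_self])
  \<comment> \<open>As \<open>H\<close> is orthogonal to all brackets, the positive term of
    \<open>mom br H y\<close> vanishes, and as \<open>b H = 0\<close> the rest of the equation is
    proportional to \<open>th y\<close>.\<close>
  obtain \<kappa> where k: "(\<Sum>i\<in>bas. gh (br y i) (br H i)) = \<kappa> * th y" for y
  proof
    fix y
    have "gh H (br i j) = 0" for i j by (simp add: gh_H' th_bracket)
    then have "mom br H y = - (1/2) * (\<Sum>i\<in>bas. gh (br H i) (br y i))" by (simp add: mom_def)
    then have "- (1/2) * (\<Sum>i\<in>bas. gh (br H i) (br y i)) + (1/2) * (th H * cnj (th y)) = of_real c * cnj (th y)"
      using sol[of H y] bW[OF H_W] by (simp add: gh_H')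
    then have "(\<Sum>i\<in>bas. gh (br H i) (br y i)) = (th H - 2 * of_real c) * cnj (th y)"
      by (simp add: field_simps)
    from arg_cong[OF this, of cnj] show "(\<Sum>i\<in>bas. gh (br y i) (br H i)) = cnj (th H - 2 * of_real c) * th y"
      by (simp add: gh_cnj[symmetric])
  qed
  have rad: "killing (?d y) x = 0" for x y
  proof -
    have "killing x (?d y) = (\<Sum>k\<in>bas. gh (?d (br (br y x) k)) k)"
      by (rule killing_derivation[OF clin_adj der])
    also have "\<dots> = \<kappa> * th (br y x)" by (simp add: gh_adj[OF br_clin] k)
    finally show ?thesis by (simp add: th_bracket killing_sym[of x])
  qed
  \<comment> \<open>\<open>br (?d y) H\<close> lies in \<open>V\<close> by the radical argument and
    in \<open>W\<close> because \<open>W\<close> is invariant, so it is zero. This forces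
    \<open>gh (?d y) (?d y) = gh y (br H (?d y)) = 0\<close>.\<close>
  have dz: "?d y = 0" if y: "y \<in> W" for y
  proof -
    have "br (?d y) H \<in> V" using rad by (rule ideal_of_killing_radical[OF nil])
    moreover have "br (?d y) H \<in> W" by (rule Wc[OF adj_br_W[OF H_W y] H_W])
    ultimately have "br (?d y) H = 0" using perpD gh_eq0 by blast
    then have "br H (?d y) = 0" using br_skew[of H "?d y"] by simp
    then have "gh (?d y) (?d y) = 0" by (simp add: gh_adj[OF br_clin])
    then show ?thesis by simp
  qed
  \<comment> \<open>The adjoint of \<open>ad H\<close> kills \<open>W\<close>, in particular
    \<open>br H Y\<close>.\<close>
  have "gh (br H Y) (br H Y) = 0"
    using dz[OF Wc[OF H_W Y]] gh_adj'[OF br_clin, of Y H "br H Y"] gh_adj[OF br_clin, of H "br H Y" Y] by simp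
  then show ?thesis using br_skew[of Y H] by simp
qed

text \<open>Because each \<open>adj (br i)\<close> is a derivation, the sum of commutators is
  \<open>- ad Z\<close>, and \<open>Z\<close> is minus the dual of the trace form of
  \<open>W\<close>. A sum of commutators has trace zero on \<open>W\<close>, so
  \<open>gh Z Z = 0\<close> and both claims follow at once.\<close>

lemma trace_and_commutator_W:
  assumes nil: "is_nilradical br V"
  shows "ctr gh W (br x) = 0" "(\<Sum>i\<in>Sw. br i (adj (br i) x) - adj (br i) (br i x)) = 0"
proof -
  define Z where "Z = (\<Sum>i\<in>Sw. adj (br i) i)"
  have com: "(\<Sum>i\<in>Sw. br i (adj (br i) x) - adj (br i) (br i x)) = - br Z x" for x
  proof -
    have "adj (br i) (br i x) = br (adj (br i) i) x + br i (adj (br i) x)" if "i \<in> Sw" for i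
      using onb_in[OF Sw that] by (intro adj_br_derivation H_central_W[OF nil])
    then show ?thesis by (simp add: Z_def clin_sum[OF br_clin_left] sum_negf)
  qed
  have gZ: "gh Z x = - cnj (ctr gh W (br x))" for x
  proof -
    have "gh Z x = (\<Sum>i\<in>Sw. gh i (br i x))" by (simp add: Z_def gh_sum_left gh_adj[OF br_clin])
    also have "\<dots> = (\<Sum>i\<in>Sw. - cnj (gh (br x i) i))"
    proof (intro sum.cong refl)
      fix i
      have "br i x = - br x i" by (rule br_skew)
      then show "gh i (br i x) = - cnj (gh (br x i) i)" using gh_cnj[of i "br x i"] by simp
    qed
    also have "\<dots> = - cnj (ctr gh W (br x))" by (simp add: ctr_onb[OF Sw br_clin] sum_negf)
    finally show ?thesis .
  qed
  have "ctr gh W (br Z) = (\<Sum>k\<in>Sw. gh (br Z k) k)" by (rule ctr_onb[OF Sw br_clin])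
  also have "\<dots> = - (\<Sum>k\<in>Sw. \<Sum>i\<in>Sw. gh (br i (adj (br i) k) - adj (br i) (br i k)) k)"
  proof -
    have "br Z k = - (\<Sum>i\<in>Sw. br i (adj (br i) k) - adj (br i) (br i k))" for k unfolding com by simp
    then show ?thesis by (simp add: gh_sum_left sum_negf)
  qed
  also have "\<dots> = - (\<Sum>i\<in>Sw. \<Sum>k\<in>Sw. gh (br i (adj (br i) k) - adj (br i) (br i k)) k)" by (subst sum.swap) (rule refl)
  also have "\<dots> = 0"
  proof -
    have "(\<Sum>k\<in>Sw. gh (br i (adj (br i) k) - adj (br i) (br i k)) k) = 0" if "i \<in> Sw" for i
    proof -
      have iW: "i \<in> W" by (rule onb_in[OF Sw that])
      have "(\<Sum>k\<in>Sw. gh (br i (adj (br i) k)) k) = (\<Sum>k\<in>Sw. \<Sum>l\<in>Sw. gh k (br i l) * gh (br i l) k)"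
      proof (rule sum.cong[OF refl])
        fix k assume k: "k \<in> Sw"
        have "gh (br i (adj (br i) k)) k = gh (adj (br i) k) (adj (br i) k)" by (simp add: gh_adj'[OF br_clin])
        also have "\<dots> = (\<Sum>l\<in>Sw. gh (adj (br i) k) l * gh l (adj (br i) k))"
          by (rule gh_expand_left[OF Sw adj_br_W[OF iW onb_in[OF Sw k]]])
        finally show "gh (br i (adj (br i) k)) k = (\<Sum>l\<in>Sw. gh k (br i l) * gh (br i l) k)"
          by (simp add: gh_adj[OF br_clin] gh_adj'[OF br_clin])
      qed
      also have "\<dots> = (\<Sum>l\<in>Sw. \<Sum>k\<in>Sw. gh (br i l) k * gh k (br i l))" by (subst sum.swap) (simp add: mult.commute)
      also have "\<dots> = (\<Sum>l\<in>Sw. gh (br i l) (br i l))"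
        by (intro sum.cong refl gh_expand_left[OF Sw, symmetric] Wc[OF iW] onb_in[OF Sw])
      also have "\<dots> = (\<Sum>k\<in>Sw. gh (adj (br i) (br i k)) k)" by (simp add: gh_adj[OF br_clin])
      finally show ?thesis by (simp add: gh_diff_left sum_subtractf)
    qed
    then show ?thesis by simp
  qed
  finally have "gh Z Z = 0" unfolding gZ by simp
  then have Z: "Z = 0" by simp
  show "ctr gh W (br x) = 0" using gZ[of x] Z by simp
  show "(\<Sum>i\<in>Sw. br i (adj (br i) x) - adj (br i) (br i x)) = 0" unfolding com Z by (simp add: br_simps)
qed

text \<open>The vanishing sum of commutators allows \<open>complement_invariant\<close> for the
  adjoint action on \<open>W\<close>: the orthogonal complement in \<open>W\<close> of an ideal is
  an ideal.\<close>

lemma reductive_W: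
  assumes nil: "is_nilradical br V"
  shows "reductive_subalgebra br W"
  unfolding reductive_subalgebra_def
proof (intro conjI allI impI subalgebra_W)
  fix I assume I: "lie_ideal br W I"
  then have sI: "vec.subspace I" and IW: "I \<subseteq> W" and iI: "\<And>x y. x \<in> W \<Longrightarrow> y \<in> I \<Longrightarrow> br x y \<in> I"
    by (auto simp: lie_ideal_def)
  let ?C = "W \<inter> perp I"
  have sC: "vec.subspace ?C" by (intro vec.subspace_inter sW subspace_perp)
  have iC: "br x y \<in> ?C" if x: "x \<in> W" and y: "y \<in> ?C" for x y
  proof -
    have "gh (br x y) z = 0" if z: "z \<in> I" for z
    proof -
      have "gh (br i y) z = 0" if i: "i \<in> Sw" for i
        by (rule complement_invariant[where I = Sw and A = br and W = I])
          (use fin br_clin trace_and_commutator_W(2)[OF nil] sI iI onb_in[OF Sw] i perpD y z in auto)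
      then show ?thesis unfolding br_W_expand[OF x] by (simp add: gh_sum_left)
    qed
    then show ?thesis using Wc[OF x, of y] y by (simp add: perp_def)
  qed
  have "I \<inter> ?C = {0}"
  proof -
    have "x = 0" if "x \<in> I" "x \<in> perp I" for x using perpD[OF that(2,1)] by simp
    then show ?thesis using vec.subspace_0[OF sI] vec.subspace_0[OF sC] by auto
  qed
  moreover have "{x + y |x y. x \<in> I \<and> y \<in> ?C} = W"
  proof (intro equalityI subsetI)
    fix x assume "x \<in> {x + y |x y. x \<in> I \<and> y \<in> ?C}"
    then show "x \<in> W" using IW vec.subspace_add[OF sW] by auto
  next
    fix x assume x: "x \<in> W"
    have "prj I x \<in> I" by (rule prj_in[OF sI])
    moreover have "x - prj I x \<in> ?C"
      using diff_prj_perp[OF sI, of x] vec.subspace_diff[OF sW x, of "prj I x"] IW \<open>prj I x \<in> I\<close> by auto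
    moreover have "x = prj I x + (x - prj I x)" by simp
    ultimately show "x \<in> {x + y |x y. x \<in> I \<and> y \<in> ?C}" by blast
  qed
  ultimately show "\<exists>I'. lie_ideal br W I' \<and> I \<inter> I' = {0} \<and> {x + y |x y. x \<in> I \<and> y \<in> I'} = W"
    using sC iC unfolding lie_ideal_def by blast
qed

text \<open>\<open>b\<close> serves as the derivation and, being self-adjoint, also as its adjoint;
  \<open>P_zero\<close> removes the correction in \<open>mom_om_eq\<close>.\<close>

lemma alg_soliton_V: "alg_soliton gh br V c"
proof -
  have l: "lin_on V b" using cb by (simp add: lin_on_def)
  have h: "hadj gh V b x = b x" if "x \<in> V" for x
    by (rule gh_eqI[OF sV hadj_in[OF sV] bV]) (simp add: gh_hadj[OF sV l] bsym)
  have "is_derivation br V b"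
    using bV bder by (simp add: is_derivation_def clin_add[OF cb] clin_scale[OF cb])
  moreover have "is_derivation br V (hadj gh V b)"
    using calculation ideal vec.subspace_add[OF sV] vec.subspace_scale[OF sV]
    by (simp add: is_derivation_def h)
  moreover have "hcf_K gh br V X Y = of_real c * gh X Y + (gh (b X) Y + gh (hadj gh V b X) Y) / 2"
    if X: "X \<in> V" and Y: "Y \<in> V" for X Y
    using hcf_K_V[OF nilpotent_th_zero(1)[OF sV ideal nilV] X Y] mom_om_eq[OF X Y] by (simp add: h[OF X] P_zero)
  ultimately show ?thesis unfolding alg_soliton_def by blast
qed

lemma commutator_V: "x \<in> V \<Longrightarrow> (\<Sum>i\<in>Sw. br i (hadj gh V (br i) x) - hadj gh V (br i) (br i x)) = 0"
  using P_eq[of x] P_zero[of x] by simp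

lemma hcf_K_W_eq:
  assumes nil: "is_nilradical br V" and X: "X \<in> W" and Y: "Y \<in> W"
  shows "hcf_K gh br W X Y = of_real c * gh X Y + ctr gh V (\<lambda>x. br X (hadj gh V (br Y) x)) / 2
    - th X * cnj (th Y) / 2"
  using sol[of X Y] bW[OF X]
  unfolding hcf_K_W[OF trace_and_commutator_W(1)[OF nil] X Y] T_eq[OF X Y] by (simp add: algebra_simps)

end

section \<open>From the structure conditions to solitons\<close>

text \<open>An ideal complementing the derived algebra is central, since its brackets lie in both.
  Brackets and central elements have trace zero.\<close>

lemma (in hermitian_lie) reductive_ctr_zero:
  assumes V: "reductive_subalgebra br V" and x: "x \<in> V"
  shows "ctr gh V (br x) = 0"
proof -
  have sa: "lie_subalgebra br V" and sV: "vec.subspace V" and V2: "\<And>x y. x \<in> V \<Longrightarrow> y \<in> V \<Longrightarrow> br x y \<in> V"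
    using V by (auto simp: reductive_subalgebra_def lie_subalgebra_def)
  obtain S where S: "onb V S" using onb_exists[OF sV] .
  let ?G = "{br x y |x y. x \<in> V \<and> y \<in> V}"
  let ?I = "vec.span ?G"
  have IV: "?I \<subseteq> V" using V2 by (intro vec.span_minimal sV) auto
  have "lie_ideal br V ?I" unfolding lie_ideal_def using IV by (auto intro: vec.span_base)
  then obtain I' where I': "lie_ideal br V I'" "?I \<inter> I' = {0}" and s: "{x + y |x y. x \<in> ?I \<and> y \<in> I'} = V"
    using V unfolding reductive_subalgebra_def by blast
  obtain u v where u: "u \<in> ?I" and v: "v \<in> I'" and xuv: "x = u + v" using x s by blast
  have "br v y = 0" if y: "y \<in> V" for y
  proof -
    have "br y v \<in> I'" "v \<in> V" using I'(1) v y by (auto simp: lie_ideal_def)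
    then have "br v y \<in> I'" using br_skew[of v y] I'(1) vec.subspace_neg by (auto simp: lie_ideal_def)
    moreover have "br v y \<in> ?I" using \<open>v \<in> V\<close> y by (auto intro: vec.span_base)
    ultimately show ?thesis using I'(2) by blast
  qed
  then have "ctr gh V (br v) = 0" using onb_in[OF S] by (simp add: ctr_onb[OF S br_clin])
  moreover have "ctr gh V (br u) = 0"
  proof -
    have "vec.subspace {u. ctr gh V (br u) = 0}"
      by (intro vec.subspaceI) (auto simp: ctr_onb[OF S br_clin] br_simps gh_simps sum.distrib sum_distrib_left[symmetric])
    moreover have "?G \<subseteq> {u. ctr gh V (br u) = 0}" using ctr_br_bracket[OF sa] by auto
    ultimately have "?I \<subseteq> {u. ctr gh V (br u) = 0}" by (intro vec.span_minimal)
    then show ?thesis using u by blast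
  qed
  ultimately show ?thesis
    unfolding xuv by (simp add: ctr_onb[OF S br_clin] br_simps gh_simps sum.distrib)
qed

context ideal_split begin

lemma adj_A_W: "x \<in> W \<Longrightarrow> adj (A i) x = 0"
  by (rule eq_by_gh) (simp add: gh_adj[OF clin_A] perpD[OF _ A_V])

lemma P_zero_if: assumes "\<And>x. x \<in> V \<Longrightarrow> P x = 0" shows "P x = 0"
proof -
  have "P (x - p x) = 0" using qW[of x] by (simp add: P_def A_W adj_A_W clin_zero[OF clin_adj] clin_zero[OF clin_A])
  then show ?thesis using assms[OF pV[of x]] by (simp add: clin_diff[OF clin_P])
qed

text \<open>Since \<open>A i\<close> is a derivation of \<open>om\<close>, the trace of \<open>P\<close> against the moment map is the sum
  of the squared norms of \<open>act (adj (A i)) om\<close>.\<close>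

lemma adj_A_derivation:
  assumes P: "\<And>x. P x = 0" and i: "i \<in> Sw"
  shows "act (adj (A i)) om x y = 0"
proof -
  let ?q = "\<lambda>i. ipb (act (adj (A i)) om) (act (adj (A i)) om)"
  have Pi: "(\<Sum>i\<in>Sw. A i (adj (A i) k) - adj (A i) (A i k)) = 0" for k using P[of k] by (simp add: P_def)
  have m0: "mom om 0 k = 0" for k using mom_scale_left[OF bilin_om, of 0 0 k] by simp
  have "(\<Sum>i\<in>Sw. (1/4) * ?q i) = (\<Sum>i\<in>Sw. \<Sum>k\<in>bas. mom om (A i (adj (A i) k) - adj (A i) (A i k)) k)"
    by (simp add: mom_trace_comm[OF bilin_om om_skew clin_A clin_adj act_A])
  also have "\<dots> = (\<Sum>k\<in>bas. mom om (\<Sum>i\<in>Sw. A i (adj (A i) k) - adj (A i) (A i k)) k)"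
    unfolding sesq_sum_left[OF sesq_mom[OF bilin_om]] by (rule sum.swap)
  also have "\<dots> = 0" unfolding Pi m0 by simp
  finally have "Re (\<Sum>i\<in>Sw. (1/4) * ?q i) = 0" by simp
  then have "(\<Sum>i\<in>Sw. Re (?q i)) = 0" by (simp add: sum_divide_distrib[symmetric])
  then have "Re (?q i) = 0" using i fin by (subst (asm) sum_nonneg_eq_0_iff) (auto intro: ipb_nonneg)
  then have "?q i = 0" using ipb_real[of "act (adj (A i)) om"] by (simp add: complex_eq_iff)
  then show ?thesis by (rule ipb_zero[OF bilin_act[OF clin_adj bilin_om]])
qed

text \<open>A derivation of \<open>om\<close> that preserves \<open>V\<close> preserves the lower
  central series of \<open>V\<close>.\<close>

lemma adj_A_lower_central:
  assumes d: "\<And>x y. act (adj (A i)) om x y = 0" and x: "x \<in> lower_central br V k"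
  shows "adj (A i) x \<in> lower_central br V k"
  using x
proof (induction k arbitrary: x)
  case 0
  then show ?case using adjA_V by simp
next
  case (Suc k)
  let ?L = "lower_central br V"
  let ?G = "{br x y |x y. x \<in> V \<and> y \<in> ?L k}"
  have LV: "?L k \<subseteq> V" using lower_central_ideal[OF sV ideal] by blast
  have "vec.subspace {x. adj (A i) x \<in> ?L (Suc k)}"
    by (intro vec.subspaceI) (auto simp: clin_zero[OF clin_adj] clin_add[OF clin_adj] clin_scale[OF clin_adj]
      vec.span_zero vec.span_add vec.span_scale)
  moreover have "?G \<subseteq> {x. adj (A i) x \<in> ?L (Suc k)}"
  proof safe
    fix u v assume u: "u \<in> V" and v: "v \<in> ?L k"
    have "adj (A i) (br u v) = br (adj (A i) u) v + br u (adj (A i) v)"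
      using d[of u v] u v LV by (simp add: act_def om_def pid adjA_V subset_iff diff_eq_eq add.commute)
    moreover have "br (adj (A i) u) v \<in> ?L (Suc k)" by (rule lower_central_br[OF adjA_V v])
    moreover have "br u (adj (A i) v) \<in> ?L (Suc k)" by (rule lower_central_br[OF u Suc.IH[OF v]])
    ultimately show "adj (A i) (br u v) \<in> ?L (Suc k)" by (simp add: vec.span_add)
  qed
  ultimately have "vec.span ?G \<subseteq> {x. adj (A i) x \<in> ?L (Suc k)}" by (rule vec.span_minimal[rotated])
  then show ?case using Suc.prems by auto
qed

text \<open>The mixed entry is a combination of conjugates of traces of \<open>adj (A i)\<close>
  composed with \<open>ad y\<close>. The former preserves the lower central series of
  \<open>V\<close> and the latter lowers it.\<close>

lemma mom_WV_zero:
  assumes nil: "nilpotent_lie br V" and P: "\<And>x. P x = 0" and x: "x \<in> W" and y: "y \<in> V"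
  shows "mom br x y = 0"
proof -
  have "(\<Sum>e\<in>Sv. gh (br i e) (br y e)) = 0" if i: "i \<in> Sw" for i
  proof -
    let ?f = "adj (A i)"
    have "(\<Sum>e\<in>Sv. gh (br y (?f e)) e) = ctr gh V (\<lambda>u. br y (?f u))"
      by (rule ctr_onb[OF Sv clin_compose[OF br_clin clin_adj], symmetric])
    also have "\<dots> = 0"
      by (rule nilpotent_trace_zero[OF sV ideal nil clin_adj adj_A_lower_central[OF adj_A_derivation[OF P i]] y])
    finally have 1: "(\<Sum>e\<in>Sv. gh (br y (?f e)) e) = 0" .
    have "(\<Sum>e\<in>Sv. gh (?f (br y e)) e) = (\<Sum>e\<in>Sv \<union> Sw. gh (?f (br y e)) e)"
      unfolding sum_split using perpD'[OF onb_in[OF Sw] adjA_V] by simp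
    also have "\<dots> = (\<Sum>e\<in>Sv \<union> Sw. gh (br y (?f e)) e)" by (rule trace_comm[OF clin_adj br_clin SvSw(1)])
    also have "\<dots> = 0" unfolding sum_split 1 using perpD'[OF onb_in[OF Sw] ideal'[OF y]] by simp
    finally have 2: "(\<Sum>e\<in>Sv. gh (?f (br y e)) e) = 0" .
    have "gh (br i e) (br y e) = cnj (gh (?f (br y e)) e)" if "e \<in> Sv" for e
      using gh_cnj[of "br i e" "br y e"] onb_in[OF Sv that] by (simp add: gh_adj[OF clin_A] A_def pid)
    then have "(\<Sum>e\<in>Sv. gh (br i e) (br y e)) = cnj (\<Sum>e\<in>Sv. gh (?f (br y e)) e)" by simp
    then show ?thesis unfolding 2 by simp
  qed
  then have "(\<Sum>i\<in>Sw. gh x i * (\<Sum>e\<in>Sv. gh (br i e) (br y e))) = 0" by simp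
  then have "(\<Sum>e\<in>Sv. gh (br x e) (br y e)) = 0"
    unfolding sum_distrib_left by (subst (asm) sum.swap) (simp add: br_W_expand[OF x] gh_sum_left)
  then show ?thesis by (simp add: mom_WV[OF x y])
qed

text \<open>Testing the moment map equation against \<open>[A i, C]\<close> with \<open>C\<close> the adjoint of \<open>[b, A i]\<close>.\<close>

lemma commutes_A:
  assumes d: "\<And>x y. act (adj (A i)) om x y = 0" and cb: "clin b" and bV: "\<And>x. b x \<in> V"
    and bsym: "\<And>x y. gh (b x) y = gh x (b y)"
    and sol: "\<And>x y. x \<in> V \<Longrightarrow> y \<in> V \<Longrightarrow> mom om x y = of_real c * gh x y + gh (b x) y"
  shows "b (A i x) = A i (b x)"
proof -
  define C where "C x = adj (A i) (b x) - b (adj (A i) x)" for x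
  have cC: "clin C" unfolding C_def by (intro clin_sub clin_compose[OF clin_adj cb] clin_compose[OF cb clin_adj])
  have CV: "C x \<in> V" for x unfolding C_def by (intro vec.subspace_diff sV adjA_V bV)
  have gC: "gh (C x) y = gh x (b (A i y) - A i (b y))" for x y
    by (simp add: C_def gh_diff_left gh_diff_right gh_adj[OF clin_A] bsym)
  have gp: "gh v (p k) = gh v k" if "v \<in> V" for v k
    using gh_prj_self[OF sV, of v k] by (simp add: pid[OF that])
  have e: "mom om v k = of_real c * gh v k + gh (b v) k" if v: "v \<in> V" for v k
    unfolding mom_om_p[of v k] sol[OF v pV] gp[OF v] gp[OF bV] ..
  have "(\<Sum>k\<in>bas. mom om (A i (C k) - C (A i k)) k) = 0"
    using mom_trace_comm[OF bilin_om om_skew clin_A cC act_A, of i] d by (simp add: ipb_def)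
  moreover have "A i (C k) - C (A i k) \<in> V" for k by (intro vec.subspace_diff sV A_V CV)
  moreover have "(\<Sum>k\<in>bas. gh (A i (C k) - C (A i k)) k) = 0"
    using trace_comm[OF clin_A cC onb_bas, of i] by (simp add: gh_diff_left sum_subtractf)
  ultimately have "(\<Sum>k\<in>bas. gh (b (A i (C k) - C (A i k))) k) = 0"
    by (simp add: e sum.distrib sum_distrib_left[symmetric])
  moreover have "(\<Sum>k\<in>bas. gh (b (C (A i k))) k) = (\<Sum>k\<in>bas. gh (A i (b (C k))) k)"
    by (rule trace_comm[OF clin_compose[OF cb cC] clin_A onb_bas])
  ultimately have "(\<Sum>k\<in>bas. gh (b (A i (C k)) - A i (b (C k))) k) = 0"
    by (simp add: clin_diff[OF cb] gh_diff_left sum_subtractf)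
  \<comment> \<open>As \<open>C\<close> is the adjoint of \<open>[b, A i]\<close>, the trace of
    \<open>[b, A i] C\<close> is the squared norm of \<open>C\<close>.\<close>
  moreover have "gh (b (A i (C k)) - A i (b (C k))) k = gh (C k) (C k)" for k
  proof -
    have "gh (b (A i (C k)) - A i (b (C k))) k = cnj (gh (C k) (C k))" unfolding gC by (rule gh_cnj)
    also have "\<dots> = gh (C k) (C k)" by (rule gh_cnj[symmetric])
    finally show ?thesis .
  qed
  ultimately have "(\<Sum>k\<in>bas. gh (C k) (C k)) = 0" by simp
  then have "C k = 0" if "k \<in> bas" for k by (rule cmod_zero_of_sum[OF finite_bas _ that])
  then have "C u = 0" for u by (rule clin_zero_on_onb[OF cC onb_bas])
  then have "gh u (b (A i x) - A i (b x)) = 0" for u using gC[of u x] by simp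
  then have "b (A i x) - A i (b x) = 0" using gh_eq0 by blast
  then show ?thesis by simp
qed

text \<open>The witness is \<open>b\<close>, the symmetric part of the derivation of
  \<open>V\<close>, extended by zero. On \<open>V\<close> it is a derivation since the soliton there
  is algebraic, across \<open>W\<close> and \<open>V\<close> since it commutes with
  \<open>ad W\<close>, and on \<open>W\<close> trivially.\<close>

lemma semi_alg_soliton_if:
  assumes nil: "nilpotent_lie br V" and alg: "alg_soliton gh br V c" and red: "reductive_subalgebra br W"
    and P0: "\<And>x. x \<in> V \<Longrightarrow> (\<Sum>i\<in>Sw. br i (hadj gh V (br i) x) - hadj gh V (br i) (br i x)) = 0"
    and K: "\<And>X Y. X \<in> W \<Longrightarrow> Y \<in> W \<Longrightarrow> hcf_K gh br W X Y =
      of_real c * gh X Y + ctr gh V (\<lambda>x. br X (hadj gh V (br Y) x)) / 2 - th X * cnj (th Y) / 2"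
  shows "semi_alg_soliton gh br UNIV c"
proof -
  have P: "P x = 0" for x by (rule P_zero_if) (simp add: P_eq P0)
  have der: "act (adj (A i)) om x y = 0" if "i \<in> Sw" for i x y by (rule adj_A_derivation[OF P that])
  obtain D where D: "is_derivation br V D" "is_derivation br V (hadj gh V D)"
    and sD: "\<And>X Y. X \<in> V \<Longrightarrow> Y \<in> V \<Longrightarrow> hcf_K gh br V X Y = of_real c * gh X Y + (gh (D X) Y + gh (hadj gh V D X) Y) / 2"
    using alg unfolding alg_soliton_def by blast
  have lD: "lin_on V D" and DV: "\<And>x. x \<in> V \<Longrightarrow> D x \<in> V" using D(1) by (auto simp: lin_on_def is_derivation_def)
  define b where "b x = (1/2) *s (D (p x) + hadj gh V D (p x))" for x
  have cDp: "clin (\<lambda>x. D (p x))"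
    using lD pV by (intro clinI) (simp_all add: lin_on_def clin_add[OF cp] clin_scale[OF cp])
  have cb: "clin b" unfolding b_def by (intro clin_smult clin_plus cDp clin_compose[OF clin_hadj[OF sV] cp])
  have bV: "b x \<in> V" for x
    unfolding b_def by (intro vec.subspace_scale vec.subspace_add sV DV pV hadj_in)
  have bW: "b x = 0" if "x \<in> W" for x
    using clin_zero[OF cDp] clin_zero[OF clin_hadj[OF sV]] clin_zero[OF cp] by (simp add: b_def pW[OF that])
  have bp: "b (p x) = b x" for x by (simp add: b_def pid pV)
  have gp: "gh v y = gh v (p y)" if "v \<in> V" for v y
    using gh_prj_self[OF sV, of v y] by (simp add: pid[OF that])
  have gb: "gh (b x) y = (1/2) * (gh (D (p x)) (p y) + gh (p x) (D (p y)))" for x y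
    by (subst gp[OF bV]) (simp add: b_def gh_add_left gh_hadj[OF sV lD pV])
  have bsym: "gh (b x) y = gh x (b y)" for x y
  proof -
    have "gh x (b y) = cnj (gh (b y) x)" by (rule gh_cnj)
    also have "\<dots> = (1/2) * (cnj (gh (D (p y)) (p x)) + cnj (gh (p y) (D (p x))))" unfolding gb by simp
    also have "\<dots> = gh (b x) y"
      unfolding gb gh_cnj[of "p x" "D (p y)", symmetric] gh_cnj[of "D (p x)" "p y", symmetric] by (simp only: add.commute)
    finally show ?thesis by (rule sym)
  qed
  have bderV: "b (br x y) = br (b x) y + br x (b y)" if "x \<in> V" "y \<in> V" for x y
    using D that ideal[OF that(2), of x] unfolding is_derivation_def
    by (simp add: b_def pid br_simps vec.scale_right_distrib)
  have solV: "mom om x y = of_real c * gh x y + gh (b x) y" if x: "x \<in> V" and y: "y \<in> V" for x y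
    using sD[OF x y] hcf_K_V[OF nilpotent_th_zero(1)[OF sV ideal nil] x y]
    by (simp add: b_def pid[OF x] gh_add_left)
  have bcomm: "b (br x v) = br x (b v)" if x: "x \<in> W" and v: "v \<in> V" for x v
  proof -
    have "b (br i v) = br i (b v)" if "i \<in> Sw" for i
      using commutes_A[OF der[OF that] cb bV bsym solV, of v] by (simp add: A_def pid v bV)
    then show ?thesis unfolding br_W_expand[OF x] by (simp add: clin_sum[OF cb] clin_scale[OF cb])
  qed
  have bder: "b (br x y) = br (b x) y + br x (b y)" for x y
  proof -
    define x' y' where "x' = x - p x" and "y' = y - p y"
    have W: "x' \<in> W" "y' \<in> W" unfolding x'_def y'_def by (rule qW)+
    have xy: "x = p x + x'" "y = p y + y'" by (simp_all add: x'_def y'_def)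
    have 1: "b (br (p x) (p y)) = br (b x) (p y) + br (p x) (b y)" using bderV[OF pV pV, of x y] by (simp add: bp)
    have 2: "b (br x' (p y)) = br x' (b y)" using bcomm[OF W(1) pV, of y] by (simp add: bp)
    have 3: "b (br (p x) y') = br (b x) y'"
      using bcomm[OF W(2) pV, of x] br_skew[of "p x" y'] br_skew[of "b x" y'] by (simp add: bp clin_minus[OF cb])
    have 4: "b (br x' y') = 0" by (rule bW[OF Wc[OF W]])
    have "br x y = br (p x) (p y) + br (p x) y' + (br x' (p y) + br x' y')"
      by (subst xy(1), subst xy(2)) (simp only: br_simps ac_simps)
    then have "b (br x y) = br (b x) (p y) + br (p x) (b y) + br (b x) y' + br x' (b y)"
      by (simp add: clin_add[OF cb] 1 2 3 4)
    moreover have "br (b x) y = br (b x) (p y) + br (b x) y'" by (subst xy(2)) (simp only: br_simps)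
    moreover have "br x (b y) = br (p x) (b y) + br x' (b y)" by (subst xy(1)) (simp only: br_simps)
    ultimately show ?thesis by (simp add: algebra_simps)
  qed
  have thV: "th x = 0" if "x \<in> V" for x by (rule nilpotent_th_zero(2)[OF sV ideal nil that])
  \<comment> \<open>The defect of the modified soliton equation. Being sesquilinear, it is tested on
    the blocks: \<open>V\<close> with \<open>V\<close> by the soliton of \<open>V\<close> and
    condition (3), the mixed ones by \<open>mom_WV_zero\<close>, \<open>W\<close> with
    \<open>W\<close> by condition (4).\<close>
  define G where "G x y = mom br x y + (1/2) * (th x * cnj (th y)) - of_real c * gh x y - gh (b x) y" for x y
  have "sesq G"
    unfolding sesq_def G_def gh_H[symmetric]
    by (simp add: mom_add_left[OF br_bilin] mom_add_right[OF br_bilin] mom_scale_left[OF br_bilin] mom_scale_right[OF br_bilin]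
      clin_add[OF cb] clin_scale[OF cb] gh_simps algebra_simps)
  moreover have "G x y = 0" if x: "x \<in> Sv \<union> Sw" and y: "y \<in> Sv \<union> Sw" for x y
  proof -
    have GWV: "G x y = 0" if x: "x \<in> W" and y: "y \<in> V" for x y
      using perpD[OF x y] by (simp add: G_def mom_WV_zero[OF nil P x y] thV[OF y] bW[OF x])
    consider "x \<in> V" "y \<in> V" | "x \<in> W" "y \<in> V" | "x \<in> V" "y \<in> W" | "x \<in> W" "y \<in> W"
      using x y onb_in[OF Sv] onb_in[OF Sw] by blast
    then show ?thesis
    proof cases
      case 1
      then show ?thesis by (simp add: G_def mom_VV[OF 1] P thV solV)
    next
      case 2
      then show ?thesis by (rule GWV)
    next
      case 3
      have "mom br x y = 0" using mom_cnj[of br x y] mom_WV_zero[OF nil P 3(2,1)] by simp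
      then show ?thesis using perpD'[OF 3(2,1)] perpD'[OF 3(2) bV[of x]] by (simp add: G_def thV[OF 3(1)])
    next
      case 4
      have "mom br x y + (1/2) * (\<Sum>e\<in>Sv. gh (br x e) (br y e)) =
        of_real c * gh x y + (\<Sum>e\<in>Sv. gh (br x e) (br y e)) / 2 - th x * cnj (th y) / 2"
        using K[OF 4] hcf_K_W[OF _ 4] reductive_ctr_zero[OF red] unfolding T_eq[OF 4] by simp
      then show ?thesis by (simp add: G_def bW[OF 4(1)])
    qed
  qed
  ultimately have "G x y = 0" for x y by (rule sesq_eq_on_onb[OF _ SvSw(1)])
  then have "mom br x y + (1/2) * (th x * cnj (th y)) = of_real c * gh x y + (1/2) * (gh (b x) y + gh x (b y))" for x y
    unfolding bsym[symmetric] by (simp add: G_def diff_eq_eq)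
  then show ?thesis unfolding semi_alg_soliton_iff using cb bder by blast
qed

end

theorem theorem1p1:
  fixes br :: "complex ^ 'n \<Rightarrow> complex ^ 'n \<Rightarrow> complex ^ 'n"
    and gh :: "complex ^ 'n \<Rightarrow> complex ^ 'n \<Rightarrow> complex"
    and N R :: "(complex ^ 'n) set"
    and c :: real
  assumes "complex_lie_algebra br"
    and "hermitian_ip gh"
    and "is_nilradical br N"
    and "R = {x. \<forall>y\<in>N. gh x y = 0}"
    and "c < 0"
  shows "semi_alg_soliton gh br UNIV c \<longleftrightarrow>
     (alg_soliton gh br N c \<and>
      reductive_subalgebra br R \<and>
      (\<forall>rs. unitary_basis gh R rs \<longrightarrow>
         (\<forall>x\<in>N. (\<Sum>r\<leftarrow>rs. br r (hadj gh N (br r) x) - hadj gh N (br r) (br r x)) = 0)) \<and>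
      (\<forall>X\<in>R. \<forall>Y\<in>R. hcf_K gh br R X Y =
         of_real c * gh X Y + ctr gh N (\<lambda>x. br X (hadj gh N (br Y) x)) / 2
         - ctr gh UNIV (br X) * cnj (ctr gh UNIV (br Y)) / 2))"
    (is "?S \<longleftrightarrow> ?C")
proof -
  interpret hermitian_lie gh br using assms(1,2) by unfold_locales
  have R: "R = perp N" unfolding perp_def assms(4) ..
  have N: "vec.subspace N" "\<And>x y. y \<in> N \<Longrightarrow> br x y \<in> N" "nilpotent_lie br N"
    using assms(3) by (simp_all add: is_nilradical_def lie_ideal_def)
  have sum: "(\<Sum>r\<leftarrow>rs. f r) = (\<Sum>r\<in>set rs. f r)" if "unitary_basis gh R rs" for rs and f :: "complex ^ 'n \<Rightarrow> complex ^ 'n"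
    by (rule sum_list_distinct_conv_sum_set[OF unitary_basis_onb(2)[OF that]])
  show ?thesis
  proof
    assume ?S
    then obtain V b where V: "vec.subspace V" and split: "\<And>S. onb (perp V) S \<Longrightarrow> soliton_split gh br V S b c"
      using soliton_structure[OF assms(5)] by metis
    obtain S where S: "onb (perp V) S" using onb_exists[OF subspace_perp] .
    interpret S: soliton_split gh br V S b c by (rule split[OF S])
    have "lie_ideal br UNIV V" using V S.ideal by (simp add: lie_ideal_def)
    \<comment> \<open>\<open>V\<close> is a nilpotent ideal and so lies in the nilradical;
      \<open>V_maximal\<close> gives equality.\<close>
    then have NV: "N = V" using assms(3) S.nilV S.V_maximal unfolding is_nilradical_def by blast
    have nil: "is_nilradical br V" using assms(3) NV by simp
    show ?C unfolding R NV
    proof (intro conjI allI impI ballI)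
      fix rs x assume rs: "unitary_basis gh (perp V) rs" and x: "x \<in> V"
      \<comment> \<open>The structure is available for every orthonormal basis of the complement,
        with the same \<open>b\<close>; this gives condition (3) for an arbitrary unitary
        basis.\<close>
      interpret rs: soliton_split gh br V "set rs" b c by (rule split[OF unitary_basis_onb(1)[OF rs]])
      show "(\<Sum>r\<leftarrow>rs. br r (hadj gh V (br r) x) - hadj gh V (br r) (br r x)) = 0"
        using rs.commutator_V[OF x] sum[unfolded R NV, OF rs] by simp
    qed (use S.alg_soliton_V S.reductive_W[OF nil] S.hcf_K_W_eq[OF nil] in auto)
  next
    assume C: ?C
    obtain S where S: "onb R S" using onb_exists[OF subspace_perp] R by blast
    have red: "reductive_subalgebra br (perp N)" using C R by blast
    interpret ideal_split gh br N S
      using N red S unfolding reductive_subalgebra_def lie_subalgebra_def R by unfold_locales auto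
    obtain rs where rs: "unitary_basis gh R rs" "set rs = S" using onb_unitary_basis[OF S] by blast
    have "(\<Sum>i\<in>S. br i (hadj gh N (br i) x) - hadj gh N (br i) (br i x)) = 0" if "x \<in> N" for x
      using C rs sum[OF rs(1)] that by fastforce
    then show ?S using C by (intro semi_alg_soliton_if[OF N(3) _ red]) (auto simp: R)
  qed
qed

end
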